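(* Let $R$ be an associative unital ring with at least two elements, and let $G$ be a discrete group. Suppose that one of the following holds: (a) $R$ is commutative and $G$ is a $2$-dimensional Poincaré duality group over $R$; or (b) $R$ is a $*$-ring and $G$ is an oriented $2$-dimensional Poincaré duality group over $R$. Then either $G$ is non-elementary (Gromov) hyperbolic or $G$ is amenable.
   Context: A group $G$ is a Poincaré duality group of dimension $n\geq 1$ over $R$ (a $\mathrm{PD}^n_R$ group) if $G$ is of type $\mathrm{FP}$ over $R$ (the trivial $RG$-module $R$ has a finite-length resolution by finitely generated projective $RG$-modules) and $H^k(G;RG)\cong R$ as an $R$-module if $k=n$, while $H^k(G;RG)=0$ for $k\neq n$. It is oriented (or orientable) if $H^n(G;RG)$ is the trivial $RG$-module $R$ (i.e. $R$ with every $g\in G$ acting as the identity). $G$ is not assumed to be finitely presented. A $*$-ring is a ring $R$ equipped with an involutive antiautomorphism $R\to R$, $r\mapsto r^*$. Then $RG$ is also a $*$-ring via $\big(\sum_g r_g g\big)^*=\sum_g r_g^* g^{-1}$. Modules are left modules; the natural right $RG$-module $H^n(G;RG)$ is regarded as a left module via $x\cdot c = c\,x^*$ (with $r^*=r$ when $R$ is commutative). A hyperbolic group is elementary if it is virtually cyclic (including finite), and non-elementary otherwise. *)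

theory Defs
  imports Complex_Main "HOL-Library.FuncSet" "HOL-Algebra.Module" "HOL-Algebra.AbelCoset"
    "HOL-Algebra.Elementary_Groups"
begin

section \<open>Left modules over a ring that need not be commutative\<close>

text \<open>The locale \<^locale>\<open>module\<close> requires a commutative ring of scalars. As there, modules are
  records of type \<^typ>\<open>('a, 'm) module\<close> whose fields \<^const>\<open>mult\<close> and \<^const>\<open>one\<close> play no role;
  the values they get below are irrelevant.\<close>

locale left_module = R?: ring R + M?: abelian_group M
  for R (structure) and M :: "('a, 'm, 'z) module_scheme" (structure) +
  assumes smult_closed:
      "\<lbrakk>a \<in> carrier R; x \<in> carrier M\<rbrakk> \<Longrightarrow> a \<odot>\<^bsub>M\<^esub> x \<in> carrier M"
    and smult_l_distr:
      "\<lbrakk>a \<in> carrier R; b \<in> carrier R; x \<in> carrier M\<rbrakk> \<Longrightarrow>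
        (a \<oplus>\<^bsub>R\<^esub> b) \<odot>\<^bsub>M\<^esub> x = a \<odot>\<^bsub>M\<^esub> x \<oplus>\<^bsub>M\<^esub> b \<odot>\<^bsub>M\<^esub> x"
    and smult_r_distr:
      "\<lbrakk>a \<in> carrier R; x \<in> carrier M; y \<in> carrier M\<rbrakk> \<Longrightarrow>
        a \<odot>\<^bsub>M\<^esub> (x \<oplus>\<^bsub>M\<^esub> y) = a \<odot>\<^bsub>M\<^esub> x \<oplus>\<^bsub>M\<^esub> a \<odot>\<^bsub>M\<^esub> y"
    and smult_assoc:
      "\<lbrakk>a \<in> carrier R; b \<in> carrier R; x \<in> carrier M\<rbrakk> \<Longrightarrow>
        (a \<otimes>\<^bsub>R\<^esub> b) \<odot>\<^bsub>M\<^esub> x = a \<odot>\<^bsub>M\<^esub> (b \<odot>\<^bsub>M\<^esub> x)"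
    and smult_one:
      "x \<in> carrier M \<Longrightarrow> \<one>\<^bsub>R\<^esub> \<odot>\<^bsub>M\<^esub> x = x"

definition lmod_hom ::
  "('a, 'z) ring_scheme \<Rightarrow> ('a, 'm) module \<Rightarrow> ('a, 'n) module \<Rightarrow> ('m \<Rightarrow> 'n) set" where
  "lmod_hom A M N = {h \<in> hom (add_monoid M) (add_monoid N).
     \<forall>a\<in>carrier A. \<forall>x\<in>carrier M. h (a \<odot>\<^bsub>M\<^esub> x) = a \<odot>\<^bsub>N\<^esub> h x}"

definition lmod_isomorphic ::
  "('a, 'z) ring_scheme \<Rightarrow> ('a, 'm) module \<Rightarrow> ('a, 'n) module \<Rightarrow> bool" where
  "lmod_isomorphic A M N \<longleftrightarrow> (\<exists>h\<in>lmod_hom A M N. bij_betw h (carrier M) (carrier N))"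

definition lmod_finitely_generated :: "('a, 'z) ring_scheme \<Rightarrow> ('a, 'm) module \<Rightarrow> bool" where
  "lmod_finitely_generated A M \<longleftrightarrow> (\<exists>S. finite S \<and> S \<subseteq> carrier M \<and>
     (\<forall>x\<in>carrier M. \<exists>c\<in>S \<rightarrow> carrier A. x = (\<Oplus>\<^bsub>M\<^esub>s\<in>S. c s \<odot>\<^bsub>M\<^esub> s)))"

text \<open>The lifting property against surjections \<open>f : X \<rightarrow> Y\<close>. The carrier types are no restriction:
  \<open>Y\<close> may be \<open>P\<close> itself and \<open>X\<close> the free module on the elements of \<open>P\<close> (finitely supported
  functions \<^typ>\<open>'m \<Rightarrow> 'a\<close>), so \<open>P\<close> is a direct summand of a free module and lifts against
  surjections of modules on arbitrary types.\<close>

definition lmod_projective :: "('a, 'z) ring_scheme \<Rightarrow> ('a, 'm) module \<Rightarrow> bool" where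
  "lmod_projective A P \<longleftrightarrow>
     (\<forall>(X :: ('a, 'm \<Rightarrow> 'a) module) (Y :: ('a, 'm) module) f g.
        left_module A X \<longrightarrow> left_module A Y \<longrightarrow> f \<in> lmod_hom A X Y \<longrightarrow>
        f ` carrier X = carrier Y \<longrightarrow> g \<in> lmod_hom A P Y \<longrightarrow>
        (\<exists>h\<in>lmod_hom A P X. \<forall>x\<in>carrier P. f (h x) = g x))"

text \<open>A resolution \<open>0 \<rightarrow> P\<^sub>n \<rightarrow> \<dots> \<rightarrow> P\<^sub>0 \<rightarrow> M \<rightarrow> 0\<close> by finitely generated projectives. A finitely
  generated module is a quotient of \<open>A\<^sup>m\<close>, hence (choosing coset representatives) isomorphic to one
  carried by a subset of \<^typ>\<open>nat \<Rightarrow> 'a\<close>, so this carrier type is no restriction either.\<close>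

definition lmod_type_FP :: "('a, 'z) ring_scheme \<Rightarrow> ('a, 'm) module \<Rightarrow> bool" where
  "lmod_type_FP A M \<longleftrightarrow>
     (\<exists>(P :: nat \<Rightarrow> ('a, nat \<Rightarrow> 'a) module) d e n.
        (\<forall>k. left_module A (P k) \<and> lmod_finitely_generated A (P k) \<and> lmod_projective A (P k)) \<and>
        (\<forall>k>n. carrier (P k) = {\<zero>\<^bsub>P k\<^esub>}) \<and>
        (\<forall>k. d k \<in> lmod_hom A (P (Suc k)) (P k)) \<and>
        e \<in> lmod_hom A (P 0) M \<and>
        e ` carrier (P 0) = carrier M \<and>
        a_kernel (P 0) M e = d 0 ` carrier (P 1) \<and>
        (\<forall>k. a_kernel (P (Suc k)) (P k) (d k) = d (Suc k) ` carrier (P (Suc (Suc k)))))"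

definition quotient_lmod :: "('a, 'm) module \<Rightarrow> 'm set \<Rightarrow> ('a, 'm set) module" where
  "quotient_lmod M N =
     \<lparr>carrier = a_rcosets\<^bsub>M\<^esub> N, mult = undefined, one = undefined,
      zero = N, add = set_add M, smult = (\<lambda>a X. \<Union>x\<in>X. N +>\<^bsub>M\<^esub> (a \<odot>\<^bsub>M\<^esub> x))\<rparr>"

definition restrict_scalars :: "('b \<Rightarrow> 'a) \<Rightarrow> ('a, 'm) module \<Rightarrow> ('b, 'm) module" where
  "restrict_scalars i M =
     \<lparr>carrier = carrier M, mult = mult M, one = one M, zero = zero M, add = add M,
      smult = (\<lambda>b. smult M (i b))\<rparr>"

definition regular_module :: "('a, 'z) ring_scheme \<Rightarrow> ('a, 'a) module" where
  "regular_module A =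
     \<lparr>carrier = carrier A, mult = mult A, one = one A, zero = zero A, add = add A,
      smult = mult A\<rparr>"

section \<open>The group ring\<close>

definition group_ring ::
  "('r, 'x) ring_scheme \<Rightarrow> ('g, 'y) monoid_scheme \<Rightarrow> ('g \<Rightarrow> 'r) ring" where
  "group_ring R G =
     \<lparr>carrier = {a. (\<forall>g. a g \<in> carrier R) \<and> {g. a g \<noteq> \<zero>\<^bsub>R\<^esub>} \<subseteq> carrier G \<and>
                   finite {g. a g \<noteq> \<zero>\<^bsub>R\<^esub>}},
      mult = (\<lambda>a b g. if g \<in> carrier G
                then \<Oplus>\<^bsub>R\<^esub>h\<in>{h. a h \<noteq> \<zero>\<^bsub>R\<^esub>}. a h \<otimes>\<^bsub>R\<^esub> b (inv\<^bsub>G\<^esub> h \<otimes>\<^bsub>G\<^esub> g)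
                else \<zero>\<^bsub>R\<^esub>),
      one = (\<lambda>g. if g = \<one>\<^bsub>G\<^esub> then \<one>\<^bsub>R\<^esub> else \<zero>\<^bsub>R\<^esub>),
      zero = (\<lambda>g. \<zero>\<^bsub>R\<^esub>),
      add = (\<lambda>a b g. a g \<oplus>\<^bsub>R\<^esub> b g)\<rparr>"

definition gr_monom :: "('r, 'x) ring_scheme \<Rightarrow> 'r \<Rightarrow> 'g \<Rightarrow> ('g \<Rightarrow> 'r)" where
  "gr_monom R r g = (\<lambda>h. if h = g then r else \<zero>\<^bsub>R\<^esub>)"

definition augmentation :: "('r, 'x) ring_scheme \<Rightarrow> ('g \<Rightarrow> 'r) \<Rightarrow> 'r" where
  "augmentation R a = (\<Oplus>\<^bsub>R\<^esub>g\<in>{g. a g \<noteq> \<zero>\<^bsub>R\<^esub>}. a g)"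

definition trivial_module :: "('r, 'x) ring_scheme \<Rightarrow> ('g \<Rightarrow> 'r, 'r) module" where
  "trivial_module R =
     \<lparr>carrier = carrier R, mult = mult R, one = one R, zero = zero R, add = add R,
      smult = (\<lambda>a r. augmentation R a \<otimes>\<^bsub>R\<^esub> r)\<rparr>"

definition star_ring :: "('r, 'x) ring_scheme \<Rightarrow> ('r \<Rightarrow> 'r) \<Rightarrow> bool" where
  "star_ring R star \<longleftrightarrow> ring R \<and> star \<in> carrier R \<rightarrow> carrier R \<and>
     (\<forall>r\<in>carrier R. star (star r) = r) \<and>
     (\<forall>r\<in>carrier R. \<forall>s\<in>carrier R. star (r \<oplus>\<^bsub>R\<^esub> s) = star r \<oplus>\<^bsub>R\<^esub> star s) \<and>
     (\<forall>r\<in>carrier R. \<forall>s\<in>carrier R. star (r \<otimes>\<^bsub>R\<^esub> s) = star s \<otimes>\<^bsub>R\<^esub> star r) \<and>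
     star \<one>\<^bsub>R\<^esub> = \<one>\<^bsub>R\<^esub>"

definition gr_star ::
  "('r, 'x) ring_scheme \<Rightarrow> ('g, 'y) monoid_scheme \<Rightarrow> ('r \<Rightarrow> 'r) \<Rightarrow> ('g \<Rightarrow> 'r) \<Rightarrow> ('g \<Rightarrow> 'r)" where
  "gr_star R G star a = (\<lambda>g. if g \<in> carrier G then star (a (inv\<^bsub>G\<^esub> g)) else \<zero>\<^bsub>R\<^esub>)"

section \<open>Cohomology with group ring coefficients\<close>

definition words :: "('g, 'y) monoid_scheme \<Rightarrow> nat \<Rightarrow> 'g list set" where
  "words G k = {w. length w = k \<and> set w \<subseteq> carrier G}"

text \<open>The cochains obtained by applying \<open>Hom\<^bsub>RG\<^esub>(_, RG)\<close> to the bar resolution: functions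
  \<open>G\<^sup>k \<rightarrow> RG\<close>. The right \<open>RG\<close>-module structure comes from right multiplication on the
  coefficients; it is turned into a left one by \<open>c \<cdot> f = f c\<^sup>*\<close>.\<close>

definition cochains ::
  "('r, 'x) ring_scheme \<Rightarrow> ('r \<Rightarrow> 'r) \<Rightarrow> ('g, 'y) monoid_scheme \<Rightarrow> nat \<Rightarrow>
    ('g \<Rightarrow> 'r, 'g list \<Rightarrow> 'g \<Rightarrow> 'r) module" where
  "cochains R star G k =
     \<lparr>carrier = words G k \<rightarrow>\<^sub>E carrier (group_ring R G), mult = undefined, one = undefined,
      zero = (\<lambda>w\<in>words G k. \<zero>\<^bsub>group_ring R G\<^esub>),
      add = (\<lambda>f f'. \<lambda>w\<in>words G k. f w \<oplus>\<^bsub>group_ring R G\<^esub> f' w),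
      smult = (\<lambda>c f. \<lambda>w\<in>words G k. f w \<otimes>\<^bsub>group_ring R G\<^esub> gr_star R G star c)\<rparr>"

definition alt_sign :: "('a, 'z) ring_scheme \<Rightarrow> nat \<Rightarrow> 'a \<Rightarrow> 'a" where
  "alt_sign A i x = (if even i then x else \<ominus>\<^bsub>A\<^esub> x)"

text \<open>\<open>(\<delta>f)(g\<^sub>1,\<dots>,g\<^sub>k\<^sub>+\<^sub>1) = g\<^sub>1 f(g\<^sub>2,\<dots>,g\<^sub>k\<^sub>+\<^sub>1) + \<Sum>\<^sub>i (-1)\<^sup>i f(\<dots>,g\<^sub>i g\<^sub>i\<^sub>+\<^sub>1,\<dots>)
  + (-1)\<^sup>k\<^sup>+\<^sup>1 f(g\<^sub>1,\<dots>,g\<^sub>k)\<close>; list positions start at \<open>0\<close>, whence the shift of \<open>i\<close>.\<close>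

definition coboundary ::
  "('r, 'x) ring_scheme \<Rightarrow> ('g, 'y) monoid_scheme \<Rightarrow> nat \<Rightarrow>
    ('g list \<Rightarrow> 'g \<Rightarrow> 'r) \<Rightarrow> ('g list \<Rightarrow> 'g \<Rightarrow> 'r)" where
  "coboundary R G k f = (let A = group_ring R G in
     (\<lambda>w\<in>words G (Suc k).
       (gr_monom R \<one>\<^bsub>R\<^esub> (hd w) \<otimes>\<^bsub>A\<^esub> f (tl w)) \<oplus>\<^bsub>A\<^esub>
       (\<Oplus>\<^bsub>A\<^esub>i\<in>{..<k}. alt_sign A (Suc i)
           (f (take i w @ (w ! i \<otimes>\<^bsub>G\<^esub> w ! Suc i) # drop (i + 2) w))) \<oplus>\<^bsub>A\<^esub>
       alt_sign A (Suc k) (f (butlast w))))"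

definition cocycles ::
  "('r, 'x) ring_scheme \<Rightarrow> ('r \<Rightarrow> 'r) \<Rightarrow> ('g, 'y) monoid_scheme \<Rightarrow> nat \<Rightarrow>
    ('g list \<Rightarrow> 'g \<Rightarrow> 'r) set" where
  "cocycles R star G k =
     a_kernel (cochains R star G k) (cochains R star G (Suc k)) (coboundary R G k)"

fun coboundaries ::
  "('r, 'x) ring_scheme \<Rightarrow> ('r \<Rightarrow> 'r) \<Rightarrow> ('g, 'y) monoid_scheme \<Rightarrow> nat \<Rightarrow>
    ('g list \<Rightarrow> 'g \<Rightarrow> 'r) set" where
  "coboundaries R star G 0 = {\<zero>\<^bsub>cochains R star G 0\<^esub>}"
| "coboundaries R star G (Suc k) = coboundary R G k ` carrier (cochains R star G k)"

definition group_cohomology ::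
  "('r, 'x) ring_scheme \<Rightarrow> ('r \<Rightarrow> 'r) \<Rightarrow> ('g, 'y) monoid_scheme \<Rightarrow> nat \<Rightarrow>
    ('g \<Rightarrow> 'r, ('g list \<Rightarrow> 'g \<Rightarrow> 'r) set) module" where
  "group_cohomology R star G k =
     quotient_lmod ((cochains R star G k)\<lparr>carrier := cocycles R star G k\<rparr>)
       (coboundaries R star G k)"

section \<open>Poincare duality groups\<close>

text \<open>The involution only serves to regard the right module \<open>H\<^sup>k(G;RG)\<close> as a left module; for
  commutative \<open>R\<close> it is the identity.\<close>

definition PD_group ::
  "('r, 'x) ring_scheme \<Rightarrow> ('r \<Rightarrow> 'r) \<Rightarrow> nat \<Rightarrow> ('g, 'y) monoid_scheme \<Rightarrow> bool" where
  "PD_group R star n G \<longleftrightarrow> group G \<and> n \<ge> 1 \<and>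
     lmod_type_FP (group_ring R G) (trivial_module R :: ('g \<Rightarrow> 'r, 'r) module) \<and>
     lmod_isomorphic R
       (restrict_scalars (\<lambda>r. gr_monom R r \<one>\<^bsub>G\<^esub>) (group_cohomology R star G n))
       (regular_module R) \<and>
     (\<forall>k. k \<noteq> n \<longrightarrow>
       carrier (group_cohomology R star G k) = {\<zero>\<^bsub>group_cohomology R star G k\<^esub>})"

definition oriented_PD_group ::
  "('r, 'x) ring_scheme \<Rightarrow> ('r \<Rightarrow> 'r) \<Rightarrow> nat \<Rightarrow> ('g, 'y) monoid_scheme \<Rightarrow> bool" where
  "oriented_PD_group R star n G \<longleftrightarrow> PD_group R star n G \<and>
     lmod_isomorphic (group_ring R G) (group_cohomology R star G n) (trivial_module R)"

section \<open>Hyperbolic, elementary and amenable groups\<close>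

definition word_norm :: "('g, 'y) monoid_scheme \<Rightarrow> 'g set \<Rightarrow> 'g \<Rightarrow> nat" where
  "word_norm G S g = (LEAST n. \<exists>w. length w = n \<and> set w \<subseteq> S \<union> m_inv G ` S \<and>
     foldr (mult G) w \<one>\<^bsub>G\<^esub> = g)"

definition word_dist :: "('g, 'y) monoid_scheme \<Rightarrow> 'g set \<Rightarrow> 'g \<Rightarrow> 'g \<Rightarrow> real" where
  "word_dist G S g h = real (word_norm G S (inv\<^bsub>G\<^esub> g \<otimes>\<^bsub>G\<^esub> h))"

definition gromov_product :: "('p \<Rightarrow> 'p \<Rightarrow> real) \<Rightarrow> 'p \<Rightarrow> 'p \<Rightarrow> 'p \<Rightarrow> real" where
  "gromov_product d p x y = (d p x + d p y - d x y) / 2"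

definition gromov_hyperbolic :: "'p set \<Rightarrow> ('p \<Rightarrow> 'p \<Rightarrow> real) \<Rightarrow> bool" where
  "gromov_hyperbolic X d \<longleftrightarrow> (\<exists>\<delta>\<ge>0. \<forall>p\<in>X. \<forall>x\<in>X. \<forall>y\<in>X. \<forall>z\<in>X.
     gromov_product d p x z \<ge> min (gromov_product d p x y) (gromov_product d p y z) - \<delta>)"

definition hyperbolic_group :: "('g, 'y) monoid_scheme \<Rightarrow> bool" where
  "hyperbolic_group G \<longleftrightarrow> group G \<and> (\<exists>S. finite S \<and> S \<subseteq> carrier G \<and>
     generate G S = carrier G \<and> gromov_hyperbolic (carrier G) (word_dist G S))"

definition virtually_cyclic :: "('g, 'y) monoid_scheme \<Rightarrow> bool" where
  "virtually_cyclic G \<longleftrightarrow>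
     (\<exists>H. subgroup H G \<and> finite (rcosets\<^bsub>G\<^esub> H) \<and> cyclic_group (subgroup_generated G H))"

text \<open>Amenability of a discrete group: a left-invariant finitely additive probability measure on
  all subsets.\<close>

definition amenable_group :: "('g, 'y) monoid_scheme \<Rightarrow> bool" where
  "amenable_group G \<longleftrightarrow> group G \<and> (\<exists>\<mu> :: 'g set \<Rightarrow> real.
     \<mu> (carrier G) = 1 \<and>
     (\<forall>A. A \<subseteq> carrier G \<longrightarrow> \<mu> A \<ge> 0) \<and>
     (\<forall>A B. A \<subseteq> carrier G \<longrightarrow> B \<subseteq> carrier G \<longrightarrow> A \<inter> B = {} \<longrightarrow> \<mu> (A \<union> B) = \<mu> A + \<mu> B) \<and>
     (\<forall>g\<in>carrier G. \<forall>A. A \<subseteq> carrier G \<longrightarrow> \<mu> (g <#\<^bsub>G\<^esub> A) = \<mu> A))"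

end

theory Submission
  imports Defs "HOL-Library.Function_Algebras" "HOL-Analysis.Function_Topology"
begin

text \<open>Let \<open>P\<close> be a finite resolution of \<open>R\<close> by finitely generated projective \<open>RG\<close>-modules. Since
  \<open>H\<^sup>k(G;RG) = 0\<close> for \<open>k \<ge> 3\<close>, the inclusion of each module of cycles in high degree splits, so by
  descending induction the module \<open>Z\<close> of cycles in \<open>P\<^sub>1\<close> is finitely generated and projective: there are
  \<open>t\<^sub>1,\<dots>,t\<^sub>n \<in> Z\<close> and homomorphisms \<open>z\<^sub>j : Z \<rightarrow> RG\<close> with \<open>p = \<Sum>\<^sub>j z\<^sub>j(p) t\<^sub>j\<close>. Each \<open>z\<^sub>j\<close> defines a
  class in \<open>H\<^sup>2(G;RG) \<cong> R\<close>. Hence, up to homomorphisms that extend to \<open>P\<^sub>1\<close> and so enlarge supports only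
  linearly, it is a right multiple by a scalar of a single homomorphism \<open>\<theta> : Z \<rightarrow> RG\<close>. The right
  translate of \<open>\<theta>\<close> by \<open>g \<in> G\<close> is of this form, too, so for \<open>F = supp (\<theta> p)\<close> the set \<open>F g - F\<close> has at
  most \<open>C\<^sub>g |p|\<close> elements. If \<open>G\<close> is not amenable then by Folner \<open>|F| \<le> K \<Sum>\<^sub>g |F g - F|\<close> for a finite
  set of \<open>g\<close>, whence \<open>|z\<^sub>j(p)| \<le> C |p|\<close>: the cycles satisfy a linear isoperimetric inequality.
  Chain maps carry it over to the Cayley graph, where every closed path of length \<open>n\<close> is homologous to
  zero by at most \<open>C n\<close> cycles of bounded size. Coefficients play no role any more in the argument that such
  a graph satisfies a Morse lemma and is therefore hyperbolic. Virtually cyclic groups are amenable.\<close>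

section \<open>Folner sets and amenability\<close>

text \<open>Elements of \<open>R\<close> have no absolute value, so the size of a chain is its
  number of nonzero coefficients. Homomorphisms out of a finitely generated projective module
  enlarge it at most linearly. One that is defined on \<open>Z\<close> only is controlled by the
  coordinates with respect to the \<open>t\<^sub>j\<close>, not by the size in
  \<open>P\<^sub>1\<close>; the isoperimetric inequality compares the two. Cohomology is computed
  from the bar resolution, whose modules are in general not finitely generated and whose contraction
  is not equivariant, so every estimate is made for a map that starts in \<open>P\<^sub>1\<close>.
  The bound for \<open>F g - F\<close> comes from an identity
  \<open>\<theta>(p) g = \<theta>(p) \<rho> + c(p)\<close> with a scalar \<open>\<rho>\<close> and
  with \<open>c\<close> defined on all of \<open>P\<^sub>1\<close>. A scalar cannot create support,
  so at a point of \<open>F g\<close> outside \<open>F\<close> the left side is nonzero, the first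
  term on the right vanishes, and \<open>c(p)\<close> is nonzero, even if \<open>\<rho>\<close> is a
  zero divisor. In the graph a filling is measured by its number of small cycles. Lower bounds for
  this number come from connectivity alone: a chain whose boundary is a nonzero multiple of
  \<open>x - y\<close> has to cross every sphere around \<open>x\<close> that separates it from
  \<open>y\<close>.\<close>

lemma compact_unit_interval_functions:
  "compact {\<mu> :: 'a \<Rightarrow> real. \<forall>A. 0 \<le> \<mu> A \<and> \<mu> A \<le> 1}"
proof -
  have "compactin (product_topology (\<lambda>_::'a. euclidean :: real topology) UNIV) (PiE UNIV (\<lambda>_. {0..1}))"
    by (subst compactin_PiE) auto
  then have "compact (PiE UNIV (\<lambda>_::'a. {0..1::real}))"
    by (simp add: euclidean_product_topology)
  moreover have "PiE UNIV (\<lambda>_::'a. {0..1::real}) = {\<mu>. \<forall>A. 0 \<le> \<mu> A \<and> \<mu> A \<le> 1}"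
    by (auto simp: PiE_def)
  ultimately show ?thesis by simp
qed

lemma card_inter_translate_le:
  assumes "finite F" "finite F'"
  shows "card (F' \<inter> A) \<le> card (F \<inter> A) + card (F' - F)"
proof -
  have "card (F' \<inter> A) \<le> card ((F \<inter> A) \<union> (F' - F))"
    by (rule card_mono) (use assms in auto)
  also have "\<dots> \<le> card (F \<inter> A) + card (F' - F)" by (rule card_Un_le)
  finally show ?thesis .
qed

text \<open>Compactness of the cube of functions from sets to \<open>[0, 1]\<close>. Additivity and
  invariance under \<open>g\<close> up to \<open>1 / (n + 1)\<close> are closed conditions, and
  finitely many of them hold for the normalised counting measure of one Folner set. A point that
  satisfies all of them is exactly invariant.\<close>

lemma (in group) folner_imp_amenable:
  assumes folner: "\<And>T n. finite T \<Longrightarrow> T \<subseteq> carrier G \<Longrightarrow> \<exists>F. finite F \<and> F \<noteq> {} \<and> F \<subseteq> carrier G \<and>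
     (\<forall>g\<in>T. n * card ((\<lambda>x. x \<otimes> g) ` F - F) \<le> card F)"
  shows "amenable_group G"
proof -
  define K where "K = {\<mu> :: 'a set \<Rightarrow> real. \<forall>A. 0 \<le> \<mu> A \<and> \<mu> A \<le> 1}"
  define C where "C = (\<lambda>(g, n::nat). {\<mu> :: 'a set \<Rightarrow> real. \<mu> (carrier G) = 1 \<and>
     (\<forall>A B. A \<inter> B = {} \<longrightarrow> \<mu> (A \<union> B) = \<mu> A + \<mu> B) \<and>
     (\<forall>A. A \<subseteq> carrier G \<longrightarrow> \<bar>\<mu> (g <# A) - \<mu> A\<bar> \<le> 1 / real (Suc n))})"
  have "K \<inter> (\<Inter>i\<in>carrier G \<times> UNIV. C i) \<noteq> {}"
  proof (rule compact_imp_fip_image)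
    show "compact K" unfolding K_def by (rule compact_unit_interval_functions)
  next
    fix i assume "i \<in> carrier G \<times> (UNIV::nat set)"
    obtain g n where i: "i = (g, n)" by (cases i)
    have c1: "closed {\<mu> :: 'a set \<Rightarrow> real. \<mu> (carrier G) = 1}"
      by (rule closed_Collect_eq) (auto intro: continuous_on_product_coordinates)
    have c2: "closed {\<mu> :: 'a set \<Rightarrow> real. \<mu> (A \<union> B) = \<mu> A + \<mu> B}" for A B
      by (rule closed_Collect_eq) (auto intro!: continuous_on_add)
    have c3: "closed {\<mu> :: 'a set \<Rightarrow> real. \<bar>\<mu> (g <# A) - \<mu> A\<bar> \<le> 1 / real (Suc n)}" for A
      by (rule closed_Collect_le) (auto intro!: continuous_on_diff continuous_on_rabs)
    have "C i = {\<mu>. \<mu> (carrier G) = 1} \<inter>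
        (\<Inter>(A, B)\<in>{(A, B). A \<inter> B = {}}. {\<mu>. \<mu> (A \<union> B) = \<mu> A + \<mu> B}) \<inter>
        (\<Inter>A\<in>Pow (carrier G). {\<mu>. \<bar>\<mu> (g <# A) - \<mu> A\<bar> \<le> 1 / real (Suc n)})"
      unfolding C_def i by blast
    then show "closed (C i)" using c1 c2 c3 by (auto intro!: closed_Int closed_INT)
  next
    fix I' assume fin: "finite I'" and sub: "I' \<subseteq> carrier G \<times> (UNIV :: nat set)"
    define T where "T = fst ` I'"
    define n where "n = Max (insert 0 (snd ` I'))"
    have T: "finite T" "T \<subseteq> carrier G" using fin sub by (auto simp: T_def)
    obtain F where F: "finite F" "F \<noteq> {}" "F \<subseteq> carrier G"
      and Fg: "\<And>g. g \<in> T \<Longrightarrow> Suc n * card ((\<lambda>x. x \<otimes> g) ` F - F) \<le> card F"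
      using folner[OF T, of "Suc n"] by auto
    \<comment> \<open>Folner sets are almost invariant under right translation, whereas the measure
      has to be left invariant; inversion exchanges the two.\<close>
    define \<mu> where "\<mu> = (\<lambda>A. real (card (F \<inter> {x. inv x \<in> A})) / real (card F))"
    have cpos: "card F > 0" using F by (simp add: card_gt_0_iff)
    have "\<mu> \<in> K"
      unfolding K_def \<mu>_def using cpos F(1) by (simp add: card_mono)
    moreover have "\<mu> \<in> C i" if i: "i \<in> I'" for i
    proof -
      obtain g k where ik: "i = (g, k)" by (cases i)
      have gT: "g \<in> T" using i unfolding ik T_def by force
      then have g: "g \<in> carrier G" using T by auto
      have "k \<in> snd ` I'" using i unfolding ik by force
      then have kn: "k \<le> n" unfolding n_def using fin by (intro Max_ge) auto
      have "F \<inter> {x. inv x \<in> carrier G} = F" using F(3) by auto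
      then have 1: "\<mu> (carrier G) = 1" using cpos by (simp add: \<mu>_def)
      have 2: "\<mu> (A \<union> B) = \<mu> A + \<mu> B" if "A \<inter> B = {}" for A B
      proof -
        have eq: "F \<inter> {x. inv x \<in> A \<union> B} = (F \<inter> {x. inv x \<in> A}) \<union> (F \<inter> {x. inv x \<in> B})" by auto
        have "card (F \<inter> {x. inv x \<in> A \<union> B}) = card (F \<inter> {x. inv x \<in> A}) + card (F \<inter> {x. inv x \<in> B})"
          unfolding eq by (rule card_Un_disjoint) (use F(1) that in auto)
        then show ?thesis by (simp add: \<mu>_def add_divide_distrib)
      qed
      have 3: "\<bar>\<mu> (g <# A) - \<mu> A\<bar> \<le> 1 / real (Suc k)" if A: "A \<subseteq> carrier G" for A
      proof -
        let ?F' = "(\<lambda>x. x \<otimes> g) ` F"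
        let ?A = "{x. inv x \<in> A}"
        have inj: "inj_on (\<lambda>x. x \<otimes> g) F" using F(3) g by (auto simp: inj_on_def subset_iff)
        have mem: "inv x \<in> g <# A \<longleftrightarrow> inv (x \<otimes> g) \<in> A" if x: "x \<in> F" for x
        proof -
          have xG: "x \<in> carrier G" using x F(3) by auto
          have e: "inv (x \<otimes> g) = inv g \<otimes> inv x" using xG g by (simp add: inv_mult_group)
          show ?thesis
          proof
            assume "inv x \<in> g <# A"
            then obtain a where a: "a \<in> A" "inv x = g \<otimes> a" by (auto simp: l_coset_def)
            then have "inv g \<otimes> inv x = a" using A g by (auto simp: m_assoc[symmetric])
            then show "inv (x \<otimes> g) \<in> A" using a e by simp
          next
            assume "inv (x \<otimes> g) \<in> A"
            moreover have "inv x = g \<otimes> inv (x \<otimes> g)" using xG g by (simp add: e m_assoc[symmetric])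
            ultimately show "inv x \<in> g <# A" by (auto simp: l_coset_def)
          qed
        qed
        have "card (F \<inter> {x. inv x \<in> g <# A}) = card ((\<lambda>x. x \<otimes> g) ` (F \<inter> {x. inv x \<in> g <# A}))"
          by (rule card_image[symmetric]) (rule inj_on_subset[OF inj], auto)
        also have "(\<lambda>x. x \<otimes> g) ` (F \<inter> {x. inv x \<in> g <# A}) = ?F' \<inter> ?A"
          using mem by auto
        finally have c: "card (F \<inter> {x. inv x \<in> g <# A}) = card (?F' \<inter> ?A)" .
        have cF: "card ?F' = card F" by (rule card_image[OF inj])
        have fF': "finite ?F'" using F(1) by simp
        have cd: "card (F - ?F') = card (?F' - F)"
          using card_Diff_subset_Int[of F ?F'] card_Diff_subset_Int[of ?F' F] F(1) fF' cF
          by (simp add: Int_commute)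
        have "card (?F' \<inter> ?A) \<le> card (F \<inter> ?A) + card (?F' - F)"
          "card (F \<inter> ?A) \<le> card (?F' \<inter> ?A) + card (?F' - F)"
          using card_inter_translate_le[OF F(1) fF', of ?A] card_inter_translate_le[OF fF' F(1), of ?A] cd by auto
        then have "\<bar>real (card (?F' \<inter> ?A)) - real (card (F \<inter> ?A))\<bar> \<le> real (card (?F' - F))"
          by linarith
        moreover have "\<mu> (g <# A) - \<mu> A = (real (card (?F' \<inter> ?A)) - real (card (F \<inter> ?A))) / real (card F)"
          by (simp add: \<mu>_def c diff_divide_distrib)
        ultimately have "\<bar>\<mu> (g <# A) - \<mu> A\<bar> \<le> real (card (?F' - F)) / real (card F)"
          using cpos by (simp add: divide_right_mono)
        also have "\<dots> \<le> 1 / real (Suc n)"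
        proof -
          have "real (Suc n * card (?F' - F)) \<le> real (card F)" using Fg[OF gT] by linarith
          then show ?thesis using cpos by (simp add: field_simps)
        qed
        also have "\<dots> \<le> 1 / real (Suc k)" using kn by (simp add: field_simps)
        finally show ?thesis .
      qed
      show ?thesis unfolding C_def ik using 1 2 3 by auto
    qed
    ultimately show "K \<inter> (\<Inter>i\<in>I'. C i) \<noteq> {}" by auto
  qed
  then obtain \<mu> where \<mu>: "\<mu> \<in> K" and C: "\<And>g n. g \<in> carrier G \<Longrightarrow> \<mu> \<in> C (g, n)" by auto
  have inv: "\<mu> (g <# A) = \<mu> A" if g: "g \<in> carrier G" and A: "A \<subseteq> carrier G" for g A
  proof (rule ccontr)
    assume "\<mu> (g <# A) \<noteq> \<mu> A"
    then have "0 < \<bar>\<mu> (g <# A) - \<mu> A\<bar>" by simp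
    then obtain n where "1 / real (Suc n) < \<bar>\<mu> (g <# A) - \<mu> A\<bar>"
      using nat_approx_posE by blast
    moreover have "\<bar>\<mu> (g <# A) - \<mu> A\<bar> \<le> 1 / real (Suc n)" using C[OF g, of n] A by (auto simp: C_def)
    ultimately show False by simp
  qed
  show ?thesis unfolding amenable_group_def
    using \<mu> C[OF one_closed, of 0] inv is_group by (intro conjI exI[of _ \<mu>]) (auto simp: K_def C_def)
qed

section \<open>Folner sets in virtually cyclic groups\<close>

lemma (in group) virtually_cyclic_cover:
  assumes "virtually_cyclic G"
  obtains h T where "h \<in> carrier G" "finite T" "T \<subseteq> carrier G"
    "\<And>x. x \<in> carrier G \<Longrightarrow> \<exists>k::int. \<exists>t\<in>T. x = h [^] k \<otimes> t"
proof -
  obtain H where H: "subgroup H G" "finite (rcosets H)" "cyclic_group (subgroup_generated G H)"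
    using assms by (auto simp: virtually_cyclic_def)
  have carr: "carrier (subgroup_generated G H) = H"
    by (simp add: H(1) subgroup.carrier_subgroup_generated_subgroup)
  interpret S: group "subgroup_generated G H" by (rule group_subgroup_generated)
  obtain h where h: "h \<in> H" and Heq: "H = range (\<lambda>n::int. h [^]\<^bsub>subgroup_generated G H\<^esub> n)"
    using H(3) S.cyclic_group carr by auto
  have hG: "h \<in> carrier G" using h H(1) by (rule subgroup.mem_carrier[rotated])
  have pw: "H = range (\<lambda>n::int. h [^] n)"
    using Heq h carr by (simp add: int_pow_subgroup_generated)
  define T where "T = (\<lambda>C. SOME x. x \<in> C) ` (rcosets H)"
  have TC: "(SOME x. x \<in> C) \<in> C" if "C \<in> rcosets H" for C
  proof -
    have "C \<noteq> {}" using that subgroup.rcosets_non_empty[OF H(1)] by blast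
    then show ?thesis by (simp add: some_in_eq)
  qed
  have sub: "C \<subseteq> carrier G" if "C \<in> rcosets H" for C
    using that subgroup.rcosets_carrier[OF H(1) is_group] by blast
  have "\<exists>k::int. \<exists>t\<in>T. x = h [^] k \<otimes> t" if x: "x \<in> carrier G" for x
  proof -
    define t where "t = (SOME y. y \<in> H #> x)"
    have Hx: "H #> x \<in> rcosets H" using x H(1) by (simp add: rcosetsI subgroup.subset)
    have "t \<in> T" using Hx by (auto simp: T_def t_def)
    moreover have "t \<in> H #> x" using TC[OF Hx] by (simp add: t_def)
    then have tG: "t \<in> carrier G" and "H #> x = H #> t"
      using sub[OF Hx] repr_independence[OF _ x H(1)] by auto
    then have "x \<in> H #> t" using x H(1) by (metis rcos_self)
    then obtain a where "a \<in> H" "x = a \<otimes> t" by (auto simp: r_coset_def)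
    ultimately show ?thesis using pw by auto
  qed
  moreover have "finite T" "T \<subseteq> carrier G" using H(2) TC sub by (auto simp: T_def)
  ultimately show thesis using that hG by blast
qed

text \<open>Thickened intervals \<open>F N\<close> of the cyclic subgroup are Folner sets: right
  translation by \<open>S\<close> maps \<open>F N\<close> into \<open>F (N + M)\<close>, which has
  at most \<open>2 * M * card T\<close> further elements whatever \<open>N\<close> is, while the
  size of \<open>F N\<close> is unbounded if the group is infinite.\<close>

lemma (in group) virtually_cyclic_imp_amenable:
  assumes "virtually_cyclic G"
  shows "amenable_group G"
proof (rule folner_imp_amenable)
  fix S :: "'a set" and n :: nat
  assume S: "finite S" "S \<subseteq> carrier G"
  obtain h T where h: "h \<in> carrier G" and T: "finite T" "T \<subseteq> carrier G"
    and cov: "\<And>x. x \<in> carrier G \<Longrightarrow> \<exists>k::int. \<exists>t\<in>T. x = h [^] k \<otimes> t"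
    using virtually_cyclic_cover[OF assms] by metis
  show "\<exists>F. finite F \<and> F \<noteq> {} \<and> F \<subseteq> carrier G \<and>
     (\<forall>g\<in>S. n * card ((\<lambda>x. x \<otimes> g) ` F - F) \<le> card F)"
  proof (cases "finite (carrier G)")
    case True
    have "(\<lambda>x. x \<otimes> g) ` carrier G - carrier G = {}" if "g \<in> S" for g
      using that S by auto
    then have "\<forall>g\<in>S. n * card ((\<lambda>x. x \<otimes> g) ` carrier G - carrier G) \<le> card (carrier G)"
      by (metis card.empty le0 mult_0_right)
    then show ?thesis using True carrier_not_empty by blast
  next
    case False
    define F where "F N = (\<lambda>(k::int, t). h [^] k \<otimes> t) ` ({- int N..int N} \<times> T)" for N
    have fF: "finite (F N)" for N using T by (simp add: F_def)
    have FG: "F N \<subseteq> carrier G" for N using T h by (auto simp: F_def)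
    have Fmono: "N \<le> N' \<Longrightarrow> F N \<subseteq> F N'" for N N' unfolding F_def by (intro image_mono) auto
    have "\<forall>p\<in>T\<times>S. \<exists>k::int. \<exists>t\<in>T. fst p \<otimes> snd p = h [^] k \<otimes> t"
      using T S by (intro ballI cov) (auto intro!: m_closed)
    then obtain m where m: "\<And>t g. t \<in> T \<Longrightarrow> g \<in> S \<Longrightarrow> \<exists>t'\<in>T. t \<otimes> g = h [^] (m (t, g) :: int) \<otimes> t'"
      by (metis (no_types, lifting) SigmaI fst_conv snd_conv)
    \<comment> \<open>The largest shift along the cyclic subgroup that is caused by rewriting
      \<open>t \<otimes> g\<close> as a power of \<open>h\<close> times a representative.\<close>
    define M where "M = Max (insert 0 ((\<lambda>p. nat \<bar>m p\<bar>) ` (T \<times> S)))"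
    have M: "\<bar>m (t, g)\<bar> \<le> int M" if "t \<in> T" "g \<in> S" for t g
    proof -
      have "nat \<bar>m (t, g)\<bar> \<le> M" unfolding M_def using that T S by (intro Max_ge) auto
      then show ?thesis by linarith
    qed
    have trans: "x \<otimes> g \<in> F (N + M)" if x: "x \<in> F N" and g: "g \<in> S" for x g N
    proof -
      obtain k t where kt: "k \<in> {- int N..int N}" "t \<in> T" "x = h [^] k \<otimes> t"
        using x by (auto simp: F_def)
      obtain t' where t': "t' \<in> T" "t \<otimes> g = h [^] m (t, g) \<otimes> t'" using m[OF kt(2) g] by blast
      have "x \<otimes> g = h [^] (k + m (t, g)) \<otimes> t'"
        using kt t' h T S g by (auto simp: m_assoc int_pow_mult subset_iff)
      moreover have "k + m (t, g) \<in> {- int (N + M)..int (N + M)}" using kt M[OF kt(2) g] by auto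
      ultimately show ?thesis using t' unfolding F_def by force
    qed
    have diff: "card (F (N + M) - F N) \<le> 2 * M * card T" for N
    proof -
      have "F (N + M) - F N \<subseteq> (\<lambda>(k::int, t). h [^] k \<otimes> t) ` (({- int (N + M)..int (N + M)} - {- int N..int N}) \<times> T)"
        unfolding F_def by blast
      then have "card (F (N + M) - F N) \<le> card ((\<lambda>(k::int, t). h [^] k \<otimes> t) ` (({- int (N + M)..int (N + M)} - {- int N..int N}) \<times> T))"
        by (rule card_mono[rotated]) (use T in auto)
      also have "\<dots> \<le> card (({- int (N + M)..int (N + M)} - {- int N..int N}) \<times> T)"
        by (rule card_image_le) (use T in auto)
      also have "\<dots> = card ({- int (N + M)..int (N + M)} - {- int N..int N}) * card T"
        by (simp add: card_cartesian_product)
      also have "card ({- int (N + M)..int (N + M)} - {- int N..int N}) = 2 * M"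
        by (subst card_Diff_subset) auto
      finally show ?thesis .
    qed
    \<comment> \<open>More than \<open>n\<close> times the bound in \<open>diff\<close>. The
      increasing sets \<open>F N\<close> exhaust the group, so one of them contains
      \<open>Y\<close>.\<close>
    obtain Y where Y: "finite Y" "Y \<subseteq> carrier G" "card Y = Suc (n * (2 * M * card T))"
      using False infinite_arbitrarily_large by metis
    have "\<forall>y\<in>Y. \<exists>N. y \<in> F N"
    proof
      fix y assume "y \<in> Y"
      then obtain k :: int and t where "t \<in> T" "y = h [^] k \<otimes> t" using cov Y by blast
      then have "y \<in> F (nat \<bar>k\<bar>)" unfolding F_def by (auto intro!: image_eqI[of _ _ "(k, t)"])
      then show "\<exists>N. y \<in> F N" ..
    qed
    then obtain Nf where Nf: "\<And>y. y \<in> Y \<Longrightarrow> y \<in> F (Nf y)" by metis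
    define N where "N = Max (insert 0 (Nf ` Y))"
    have "Y \<subseteq> F N"
    proof
      fix y assume y: "y \<in> Y"
      then have "Nf y \<le> N" unfolding N_def using Y by (intro Max_ge) auto
      then show "y \<in> F N" using Nf[OF y] Fmono by blast
    qed
    then have cardF: "card Y \<le> card (F N)" by (rule card_mono[OF fF])
    have "n * card ((\<lambda>x. x \<otimes> g) ` F N - F N) \<le> card (F N)" if g: "g \<in> S" for g
    proof -
      have "card ((\<lambda>x. x \<otimes> g) ` F N - F N) \<le> card (F (N + M) - F N)"
        by (rule card_mono) (use fF trans g in auto)
      then have "n * card ((\<lambda>x. x \<otimes> g) ` F N - F N) \<le> n * (2 * M * card T)"
        using diff[of N] by (intro mult_le_mono2) linarith
      then show ?thesis using cardF Y(3) by linarith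
    qed
    then show ?thesis using fF FG cardF Y(3) by (intro exI[of _ "F N"]) (auto simp: card_gt_0_iff)
  qed
qed

section \<open>Linear isoperimetric inequalities in geodesic spaces\<close>

lemma sum_fun_apply: "(sum f A) x = (\<Sum>i\<in>A. f i x)" for f :: "'a \<Rightarrow> 'b \<Rightarrow> 'c::comm_monoid_add"
  by (induction A rule: infinite_finite_induct) auto

definition sgl :: "'v \<times> 'v \<Rightarrow> 'u::zero \<Rightarrow> 'v \<times> 'v \<Rightarrow> 'u" where
  "sgl p u = (\<lambda>q. if q = p then u else 0)"

definition edge_supp :: "('v \<times> 'v \<Rightarrow> 'u::zero) \<Rightarrow> ('v \<times> 'v) set" where
  "edge_supp c = {p. c p \<noteq> 0}"

text \<open>The sum over \<open>K\<close> of the coefficients of the boundary of \<open>c\<close>,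
  that is, the net flow into \<open>K\<close>. A chain is a cycle if this vanishes for every
  \<open>K\<close>, which dispenses with chains on vertices.\<close>

definition flux :: "'v set \<Rightarrow> ('v \<times> 'v \<Rightarrow> 'u::ab_group_add) \<Rightarrow> 'u" where
  "flux K c = (\<Sum>p\<in>edge_supp c. (if snd p \<in> K then c p else 0) - (if fst p \<in> K then c p else 0))"

definition path_chain :: "'u::ab_group_add \<Rightarrow> (nat \<Rightarrow> 'v) \<Rightarrow> nat \<Rightarrow> nat \<Rightarrow> 'v \<times> 'v \<Rightarrow> 'u" where
  "path_chain e p i j = (\<Sum>k\<in>{i..<j}. sgl (p k, p (Suc k)) e)"

lemma flux_superset:
  assumes "finite T" "edge_supp c \<subseteq> T"
  shows "flux K c = (\<Sum>p\<in>T. (if snd p \<in> K then c p else 0) - (if fst p \<in> K then c p else 0))"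
  unfolding flux_def by (rule sum.mono_neutral_left) (use assms in \<open>auto simp: edge_supp_def\<close>)

lemma edge_supp_add: "edge_supp (c + c' :: _ \<Rightarrow> 'u::ab_group_add) \<subseteq> edge_supp c \<union> edge_supp c'"
  by (auto simp: edge_supp_def)

lemma flux_add:
  assumes "finite (edge_supp c)" "finite (edge_supp c')"
  shows "flux K (c + c') = flux K c + flux K c'"
proof -
  let ?T = "edge_supp c \<union> edge_supp c'"
  have "flux K (c + c') = (\<Sum>p\<in>?T. (if snd p \<in> K then (c + c') p else 0) - (if fst p \<in> K then (c + c') p else 0))"
    by (rule flux_superset) (use assms edge_supp_add in auto)
  also have "\<dots> = (\<Sum>p\<in>?T. ((if snd p \<in> K then c p else 0) - (if fst p \<in> K then c p else 0)) +
      ((if snd p \<in> K then c' p else 0) - (if fst p \<in> K then c' p else 0)))"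
    by (rule sum.cong) auto
  also have "\<dots> = flux K c + flux K c'"
    by (simp only: sum.distrib) (use assms in \<open>simp add: flux_superset[of ?T]\<close>)
  finally show ?thesis .
qed

lemma edge_supp_uminus [simp]: "edge_supp (- c :: _ \<Rightarrow> 'u::ab_group_add) = edge_supp c"
  by (simp add: edge_supp_def)

lemma flux_uminus: "flux K (- c) = - flux K (c :: _ \<Rightarrow> 'u::ab_group_add)"
proof -
  have "flux K (- c) = (\<Sum>p\<in>edge_supp c. - ((if snd p \<in> K then c p else 0) - (if fst p \<in> K then c p else 0)))"
    unfolding flux_def edge_supp_uminus by (rule sum.cong) auto
  then show ?thesis by (simp only: sum_negf flux_def)
qed

lemma flux_diff:
  assumes "finite (edge_supp c)" "finite (edge_supp c')"
  shows "flux K (c - c') = flux K c - flux K (c' :: _ \<Rightarrow> 'u::ab_group_add)"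
  using flux_add[of c "- c'" K] assms by (simp add: flux_uminus)

lemma edge_supp_sum:
  "edge_supp (sum f A :: _ \<Rightarrow> 'u::ab_group_add) \<subseteq> (\<Union>i\<in>A. edge_supp (f i))"
  by (auto simp: edge_supp_def sum_fun_apply elim: sum.not_neutral_contains_not_neutral)

lemma finite_edge_supp_sum:
  assumes "finite A" "\<And>i. i \<in> A \<Longrightarrow> finite (edge_supp (f i))"
  shows "finite (edge_supp (sum f A :: _ \<Rightarrow> 'u::ab_group_add))"
  using edge_supp_sum[of f A] by (rule finite_subset) (use assms in auto)

lemma flux_zero [simp]: "flux K 0 = 0"
  by (simp add: flux_def edge_supp_def)

lemma flux_sum:
  assumes "finite A" "\<And>i. i \<in> A \<Longrightarrow> finite (edge_supp (f i))"
  shows "flux K (sum f A) = (\<Sum>i\<in>A. flux K (f i :: _ \<Rightarrow> 'u::ab_group_add))"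
  using assms
  by (induction A rule: finite_induct) (simp_all add: flux_add finite_edge_supp_sum)

lemma edge_supp_sgl: "edge_supp (sgl p u) \<subseteq> {p}" by (auto simp: edge_supp_def sgl_def)

lemma flux_sgl: "flux K (sgl (x, y) u) = (if y \<in> K then u else 0) - (if x \<in> K then u else (0::'u::ab_group_add))"
  by (subst flux_superset[of "{(x, y)}"]) (use edge_supp_sgl[of "(x, y)" u] in \<open>auto simp: sgl_def\<close>)

lemma edge_supp_path_chain: "edge_supp (path_chain e p i j) \<subseteq> (\<lambda>k. (p k, p (Suc k))) ` {i..<j}"
proof -
  have "edge_supp (path_chain e p i j) \<subseteq> (\<Union>k\<in>{i..<j}. edge_supp (sgl (p k, p (Suc k)) e))"
    unfolding path_chain_def by (rule edge_supp_sum)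
  also have "\<dots> \<subseteq> (\<Union>k\<in>{i..<j}. {(p k, p (Suc k))})" by (intro UN_mono edge_supp_sgl) auto
  finally show ?thesis by auto
qed

lemma path_chain_nonzeroD:
  assumes "path_chain e p i j q \<noteq> 0"
  shows "\<exists>k\<ge>i. k < j \<and> q = (p k, p (Suc k))"
proof -
  have "q \<in> (\<lambda>k. (p k, p (Suc k))) ` {i..<j}"
    using assms edge_supp_path_chain[of e p i j] by (auto simp: edge_supp_def)
  then show ?thesis by auto
qed

lemma finite_edge_supp_path_chain: "finite (edge_supp (path_chain e p i j))"
  using edge_supp_path_chain by (rule finite_subset) auto

lemma flux_path_chain:
  assumes "i \<le> j"
  shows "flux K (path_chain e p i j) = (if p j \<in> K then e else 0) - (if p i \<in> K then e else (0::'u::ab_group_add))"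
proof -
  have "flux K (path_chain e p i j) = (\<Sum>k\<in>{i..<j}. flux K (sgl (p k, p (Suc k)) e))"
    unfolding path_chain_def
    by (rule flux_sum) (auto intro: finite_subset[OF edge_supp_sgl])
  also have "\<dots> = (\<Sum>k\<in>{i..<j}. (if p (Suc k) \<in> K then e else 0) - (if p k \<in> K then e else 0))"
    by (simp add: flux_sgl)
  also have "\<dots> = (if p j \<in> K then e else 0) - (if p i \<in> K then e else 0)"
    using assms sum_Suc_diff'[of i j "\<lambda>k. if p k \<in> K then e else 0"] by simp
  finally show ?thesis .
qed

lemma path_chain_split:
  assumes "i \<le> j" "j \<le> k"
  shows "path_chain e p i k = path_chain e p i j + path_chain e p j k"
  unfolding path_chain_def using assms by (simp add: sum.atLeastLessThan_concat)

section \<open>Paths and geodesics\<close>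

locale discrete_geodesic_space =
  fixes V :: "'v set" and d :: "'v \<Rightarrow> 'v \<Rightarrow> nat"
  assumes d_refl [simp]: "x \<in> V \<Longrightarrow> d x x = 0"
    and d_sym: "x \<in> V \<Longrightarrow> y \<in> V \<Longrightarrow> d x y = d y x"
    and d_tri: "x \<in> V \<Longrightarrow> y \<in> V \<Longrightarrow> z \<in> V \<Longrightarrow> d x z \<le> d x y + d y z"
    and d_geodesic: "x \<in> V \<Longrightarrow> y \<in> V \<Longrightarrow>
      \<exists>p. p 0 = x \<and> p (d x y) = y \<and> (\<forall>i\<le>d x y. p i \<in> V) \<and> (\<forall>i<d x y. d (p i) (p (Suc i)) \<le> 1)"
begin

definition is_path :: "(nat \<Rightarrow> 'v) \<Rightarrow> nat \<Rightarrow> bool" where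
  "is_path p n \<longleftrightarrow> (\<forall>i\<le>n. p i \<in> V) \<and> (\<forall>i<n. d (p i) (p (Suc i)) \<le> 1)"

definition geod :: "(nat \<Rightarrow> 'v) \<Rightarrow> 'v \<Rightarrow> 'v \<Rightarrow> bool" where
  "geod p x y \<longleftrightarrow> p 0 = x \<and> p (d x y) = y \<and> is_path p (d x y)"

lemma geod_ex: "x \<in> V \<Longrightarrow> y \<in> V \<Longrightarrow> \<exists>p. geod p x y"
  using d_geodesic unfolding geod_def is_path_def by blast

lemma path_dist:
  assumes "is_path p n" "i \<le> j" "j \<le> n"
  shows "d (p i) (p j) \<le> j - i"
  using assms(2,3)
proof (induction j rule: dec_induct)
  case base
  then show ?case using assms(1) by (simp add: is_path_def)
next
  case (step j)
  have "d (p i) (p (Suc j)) \<le> d (p i) (p j) + d (p j) (p (Suc j))"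
    by (rule d_tri) (use assms(1) step in \<open>auto simp: is_path_def\<close>)
  also have "\<dots> \<le> (j - i) + 1"
    by (intro add_mono step.IH) (use step assms(1) in \<open>auto simp: is_path_def\<close>)
  finally show ?case using step by simp
qed

lemma geod_dist:
  assumes "geod p x y" "i \<le> j" "j \<le> d x y"
  shows "d (p i) (p j) = j - i"
proof (rule antisym)
  have p: "is_path p (d x y)" and ends: "p 0 = x" "p (d x y) = y" using assms(1) by (auto simp: geod_def)
  then show "d (p i) (p j) \<le> j - i" using path_dist assms by blast
  have V: "p k \<in> V" if "k \<le> d x y" for k using p that by (simp add: is_path_def)
  have "d (p 0) (p (d x y)) \<le> d (p 0) (p i) + d (p i) (p (d x y))"
    by (rule d_tri) (use V assms in auto)
  moreover have "d (p i) (p (d x y)) \<le> d (p i) (p j) + d (p j) (p (d x y))"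
    by (rule d_tri) (use V assms in auto)
  moreover have "d (p 0) (p i) \<le> i" "d (p j) (p (d x y)) \<le> d x y - j"
    using path_dist[OF p, of 0 i] path_dist[OF p, of j "d x y"] assms by auto
  ultimately show "j - i \<le> d (p i) (p j)" using assms ends by simp
qed

lemma geod_V: "geod p x y \<Longrightarrow> i \<le> d x y \<Longrightarrow> p i \<in> V"
  by (simp add: geod_def is_path_def)

lemma geod_dist_ends:
  assumes "geod p x y" "i \<le> d x y"
  shows "d x (p i) = i" "d (p i) y = d x y - i"
  using geod_dist[OF assms(1), of 0 i] geod_dist[OF assms(1), of i "d x y"] assms
  by (auto simp: geod_def)

text \<open>Every sphere around \<open>x\<close> of radius at most \<open>d x y\<close> is crossed by the support of \<open>c\<close>, and an
  edge crosses only one of them.\<close>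

lemma card_edge_supp_ge_dist:
  fixes c :: "'v \<times> 'v \<Rightarrow> 'u::ab_group_add"
  assumes fin: "finite (edge_supp c)" and sub: "\<And>u v. c (u, v) \<noteq> 0 \<Longrightarrow> u \<in> V \<and> v \<in> V \<and> d u v \<le> 1"
    and xy: "x \<in> V" "y \<in> V"
    and flux: "\<And>K. flux K c = (if x \<in> K then a else 0) - (if y \<in> K then a else 0)" and "a \<noteq> 0"
  shows "d x y \<le> card (edge_supp c)"
proof -
  have "\<exists>p\<in>edge_supp c. (d x (fst p) \<le> t \<and> \<not> d x (snd p) \<le> t) \<or> (\<not> d x (fst p) \<le> t \<and> d x (snd p) \<le> t)"
    if "t < d x y" for t
  proof (rule ccontr)
    assume no: "\<not> ?thesis"
    let ?K = "{v. d x v \<le> t}"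
    have "flux ?K c = 0"
      unfolding flux_def by (rule sum.neutral) (use no in auto)
    moreover have "flux ?K c = a" using flux[of ?K] that xy by simp
    ultimately show False using \<open>a \<noteq> 0\<close> by simp
  qed
  then obtain f where f: "\<And>t. t < d x y \<Longrightarrow> f t \<in> edge_supp c \<and>
      ((d x (fst (f t)) \<le> t \<and> \<not> d x (snd (f t)) \<le> t) \<or> (\<not> d x (fst (f t)) \<le> t \<and> d x (snd (f t)) \<le> t))"
    by metis
  have level: "t = min (d x (fst (f t))) (d x (snd (f t)))" if t: "t < d x y" for t
  proof -
    obtain u v where uv: "f t = (u, v)" by (cases "f t")
    have c: "c (u, v) \<noteq> 0" using f[OF t] uv by (simp add: edge_supp_def)
    have "d x u \<le> d x v + d v u" "d x v \<le> d x u + d u v" "d v u = d u v" "d u v \<le> 1"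
      using sub[OF c] xy by (auto intro: d_tri d_sym)
    then show ?thesis using f[OF t] uv by auto
  qed
  have "inj_on f {..<d x y}"
    by (rule inj_onI) (metis lessThan_iff level)
  then have "card {..<d x y} \<le> card (edge_supp c)"
    by (rule card_inj_on_le) (use f fin in auto)
  then show ?thesis by simp
qed

end

text \<open>Only the support is bounded, in number of edges and in diameter, and not the
  coefficients. All scalar multiples of all translates of finitely many cycles are therefore small
  for a common \<open>D\<close>.\<close>

definition (in discrete_geodesic_space) small_cycle :: "nat \<Rightarrow> ('v \<times> 'v \<Rightarrow> 'u::ab_group_add) \<Rightarrow> bool" where
  "small_cycle D c \<longleftrightarrow> finite (edge_supp c) \<and> card (edge_supp c) \<le> D \<and> (\<forall>K. flux K c = 0) \<and>
     (\<forall>u v. c (u, v) \<noteq> 0 \<longrightarrow> u \<in> V \<and> v \<in> V \<and> d u v \<le> 1) \<and>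
     (\<forall>u v u' v'. c (u, v) \<noteq> 0 \<longrightarrow> c (u', v') \<noteq> 0 \<longrightarrow> d u u' \<le> D \<and> d v u' \<le> D)"

text \<open>The constant \<open>e\<close> is the coefficient that a loop carries on each of its
  steps, in the application the unit of \<open>R\<close>. The bound on \<open>N\<close> counts small
  cycles irrespective of their coefficients.\<close>

locale linear_isoperimetric_space = discrete_geodesic_space V d
  for V :: "'v set" and d :: "'v \<Rightarrow> 'v \<Rightarrow> nat" +
  fixes e :: "'u::ab_group_add" and C D :: nat
  assumes e_nonzero: "e \<noteq> 0"
    and isoperimetric: "is_path p n \<Longrightarrow> p n = p 0 \<Longrightarrow>
      \<exists>N \<omega>. N \<le> C * n \<and> path_chain e p 0 n = (\<Sum>i<N. \<omega> i) \<and> (\<forall>i<N. small_cycle D (\<omega> i))"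
begin

text \<open>The core of the argument: cut a filling of the loop along the balls of radius \<open>t < M\<close>
  around \<open>\<gamma> i0\<close>. The small cycles that straddle the sphere of radius \<open>t\<close> carry a chain that
  joins the two points where \<open>\<gamma>\<close> leaves the ball, so there are at least \<open>(2 t + 2) / D\<close>
  of them; each small cycle straddles at most \<open>D\<close> of these spheres.\<close>

lemma quadratic_filling:
  assumes p: "is_path p n" "p n = p 0"
    and im: "i1 + M \<le> i0" "i0 + M \<le> i2" "i2 \<le> n"
    and iso: "\<And>i j. i1 \<le> i \<Longrightarrow> i \<le> j \<Longrightarrow> j \<le> i2 \<Longrightarrow> d (p i) (p j) = j - i"
    and far: "\<And>i. i \<le> i1 \<or> i2 \<le> i \<Longrightarrow> i \<le> n \<Longrightarrow> M \<le> d (p i0) (p i)"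
  shows "M * M \<le> D * D * (C * n)"
proof -
  let ?a = "p i0"
  have pV: "p i \<in> V" if "i \<le> n" for i using p that by (simp add: is_path_def)
  have aV: "?a \<in> V" using pV im by simp
  obtain N \<omega> where N: "N \<le> C * n" and z: "path_chain e p 0 n = (\<Sum>i<N. \<omega> i)"
    and small: "\<And>i. i < N \<Longrightarrow> small_cycle D (\<omega> i)"
    using isoperimetric[OF p] by blast
  have fin: "finite (edge_supp (\<omega> i))" and card: "card (edge_supp (\<omega> i)) \<le> D"
    and flux: "flux K (\<omega> i) = 0" if "i < N" for i K
    using small[OF that] by (auto simp: small_cycle_def)
  have V: "u \<in> V \<and> v \<in> V \<and> d u v \<le> 1" if "i < N" "(u, v) \<in> edge_supp (\<omega> i)" for i u v
    using small[OF that(1)] that(2) by (simp add: small_cycle_def edge_supp_def)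
  have diam: "d u u' \<le> D \<and> d v u' \<le> D"
    if "i < N" "(u, v) \<in> edge_supp (\<omega> i)" "(u', v') \<in> edge_supp (\<omega> i)" for i u v u' v'
    using small[OF that(1)] that(2,3) unfolding small_cycle_def edge_supp_def by blast
  \<comment> \<open>An edge touches the ball of radius \<open>t\<close> if one of its ends lies in
    it. \<open>T t\<close> collects the small cycles with such an edge, and \<open>Sh t\<close>
    those among them that also have an edge outside.\<close>
  define touch where "touch t q \<longleftrightarrow> d ?a (fst q) \<le> t \<or> d ?a (snd q) \<le> t" for t q
  define T where "T t = {i. i < N \<and> (\<exists>q\<in>edge_supp (\<omega> i). touch t q)}" for t
  define Sh where "Sh t = {i\<in>T t. \<exists>q\<in>edge_supp (\<omega> i). \<not> touch t q}" for t
  have finT: "finite (T t)" "finite (Sh t)" for t by (simp_all add: T_def Sh_def)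
  have lower: "2 * t + 2 \<le> D * card (Sh t)" if t: "t < M" for t
  proof -
    \<comment> \<open>The points at distance \<open>t + 1\<close> from the centre on either side.
      Between them lie exactly the edges of the loop that touch the ball; the remaining ones are
      excluded by \<open>iso\<close> near the centre and by \<open>far\<close> elsewhere.\<close>
    let ?l = "i0 - t - 1" and ?r = "i0 + t + 1"
    have lr: "i1 \<le> ?l" "?l \<le> i0" "i0 \<le> ?r" "?r \<le> i2" "?r \<le> n" "?l \<le> n" using t im by auto
    let ?g = "path_chain e p ?l ?r"
    let ?z = "\<Sum>i\<in>T t. \<omega> i"
    \<comment> \<open>Subtracting cycles does not alter the flux, so \<open>?c\<close> still
      connects the ends of \<open>?g\<close>. On edges that touch the ball the cycles in
      \<open>T t\<close> sum up to the loop, hence to \<open>?g\<close>, so \<open>?c\<close>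
      vanishes there and is supported on the straddling cycles.\<close>
    let ?c = "?g - ?z"
    have da: "d ?a (p j) = (if j \<le> i0 then i0 - j else j - i0)" if "i1 \<le> j" "j \<le> i2" for j
      using iso[of j i0] iso[of i0 j] that im d_sym[of ?a "p j"] pV by auto
    have g_touch: "touch t q" if q: "?g q \<noteq> 0" for q
    proof -
      obtain k where k: "?l \<le> k" "k < ?r" "q = (p k, p (Suc k))"
        using path_chain_nonzeroD[OF q] by blast
      then show ?thesis using lr da[of k] da[of "Suc k"] t im by (auto simp: touch_def split: if_splits)
    qed
    have outer: "\<not> touch t (p k, p (Suc k))" if k: "k < ?l \<or> ?r \<le> k" "k < n" for k
    proof -
      have "d ?a (p j) > t" if "j = k \<or> j = Suc k" for j
      proof (cases "j \<le> i1 \<or> i2 \<le> j")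
        case True
        then show ?thesis using far[of j] that k t by auto
      next
        case False
        then show ?thesis using da[of j] that k by (auto split: if_splits)
      qed
      then show ?thesis by (auto simp: touch_def not_le)
    qed
    have zero: "path_chain e p i j q = 0"
      if "touch t q" "j \<le> ?l \<or> ?r \<le> i" "j \<le> n" for i j q
    proof (rule ccontr)
      assume "path_chain e p i j q \<noteq> 0"
      then obtain k where "i \<le> k" "k < j" "q = (p k, p (Suc k))"
        using path_chain_nonzeroD by blast
      then show False using outer[of k] that by auto
    qed
    have zg: "path_chain e p 0 n q = ?g q" if "touch t q" for q
    proof -
      have "path_chain e p 0 n = path_chain e p 0 ?l + (?g + path_chain e p ?r n)"
        using lr by (subst path_chain_split[of 0 ?l n]; (subst path_chain_split[of ?l ?r n])?) auto
      then show ?thesis using zero[OF that, of ?l 0] zero[OF that, of n ?r] lr by simp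
    qed
    have c_touch: "?c q = 0" if q: "touch t q" for q
    proof -
      have "(\<Sum>i<N. \<omega> i) q = (\<Sum>i<N. \<omega> i q)" by (simp add: sum_fun_apply)
      also have "\<dots> = (\<Sum>i\<in>T t. \<omega> i q)"
      proof (rule sum.mono_neutral_right)
        show "\<forall>i\<in>{..<N} - T t. \<omega> i q = 0" using q unfolding T_def edge_supp_def by blast
      qed (auto simp: T_def)
      also have "\<dots> = ?z q" by (simp add: sum_fun_apply)
      finally show ?thesis using zg[OF q] z by simp
    qed
    have c_supp: "edge_supp ?c \<subseteq> (\<Union>i\<in>Sh t. edge_supp (\<omega> i))"
    proof
      fix q assume "q \<in> edge_supp ?c"
      then have q: "?c q \<noteq> 0" by (simp add: edge_supp_def)
      then have nt: "\<not> touch t q" using c_touch by blast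
      then have "?z q \<noteq> 0" using g_touch[of q] q by auto
      then have "q \<in> edge_supp ?z" by (simp add: edge_supp_def)
      then obtain i where "i \<in> T t" "q \<in> edge_supp (\<omega> i)" using edge_supp_sum[of \<omega> "T t"] by auto
      then show "q \<in> (\<Union>i\<in>Sh t. edge_supp (\<omega> i))" using nt by (auto simp: Sh_def)
    qed
    have finz: "finite (edge_supp ?z)"
      by (rule finite_edge_supp_sum) (use finT fin in \<open>auto simp: T_def\<close>)
    have "2 * t + 2 = d (p ?r) (p ?l)"
      using iso[of ?l ?r] lr d_sym[of "p ?r" "p ?l"] pV t im by simp
    also have "\<dots> \<le> card (edge_supp ?c)"
    proof (rule card_edge_supp_ge_dist)
      show "finite (edge_supp ?c)" using c_supp
        by (rule finite_subset) (use finT fin in \<open>auto simp: Sh_def T_def\<close>)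
      show "u \<in> V \<and> v \<in> V \<and> d u v \<le> 1" if "?c (u, v) \<noteq> 0" for u v
        using c_supp that V by (auto simp: edge_supp_def Sh_def T_def)
      show "p ?r \<in> V" "p ?l \<in> V" using pV lr by auto
      fix K
      have "flux K ?z = (\<Sum>i\<in>T t. flux K (\<omega> i))"
        by (rule flux_sum) (use finT fin in \<open>auto simp: T_def\<close>)
      also have "\<dots> = 0" by (rule sum.neutral) (use flux in \<open>auto simp: T_def\<close>)
      finally have "flux K ?z = 0" .
      then show "flux K ?c = (if p ?r \<in> K then e else 0) - (if p ?l \<in> K then e else 0)"
        using flux_diff[OF finite_edge_supp_path_chain finz, of K e p ?l ?r] flux_path_chain[of ?l ?r K e p]
        by simp
    qed (rule e_nonzero)
    also have "\<dots> \<le> card (\<Union>i\<in>Sh t. edge_supp (\<omega> i))"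
      by (rule card_mono[OF _ c_supp]) (use finT fin in \<open>auto simp: Sh_def T_def\<close>)
    also have "\<dots> \<le> (\<Sum>i\<in>Sh t. card (edge_supp (\<omega> i)))"
      by (rule card_UN_le[OF finT(2)])
    also have "\<dots> \<le> (\<Sum>i\<in>Sh t. D)" by (rule sum_mono) (use card in \<open>auto simp: Sh_def T_def\<close>)
    also have "\<dots> = D * card (Sh t)" by simp
    finally show ?thesis .
  qed
  have few: "card {t. t < M \<and> i \<in> Sh t} \<le> D" if i: "i < N" for i
  proof (cases "{t. t < M \<and> i \<in> Sh t} = {}")
    case True
    then show ?thesis by (simp only: card.empty le0)
  next
    case False
    let ?S = "{t. t < M \<and> i \<in> Sh t}"
    \<comment> \<open>One edge of the cycle has an end within \<open>t\<close> of the centre,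
      another one starts beyond \<open>t'\<close>, and the two are at most \<open>D\<close>
      apart.\<close>
    have close: "t' < t + D" if t: "t \<in> ?S" and t': "t' \<in> ?S" for t t'
    proof -
      obtain u v where uv: "(u, v) \<in> edge_supp (\<omega> i)" "touch t (u, v)"
        using t by (auto simp: Sh_def T_def)
      obtain u' v' where uv': "(u', v') \<in> edge_supp (\<omega> i)" "\<not> touch t' (u', v')"
        using t' by (auto simp: Sh_def)
      have "u \<in> V" "v \<in> V" "u' \<in> V" using V[OF i uv(1)] V[OF i uv'(1)] by auto
      then have "d ?a u' \<le> d ?a u + d u u'" "d ?a u' \<le> d ?a v + d v u'"
        using aV d_tri by blast+
      moreover have "d u u' \<le> D" "d v u' \<le> D" using diam[OF i uv(1) uv'(1)] by auto
      ultimately show ?thesis using uv uv' by (auto simp: touch_def)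
    qed
    define m where "m = Min ?S"
    have "finite ?S" by simp
    then have "m \<in> ?S" unfolding m_def using False by (intro Min_in)
    then have "?S \<subseteq> {m..<m + D}"
      using close[of m] \<open>finite ?S\<close> by (auto simp: m_def)
    then have "card ?S \<le> card {m..<m + D}" by (intro card_mono) auto
    then show ?thesis by simp
  qed
  \<comment> \<open>Pairs of a radius below \<open>M\<close> and a small cycle that straddles the
    sphere of this radius are counted in two ways.\<close>
  have "M * M \<le> (\<Sum>t<M. 2 * t + 2)" by (induction M) auto
  also have "\<dots> \<le> (\<Sum>t<M. D * card (Sh t))" by (rule sum_mono) (use lower in auto)
  also have "\<dots> = D * (\<Sum>t<M. card (Sh t))" by (simp add: sum_distrib_left)
  also have "(\<Sum>t<M. card (Sh t)) = (\<Sum>t<M. \<Sum>i<N. if i \<in> Sh t then 1 else 0)"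
  proof (rule sum.cong)
    fix t
    have "{..<N} \<inter> Sh t = Sh t" by (auto simp: Sh_def T_def)
    then show "card (Sh t) = (\<Sum>i<N. if i \<in> Sh t then 1 else 0)"
      by (simp add: sum.If_cases)
  qed auto
  also have "\<dots> = (\<Sum>i<N. \<Sum>t<M. if i \<in> Sh t then 1 else 0)" by (rule sum.swap)
  also have "\<dots> = (\<Sum>i<N. card {t. t < M \<and> i \<in> Sh t})"
  proof (rule sum.cong)
    fix i
    have "{..<M} \<inter> {t. i \<in> Sh t} = {t. t < M \<and> i \<in> Sh t}" by auto
    then show "(\<Sum>t<M. if i \<in> Sh t then 1 else 0) = card {t. t < M \<and> i \<in> Sh t}"
      by (simp add: sum.If_cases)
  qed auto
  also have "\<dots> \<le> (\<Sum>i<N. D)" by (rule sum_mono) (use few in auto)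
  also have "\<dots> = D * N" by simp
  finally have "M * M \<le> D * (D * N)" by simp
  also have "\<dots> \<le> D * D * (C * n)" using N by simp
  finally show ?thesis .
qed

end

section \<open>Concatenation and reversal of paths\<close>

definition path_append :: "(nat \<Rightarrow> 'v) \<Rightarrow> nat \<Rightarrow> (nat \<Rightarrow> 'v) \<Rightarrow> nat \<Rightarrow> 'v" where
  "path_append p n q = (\<lambda>i. if i \<le> n then p i else q (i - n))"

context discrete_geodesic_space
begin

lemma path_append:
  assumes p: "is_path p n" and q: "is_path q m" and pq: "p n = q 0"
  shows "is_path (path_append p n q) (n + m)"
  unfolding is_path_def
proof (intro conjI allI impI)
  fix i assume "i \<le> n + m"
  then show "path_append p n q i \<in> V" using p q by (auto simp: is_path_def path_append_def)
next
  fix i assume i: "i < n + m"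
  show "d (path_append p n q i) (path_append p n q (Suc i)) \<le> 1"
  proof (cases "i < n")
    case True
    then show ?thesis using p by (simp add: is_path_def path_append_def)
  next
    case False
    then have "path_append p n q i = q (i - n)" "path_append p n q (Suc i) = q (Suc (i - n))"
      using pq by (auto simp: path_append_def Suc_diff_le)
    moreover have "i - n < m" using False i by auto
    ultimately show ?thesis using q by (simp add: is_path_def)
  qed
qed

lemma path_append_end: "p n = q 0 \<Longrightarrow> path_append p n q (n + m) = q m"
  by (auto simp: path_append_def)

lemma path_append_start: "path_append p n q 0 = p 0"
  by (simp add: path_append_def)

lemma path_append_cases:
  assumes "i \<le> n + m"
  obtains j where "j \<le> n" "path_append p n q i = p j" | j where "j \<le> m" "path_append p n q i = q j"
proof (cases "i \<le> n")
  case True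
  then show thesis by (intro that(1)[of i]) (auto simp: path_append_def)
next
  case False
  then show thesis using assms by (intro that(2)[of "i - n"]) (auto simp: path_append_def)
qed

lemma is_path_shift:
  assumes "is_path p n" "i + m \<le> n"
  shows "is_path (\<lambda>k. p (i + k)) m"
  using assms by (auto simp: is_path_def)

lemma is_path_rev:
  assumes "is_path p n"
  shows "is_path (\<lambda>k. p (n - k)) n"
  unfolding is_path_def
proof (intro conjI allI impI)
  fix i assume i: "i < n"
  then have "n - i = Suc (n - Suc i)" by simp
  moreover have "d (p (n - Suc i)) (p (Suc (n - Suc i))) \<le> 1" using assms i by (auto simp: is_path_def)
  moreover have "p (n - Suc i) \<in> V" "p (n - i) \<in> V" using assms by (auto simp: is_path_def)
  ultimately show "d (p (n - i)) (p (n - Suc i)) \<le> 1" using d_sym by metis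
qed (use assms in \<open>auto simp: is_path_def\<close>)

end

section \<open>Stability of geodesics: a Morse lemma\<close>

context linear_isoperimetric_space
begin

text \<open>Let \<open>\<gamma> i0\<close> be a point of the geodesic farthest from
  \<open>B\<close>, at distance \<open>M\<close>. Leave the geodesic at distance
  \<open>2 * M\<close> on both sides, walk to \<open>B\<close> and close up inside \<open>B\<close>.
  The loop has length linear in \<open>M\<close> and keeps distance \<open>M\<close> from
  \<open>\<gamma> i0\<close> off the geodesic piece, so \<open>quadratic_filling\<close> bounds
  \<open>M * M\<close> by a multiple of \<open>M\<close>.\<close>

lemma geodesic_near_quasiconvex:
  assumes B: "B \<subseteq> V" "x \<in> B" "y \<in> B" and g: "geod \<gamma> x y"
    and conn: "\<And>b b'. b \<in> B \<Longrightarrow> b' \<in> B \<Longrightarrow>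
      \<exists>q m. q 0 = b \<and> q m = b' \<and> is_path q m \<and> (\<forall>i\<le>m. q i \<in> B) \<and> m \<le> K * d b b' + K"
    and i: "i \<le> d x y"
  shows "\<exists>b\<in>B. d (\<gamma> i) b \<le> D * D * C * (7 * K + 6)"
proof -
  let ?n = "d x y"
  define f where "f i = (LEAST m. \<exists>b\<in>B. d (\<gamma> i) b = m)" for i
  have f_ex: "\<exists>b\<in>B. d (\<gamma> i) b = f i" for i
    unfolding f_def by (rule LeastI_ex) (use B in blast)
  have f_le: "f i \<le> d (\<gamma> i) b" if "b \<in> B" for i b
    unfolding f_def by (rule Least_le) (use that in blast)
  obtain i0 where i0: "i0 \<le> ?n" and max: "\<And>i. i \<le> ?n \<Longrightarrow> f i \<le> f i0"
  proof -
    have "Max (f ` {..?n}) \<in> f ` {..?n}" by (rule Max_in) auto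
    then obtain i0 where "i0 \<le> ?n" "f i0 = Max (f ` {..?n})" by (metis atMost_iff imageE)
    then show thesis by (intro that[of i0]) (auto intro!: Max_ge)
  qed
  define M where "M = f i0"
  have gV: "\<gamma> i \<in> V" if "i \<le> ?n" for i using geod_V[OF g that] .
  have gB: "\<gamma> 0 \<in> B" "\<gamma> ?n \<in> B" using g B by (auto simp: geod_def)
  have ends: "M \<le> i0" "M \<le> ?n - i0"
    using f_le[OF gB(1), of i0] f_le[OF gB(2), of i0] geod_dist[OF g, of 0 i0] geod_dist[OF g, of i0 ?n]
      d_sym[OF gV[OF i0] gV[of 0]] i0 by (auto simp: M_def)
  have far: "M \<le> d (\<gamma> i0) b" if "b \<in> B" for b using f_le[OF that] by (simp add: M_def)
  have "M \<le> D * D * C * (7 * K + 6)"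
  proof (cases "M = 0")
    case False
    \<comment> \<open>Truncated subtraction here, and the minimum in \<open>i2\<close>, stop at the
      ends of the geodesic if these are nearer than \<open>2 * M\<close>.\<close>
    define i1 where "i1 = i0 - 2 * M"
    define i2 where "i2 = min ?n (i0 + 2 * M)"
    have i12: "i1 + M \<le> i0" "i0 + M \<le> i2" "i2 \<le> ?n" "i1 \<le> ?n" "i2 - i1 \<le> 4 * M"
      using ends i0 by (auto simp: i1_def i2_def)
    obtain b1 where b1: "b1 \<in> B" "d (\<gamma> i1) b1 = f i1" using f_ex by blast
    obtain b2 where b2: "b2 \<in> B" "d (\<gamma> i2) b2 = f i2" using f_ex by blast
    have V: "\<gamma> i1 \<in> V" "\<gamma> i2 \<in> V" "\<gamma> i0 \<in> V" "b1 \<in> V" "b2 \<in> V" using gV i12 i0 b1 b2 B by auto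
    have f1: "f i1 \<le> M" and f2: "f i2 \<le> M" using max i12 by (auto simp: M_def)
    obtain q m where q: "q 0 = b2" "q m = b1" "is_path q m" "\<And>i. i \<le> m \<Longrightarrow> q i \<in> B" "m \<le> K * d b2 b1 + K"
      using conn[OF b2(1) b1(1)] by blast
    have "d (\<gamma> i2) (\<gamma> i1) = i2 - i1" using geod_dist[OF g, of i1 i2] d_sym[OF V(1,2)] i12 by simp
    then have "d b2 b1 \<le> 6 * M"
      using d_tri[of b2 "\<gamma> i2" b1] d_tri[of "\<gamma> i2" "\<gamma> i1" b1] d_sym[of b2 "\<gamma> i2"] V b1 b2 f1 f2 i12
      by linarith
    then have m: "m \<le> K * (6 * M) + K" using q(5) by (meson add_le_mono1 le_trans mult_le_mono2)
    \<comment> \<open>A connection to \<open>B\<close> has length at most \<open>M\<close> and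
      starts \<open>2 * M\<close> away from \<open>\<gamma> i0\<close>, unless it starts at an end
      of the geodesic. The ends lie in \<open>B\<close>, so there its length is 0.\<close>
    have near_far: "M \<le> d (\<gamma> i0) v"
      if v: "v \<in> V" "d (\<gamma> j) v \<le> f j" and j: "j = i1 \<or> j = i2" for v j
    proof (cases "d (\<gamma> i0) (\<gamma> j) = 2 * M")
      case True
      have "f j \<le> M" using j f1 f2 by auto
      moreover have "d (\<gamma> i0) (\<gamma> j) \<le> d (\<gamma> i0) v + d (\<gamma> j) v"
        using d_tri[of "\<gamma> i0" v "\<gamma> j"] d_sym[of "\<gamma> j" v] V v j by auto
      ultimately show ?thesis using True v by linarith
    next
      case False
      have d1: "d (\<gamma> i0) (\<gamma> i1) = i0 - i1"
        using geod_dist[OF g, of i1 i0] d_sym[OF V(1,3)] i12 i0 by simp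
      have d2: "d (\<gamma> i0) (\<gamma> i2) = i2 - i0" using geod_dist[OF g, of i0 i2] i12 by simp
      have "j = 0 \<or> j = ?n"
      proof (cases "j = i1")
        case True
        then have "i0 - i1 \<noteq> 2 * M" using False d1 by simp
        then show ?thesis using True unfolding i1_def by linarith
      next
        case j2: False
        then have "i2 - i0 \<noteq> 2 * M" using False d2 j by simp
        then show ?thesis using j2 j unfolding i2_def by linarith
      qed
      then have jB: "\<gamma> j \<in> B" using gB by auto
      then have "f j = 0" using f_le[OF jB, of j] d_refl[of "\<gamma> j"] B by auto
      then have "d (\<gamma> i0) (\<gamma> j) \<le> d (\<gamma> i0) v"
        using d_tri[of "\<gamma> i0" v "\<gamma> j"] d_sym[of "\<gamma> j" v] V v jB B by auto
      then show ?thesis using far[OF jB] by linarith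
    qed
    obtain g1 where g1: "geod g1 b1 (\<gamma> i1)" using geod_ex V by blast
    obtain g2 where g2: "geod g2 (\<gamma> i2) b2" using geod_ex V by blast
    have l1: "d b1 (\<gamma> i1) = f i1" using b1 d_sym V by metis
    have g1p: "is_path g1 (f i1)" "g1 0 = b1" "g1 (f i1) = \<gamma> i1" using g1 l1 by (auto simp: geod_def)
    have g2p: "is_path g2 (f i2)" "g2 0 = \<gamma> i2" "g2 (f i2) = b2" using g2 b2 by (auto simp: geod_def)
    have g1_far: "M \<le> d (\<gamma> i0) (g1 j)" if "j \<le> f i1" for j
    proof (rule near_far[of _ i1])
      show "g1 j \<in> V" using g1p that by (simp add: is_path_def)
      then show "d (\<gamma> i1) (g1 j) \<le> f i1"
        using geod_dist_ends(2)[OF g1, of j] l1 that d_sym V by (metis diff_le_self)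
    qed simp
    have g2_far: "M \<le> d (\<gamma> i0) (g2 j)" if "j \<le> f i2" for j
    proof (rule near_far[of _ i2])
      show "g2 j \<in> V" using g2p that by (simp add: is_path_def)
      show "d (\<gamma> i2) (g2 j) \<le> f i2"
        using geod_dist_ends(1)[OF g2, of j] b2 that by simp
    qed simp
    define \<sigma>1 where "\<sigma>1 = path_append q m g1"
    define \<sigma> where "\<sigma> = path_append g2 (f i2) \<sigma>1"
    define L where "L = f i2 + (m + f i1)"
    have \<sigma>1: "is_path \<sigma>1 (m + f i1)" "\<sigma>1 0 = b2" "\<sigma>1 (m + f i1) = \<gamma> i1"
      unfolding \<sigma>1_def using q g1p by (auto intro!: path_append simp: path_append_end path_append_start)
    have \<sigma>: "is_path \<sigma> L" "\<sigma> 0 = \<gamma> i2" "\<sigma> L = \<gamma> i1"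
      unfolding \<sigma>_def L_def using \<sigma>1 g2p by (auto intro!: path_append simp: path_append_end path_append_start)
    have \<sigma>_far: "M \<le> d (\<gamma> i0) (\<sigma> j)" if j: "j \<le> L" for j
      using j unfolding \<sigma>_def L_def
    proof (cases rule: path_append_cases[of j "f i2" "m + f i1" g2 \<sigma>1])
      case (2 k)
      from \<open>k \<le> m + f i1\<close> have "M \<le> d (\<gamma> i0) (\<sigma>1 k)"
        unfolding \<sigma>1_def
        by (cases rule: path_append_cases[of k m "f i1" q g1]) (use q far g1_far in auto)
      then show "M \<le> d (\<gamma> i0) (path_append g2 (f i2) \<sigma>1 j)" using 2 by simp
    qed (use g2_far in auto)
    define l where "l = i2 - i1"
    define p where "p = path_append (\<lambda>k. \<gamma> (i1 + k)) l \<sigma>"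
    have lg: "is_path (\<lambda>k. \<gamma> (i1 + k)) l"
      using g i12 by (intro is_path_shift[of _ ?n]) (auto simp: geod_def l_def)
    have il: "i1 + l = i2" using i12 by (simp add: l_def)
    have pp: "is_path p (l + L)" "p (l + L) = p 0"
      unfolding p_def using lg \<sigma> il by (auto intro!: path_append simp: path_append_end path_append_start)
    have pin: "p k = \<gamma> (i1 + k)" if "k \<le> l" for k using that by (simp add: p_def path_append_def)
    have p0: "p (i0 - i1) = \<gamma> i0" using pin[of "i0 - i1"] i12 by (simp add: l_def)
    have "M * M \<le> D * D * (C * (l + L))"
    proof (rule quadratic_filling[OF pp, of 0 M "i0 - i1" l])
      fix i j assume "0 \<le> i" "i \<le> j" "j \<le> l"
      then show "d (p i) (p j) = j - i" using pin geod_dist[OF g, of "i1 + i" "i1 + j"] i12 il by auto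
    next
      fix k assume k: "k \<le> 0 \<or> l \<le> k" "k \<le> l + L"
      show "M \<le> d (p (i0 - i1)) (p k)"
      proof (cases "k = 0")
        case True
        have "d (\<gamma> i0) (\<gamma> i1) = i0 - i1" using geod_dist[OF g, of i1 i0] d_sym[OF V(1,3)] i12 i0 by simp
        then show ?thesis using True p0 pin[of 0] i12 by auto
      next
        case False
        then have "p k = \<sigma> (k - l)" using k il \<sigma> by (auto simp: p_def path_append_def)
        then show ?thesis using \<sigma>_far[of "k - l"] k p0 by auto
      qed
    qed (use i12 in \<open>auto simp: l_def\<close>)
    \<comment> \<open>The geodesic piece contributes \<open>4 * M\<close>, the two connections
      \<open>2 * M\<close>, and the path inside \<open>B\<close> at most
      \<open>K * (6 * M) + K\<close>, which is at most \<open>7 * K * M\<close> because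
      \<open>M\<close> is positive.\<close>
    moreover have "l + L \<le> (7 * K + 6) * M"
    proof -
      have "K \<le> K * M" using False by simp
      then have "L \<le> M + (K * (6 * M) + K * M + M)" using f1 f2 m unfolding L_def by linarith
      then show ?thesis using i12(5) by (simp add: l_def algebra_simps)
    qed
    ultimately have "M * M \<le> D * D * (C * ((7 * K + 6) * M))"
      by (meson le_trans mult_le_mono2)
    then have "M * M \<le> (D * D * C * (7 * K + 6)) * M" by (simp add: mult.assoc)
    then show ?thesis using False by simp
  qed simp
  then show ?thesis using f_ex[of i] max[OF i] by (metis M_def le_trans)
qed

end

section \<open>Slim triangles\<close>

context discrete_geodesic_space
begin

definition on_geod :: "(nat \<Rightarrow> 'v) \<Rightarrow> 'v \<Rightarrow> 'v \<Rightarrow> 'v set" where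
  "on_geod p x y = p ` {..d x y}"

lemma on_geodD:
  assumes "geod p x y" "x \<in> V" "y \<in> V" "u \<in> on_geod p x y"
  shows "u \<in> V" "d x u + d u y = d x y"
proof -
  obtain i where i: "i \<le> d x y" "u = p i" using assms(4) by (auto simp: on_geod_def)
  then show "u \<in> V" using geod_V[OF assms(1)] by blast
  show "d x u + d u y = d x y" using geod_dist_ends[OF assms(1) i(1)] i by simp
qed

definition slim :: "nat \<Rightarrow> bool" where
  "slim \<delta> \<longleftrightarrow> (\<forall>x y z \<alpha> \<beta> \<gamma> w. x \<in> V \<longrightarrow> y \<in> V \<longrightarrow> z \<in> V \<longrightarrow>
     geod \<alpha> x y \<longrightarrow> geod \<beta> y z \<longrightarrow> geod \<gamma> x z \<longrightarrow> w \<in> on_geod \<gamma> x z \<longrightarrow>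
     (\<exists>v\<in>on_geod \<alpha> x y \<union> on_geod \<beta> y z. d w v \<le> \<delta>))"

lemma slimD:
  assumes "slim \<delta>" "x \<in> V" "y \<in> V" "z \<in> V" "geod \<alpha> x y" "geod \<beta> y z" "geod \<gamma> x z" "w \<in> on_geod \<gamma> x z"
  shows "\<exists>v\<in>on_geod \<alpha> x y \<union> on_geod \<beta> y z. d w v \<le> \<delta>"
  using assms unfolding slim_def by blast

lemma geod_ends_on: "geod p x y \<Longrightarrow> x \<in> on_geod p x y \<and> y \<in> on_geod p x y"
  unfolding on_geod_def geod_def by force

lemma geod_subpath:
  assumes g: "geod p x y" "x \<in> V" "y \<in> V" and u: "u \<in> on_geod p x y" and v: "v \<in> on_geod p x y"
  shows "\<exists>q. q 0 = u \<and> q (d u v) = v \<and> is_path q (d u v) \<and> (\<forall>i\<le>d u v. q i \<in> on_geod p x y)"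
proof -
  have p: "is_path p (d x y)" using g by (simp add: geod_def)
  have fwd: "\<exists>q. q 0 = p i \<and> q (d (p i) (p j)) = p j \<and> is_path q (d (p i) (p j)) \<and>
      (\<forall>k\<le>d (p i) (p j). q k \<in> on_geod p x y)" if "i \<le> j" "j \<le> d x y" for i j
    using is_path_shift[OF p, of i "j - i"] that geod_dist[OF g(1) that]
    by (intro exI[of _ "\<lambda>k. p (i + k)"]) (auto simp: on_geod_def)
  obtain i j where ij: "i \<le> d x y" "u = p i" "j \<le> d x y" "v = p j"
    using u v by (auto simp: on_geod_def)
  show ?thesis
  proof (cases "i \<le> j")
    case True
    then show ?thesis using fwd[of i j] ij by simp
  next
    case False
    have sym: "d v u = d u v" using u v g on_geodD d_sym by metis
    obtain q where q: "q 0 = v" "q (d u v) = u" "is_path q (d u v)" "\<forall>k\<le>d u v. q k \<in> on_geod p x y"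
      using fwd[of j i] ij False sym by auto
    then show ?thesis using is_path_rev[OF q(3)]
      by (intro exI[of _ "\<lambda>k. q (d u v - k)"]) auto
  qed
qed

end

context linear_isoperimetric_space
begin

text \<open>By \<open>bend\<close>, passing through the corner \<open>m\<close> costs only a linear
  detour, so the union of both sides is quasi-convex in the sense of
  \<open>geodesic_near_quasiconvex\<close>. Two points of the same side are joined along that side,
  which is why \<open>1 \<le> K\<close> is required.\<close>

lemma bent_geodesic:
  assumes V: "x \<in> V" "m \<in> V" "y \<in> V" and a: "geod \<alpha> x m" and b: "geod \<beta> m y"
    and bend: "\<And>u v. u \<in> on_geod \<alpha> x m \<Longrightarrow> v \<in> on_geod \<beta> m y \<Longrightarrow> d u m + d m v \<le> K * d u v + K"
    and K: "1 \<le> K" and g: "geod \<gamma> x y" and w: "w \<in> on_geod \<gamma> x y"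
  shows "\<exists>b\<in>on_geod \<alpha> x m \<union> on_geod \<beta> m y. d w b \<le> D * D * C * (7 * K + 6)"
proof -
  let ?A = "on_geod \<alpha> x m" and ?B = "on_geod \<beta> m y"
  obtain i where i: "i \<le> d x y" "w = \<gamma> i" using w by (auto simp: on_geod_def)
  have AV: "?A \<subseteq> V" and BV: "?B \<subseteq> V" using on_geodD a b V by blast+
  have mA: "m \<in> ?A" and mB: "m \<in> ?B" using geod_ends_on a b by blast+
  have one: "\<exists>q n. q 0 = u \<and> q n = v \<and> is_path q n \<and> (\<forall>i\<le>n. q i \<in> ?A \<union> ?B) \<and> n \<le> K * d u v + K"
    if "(u \<in> ?A \<and> v \<in> ?A) \<or> (u \<in> ?B \<and> v \<in> ?B)" for u v
  proof -
    have "d u v \<le> K * d u v + K" using K by (simp add: trans_le_add1)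
    then show ?thesis using that geod_subpath[OF a V(1,2)] geod_subpath[OF b V(2,3)] by (meson UnI1 UnI2)
  qed
  have two: "\<exists>q n. q 0 = u \<and> q n = v \<and> is_path q n \<and> (\<forall>i\<le>n. q i \<in> ?A \<union> ?B) \<and> n \<le> K * d u v + K"
    if u: "u \<in> ?A" and v: "v \<in> ?B" for u v
  proof -
    obtain q where q: "q 0 = u" "q (d u m) = m" "is_path q (d u m)" "\<forall>i\<le>d u m. q i \<in> ?A"
      using geod_subpath[OF a V(1,2) u mA] by blast
    obtain q' where q': "q' 0 = m" "q' (d m v) = v" "is_path q' (d m v)" "\<forall>i\<le>d m v. q' i \<in> ?B"
      using geod_subpath[OF b V(2,3) mB v] by blast
    let ?p = "path_append q (d u m) q'"
    have "is_path ?p (d u m + d m v)" "?p (d u m + d m v) = v" "?p 0 = u"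
      using q q' by (auto intro!: path_append simp: path_append_end path_append_start)
    moreover have "\<forall>i\<le>d u m + d m v. ?p i \<in> ?A \<union> ?B" using q q' by (auto simp: path_append_def)
    ultimately show ?thesis using bend[OF u v] by blast
  qed
  have two': "\<exists>q n. q 0 = v \<and> q n = u \<and> is_path q n \<and> (\<forall>i\<le>n. q i \<in> ?A \<union> ?B) \<and> n \<le> K * d v u + K"
    if u: "u \<in> ?A" and v: "v \<in> ?B" for u v
  proof -
    obtain q n where q: "q 0 = u" "q n = v" "is_path q n" "\<forall>i\<le>n. q i \<in> ?A \<union> ?B" "n \<le> K * d u v + K"
      using two[OF u v] by blast
    have "d v u = d u v" using d_sym u v AV BV by blast
    then show ?thesis using q is_path_rev[OF q(3)]
      by (intro exI[of _ "\<lambda>k. q (n - k)"] exI[of _ n]) auto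
  qed
  show ?thesis unfolding i
  proof (rule geodesic_near_quasiconvex[OF _ _ _ g _ i(1)])
    show "?A \<union> ?B \<subseteq> V" "x \<in> ?A \<union> ?B" "y \<in> ?A \<union> ?B"
      using AV BV geod_ends_on[OF a] geod_ends_on[OF b] by auto
    fix u v assume "u \<in> ?A \<union> ?B" "v \<in> ?A \<union> ?B"
    then consider "(u \<in> ?A \<and> v \<in> ?A) \<or> (u \<in> ?B \<and> v \<in> ?B)" | "u \<in> ?A" "v \<in> ?B" | "u \<in> ?B" "v \<in> ?A" by blast
    then show "\<exists>q n. q 0 = u \<and> q n = v \<and> is_path q n \<and> (\<forall>i\<le>n. q i \<in> ?A \<union> ?B) \<and> n \<le> K * d u v + K"
    proof cases
      case 1
      then show ?thesis by (rule one)
    next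
      case 2
      then show ?thesis by (rule two)
    next
      case 3
      then show ?thesis by (intro two')
    qed
  qed
qed

text \<open>If \<open>m\<close> is a point of \<open>[x, y]\<close> closest to \<open>z\<close>, then \<open>[x, m] \<union> [m, z]\<close> is a quasi-geodesic.\<close>

lemma nearest_point_bend:
  assumes V: "z \<in> V" "m \<in> V"
    and min: "\<And>u. u \<in> A \<Longrightarrow> d z m \<le> d z u" and AV: "A \<subseteq> V"
    and b: "geod \<beta> m z" and u: "u \<in> A" and v: "v \<in> on_geod \<beta> m z"
  shows "d u m + d m v \<le> 3 * d u v + 3"
proof -
  have vV: "v \<in> V" "d m v + d v z = d m z" using on_geodD[OF b V(2,1) v] by auto
  have uV: "u \<in> V" using u AV by blast
  have "d z m \<le> d z v + d v u" using min[OF u] d_tri[of z v u] vV uV V by linarith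
  then have "d m v \<le> d u v" using vV d_sym[of z m] d_sym[of z v] d_sym[of u v] V uV by linarith
  moreover have "d u m \<le> d u v + d m v" using d_tri[of u v m] d_sym[of v m] vV uV V by linarith
  ultimately show ?thesis by linarith
qed

lemma ex_nearest:
  assumes "A \<noteq> {}"
  obtains m where "m \<in> A" "\<And>u. u \<in> A \<Longrightarrow> d z m \<le> d z u"
  using assms arg_min_nat_lemma[of "\<lambda>a. a \<in> A" _ "d z"] by blast

text \<open>A discrete intermediate value argument: the geodesic starts close to \<open>P\<close>,
  and as soon as it ceases to be so it is close to \<open>Q\<close>. The additional 1 is the step
  between the two indices.\<close>

lemma close_to_both:
  assumes V: "x \<in> V" "y \<in> V" and g: "geod \<gamma> x y"
    and cov: "\<And>w. w \<in> on_geod \<gamma> x y \<Longrightarrow> \<exists>b\<in>P \<union> Q. d w b \<le> M"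
    and PQ: "x \<in> P" "y \<in> Q" "P \<subseteq> V" "Q \<subseteq> V"
  shows "\<exists>w\<in>on_geod \<gamma> x y. \<exists>p\<in>P. \<exists>q\<in>Q. d w p \<le> M \<and> d w q \<le> M + 1"
proof -
  let ?n = "d x y"
  define nP where "nP i \<longleftrightarrow> (\<exists>p\<in>P. d (\<gamma> i) p \<le> M)" for i
  have ends: "\<gamma> 0 = x" "\<gamma> ?n = y" using g by (auto simp: geod_def)
  have on: "\<gamma> i \<in> on_geod \<gamma> x y" if "i \<le> ?n" for i using that by (auto simp: on_geod_def)
  have "nP 0" unfolding nP_def using ends PQ V by (intro bexI[of _ x]) auto
  show ?thesis
  proof (cases "nP ?n")
    case True
    then obtain p where "p \<in> P" "d y p \<le> M" using ends by (auto simp: nP_def)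
    then show ?thesis using on[of ?n] ends PQ V
      by (intro bexI[of _ y] bexI[of _ p] bexI[of _ y]) auto
  next
    case False
    obtain i where i: "i < ?n" "nP i" "\<not> nP (Suc i)"
      using ex_least_nat_less[of "\<lambda>i. \<not> nP i" ?n] False \<open>nP 0\<close> by auto
    then obtain q where q: "q \<in> Q" "d (\<gamma> (Suc i)) q \<le> M"
      using cov[OF on[of "Suc i"]] by (auto simp: nP_def)
    obtain p where p: "p \<in> P" "d (\<gamma> i) p \<le> M" using i by (auto simp: nP_def)
    have "\<gamma> i \<in> V" "\<gamma> (Suc i) \<in> V" "d (\<gamma> i) (\<gamma> (Suc i)) \<le> 1"
      using g i by (auto simp: geod_def is_path_def)
    then have "d (\<gamma> i) q \<le> M + 1" using d_tri[of "\<gamma> i" "\<gamma> (Suc i)" q] q PQ by auto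
    then show ?thesis using p q on[of i] i by auto
  qed
qed

text \<open>Let \<open>m\<close> be a point of \<open>[x, y]\<close> closest to \<open>z\<close>.
  Both \<open>[x, m] \<union> [m, z]\<close> and \<open>[y, m] \<union> [m, z]\<close> are
  quasi-geodesics, so \<open>[x, z]\<close> is close to the former and \<open>[y, z]\<close> to the
  latter. Some \<open>n\<close> on \<open>[y, z]\<close> is close to both \<open>[y, m]\<close> and
  \<open>[m, z]\<close>, hence close to \<open>m\<close>. Therefore \<open>[m, z]\<close> stays
  close to \<open>[m, n] \<union> [n, z]\<close>, that is, to \<open>[y, z]\<close>, and whatever
  part of \<open>[x, z]\<close> follows \<open>[m, z]\<close> is close to
  \<open>[y, z]\<close>.\<close>

lemma slim_triangles:
  "\<exists>\<delta>. slim \<delta>"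
proof -
  \<comment> \<open>The 3 is the constant of \<open>nearest_point_bend\<close>. Next,
    \<open>\<kappa>\<close> bounds the distance of \<open>m\<close> and \<open>n\<close>: with
    \<open>d p q \<le> 2 * M + 1\<close> the bend inequality gives
    \<open>d p m \<le> 6 * M + 6\<close>, and \<open>n\<close> is within \<open>M\<close> of
    \<open>p\<close>. Finally \<open>M'\<close> belongs to the bent path from \<open>m\<close> over
    \<open>n\<close> to \<open>z\<close>, whose bend constant is
    \<open>2 * \<kappa> + 1\<close>.\<close>
  define M where "M = D * D * C * (7 * 3 + 6)"
  define \<kappa> where "\<kappa> = 7 * M + 6"
  define M' where "M' = D * D * C * (7 * (2 * \<kappa> + 1) + 6)"
  have "slim (M + M' + \<kappa>)"
    unfolding slim_def
  proof (intro allI impI)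
    fix x y z \<alpha> \<beta> \<gamma> w
    assume V: "x \<in> V" "y \<in> V" "z \<in> V" and a: "geod \<alpha> x y" and b: "geod \<beta> y z" and g: "geod \<gamma> x z"
      and w: "w \<in> on_geod \<gamma> x z"
    let ?A = "on_geod \<alpha> x y" and ?B = "on_geod \<beta> y z"
    have AV: "?A \<subseteq> V" and BV: "?B \<subseteq> V" using on_geodD a b V by blast+
    obtain m where m: "m \<in> ?A" "\<And>u. u \<in> ?A \<Longrightarrow> d z m \<le> d z u"
      using ex_nearest[where A = ?A and z = z] geod_ends_on[OF a] by blast
    have mV: "m \<in> V" using m AV by blast
    obtain i where i: "i \<le> d x y" "m = \<alpha> i" using m by (auto simp: on_geod_def)
    have lx: "d x m = i" "d m y = d x y - i" using geod_dist_ends[OF a] i by auto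
    have pa: "is_path \<alpha> (d x y)" using a by (simp add: geod_def)
    have a1: "geod \<alpha> x m" using a i lx by (auto simp: geod_def is_path_def)
    have A1: "on_geod \<alpha> x m \<subseteq> ?A" using lx i by (auto simp: on_geod_def)
    define \<alpha>2 where "\<alpha>2 = (\<lambda>k. \<alpha> (d x y - k))"
    have a2: "geod \<alpha>2 y m"
      using is_path_rev[OF pa] a lx i d_sym[OF V(2) mV] unfolding \<alpha>2_def geod_def is_path_def by auto
    have A2: "on_geod \<alpha>2 y m \<subseteq> ?A" by (auto simp: on_geod_def \<alpha>2_def)
    obtain \<mu> where mu: "geod \<mu> m z" using geod_ex mV V by blast
    let ?m = "on_geod \<mu> m z"
    have muV: "?m \<subseteq> V" using on_geodD mu mV V by blast
    have 1: "\<exists>v\<in>on_geod \<alpha> x m \<union> ?m. d w v \<le> M"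
      unfolding M_def
      by (rule bent_geodesic[OF V(1) mV V(3) a1 mu _ _ g w])
        (use nearest_point_bend[OF V(3) mV m(2) AV mu] A1 in auto)
    have 2: "\<exists>v\<in>on_geod \<alpha>2 y m \<union> ?m. d w v \<le> M" if "w \<in> ?B" for w
      unfolding M_def
      by (rule bent_geodesic[OF V(2) mV V(3) a2 mu _ _ b that])
        (use nearest_point_bend[OF V(3) mV m(2) AV mu] A2 in auto)
    obtain n p q where n: "n \<in> ?B" and p: "p \<in> on_geod \<alpha>2 y m" and q: "q \<in> ?m"
      and npq: "d n p \<le> M" "d n q \<le> M + 1"
    proof -
      have "y \<in> on_geod \<alpha>2 y m" "z \<in> ?m" "on_geod \<alpha>2 y m \<subseteq> V"
        using geod_ends_on[OF a2] geod_ends_on[OF mu] A2 AV by auto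
      from close_to_both[OF V(2,3) b 2 this muV] show thesis using that by blast
    qed
    have pV: "p \<in> V" "q \<in> V" "n \<in> V" using p q n A2 AV muV BV by auto
    have "d p q \<le> 2 * M + 1" using d_tri[of p n q] d_sym[of p n] pV npq by linarith
    moreover have "d p m \<le> 3 * d p q + 3"
    proof -
      have "d p m + d m q \<le> 3 * d p q + 3"
        by (rule nearest_point_bend[OF V(3) mV m(2) AV mu]) (use p q A2 in auto)
      then show ?thesis by simp
    qed
    ultimately have "d p m \<le> 6 * M + 6" by linarith
    then have mn: "d m n \<le> 7 * M + 6"
      using d_tri[of m p n] d_sym[of m p] d_sym[of p n] pV mV npq by linarith
    show "\<exists>v\<in>?A \<union> ?B. d w v \<le> M + M' + \<kappa>"
    proof -
      obtain v where v: "v \<in> on_geod \<alpha> x m \<union> ?m" "d w v \<le> M" using 1 by blast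
      show ?thesis
      proof (cases "v \<in> ?A")
        case True
        then show ?thesis using v(2) by (intro bexI[of _ v]) auto
      next
        case False
        then have vm: "v \<in> ?m" using v(1) A1 by blast
        then have vV: "v \<in> V" using muV by blast
        obtain j where j: "j \<le> d y z" "n = \<beta> j" using n by (auto simp: on_geod_def)
        have ln: "d n z = d y z - j" using geod_dist_ends[OF b] j by auto
        define \<beta>' where "\<beta>' = (\<lambda>k. \<beta> (j + k))"
        have b': "geod \<beta>' n z"
          using b j ln unfolding \<beta>'_def geod_def is_path_def by auto
        have B': "on_geod \<beta>' n z \<subseteq> ?B" using ln j by (auto simp: on_geod_def \<beta>'_def)
        obtain \<nu> where nu: "geod \<nu> m n" using geod_ex mV pV by blast
        \<comment> \<open>One side is short: \<open>u\<close> is within \<open>\<kappa>\<close> of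
          the corner \<open>n\<close>, so the detour through \<open>n\<close> costs at most
          \<open>2 * \<kappa>\<close>.\<close>
        have bend: "d u n + d n u' \<le> (2 * \<kappa> + 1) * d u u' + (2 * \<kappa> + 1)"
          if u: "u \<in> on_geod \<nu> m n" and u': "u' \<in> on_geod \<beta>' n z" for u u'
        proof -
          have uV: "u \<in> V" "u' \<in> V" using on_geodD[OF nu mV pV(3) u] u' B' BV by auto
          have "d u n \<le> d m n" using on_geodD(2)[OF nu mV pV(3) u] by linarith
          then have "d u n \<le> \<kappa>" using mn by (simp add: \<kappa>_def)
          moreover have "d n u' \<le> d u n + d u u'" using d_tri[of n u u'] d_sym[of n u] uV pV by simp
          ultimately have "d u n + d n u' \<le> d u u' + 2 * \<kappa>" by linarith
          also have "\<dots> \<le> (2 * \<kappa> + 1) * d u u' + (2 * \<kappa> + 1)" by simp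
          finally show ?thesis .
        qed
        obtain b where b: "b \<in> on_geod \<nu> m n \<union> on_geod \<beta>' n z" "d v b \<le> M'"
          using bent_geodesic[OF mV pV(3) V(3) nu b' bend _ mu vm] unfolding M'_def by auto
        obtain b' where b': "b' \<in> ?B" "d v b' \<le> M' + \<kappa>"
        proof (cases "b \<in> on_geod \<nu> m n")
          case True
          have bV: "b \<in> V" and "d b n \<le> d m n" using on_geodD[OF nu mV pV(3) True] by auto
          then have "d b n \<le> \<kappa>" using mn by (simp add: \<kappa>_def)
          then have "d v n \<le> M' + \<kappa>" using d_tri[of v b n] b(2) vV bV pV by linarith
          then show thesis using that n by blast
        next
          case False
          then have "b \<in> ?B" using b(1) B' by blast
          then show thesis using that[of b] b(2) by linarith
        qed
        have "d w b' \<le> M + M' + \<kappa>"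
          using d_tri[of w v b'] v(2) b' vV BV on_geodD(1)[OF g V(1,3) w] by fastforce
        then show ?thesis using b' by blast
      qed
    qed
  qed
  then show ?thesis ..
qed

text \<open>The half of the comparison between Gromov product and distance to a geodesic that needs
  slimness: a point \<open>w\<close> of \<open>[x, z]\<close> that is close to both other sides
  makes all three sides nearly pass through it. Four triangle inequalities, two with error
  \<open>\<delta>\<close> and two with \<open>\<delta> + 1\<close>, give the constant.\<close>

lemma dist_to_geodesic_le_gromov_product:
  assumes slim: "slim \<delta>"
    and V: "p \<in> V" "x \<in> V" "z \<in> V" and g: "geod \<gamma> x z"
  shows "\<exists>w\<in>on_geod \<gamma> x z. 2 * d p w + d x z \<le> d p x + d p z + 4 * \<delta> + 2"
proof -
  obtain \<alpha> where a: "geod \<alpha> x p" using geod_ex V by blast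
  obtain \<beta> where b: "geod \<beta> p z" using geod_ex V by blast
  have AV: "on_geod \<alpha> x p \<subseteq> V" "on_geod \<beta> p z \<subseteq> V" using on_geodD a b V by blast+
  obtain w u v where w: "w \<in> on_geod \<gamma> x z" and u: "u \<in> on_geod \<alpha> x p" and v: "v \<in> on_geod \<beta> p z"
    and uv: "d w u \<le> \<delta>" "d w v \<le> \<delta> + 1"
  proof -
    have "x \<in> on_geod \<alpha> x p" "z \<in> on_geod \<beta> p z" using geod_ends_on a b by auto
    from close_to_both[OF V(2,3) g slimD[OF slim V(2,1,3) a b g] this AV] show thesis using that by blast
  qed
  have uV: "u \<in> V" "d x u + d u p = d x p" using on_geodD[OF a V(2,1) u] by auto
  have vV: "v \<in> V" "d p v + d v z = d p z" using on_geodD[OF b V(1,3) v] by auto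
  have wV: "w \<in> V" "d x w + d w z = d x z" using on_geodD[OF g V(2,3) w] by auto
  have "d p w \<le> d u p + d w u" "d x w \<le> d x u + d w u"
    using d_tri[of p u w] d_tri[of x u w] d_sym[of p u] d_sym[of u w] uV wV V by auto
  moreover have "d p w \<le> d p v + d w v" "d w z \<le> d w v + d v z"
    using d_tri[of p v w] d_tri[of w v z] d_sym[of v w] vV wV V by auto
  ultimately have "2 * d p w + d x z \<le> d p x + d p z + 4 * \<delta> + 2"
    using uV vV wV uv d_sym[of x p] V by linarith
  then show ?thesis using w by blast
qed

lemma gromov_product_le_dist:
  assumes V: "p \<in> V" "x \<in> V" "z \<in> V" and g: "geod \<gamma> x z" and w: "w \<in> on_geod \<gamma> x z"
  shows "d p x + d p z \<le> 2 * d p w + d x z"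
  using on_geodD[OF g V(2,3) w] d_tri[of p w x] d_tri[of p w z] d_sym[of w x] V by linarith

theorem gromov_hyperbolic: "gromov_hyperbolic V (\<lambda>x y. real (d x y))"
proof -
  obtain \<delta> where slim: "slim \<delta>"
    using slim_triangles by blast
  let ?g = "gromov_product (\<lambda>x y. real (d x y))"
  \<comment> \<open>Replacing the product by the distance from \<open>p\<close> to
    \<open>[x, z]\<close> costs \<open>2 * \<delta> + 1\<close>; moving from \<open>w\<close> to a
    point \<open>v\<close> of another side costs \<open>\<delta>\<close>.\<close>
  have "min (?g p x y) (?g p y z) - (3 * real \<delta> + 1) \<le> ?g p x z"
    if V: "p \<in> V" "x \<in> V" "y \<in> V" "z \<in> V" for p x y z
  proof -
    obtain \<alpha> where a: "geod \<alpha> x y" using geod_ex V by blast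
    obtain \<beta> where b: "geod \<beta> y z" using geod_ex V by blast
    obtain \<gamma> where g: "geod \<gamma> x z" using geod_ex V by blast
    obtain w where w: "w \<in> on_geod \<gamma> x z" and dw: "2 * d p w + d x z \<le> d p x + d p z + 4 * \<delta> + 2"
      using dist_to_geodesic_le_gromov_product[OF slim V(1,2,4) g] by blast
    obtain v where v: "v \<in> on_geod \<alpha> x y \<union> on_geod \<beta> y z" and wv: "d w v \<le> \<delta>"
      using slimD[OF slim V(2-4) a b g w] by blast
    have wV: "w \<in> V" using on_geodD(1)[OF g V(2,4) w] .
    have vV: "v \<in> V" using v on_geodD(1)[OF a V(2,3)] on_geodD(1)[OF b V(3,4)] by blast
    have pv: "d p v \<le> d p w + \<delta>" using d_tri[of p w v] V wV vV wv by linarith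
    have "d p x + d p y \<le> 2 * d p v + d x y \<or> d p y + d p z \<le> 2 * d p v + d y z"
      using v gromov_product_le_dist[OF V(1-3) a] gromov_product_le_dist[OF V(1,3,4) b] by blast
    then have "?g p x y \<le> real (d p v) \<or> ?g p y z \<le> real (d p v)"
      unfolding gromov_product_def by auto
    moreover have "real (d p v) \<le> ?g p x z + (3 * real \<delta> + 1)"
    proof -
      have "real (2 * d p w + d x z) \<le> real (d p x + d p z + 4 * \<delta> + 2)" "real (d p v) \<le> real (d p w + \<delta>)"
        using dw pv by (simp_all only: of_nat_le_iff)
      then show ?thesis unfolding gromov_product_def by (simp add: field_simps)
    qed
    ultimately show ?thesis by linarith
  qed
  then show ?thesis unfolding gromov_hyperbolic_def
    by (intro exI[of _ "3 * real \<delta> + 1"]) auto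
qed

end

section \<open>An ambient type class ring\<close>

text \<open>The product of all rings on \<^typ>\<open>'r\<close>. Every such ring embeds into it as a direct factor, so
  that its elements can be added and multiplied with type class operations.\<close>

typedef 'r ring_product = "{F :: 'r ring \<Rightarrow> 'r. \<forall>S. (ring S \<longrightarrow> F S \<in> carrier S) \<and> (\<not> ring S \<longrightarrow> F S = undefined)}"
  by (rule exI[of _ "\<lambda>S. if ring S then \<zero>\<^bsub>S\<^esub> else undefined"]) (simp add: ring.ring_simprules)

setup_lifting type_definition_ring_product

instantiation ring_product :: (type) ring
begin

lift_definition zero_ring_product :: "'a ring_product"
  is "\<lambda>S. if ring S then \<zero>\<^bsub>S\<^esub> else undefined"
  by (simp add: ring.ring_simprules)

lift_definition plus_ring_product :: "'a ring_product \<Rightarrow> 'a ring_product \<Rightarrow> 'a ring_product"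
  is "\<lambda>a b S. if ring S then a S \<oplus>\<^bsub>S\<^esub> b S else undefined"
  by (simp add: ring.ring_simprules)

lift_definition uminus_ring_product :: "'a ring_product \<Rightarrow> 'a ring_product"
  is "\<lambda>a S. if ring S then \<ominus>\<^bsub>S\<^esub> a S else undefined"
  by (simp add: ring.ring_simprules)

lift_definition minus_ring_product :: "'a ring_product \<Rightarrow> 'a ring_product \<Rightarrow> 'a ring_product"
  is "\<lambda>a b S. if ring S then a S \<ominus>\<^bsub>S\<^esub> b S else undefined"
  by (simp add: ring.ring_simprules)

lift_definition times_ring_product :: "'a ring_product \<Rightarrow> 'a ring_product \<Rightarrow> 'a ring_product"
  is "\<lambda>a b S. if ring S then a S \<otimes>\<^bsub>S\<^esub> b S else undefined"
  by (simp add: ring.ring_simprules)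

instance
proof
  fix a b c :: "'a ring_product"
  show "a + b + c = a + (b + c)" by transfer (simp add: fun_eq_iff ring.ring_simprules)
  show "a + b = b + a" by transfer (simp add: fun_eq_iff ring.ring_simprules)
  show "0 + a = a" by transfer (simp add: fun_eq_iff ring.ring_simprules)
  show "- a + a = 0" by transfer (simp add: fun_eq_iff ring.ring_simprules)
  show "a - b = a + - b" by transfer (simp add: fun_eq_iff ring.ring_simprules)
  show "a * b * c = a * (b * c)" by transfer (simp add: fun_eq_iff ring.ring_simprules)
  show "(a + b) * c = a * c + b * c" by transfer (simp add: fun_eq_iff ring.ring_simprules)
  show "a * (b + c) = a * b + a * c" by transfer (simp add: fun_eq_iff ring.ring_simprules)
qed

end

text \<open>The inclusion of the factor \<open>R\<close>. The factors are indexed by plain ring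
  records, hence the truncation of the record extension. The unit of \<open>R\<close> does not
  become a unit of the product, only an idempotent.\<close>

definition emb :: "('r, 'x) ring_scheme \<Rightarrow> 'r \<Rightarrow> 'r ring_product" where
  "emb R r = Abs_ring_product (\<lambda>S. if S = ring.truncate R then r else if ring S then \<zero>\<^bsub>S\<^esub> else undefined)"

lemma truncate_sel [simp]:
  "carrier (ring.truncate R) = carrier R" "mult (ring.truncate R) = mult R" "one (ring.truncate R) = one R"
  "zero (ring.truncate R) = zero R" "add (ring.truncate R) = add R"
  by (simp_all add: ring.truncate_def)

lemma ring_truncate:
  assumes "ring R"
  shows "ring (ring.truncate R)"
proof -
  interpret ring R by fact
  have "\<exists>y\<in>carrier R. y \<oplus>\<^bsub>R\<^esub> x = \<zero>\<^bsub>R\<^esub>" if "x \<in> carrier R" for x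
    using that by (intro bexI[of _ "\<ominus>\<^bsub>R\<^esub> x"]) (auto simp: l_neg)
  then show ?thesis
    by (intro ringI abelian_groupI monoidI) (auto simp: ring_simprules)
qed

lemma Rep_emb:
  assumes "ring R" "r \<in> carrier R"
  shows "Rep_ring_product (emb R r) =
    (\<lambda>S. if S = ring.truncate R then r else if ring S then \<zero>\<^bsub>S\<^esub> else undefined)"
  unfolding emb_def
  by (rule Abs_ring_product_inverse) (use assms in \<open>auto simp: ring.ring_simprules ring_truncate\<close>)

lemma ring_product_eqI:
  assumes "\<And>S. ring S \<Longrightarrow> Rep_ring_product a S = Rep_ring_product b S"
  shows "a = b"
  using assms
proof transfer
  fix a b :: "'a ring \<Rightarrow> 'a"
  assume a: "\<forall>S. (ring S \<longrightarrow> a S \<in> carrier S) \<and> (\<not> ring S \<longrightarrow> a S = undefined)"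
    and b: "\<forall>S. (ring S \<longrightarrow> b S \<in> carrier S) \<and> (\<not> ring S \<longrightarrow> b S = undefined)"
    and eq: "\<And>S. ring S \<Longrightarrow> a S = b S"
  show "a = b"
  proof
    fix S show "a S = b S" using a b eq by (cases "ring S") auto
  qed
qed

context ring
begin

lemma inj_emb: "inj_on (emb R) (carrier R)"
proof (rule inj_onI)
  fix r s assume "r \<in> carrier R" "s \<in> carrier R" "emb R r = emb R s"
  then show "r = s" using Rep_emb[of R r] Rep_emb[of R s] ring_axioms by (metis (no_types, lifting))
qed

lemma emb_add:
  assumes "r \<in> carrier R" "s \<in> carrier R"
  shows "emb R (r \<oplus> s) = emb R r + emb R s"
  by (rule ring_product_eqI)
    (use assms ring_axioms in \<open>simp add: plus_ring_product.rep_eq Rep_emb ring.ring_simprules ring_truncate\<close>)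

lemma emb_mult:
  assumes "r \<in> carrier R" "s \<in> carrier R"
  shows "emb R (r \<otimes> s) = emb R r * emb R s"
  by (rule ring_product_eqI)
    (use assms ring_axioms in \<open>simp add: times_ring_product.rep_eq Rep_emb ring.ring_simprules ring_truncate\<close>)

lemma emb_zero: "emb R \<zero> = 0"
  by (rule ring_product_eqI)
    (use ring_axioms in \<open>simp add: zero_ring_product.rep_eq Rep_emb ring.ring_simprules ring_truncate\<close>)

lemma emb_eq_0_iff: "r \<in> carrier R \<Longrightarrow> emb R r = 0 \<longleftrightarrow> r = \<zero>"
  using inj_emb emb_zero by (metis inj_onD zero_closed)

lemma emb_minus:
  assumes "r \<in> carrier R"
  shows "emb R (\<ominus> r) = - emb R r"
  using emb_add[of r "\<ominus> r"] assms emb_zero by (simp add: r_neg add_eq_0_iff)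

lemma emb_finsum:
  assumes "finite A" "f \<in> A \<rightarrow> carrier R"
  shows "emb R (\<Oplus>i\<in>A. f i) = (\<Sum>i\<in>A. emb R (f i))"
  using assms by (induction A rule: finite_induct) (simp_all add: emb_zero emb_add)

end

section \<open>Free modules over a group ring\<close>

text \<open>Elements of a free module over the group ring are coefficient functions:
  \<open>b j x\<close> is the coefficient of the group element \<open>x\<close> in coordinate
  \<open>j\<close>.\<close>

definition supp :: "('j \<Rightarrow> 'g \<Rightarrow> 'u::zero) \<Rightarrow> ('j \<times> 'g) set" where
  "supp b = {p. b (fst p) (snd p) \<noteq> 0}"

definition sc :: "'u::ring \<Rightarrow> ('j \<Rightarrow> 'g \<Rightarrow> 'u) \<Rightarrow> 'j \<Rightarrow> 'g \<Rightarrow> 'u" where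
  "sc r b = (\<lambda>j x. r * b j x)"

lemma sc_simps [simp]: "sc r (b + c) = sc r b + sc r c" "sc r 0 = 0" "sc 0 b = 0"
  "sc r (sc s b) = sc (r * s) b" "sc (r + s) b = sc r b + sc s b" "sc (- r) b = - sc r b"
  "sc r (- b) = - sc r b" "sc r (b - c) = sc r b - sc r c"
  by (auto simp: sc_def fun_eq_iff algebra_simps)

lemma sc_sum: "sc r (sum f A) = (\<Sum>i\<in>A. sc r (f i))"
  using sum_comp_morphism[of "sc r" f A] by (simp add: o_def)

lemma supp_add: "supp (b + c :: _ \<Rightarrow> _ \<Rightarrow> 'u::ring) \<subseteq> supp b \<union> supp c"
  by (auto simp: supp_def)

lemma supp_zero [simp]: "supp 0 = {}"
  by (simp add: supp_def)

lemma supp_sc: "supp (sc r b) \<subseteq> supp b"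
  by (auto simp: supp_def sc_def)

text \<open>\<open>Rs\<close> plays the part of \<open>R\<close> inside the ambient ring, and
  \<open>e\<close> is its unit, which acts as a unit on \<open>Rs\<close> only; the class
  \<open>ring\<close> has no unit of its own.\<close>

locale group_coeff = group G for G :: "('g, 'y) monoid_scheme" (structure) +
  fixes Rs :: "'u::ring set" and e :: 'u
  assumes Rs_zero [simp]: "0 \<in> Rs"
    and Rs_add [simp]: "r \<in> Rs \<Longrightarrow> s \<in> Rs \<Longrightarrow> r + s \<in> Rs"
    and Rs_uminus [simp]: "r \<in> Rs \<Longrightarrow> - r \<in> Rs"
    and Rs_mult [simp]: "r \<in> Rs \<Longrightarrow> s \<in> Rs \<Longrightarrow> r * s \<in> Rs"
    and e_in [simp]: "e \<in> Rs"
    and e_l [simp]: "r \<in> Rs \<Longrightarrow> e * r = r"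
    and e_r [simp]: "r \<in> Rs \<Longrightarrow> r * e = r"
begin

definition act :: "'g \<Rightarrow> ('j \<Rightarrow> 'g \<Rightarrow> 'u) \<Rightarrow> 'j \<Rightarrow> 'g \<Rightarrow> 'u" where
  "act g b = (\<lambda>j x. if x \<in> carrier G then b j (inv g \<otimes> x) else 0)"

definition Free :: "'j set \<Rightarrow> ('j \<Rightarrow> 'g \<Rightarrow> 'u) set" where
  "Free J = {b. (\<forall>j x. b j x \<in> Rs) \<and> supp b \<subseteq> J \<times> carrier G \<and> finite (supp b)}"

definition bas :: "'j \<Rightarrow> 'j \<Rightarrow> 'g \<Rightarrow> 'u" where
  "bas j = (\<lambda>j' x. if j' = j \<and> x = \<one> then e else 0)"

text \<open>The action of the group ring is split into scalars and translations, here and in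
  \<open>hm\<close>, so that no convolution product occurs.\<close>

definition submod :: "('j \<Rightarrow> 'g \<Rightarrow> 'u) set \<Rightarrow> bool" where
  "submod M \<longleftrightarrow> M \<subseteq> Free UNIV \<and> 0 \<in> M \<and> (\<forall>x\<in>M. \<forall>y\<in>M. x + y \<in> M) \<and>
     (\<forall>r\<in>Rs. \<forall>x\<in>M. sc r x \<in> M) \<and> (\<forall>g\<in>carrier G. \<forall>x\<in>M. act g x \<in> M)"

definition hm :: "('i \<Rightarrow> 'g \<Rightarrow> 'u) set \<Rightarrow> (('i \<Rightarrow> 'g \<Rightarrow> 'u) \<Rightarrow> ('j \<Rightarrow> 'g \<Rightarrow> 'u)) \<Rightarrow> ('j \<Rightarrow> 'g \<Rightarrow> 'u) set \<Rightarrow> bool"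
  where "hm M f N \<longleftrightarrow> (\<forall>x\<in>M. f x \<in> N) \<and> (\<forall>x\<in>M. \<forall>y\<in>M. f (x + y) = f x + f y) \<and>
     (\<forall>r\<in>Rs. \<forall>x\<in>M. f (sc r x) = sc r (f x)) \<and> (\<forall>g\<in>carrier G. \<forall>x\<in>M. f (act g x) = act g (f x))"

definition ext :: "('j \<Rightarrow> 'i \<Rightarrow> 'g \<Rightarrow> 'u) \<Rightarrow> ('j \<Rightarrow> 'g \<Rightarrow> 'u) \<Rightarrow> 'i \<Rightarrow> 'g \<Rightarrow> 'u" where
  "ext n b = (\<Sum>p\<in>supp b. sc (b (fst p) (snd p)) (act (snd p) (n (fst p))))"

lemma FreeD:
  assumes "b \<in> Free J"
  shows "b j x \<in> Rs" "finite (supp b)" "b j x \<noteq> 0 \<Longrightarrow> j \<in> J" "b j x \<noteq> 0 \<Longrightarrow> x \<in> carrier G"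
    "supp b \<subseteq> J \<times> carrier G"
proof -
  show 1: "b j x \<in> Rs" "finite (supp b)" "supp b \<subseteq> J \<times> carrier G" for j x
    using assms by (auto simp: Free_def)
  show "b j x \<noteq> 0 \<Longrightarrow> j \<in> J" "b j x \<noteq> 0 \<Longrightarrow> x \<in> carrier G"
    using subsetD[OF 1(3), of "(j, x)"] by (auto simp: supp_def)
qed

lemma Free_mono: "J \<subseteq> J' \<Longrightarrow> Free J \<subseteq> Free J'"
  by (auto simp: Free_def)

lemma Free_UNIV: "b \<in> Free J \<Longrightarrow> b \<in> Free UNIV"
  using Free_mono[of J UNIV] by auto

lemma act_simps [simp]: "act g (b + c) = act g b + act g c" "act g 0 = 0" "act g (- b) = - act g b"
  "act g (sc r b) = sc r (act g b)" "act g (b - c) = act g b - act g c"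
  by (auto simp: act_def fun_eq_iff sc_def)

lemma act_sum: "act g (sum f A) = (\<Sum>i\<in>A. act g (f i))"
  using sum_comp_morphism[of "act g" f A] by (simp add: o_def)

lemma act_act: "g \<in> carrier G \<Longrightarrow> h \<in> carrier G \<Longrightarrow> act g (act h b) = act (g \<otimes> h) b"
  by (auto simp: act_def fun_eq_iff inv_mult_group m_assoc)

lemma act_one:
  assumes "b \<in> Free J" shows "act \<one> b = b"
proof (intro HOL.ext)
  fix j x show "act \<one> b j x = b j x"
    using FreeD(4)[OF assms, of j x] by (cases "b j x = 0") (auto simp: act_def)
qed

lemma sc_e: "b \<in> Free J \<Longrightarrow> sc e b = b"
  by (simp add: sc_def fun_eq_iff FreeD(1))

lemma supp_act:
  assumes "g \<in> carrier G" "b \<in> Free J"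
  shows "supp (act g b) = (\<lambda>p. (fst p, g \<otimes> snd p)) ` supp b"
proof
  show "supp (act g b) \<subseteq> (\<lambda>p. (fst p, g \<otimes> snd p)) ` supp b"
  proof
    fix p assume "p \<in> supp (act g b)"
    then have p: "snd p \<in> carrier G" "b (fst p) (inv g \<otimes> snd p) \<noteq> 0"
      by (auto simp: supp_def act_def split: if_splits)
    then have "p = (fst p, g \<otimes> (inv g \<otimes> snd p))" using assms by (simp add: m_assoc[symmetric])
    then show "p \<in> (\<lambda>p. (fst p, g \<otimes> snd p)) ` supp b"
      using p by (intro image_eqI[of _ _ "(fst p, inv g \<otimes> snd p)"]) (auto simp: supp_def)
  qed
  show "(\<lambda>p. (fst p, g \<otimes> snd p)) ` supp b \<subseteq> supp (act g b)"
  proof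
    fix q assume "q \<in> (\<lambda>p. (fst p, g \<otimes> snd p)) ` supp b"
    then obtain j x where jx: "b j x \<noteq> 0" "q = (j, g \<otimes> x)" by (auto simp: supp_def)
    moreover have "x \<in> carrier G" using FreeD(4)[OF assms(2) jx(1)] .
    ultimately show "q \<in> supp (act g b)"
      using assms by (simp add: supp_def act_def m_assoc[symmetric])
  qed
qed

lemma inj_supp_act:
  assumes "g \<in> carrier G" "b \<in> Free J"
  shows "inj_on (\<lambda>p. (fst p, g \<otimes> snd p)) (supp b)"
proof (rule inj_onI)
  fix p q assume "p \<in> supp b" "q \<in> supp b" "(fst p, g \<otimes> snd p) = (fst q, g \<otimes> snd q)"
  moreover from this have "snd p \<in> carrier G" "snd q \<in> carrier G" using FreeD(5)[OF assms(2)] by auto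
  ultimately show "p = q" using assms(1) by (simp add: prod_eq_iff)
qed

lemma act_Free: "g \<in> carrier G \<Longrightarrow> b \<in> Free J \<Longrightarrow> act g b \<in> Free J"
  using supp_act[of g b J] FreeD(1,2,5)[of b J] unfolding Free_def[of J] mem_Collect_eq
  by (auto simp: act_def)

lemma sc_Free: "r \<in> Rs \<Longrightarrow> b \<in> Free J \<Longrightarrow> sc r b \<in> Free J"
  using supp_sc[of r b] FreeD(1,2,5)[of b J] finite_subset[of "supp (sc r b)" "supp b"]
  unfolding Free_def[of J] mem_Collect_eq by (simp add: sc_def subset_trans)

lemma add_Free: "b \<in> Free J \<Longrightarrow> c \<in> Free J \<Longrightarrow> b + c \<in> Free J"
  using supp_add[of b c] FreeD(1,2,5)[of b J] FreeD(1,2,5)[of c J]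
    finite_subset[of "supp (b + c)" "supp b \<union> supp c"]
  unfolding Free_def[of J] mem_Collect_eq by simp (meson Un_least subset_trans)

lemma zero_Free [simp]: "0 \<in> Free J"
  by (simp add: Free_def)

lemma submod_Free: "submod (Free J)"
  unfolding submod_def using Free_mono[of J UNIV] by (auto simp: act_Free sc_Free add_Free)

lemma bas_Free: "j \<in> J \<Longrightarrow> bas j \<in> Free J"
proof -
  assume "j \<in> J"
  moreover have "supp (bas j) \<subseteq> {(j, \<one>)}" by (auto simp: supp_def bas_def split: if_splits)
  ultimately show ?thesis unfolding Free_def by (auto simp: bas_def intro: finite_subset)
qed

lemma submodD:
  assumes "submod M"
  shows "x \<in> M \<Longrightarrow> x \<in> Free UNIV" "0 \<in> M" "x \<in> M \<Longrightarrow> y \<in> M \<Longrightarrow> x + y \<in> M"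
    "r \<in> Rs \<Longrightarrow> x \<in> M \<Longrightarrow> sc r x \<in> M" "g \<in> carrier G \<Longrightarrow> x \<in> M \<Longrightarrow> act g x \<in> M"
  using assms by (auto simp: submod_def)

lemma submod_uminus:
  assumes "submod M" "x \<in> M" shows "- x \<in> M"
proof -
  have "sc (- e) x \<in> M" using assms by (simp add: submodD(4) del: sc_simps)
  then show ?thesis using sc_e[OF submodD(1)[OF assms]] by simp
qed

lemma submod_diff: "submod M \<Longrightarrow> x \<in> M \<Longrightarrow> y \<in> M \<Longrightarrow> x - y \<in> M"
  using submodD(3)[of M x "- y"] submod_uminus[of M y] by simp

lemma submod_sum:
  assumes "submod M" "\<And>i. i \<in> A \<Longrightarrow> f i \<in> M"
  shows "sum f A \<in> M"
proof (cases "finite A")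
  case True
  then show ?thesis using assms(2)
  proof (induct A)
    case empty
    show "sum f {} \<in> M" using submodD(2)[OF assms(1)] by simp
  next
    case (insert x F)
    then have "sum f F \<in> M" "f x \<in> M" by auto
    then have "f x + sum f F \<in> M" by (rule submodD(3)[OF assms(1), rotated])
    then show "sum f (insert x F) \<in> M" using insert by simp
  qed
next
  case False
  then show ?thesis using submodD(2)[OF assms(1)] by simp
qed

lemma hmD:
  assumes "hm M f N"
  shows "x \<in> M \<Longrightarrow> f x \<in> N" "x \<in> M \<Longrightarrow> y \<in> M \<Longrightarrow> f (x + y) = f x + f y"
    "r \<in> Rs \<Longrightarrow> x \<in> M \<Longrightarrow> f (sc r x) = sc r (f x)" "g \<in> carrier G \<Longrightarrow> x \<in> M \<Longrightarrow> f (act g x) = act g (f x)"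
  using assms by (auto simp: hm_def)

lemma hm_zero: "hm M f N \<Longrightarrow> submod M \<Longrightarrow> f 0 = 0"
  using hmD(3)[of M f N 0 0] submodD(2)[of M] by simp

lemma hm_uminus:
  assumes "hm M f N" "submod M" "submod N" "x \<in> M"
  shows "f (- x) = - f x"
proof -
  have "f (sc (- e) x) = sc (- e) (f x)" using assms by (intro hmD(3)) auto
  then show ?thesis
    using sc_e[OF submodD(1)[OF assms(2,4)]] sc_e[OF submodD(1)[OF assms(3) hmD(1)[OF assms(1,4)]]] by simp
qed

lemma hm_diff:
  assumes "hm M f N" "submod M" "submod N" "x \<in> M" "y \<in> M"
  shows "f (x - y) = f x - f y"
  using hmD(2)[OF assms(1,4), of "- y"] hm_uminus[OF assms(1-3,5)] submod_uminus[OF assms(2,5)] by simp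

lemma hm_sum:
  assumes "hm M f N" "submod M" "\<And>i. i \<in> A \<Longrightarrow> h i \<in> M"
  shows "f (sum h A) = (\<Sum>i\<in>A. f (h i))"
proof (cases "finite A")
  case True
  then show ?thesis using assms(3)
  proof (induct A)
    case empty
    show "f (sum h {}) = (\<Sum>i\<in>{}. f (h i))" using hm_zero[OF assms(1,2)] by simp
  next
    case (insert x F)
    then have "sum h F \<in> M" by (intro submod_sum[OF assms(2)]) auto
    then have "f (h x + sum h F) = f (h x) + f (sum h F)"
      using insert by (intro hmD(2)[OF assms(1)]) auto
    then show "f (sum h (insert x F)) = (\<Sum>i\<in>insert x F. f (h i))" using insert by simp
  qed
next
  case False
  then show ?thesis using hm_zero[OF assms(1,2)] by simp
qed

lemma hm_comp: "hm M f N \<Longrightarrow> hm N f' N' \<Longrightarrow> hm M (\<lambda>x. f' (f x)) N'"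
  by (simp add: hm_def)

lemma hm_mono: "hm M f N \<Longrightarrow> M' \<subseteq> M \<Longrightarrow> (\<And>x. x \<in> M' \<Longrightarrow> f x \<in> N') \<Longrightarrow> hm M' f N'"
  by (auto simp: hm_def subset_iff)

lemma hm_add: "hm M f N \<Longrightarrow> hm M f' N \<Longrightarrow> submod N \<Longrightarrow> hm M (\<lambda>x. f x + f' x) N"
  by (auto simp: hm_def submodD)

lemma hm_minus: "hm M f N \<Longrightarrow> hm M f' N \<Longrightarrow> submod N \<Longrightarrow> hm M (\<lambda>x. f x - f' x) N"
  by (auto simp: hm_def submod_diff)

lemma hm_id: "hm M (\<lambda>x. x) M"
  by (simp add: hm_def)

lemma ext_superset:
  assumes "finite T" "supp b \<subseteq> T"
  shows "ext n b = (\<Sum>p\<in>T. sc (b (fst p) (snd p)) (act (snd p) (n (fst p))))"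
  unfolding ext_def by (rule sum.mono_neutral_left) (use assms in \<open>auto simp: supp_def\<close>)

lemma ext_add:
  assumes "b \<in> Free J" "c \<in> Free J"
  shows "ext n (b + c) = ext n b + ext n c"
proof -
  let ?T = "supp b \<union> supp c"
  have T: "finite ?T" using assms FreeD by blast
  show ?thesis
    using ext_superset[OF T supp_add, of n] ext_superset[OF T, of b n] ext_superset[OF T, of c n]
    by (simp add: sum.distrib)
qed

lemma ext_sc:
  assumes "b \<in> Free J"
  shows "ext n (sc r b) = sc r (ext n b)"
  using ext_superset[OF FreeD(2)[OF assms] supp_sc, of n r]
  by (simp add: ext_def sc_sum) (simp add: sc_def)

lemma ext_act:
  assumes "b \<in> Free J" "g \<in> carrier G"
  shows "ext n (act g b) = act g (ext n b)"
proof -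
  have "ext n (act g b) = (\<Sum>p\<in>supp b. sc (act g b (fst p) (g \<otimes> snd p)) (act (g \<otimes> snd p) (n (fst p))))"
    unfolding ext_def supp_act[OF assms(2,1)]
    by (subst sum.reindex[OF inj_supp_act[OF assms(2,1)]]) simp
  also have "\<dots> = (\<Sum>p\<in>supp b. act g (sc (b (fst p) (snd p)) (act (snd p) (n (fst p)))))"
  proof (rule sum.cong)
    fix p assume p: "p \<in> supp b"
    then have x: "snd p \<in> carrier G" using FreeD(5)[OF assms(1)] by auto
    then have "act g b (fst p) (g \<otimes> snd p) = b (fst p) (snd p)"
      using assms by (simp add: act_def m_assoc[symmetric])
    then show "sc (act g b (fst p) (g \<otimes> snd p)) (act (g \<otimes> snd p) (n (fst p))) =
        act g (sc (b (fst p) (snd p)) (act (snd p) (n (fst p))))"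
      using x assms by (simp add: act_act)
  qed simp
  finally show ?thesis by (simp add: ext_def act_sum)
qed

lemma ext_closed:
  assumes "submod N" "\<And>j. j \<in> J \<Longrightarrow> n j \<in> N" "b \<in> Free J"
  shows "ext n b \<in> N"
  unfolding ext_def
proof (rule submod_sum[OF assms(1)])
  fix p assume "p \<in> supp b"
  then show "sc (b (fst p) (snd p)) (act (snd p) (n (fst p))) \<in> N"
    using FreeD[OF assms(3)] assms(1,2) by (intro submodD(4,5)) auto
qed

lemma hm_ext:
  assumes "submod N" "\<And>j. j \<in> J \<Longrightarrow> n j \<in> N"
  shows "hm (Free J) (ext n) N"
  unfolding hm_def by (simp add: ext_closed[OF assms] ext_add ext_sc ext_act)

lemma hm_of_ext:
  assumes "hm M f N" "submod M" "\<And>j. j \<in> J \<Longrightarrow> n j \<in> M" "b \<in> Free J"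
  shows "f (ext n b) = ext (\<lambda>j. f (n j)) b"
proof -
  have mem: "b (fst p) (snd p) \<in> Rs \<and> snd p \<in> carrier G \<and> n (fst p) \<in> M" if "p \<in> supp b" for p
    using that FreeD[OF assms(4)] assms(3) by auto
  have "f (ext n b) = (\<Sum>p\<in>supp b. f (sc (b (fst p) (snd p)) (act (snd p) (n (fst p)))))"
    unfolding ext_def by (rule hm_sum[OF assms(1,2)]) (use mem submodD[OF assms(2)] in auto)
  also have "\<dots> = ext (\<lambda>j. f (n j)) b"
    unfolding ext_def
    by (rule sum.cong) (use mem submodD[OF assms(2)] hmD[OF assms(1)] in auto)
  finally show ?thesis .
qed

lemma ext_cong: "b \<in> Free J \<Longrightarrow> (\<And>j. j \<in> J \<Longrightarrow> n j = n' j) \<Longrightarrow> ext n b = ext n' b"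
  unfolding ext_def using FreeD(5)[of b J] by (intro sum.cong) auto

lemma ext_ext:
  assumes "b \<in> Free J" "\<And>j. j \<in> J \<Longrightarrow> n j \<in> Free I" "\<And>i. i \<in> I \<Longrightarrow> n' i \<in> N" "submod N"
  shows "ext n' (ext n b) = ext (\<lambda>j. ext n' (n j)) b"
  using hm_of_ext[OF hm_ext[OF assms(4,3)] submod_Free assms(2,1)] .

lemma ext_bas:
  assumes "n j \<in> Free I"
  shows "ext n (bas j) = n j"
proof -
  have "ext n (bas j) = (\<Sum>p\<in>{(j, \<one>)}. sc (bas j (fst p) (snd p)) (act (snd p) (n (fst p))))"
    by (rule ext_superset) (auto simp: supp_def bas_def split: if_splits)
  then show ?thesis using assms by (simp add: act_one sc_e bas_def[of j])
qed

lemma ext_bas_id: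
  assumes "b \<in> Free J"
  shows "ext bas b = b"
proof (intro ext)
  fix j x
  have "ext bas b j x = (\<Sum>p\<in>supp b. if p = (j, x) then b j x else 0)"
    unfolding ext_def sum_fun_apply
  proof (rule sum.cong)
    fix p assume p: "p \<in> supp b"
    then have x': "snd p \<in> carrier G" using FreeD(5)[OF assms] by auto
    have "x \<in> carrier G \<Longrightarrow> inv (snd p) \<otimes> x = \<one> \<longleftrightarrow> x = snd p"
      using x' by (metis inv_closed inv_inv inv_equality l_inv r_inv)
    then have "act (snd p) (bas (fst p)) j x = (if j = fst p \<and> x = snd p then e else 0)"
      using x' by (auto simp: act_def bas_def)
    then show "sc (b (fst p) (snd p)) (act (snd p) (bas (fst p))) j x = (if p = (j, x) then b j x else 0)"
      using FreeD(1)[OF assms] by (auto simp: sc_def)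
  qed simp
  also have "\<dots> = b j x" using FreeD(2)[OF assms] by (auto simp: supp_def)
  finally show "ext bas b j x = b j x" .
qed

end

section \<open>The bar resolution\<close>

definition sz :: "('j \<Rightarrow> 'g \<Rightarrow> 'u::zero) \<Rightarrow> nat" where
  "sz b = card (supp b)"

definition aug :: "('j \<Rightarrow> 'g \<Rightarrow> 'u::comm_monoid_add) \<Rightarrow> 'u" where
  "aug b = (\<Sum>p\<in>supp b. b (fst p) (snd p))"

definition sgn_if :: "nat \<Rightarrow> 'a::uminus \<Rightarrow> 'a" where
  "sgn_if i b = (if even i then b else - b)"

context group_coeff
begin

lemma sz_add:
  assumes "b \<in> Free J" "c \<in> Free J"
  shows "sz (b + c) \<le> sz b + sz c"
proof -
  have "card (supp (b + c)) \<le> card (supp b \<union> supp c)"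
    by (rule card_mono[OF _ supp_add]) (use assms FreeD(2) in blast)
  also have "\<dots> \<le> card (supp b) + card (supp c)" by (rule card_Un_le)
  finally show ?thesis by (simp add: sz_def)
qed

lemma sz_sc: "b \<in> Free J \<Longrightarrow> sz (sc r b) \<le> sz b"
  unfolding sz_def by (rule card_mono[OF FreeD(2) supp_sc])

lemma sz_act: "g \<in> carrier G \<Longrightarrow> b \<in> Free J \<Longrightarrow> sz (act g b) = sz b"
  unfolding sz_def by (simp only: supp_act card_image[OF inj_supp_act])

lemma sz_sum:
  assumes "\<And>i. i \<in> A \<Longrightarrow> f i \<in> Free J"
  shows "sz (sum f A) \<le> (\<Sum>i\<in>A. sz (f i))"
proof (cases "finite A")
  case True
  then show ?thesis using assms
  proof (induct A)
    case empty
    then show "sz (sum f {}) \<le> (\<Sum>i\<in>{}. sz (f i))" by (simp add: sz_def)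
  next
    case (insert x F)
    have "sum f F \<in> Free J" by (rule submod_sum[OF submod_Free]) (use insert in auto)
    then have "sz (f x + sum f F) \<le> sz (f x) + sz (sum f F)" using insert by (intro sz_add) auto
    also have "sz (sum f F) \<le> (\<Sum>i\<in>F. sz (f i))" using insert by auto
    finally show "sz (sum f (insert x F)) \<le> (\<Sum>i\<in>insert x F. sz (f i))" using insert by simp
  qed
qed (simp add: sz_def)

lemma sz_ext:
  assumes b: "b \<in> Free J" and n: "\<And>j. j \<in> J \<Longrightarrow> n j \<in> Free I \<and> sz (n j) \<le> K"
  shows "sz (ext n b) \<le> K * sz b"
proof -
  have mem: "b (fst p) (snd p) \<in> Rs \<and> snd p \<in> carrier G \<and> fst p \<in> J" if "p \<in> supp b" for p
    using that FreeD[OF b] by auto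
  have "sz (ext n b) \<le> (\<Sum>p\<in>supp b. sz (sc (b (fst p) (snd p)) (act (snd p) (n (fst p)))))"
    unfolding ext_def by (rule sz_sum[where J = I]) (use mem n in \<open>auto intro!: sc_Free act_Free\<close>)
  also have "\<dots> \<le> (\<Sum>p\<in>supp b. K)"
  proof (rule sum_mono)
    fix p assume p: "p \<in> supp b"
    have "act (snd p) (n (fst p)) \<in> Free I" using mem[OF p] n by (intro act_Free) auto
    then have "sz (sc (b (fst p) (snd p)) (act (snd p) (n (fst p)))) \<le> sz (act (snd p) (n (fst p)))"
      by (rule sz_sc)
    also have "\<dots> = sz (n (fst p))" using mem[OF p] n by (intro sz_act) auto
    finally show "sz (sc (b (fst p) (snd p)) (act (snd p) (n (fst p)))) \<le> K" using mem[OF p] n by force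
  qed
  finally show ?thesis by (simp add: sz_def mult.commute)
qed

text \<open>A direct summand of \<open>Free J\<close>: \<open>ext s\<close> maps
  \<open>Free J\<close> into \<open>P\<close> and fixes \<open>P\<close>. Keeping the module inside
  a free one provides its elements with supports and sizes.\<close>

definition proj :: "'j set \<Rightarrow> ('j \<Rightarrow> 'j \<Rightarrow> 'g \<Rightarrow> 'u) \<Rightarrow> ('j \<Rightarrow> 'g \<Rightarrow> 'u) set \<Rightarrow> bool" where
  "proj J s P \<longleftrightarrow> submod P \<and> P \<subseteq> Free J \<and> (\<forall>j\<in>J. s j \<in> P) \<and> (\<forall>p\<in>P. ext s p = p)"

lemma projD:
  assumes "proj J s P"
  shows "submod P" "P \<subseteq> Free J" "j \<in> J \<Longrightarrow> s j \<in> P" "p \<in> P \<Longrightarrow> ext s p = p"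
  using assms by (auto simp: proj_def)

lemma proj_Free: "proj J bas (Free J)"
  by (simp add: proj_def submod_Free bas_Free ext_bas_id)

lemma proj_hm_eq_ext:
  assumes "proj J s P" "hm P f N" "p \<in> P"
  shows "f p = ext (\<lambda>j. f (s j)) p"
proof -
  have "f (ext s p) = ext (\<lambda>j. f (s j)) p"
    by (rule hm_of_ext[OF assms(2) projD(1)[OF assms(1)], where J = J])
      (use assms projD[OF assms(1)] in auto)
  then show ?thesis using projD(4)[OF assms(1,3)] by simp
qed

lemma proj_lift:
  assumes P: "proj J s P" and f: "hm P f Y" and Q: "submod Q" and \<pi>: "hm Q \<pi> Y'"
    and n: "\<And>j. j \<in> J \<Longrightarrow> n j \<in> Q \<and> \<pi> (n j) = f (s j)"
  shows "hm P (ext n) Q" "p \<in> P \<Longrightarrow> \<pi> (ext n p) = f p"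
proof -
  show "hm P (ext n) Q"
    by (rule hm_mono[OF hm_ext[OF Q, of J n]]) (use n projD(2)[OF P] ext_closed[OF Q, of J n] in auto)
  assume p: "p \<in> P"
  then have pF: "p \<in> Free J" using projD(2)[OF P] by auto
  have "\<pi> (ext n p) = ext (\<lambda>j. \<pi> (n j)) p" by (rule hm_of_ext[OF \<pi> Q _ pF]) (use n in auto)
  also have "\<dots> = ext (\<lambda>j. f (s j)) p" by (rule ext_cong[OF pF]) (use n in auto)
  also have "\<dots> = f p" using proj_hm_eq_ext[OF P f p] by simp
  finally show "\<pi> (ext n p) = f p" .
qed

text \<open>A homomorphism on \<open>P\<close> is determined by the finitely many values
  \<open>f (s j)\<close>, and each nonzero coefficient of \<open>p\<close> contributes a multiple of
  a translate of one of them.\<close>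

lemma proj_hm_sz:
  assumes P: "proj J s P" and J: "finite J" and f: "hm P f (Free I)"
  shows "\<exists>K. \<forall>p\<in>P. sz (f p) \<le> K * sz p"
proof (intro exI ballI)
  fix p assume p: "p \<in> P"
  have "sz (ext (\<lambda>j. f (s j)) p) \<le> Max (insert 0 ((\<lambda>j. sz (f (s j))) ` J)) * sz p"
    by (rule sz_ext[where J = J and I = I])
      (use p projD[OF P] hmD(1)[OF f] J in \<open>auto intro!: Max_ge\<close>)
  then show "sz (f p) \<le> Max (insert 0 ((\<lambda>j. sz (f (s j))) ` J)) * sz p"
    using proj_hm_eq_ext[OF P f p] by simp
qed

lemma aug_superset: "finite T \<Longrightarrow> supp b \<subseteq> T \<Longrightarrow> aug b = (\<Sum>p\<in>T. b (fst p) (snd p))"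
  unfolding aug_def by (rule sum.mono_neutral_left) (auto simp: supp_def)

lemma aug_add:
  assumes "b \<in> Free J" "c \<in> Free J"
  shows "aug (b + c) = aug b + aug c"
proof -
  let ?T = "supp b \<union> supp c"
  have T: "finite ?T" using FreeD(2) assms by auto
  show ?thesis
    using aug_superset[OF T supp_add] aug_superset[OF T, of b] aug_superset[OF T, of c]
    by (simp add: sum.distrib)
qed

lemma aug_zero [simp]: "aug 0 = 0"
  by (simp add: aug_def)

lemma aug_sc:
  assumes "b \<in> Free J"
  shows "aug (sc r b) = r * aug b"
  using aug_superset[OF FreeD(2)[OF assms] supp_sc, of r] by (simp add: aug_def sum_distrib_left sc_def)

lemma aug_act:
  assumes "b \<in> Free J" "g \<in> carrier G"
  shows "aug (act g b) = aug b"
proof -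
  have "aug (act g b) = (\<Sum>p\<in>supp b. act g b (fst p) (g \<otimes> snd p))"
    unfolding aug_def supp_act[OF assms(2,1)] by (subst sum.reindex[OF inj_supp_act[OF assms(2,1)]]) simp
  also have "\<dots> = (\<Sum>p\<in>supp b. b (fst p) (snd p))"
  proof (rule sum.cong)
    fix p assume "p \<in> supp b"
    then have "snd p \<in> carrier G" using FreeD(5)[OF assms(1)] by auto
    then show "act g b (fst p) (g \<otimes> snd p) = b (fst p) (snd p)"
      using assms by (simp add: act_def m_assoc[symmetric])
  qed simp
  finally show ?thesis by (simp add: aug_def)
qed

lemma aug_uminus:
  assumes "b \<in> Free J" shows "aug (- b) = - aug b"
  using aug_add[OF assms submod_uminus[OF submod_Free assms]] by (simp add: minus_unique)

lemma aug_bas: "aug (bas j) = e"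
proof -
  have "aug (bas j) = (\<Sum>p\<in>{(j, \<one>)}. bas j (fst p) (snd p))"
    by (rule aug_superset) (auto simp: supp_def bas_def split: if_splits)
  then show ?thesis by (simp add: bas_def)
qed

lemma aug_sum:
  assumes "\<And>i. i \<in> A \<Longrightarrow> f i \<in> Free J"
  shows "aug (sum f A) = (\<Sum>i\<in>A. aug (f i))"
proof (cases "finite A")
  case True
  then show ?thesis using assms
  proof (induct A)
    case (insert x F)
    have "sum f F \<in> Free J" by (rule submod_sum[OF submod_Free]) (use insert in auto)
    then have "aug (f x + sum f F) = aug (f x) + aug (sum f F)" using insert by (intro aug_add) auto
    then show "aug (sum f (insert x F)) = (\<Sum>i\<in>insert x F. aug (f i))" using insert by simp
  qed simp
qed simp

lemma aug_ext:
  assumes b: "b \<in> Free J" and n: "\<And>j. j \<in> J \<Longrightarrow> n j \<in> Free I"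
  shows "aug (ext n b) = (\<Sum>p\<in>supp b. b (fst p) (snd p) * aug (n (fst p)))"
proof -
  have mem: "b (fst p) (snd p) \<in> Rs \<and> snd p \<in> carrier G \<and> n (fst p) \<in> Free I" if "p \<in> supp b" for p
    using that FreeD[OF b] n by auto
  have "aug (ext n b) = (\<Sum>p\<in>supp b. aug (sc (b (fst p) (snd p)) (act (snd p) (n (fst p)))))"
    unfolding ext_def by (rule aug_sum[where J = I]) (use mem in \<open>auto intro!: sc_Free act_Free\<close>)
  also have "\<dots> = (\<Sum>p\<in>supp b. b (fst p) (snd p) * aug (n (fst p)))"
    by (rule sum.cong) (use mem in \<open>auto simp: aug_sc[OF act_Free[of _ _ I]] aug_act[of _ I]\<close>)
  finally show ?thesis .
qed

section \<open>Boundary and contraction of the bar resolution\<close>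

definition merge :: "nat \<Rightarrow> 'g list \<Rightarrow> 'g list" where
  "merge i w = take i w @ (w ! i \<otimes> w ! Suc i) # drop (i + 2) w"

definition bd :: "'g list \<Rightarrow> 'g list \<Rightarrow> 'g \<Rightarrow> 'u" where
  "bd w = act (hd w) (bas (tl w)) + (\<Sum>i<length w - 1. sgn_if (Suc i) (bas (merge i w))) +
     sgn_if (length w) (bas (butlast w))"

text \<open>The standard contracting homotopy, which maps \<open>x [g1|...|gk]\<close> to
  \<open>[x|g1|...|gk]\<close>. It is linear over \<open>R\<close> but not equivariant.\<close>

definition contract :: "('g list \<Rightarrow> 'g \<Rightarrow> 'u) \<Rightarrow> 'g list \<Rightarrow> 'g \<Rightarrow> 'u" where
  "contract b = (\<lambda>w x. if w \<noteq> [] \<and> x = \<one> then b (tl w) (hd w) else 0)"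

text \<open>The boundary in the bar resolution, whose term in degree \<open>k\<close> is \<open>Free (words G k)\<close>.\<close>

abbreviation bar_d :: "('g list \<Rightarrow> 'g \<Rightarrow> 'u) \<Rightarrow> 'g list \<Rightarrow> 'g \<Rightarrow> 'u" where
  "bar_d \<equiv> ext bd"

definition bar_ker :: "nat \<Rightarrow> ('g list \<Rightarrow> 'g \<Rightarrow> 'u) set" where
  "bar_ker k = {b \<in> Free (words G k). if k = 0 then aug b = 0 else bar_d b = 0}"

lemma sgn_if_closed: "submod M \<Longrightarrow> x \<in> M \<Longrightarrow> sgn_if i x \<in> M"
  by (simp add: sgn_if_def submod_uminus)

lemma merge_words:
  assumes "w \<in> words G (Suc k)" "i < k"
  shows "merge i w \<in> words G k"
proof -
  have w: "length w = Suc k" "set w \<subseteq> carrier G" using assms by (auto simp: words_def)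
  have "w ! i \<in> carrier G" "w ! Suc i \<in> carrier G" using w assms(2) nth_mem[of i w] nth_mem[of "Suc i" w] by auto
  moreover have "set (take i w) \<subseteq> carrier G" "set (drop (i + 2) w) \<subseteq> carrier G"
    using w set_take_subset set_drop_subset by (metis subset_trans)+
  ultimately show ?thesis using w assms(2) by (simp add: words_def merge_def)
qed

lemma words_simps:
  "[] \<in> words G k \<longleftrightarrow> k = 0" "x # w \<in> words G (Suc k) \<longleftrightarrow> x \<in> carrier G \<and> w \<in> words G k"
  by (auto simp: words_def)

lemma wordsD:
  assumes "w \<in> words G (Suc k)"
  shows "hd w \<in> carrier G" "tl w \<in> words G k" "butlast w \<in> words G k" "length w = Suc k" "w \<noteq> []"
  using assms in_set_butlastD[of _ w] by (cases w; force simp: words_def)+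

lemma bd_Free:
  assumes w: "w \<in> words G (Suc k)"
  shows "bd w \<in> Free (words G k)"
  unfolding bd_def
  by (intro submodD(3)[OF submod_Free] act_Free bas_Free submod_sum[OF submod_Free]
      sgn_if_closed[OF submod_Free] wordsD[OF w])
    (use wordsD(4)[OF w] in \<open>auto intro: merge_words[OF w]\<close>)

lemma hm_bar_d: "hm (Free (words G (Suc k))) bar_d (Free (words G k))"
  by (rule hm_ext[OF submod_Free bd_Free])

lemma supp_contract: "supp (contract b) = (\<lambda>p. (snd p # fst p, \<one>)) ` supp b"
proof
  show "supp (contract b) \<subseteq> (\<lambda>p. (snd p # fst p, \<one>)) ` supp b"
  proof
    fix p assume "p \<in> supp (contract b)"
    then have "fst p \<noteq> []" "snd p = \<one>" "b (tl (fst p)) (hd (fst p)) \<noteq> 0"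
      by (auto simp: supp_def contract_def split: if_splits)
    then show "p \<in> (\<lambda>p. (snd p # fst p, \<one>)) ` supp b"
      by (intro image_eqI[of _ _ "(tl (fst p), hd (fst p))"]) (auto simp: supp_def prod_eq_iff)
  qed
qed (auto simp: supp_def contract_def)

lemma contract_Free:
  assumes "b \<in> Free (words G k)"
  shows "contract b \<in> Free (words G (Suc k))"
proof -
  have "supp (contract b) \<subseteq> words G (Suc k) \<times> carrier G" "finite (supp (contract b))"
    unfolding supp_contract using FreeD(5,2)[OF assms] by (auto simp: words_simps)
  then show ?thesis unfolding Free_def[of "words G (Suc k)"] mem_Collect_eq
    using FreeD(1)[OF assms] by (auto simp: contract_def)
qed

lemma contract_simps:
  "contract (b + c) = contract b + contract c" "contract (sc r b) = sc r (contract b)"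
  "contract (- b) = - contract b" "contract 0 = 0"
  by (auto simp: contract_def fun_eq_iff sc_def)

lemma contract_sum: "contract (sum f A) = (\<Sum>i\<in>A. contract (f i))"
  using sum_comp_morphism[of contract f A] contract_simps by (simp add: o_def)

lemma contract_sgn_if: "contract (sgn_if i b) = sgn_if i (contract b)"
  by (simp add: sgn_if_def contract_simps)

lemma act_bas:
  assumes "g \<in> carrier G"
  shows "act g (bas w) = (\<lambda>w' x. if w' = w \<and> x = g then e else 0)"
proof (intro HOL.ext)
  fix w' x
  have "x \<in> carrier G \<Longrightarrow> inv g \<otimes> x = \<one> \<longleftrightarrow> x = g"
    using assms by (metis inv_closed inv_inv inv_equality l_inv)
  then show "act g (bas w) w' x = (if w' = w \<and> x = g then e else 0)"
    using assms by (auto simp: act_def bas_def)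
qed

lemma contract_act_bas:
  assumes "g \<in> carrier G"
  shows "contract (act g (bas w)) = bas (g # w)"
  unfolding act_bas[OF assms] by (auto simp: contract_def bas_def fun_eq_iff neq_Nil_conv)

text \<open>The linearity that the contraction has. Over \<open>R\<close> a basis of the free module
  consists of all translates \<open>act x (bas j)\<close>, so identities that involve the
  contraction are tested on these.\<close>

definition rlin :: "'j set \<Rightarrow> (('j \<Rightarrow> 'g \<Rightarrow> 'u) \<Rightarrow> ('i \<Rightarrow> 'g \<Rightarrow> 'u)) \<Rightarrow> bool" where
  "rlin J f \<longleftrightarrow> f 0 = 0 \<and> (\<forall>b\<in>Free J. \<forall>c\<in>Free J. f (b + c) = f b + f c) \<and>
     (\<forall>r\<in>Rs. \<forall>b\<in>Free J. f (sc r b) = sc r (f b))"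

lemma rlin_hm: "hm (Free J) f N \<Longrightarrow> rlin J f"
  using hm_zero[OF _ submod_Free] by (auto simp: rlin_def hm_def)

lemma rlin_expand:
  assumes f: "rlin J f" and b: "b \<in> Free J"
  shows "f b = (\<Sum>p\<in>supp b. sc (b (fst p) (snd p)) (f (act (snd p) (bas (fst p)))))"
proof -
  let ?h = "\<lambda>p. sc (b (fst p) (snd p)) (act (snd p) (bas (fst p)))"
  have mem: "act (snd p) (bas (fst p)) \<in> Free J \<and> b (fst p) (snd p) \<in> Rs" if "p \<in> supp b" for p
    using that FreeD[OF b] by (auto intro!: act_Free bas_Free)
  have "f (sum ?h A) = (\<Sum>p\<in>A. sc (b (fst p) (snd p)) (f (act (snd p) (bas (fst p)))))"
    if "finite A" "A \<subseteq> supp b" for A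
    using that
  proof (induct A)
    case empty
    show "f (sum ?h {}) = (\<Sum>p\<in>{}. sc (b (fst p) (snd p)) (f (act (snd p) (bas (fst p)))))"
      using f by (simp add: rlin_def)
  next
    case (insert q F)
    then have "sum ?h F \<in> Free J" using mem by (intro submod_sum[OF submod_Free] sc_Free) auto
    moreover have "?h q \<in> Free J" using mem insert by (auto intro!: sc_Free)
    ultimately have "f (?h q + sum ?h F) = f (?h q) + f (sum ?h F)"
      using f by (simp add: rlin_def)
    moreover have "f (?h q) = sc (b (fst q) (snd q)) (f (act (snd q) (bas (fst q))))"
      using f mem insert by (simp add: rlin_def)
    ultimately show "f (sum ?h (insert q F)) =
        (\<Sum>p\<in>insert q F. sc (b (fst p) (snd p)) (f (act (snd p) (bas (fst p)))))"
      using insert by simp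
  qed
  from this[OF FreeD(2)[OF b] subset_refl] show ?thesis
    using ext_bas_id[OF b] by (simp add: ext_def)
qed

lemma rlin_eq_on_basis:
  assumes f: "rlin J f" and f': "rlin J f'" and b: "b \<in> Free J"
    and eq: "\<And>j x. j \<in> J \<Longrightarrow> x \<in> carrier G \<Longrightarrow> f (act x (bas j)) = f' (act x (bas j))"
  shows "f b = f' b"
  unfolding rlin_expand[OF f b] rlin_expand[OF f' b]
  by (rule sum.cong) (use eq FreeD(5)[OF b] in auto)

text \<open>The first face of \<open>g # w\<close> is the translate by \<open>g\<close> of the basis
  element \<open>w\<close>. The other faces arise from those of the translated \<open>w\<close> by
  turning the group element into a first letter; this shifts their position by one and so reverses
  the sign, and they cancel against the second summand.\<close>

lemma contract_bd:
  assumes w: "w \<in> words G (Suc k)" and g: "g \<in> carrier G"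
  shows "bar_d (contract (act g (bas w))) + contract (bar_d (act g (bas w))) = act g (bas w)"
proof -
  have bw: "bas w \<in> Free (words G (Suc k))" using w by (rule bas_Free)
  have gw: "g # w \<in> words G (Suc (Suc k))" using w g by (simp add: words_simps)
  have "bar_d (act g (bas w)) = act g (bd w)"
    using ext_act[OF bw g, of bd] ext_bas[of bd w, OF bd_Free[OF w]] by simp
  then have "contract (bar_d (act g (bas w))) = bas ((g \<otimes> hd w) # tl w) +
      (\<Sum>i<k. sgn_if (Suc i) (bas (g # merge i w))) + sgn_if (Suc k) (bas (g # butlast w))"
  proof -
    assume "bar_d (act g (bas w)) = act g (bd w)"
    also have "act g (bd w) = act (g \<otimes> hd w) (bas (tl w)) +
        (\<Sum>i<k. sgn_if (Suc i) (act g (bas (merge i w)))) + sgn_if (Suc k) (act g (bas (butlast w)))"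
      unfolding bd_def using wordsD[OF w] g by (simp add: act_act act_sum sgn_if_def if_distrib cong: if_cong)
    finally show ?thesis
      using g wordsD(1)[OF w] by (simp add: contract_simps contract_sum contract_sgn_if contract_act_bas)
  qed
  moreover have "bar_d (contract (act g (bas w))) = bd (g # w)"
    using ext_bas[of bd "g # w", OF bd_Free[OF gw]] g by (simp add: contract_act_bas)
  moreover have "bd (g # w) = act g (bas w) +
      (- bas ((g \<otimes> hd w) # tl w) - (\<Sum>i<k. sgn_if (Suc i) (bas (g # merge i w)))) -
      sgn_if (Suc k) (bas (g # butlast w))"
  proof -
    have len: "length w = Suc k" using wordsD[OF w] by simp
    have m0: "merge 0 (g # w) = (g \<otimes> hd w) # tl w"
      using wordsD(5)[OF w] by (cases w) (auto simp: merge_def)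
    have mS: "merge (Suc i) (g # w) = g # merge i w" for i by (simp add: merge_def)
    have flip: "sgn_if (Suc i) x = - sgn_if i x" for i and x :: "'g list \<Rightarrow> 'g \<Rightarrow> 'u"
      by (simp add: sgn_if_def)
    have "(\<Sum>i<Suc k. sgn_if (Suc i) (bas (merge i (g # w)))) =
        - bas ((g \<otimes> hd w) # tl w) - (\<Sum>i<k. sgn_if (Suc i) (bas (g # merge i w)))"
      unfolding sum.lessThan_Suc_shift m0 mS flip[of "Suc _"]
      by (simp add: sum_negf) (simp add: sgn_if_def)
    then show ?thesis
      using wordsD(5)[OF w] flip[of "Suc k"] unfolding bd_def by (simp add: len)
  qed
  ultimately show ?thesis by simp
qed

lemma contract_homotopy:
  assumes b: "b \<in> Free (words G (Suc k))"
  shows "bar_d (contract b) + contract (bar_d b) = b"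
proof (rule rlin_eq_on_basis[OF _ _ b, of "\<lambda>b. bar_d (contract b) + contract (bar_d b)" "\<lambda>b. b"])
  have "rlin (words G (Suc (Suc k))) bar_d" "rlin (words G (Suc k)) bar_d"
    by (rule rlin_hm[OF hm_bar_d])+
  then show "rlin (words G (Suc k)) (\<lambda>b. bar_d (contract b) + contract (bar_d b))"
    unfolding rlin_def by (simp add: contract_simps contract_Free algebra_simps)
qed (simp_all add: rlin_def contract_bd)

lemma contract_homotopy_0:
  assumes b: "b \<in> Free (words G 0)"
  shows "bar_d (contract b) = b - sc (aug b) (bas [])"
proof (rule rlin_eq_on_basis[OF _ _ b, of "\<lambda>b. bar_d (contract b)" "\<lambda>b. b - sc (aug b) (bas [])"])
  have "rlin (words G (Suc 0)) bar_d"
    by (rule rlin_hm[OF hm_bar_d])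
  then show "rlin (words G 0) (\<lambda>b. bar_d (contract b))"
    unfolding rlin_def by (simp add: contract_simps contract_Free)
  show "rlin (words G 0) (\<lambda>b. b - sc (aug b) (bas []))"
    unfolding rlin_def by (simp add: aug_add aug_sc algebra_simps)
  fix w g assume "w \<in> words G 0" and g: "g \<in> carrier G"
  then have [simp]: "w = []" by (simp add: words_def)
  have gw: "[g] \<in> words G (Suc 0)" using g by (simp add: words_def)
  have "bar_d (contract (act g (bas w))) = bd [g]"
    using ext_bas[of bd "[g]", OF bd_Free[OF gw]] g by (simp add: contract_act_bas)
  also have "\<dots> = act g (bas []) - bas []" by (simp add: bd_def sgn_if_def)
  moreover have "aug (act g (bas ([] :: 'g list))) = e"
    using aug_act[OF bas_Free[of "[]" UNIV] g] by (simp add: aug_bas)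
  moreover have "sc e (bas []) = (bas [] :: 'g list \<Rightarrow> 'g \<Rightarrow> 'u)" by (rule sc_e[OF bas_Free[of _ UNIV]]) simp
  ultimately show "bar_d (contract (act g (bas w))) = act g (bas w) - sc (aug (act g (bas w))) (bas [])"
    by simp
qed

lemma bar_ker_exact:
  assumes "b \<in> bar_ker k"
  shows "contract b \<in> Free (words G (Suc k))" "bar_d (contract b) = b"
proof -
  have b: "b \<in> Free (words G k)" using assms by (simp add: bar_ker_def)
  then show "contract b \<in> Free (words G (Suc k))" by (rule contract_Free)
  show "bar_d (contract b) = b"
  proof (cases k)
    case 0
    then show ?thesis using assms contract_homotopy_0 b by (simp add: bar_ker_def)
  next
    case (Suc k')
    then have "bar_d b = 0" using assms by (simp add: bar_ker_def)
    then show ?thesis using contract_homotopy[of b k'] b Suc by (simp add: contract_simps)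
  qed
qed

text \<open>The homotopy replaces the cancellation in a double sum. A basis element
  \<open>w = g # w'\<close> is the contraction of \<open>c = act g (bas w')\<close>, so its boundary
  is \<open>c - contract (bar_d c)\<close>. By induction \<open>bar_d c\<close> is a cycle, hence
  the boundary of its contraction, and applying \<open>bar_d\<close> once more gives
  \<open>bar_d c - bar_d c\<close>.\<close>

lemma bar_d_in_ker:
  assumes "b \<in> Free (words G (Suc k))"
  shows "bar_d b \<in> bar_ker k"
  using assms
proof (induction k arbitrary: b)
  case 0
  have F: "bar_d b \<in> Free (words G 0)" using hmD(1)[OF hm_bar_d 0] .
  have "aug (bar_d b) = (\<Sum>p\<in>supp b. b (fst p) (snd p) * aug (bd (fst p)))"
    by (rule aug_ext[OF 0 bd_Free])
  also have "\<dots> = 0"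
  proof (rule sum.neutral, rule ballI)
    fix p assume "p \<in> supp b"
    then have "fst p \<in> words G (Suc 0)" using FreeD(5)[OF 0] by auto
    then obtain g where g: "fst p = [g]" "g \<in> carrier G" by (auto simp: words_def length_Suc_conv)
    let ?o = "bas ([] :: 'g list)"
    have o: "?o \<in> Free UNIV" by (rule bas_Free) simp
    have "aug (act g ?o + - ?o) = aug (act g ?o) + aug (- ?o)"
      using g o by (intro aug_add[of _ UNIV] act_Free submod_uminus[OF submod_Free])
    then have "aug (bd [g]) = 0"
      using aug_act[OF o g(2)] aug_uminus[OF o] by (simp add: bd_def sgn_if_def)
    then show "b (fst p) (snd p) * aug (bd (fst p)) = 0" using g by simp
  qed
  finally show ?case using F by (simp add: bar_ker_def)
next
  case (Suc k)
  have F: "bar_d b \<in> Free (words G (Suc k))" using hmD(1)[OF hm_bar_d Suc.prems] .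
  have gen: "bar_d (bd w) = 0" if w: "w \<in> words G (Suc (Suc k))" for w
  proof -
    obtain g w' where gw: "w = g # w'" "g \<in> carrier G" "w' \<in> words G (Suc k)"
      using w by (cases w) (auto simp: words_simps)
    define c where "c = act g (bas w')"
    have c: "c \<in> Free (words G (Suc k))" using gw by (auto simp: c_def intro: act_Free bas_Free)
    have "bd w = bar_d (contract c)"
      using ext_bas[of bd w, OF bd_Free[OF w]] gw by (simp add: c_def contract_act_bas)
    then have bdw: "bd w = c - contract (bar_d c)" using contract_homotopy[OF c] by (simp add: algebra_simps)
    have "bar_d (c - contract (bar_d c)) = bar_d c - bar_d (contract (bar_d c))"
      using c hmD(1)[OF hm_bar_d c] by (intro hm_diff[OF hm_bar_d submod_Free submod_Free] contract_Free)
    then show ?thesis using bar_ker_exact(2)[OF Suc.IH[OF c]] bdw by simp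
  qed
  have "bar_d (bar_d b) = ext (\<lambda>w. bar_d (bd w)) b"
    by (rule hm_of_ext[OF hm_bar_d submod_Free bd_Free Suc.prems])
  also have "\<dots> = ext (\<lambda>w. 0) b" by (rule ext_cong[OF Suc.prems gen])
  also have "\<dots> = 0" by (simp add: ext_def)
  finally show ?case using F by (simp add: bar_ker_def)
qed

lemma ext_bar_d:
  assumes N: "submod N" and c: "\<And>w. w \<in> words G k \<Longrightarrow> c w \<in> N" and b: "b \<in> Free (words G (Suc k))"
  shows "ext (\<lambda>w. ext c (bd w)) b = ext c (bar_d b)"
  using ext_ext[of b "words G (Suc k)" bd "words G k" c N] assms bd_Free by simp

end

section \<open>Cycles in a projective resolution\<close>

text \<open>\<open>H\<^sup>k\<^sup>+\<^sup>1(G; RG\<^sup>n) = 0\<close> for all \<open>n\<close>; mind the shift of \<open>k\<close>.\<close>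

definition (in group_coeff) vanishing :: "nat \<Rightarrow> bool" where
  "vanishing k \<longleftrightarrow> (\<forall>(n :: nat) f. (\<forall>w\<in>words G (Suc k). f w \<in> Free {..<n}) \<longrightarrow>
     (\<forall>w\<in>words G (Suc (Suc k)). ext f (bd w) = 0) \<longrightarrow>
     (\<exists>c. (\<forall>w\<in>words G k. c w \<in> Free {..<n}) \<and> (\<forall>w\<in>words G (Suc k). f w = ext c (bd w))))"

locale projective_resolution = group_coeff G Rs e
  for G :: "('g, 'y) monoid_scheme" (structure) and Rs :: "'u::ring set" and e :: 'u +
  fixes P :: "nat \<Rightarrow> (nat \<Rightarrow> 'g \<Rightarrow> 'u) set" and m :: "nat \<Rightarrow> nat"
    and s :: "nat \<Rightarrow> nat \<Rightarrow> nat \<Rightarrow> 'g \<Rightarrow> 'u"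
    and d :: "nat \<Rightarrow> (nat \<Rightarrow> 'g \<Rightarrow> 'u) \<Rightarrow> (nat \<Rightarrow> 'g \<Rightarrow> 'u)"
    and ep :: "(nat \<Rightarrow> 'g \<Rightarrow> 'u) \<Rightarrow> 'u" and len :: nat
  assumes P_proj: "proj {..<m k} (s k) (P k)"
    and d_hm: "hm (P (Suc k)) (d k) (P k)"
    and ep_in: "p \<in> P 0 \<Longrightarrow> ep p \<in> Rs"
    and ep_add: "p \<in> P 0 \<Longrightarrow> q \<in> P 0 \<Longrightarrow> ep (p + q) = ep p + ep q"
    and ep_sc: "r \<in> Rs \<Longrightarrow> p \<in> P 0 \<Longrightarrow> ep (sc r p) = r * ep p"
    and ep_act: "g \<in> carrier G \<Longrightarrow> p \<in> P 0 \<Longrightarrow> ep (act g p) = ep p"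
    and ep_onto: "\<exists>p\<in>P 0. ep p = e"
    and exact_0: "p \<in> P 0 \<Longrightarrow> ep p = 0 \<longleftrightarrow> p \<in> d 0 ` P 1"
    and exact_Suc: "p \<in> P (Suc k) \<Longrightarrow> d k p = 0 \<longleftrightarrow> p \<in> d (Suc k) ` P (Suc (Suc k))"
    and P_length: "len < k \<Longrightarrow> P k = {0}"
begin

lemma P_submod: "submod (P k)"
  using projD(1)[OF P_proj] .

lemma P_Free: "p \<in> P k \<Longrightarrow> p \<in> Free {..<m k}"
  using projD(2)[OF P_proj] by blast

lemma P_hm_ext:
  assumes "submod N" "\<And>j. j < m k \<Longrightarrow> n j \<in> N"
  shows "hm (P k) (ext n) N"
  by (rule hm_mono[OF hm_ext[OF assms(1), of "{..<m k}" n]])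
    (use assms P_Free in \<open>auto intro: ext_closed[of N "{..<m k}"]\<close>)

definition pker :: "nat \<Rightarrow> (nat \<Rightarrow> 'g \<Rightarrow> 'u) set" where
  "pker k = {p \<in> P k. if k = 0 then ep p = 0 else d (k - 1) p = 0}"

lemma pker_P: "p \<in> pker k \<Longrightarrow> p \<in> P k"
  by (simp add: pker_def)

lemma pker_exact: "p \<in> pker k \<Longrightarrow> \<exists>q\<in>P (Suc k). d k q = p"
  using exact_0[of p] exact_Suc[of p "k - 1"] by (cases k) (auto simp: pker_def)

lemma d_in_pker: "q \<in> P (Suc k) \<Longrightarrow> d k q \<in> pker k"
  using exact_0[of "d k q"] exact_Suc[of "d k q" "k - 1"] hmD(1)[OF d_hm, of q k]
  by (cases k) (auto simp: pker_def)

lemma pker_Suc: "p \<in> pker (Suc k) \<longleftrightarrow> p \<in> P (Suc k) \<and> d k p = 0"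
  by (simp add: pker_def)

lemma pker_submod: "submod (pker k)"
proof (cases k)
  case 0
  have "ep 0 = 0" using ep_sc[of 0 0] submodD(2)[OF P_submod] by simp
  then show ?thesis
    unfolding submod_def 0 pker_def using submodD[OF P_submod[of 0]]
    by (auto simp: ep_add ep_sc ep_act)
next
  case (Suc k')
  show ?thesis
    unfolding submod_def Suc pker_def using submodD[OF P_submod[of "Suc k'"]] hmD[OF d_hm[of k']]
      hm_zero[OF d_hm P_submod]
    by auto
qed

text \<open>Homomorphisms to the trivial module, whose elements are plain scalars and not
  coefficient functions, so that \<open>hm\<close> does not apply to them.\<close>

definition trivial_valued :: "('j \<Rightarrow> 'g \<Rightarrow> 'u) set \<Rightarrow> (('j \<Rightarrow> 'g \<Rightarrow> 'u) \<Rightarrow> 'u) \<Rightarrow> bool" where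
  "trivial_valued M \<tau> \<longleftrightarrow> \<tau> 0 = 0 \<and> (\<forall>x\<in>M. \<forall>y\<in>M. \<tau> (x + y) = \<tau> x + \<tau> y) \<and>
     (\<forall>r\<in>Rs. \<forall>x\<in>M. \<tau> (sc r x) = r * \<tau> x) \<and> (\<forall>g\<in>carrier G. \<forall>x\<in>M. \<tau> (act g x) = \<tau> x)"

lemma trivial_valued_ep: "trivial_valued (P 0) ep"
proof -
  have "ep 0 = 0" using ep_sc[of 0 0] submodD(2)[OF P_submod] by simp
  then show ?thesis by (simp add: trivial_valued_def ep_add ep_sc ep_act)
qed

lemma trivial_valued_aug: "trivial_valued (Free J) aug"
  by (simp add: trivial_valued_def aug_add aug_sc aug_act)

lemma trivial_valued_ext:
  assumes \<tau>: "trivial_valued M \<tau>" and M: "submod M" and n: "\<And>j. j \<in> J \<Longrightarrow> n j \<in> M" and b: "b \<in> Free J"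
  shows "\<tau> (ext n b) = (\<Sum>p\<in>supp b. b (fst p) (snd p) * \<tau> (n (fst p)))"
proof -
  let ?h = "\<lambda>p. sc (b (fst p) (snd p)) (act (snd p) (n (fst p)))"
  have mem: "b (fst p) (snd p) \<in> Rs \<and> snd p \<in> carrier G \<and> n (fst p) \<in> M" if "p \<in> supp b" for p
    using that FreeD[OF b] n by auto
  have "\<tau> (sum ?h A) = (\<Sum>p\<in>A. b (fst p) (snd p) * \<tau> (n (fst p)))" if "finite A" "A \<subseteq> supp b" for A
    using that
  proof (induct A)
    case empty
    show "\<tau> (sum ?h {}) = (\<Sum>p\<in>{}. b (fst p) (snd p) * \<tau> (n (fst p)))"
      using \<tau> by (simp add: trivial_valued_def)
  next
    case (insert q F)
    have "?h p \<in> M" if "p \<in> supp b" for p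
      using mem[OF that] by (intro submodD(4,5)[OF M]) auto
    then have "sum ?h F \<in> M" "?h q \<in> M" using insert by (auto intro!: submod_sum[OF M])
    then have "\<tau> (?h q + sum ?h F) = \<tau> (?h q) + \<tau> (sum ?h F)"
      using \<tau> by (simp add: trivial_valued_def)
    moreover have "\<tau> (?h q) = b (fst q) (snd q) * \<tau> (n (fst q))"
      using \<tau> mem insert submodD(5)[OF M] by (simp add: trivial_valued_def)
    ultimately show "\<tau> (sum ?h (insert q F)) = (\<Sum>p\<in>insert q F. b (fst p) (snd p) * \<tau> (n (fst p)))"
      using insert by simp
  qed
  from this[OF FreeD(2)[OF b] subset_refl] show ?thesis by (simp add: ext_def)
qed

text \<open>Degree \<open>k\<close> of chain maps \<open>U\<close> to and \<open>V\<close> from the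
  bar resolution, and of a homotopy between \<open>V U\<close> and the identity; on cycles the term
  with \<open>h d\<close> vanishes. That cycles are mapped to cycles replaces compatibility with the
  lower degrees and is enough to continue upwards.\<close>

definition comparison :: "nat \<Rightarrow> ((nat \<Rightarrow> 'g \<Rightarrow> 'u) \<Rightarrow> 'g list \<Rightarrow> 'g \<Rightarrow> 'u) \<Rightarrow>
    (('g list \<Rightarrow> 'g \<Rightarrow> 'u) \<Rightarrow> nat \<Rightarrow> 'g \<Rightarrow> 'u) \<Rightarrow> ((nat \<Rightarrow> 'g \<Rightarrow> 'u) \<Rightarrow> nat \<Rightarrow> 'g \<Rightarrow> 'u) \<Rightarrow> bool" where
  "comparison k U V h \<longleftrightarrow> hm (P k) U (Free (words G k)) \<and> hm (Free (words G k)) V (P k) \<and>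
     hm (P k) h (P (Suc k)) \<and> (\<forall>p\<in>pker k. U p \<in> bar_ker k) \<and> (\<forall>b\<in>bar_ker k. V b \<in> pker k) \<and>
     (\<forall>p\<in>pker k. p - V (U p) = d k (h p))"

lemma nil_word: "[] \<in> words G 0"
  by (simp add: words_def)

lemma ep_diff: "p \<in> P 0 \<Longrightarrow> q \<in> P 0 \<Longrightarrow> ep (p - q) = ep p - ep q"
  using ep_add[of "p - q" q] submod_diff[OF P_submod, of p 0 q] by simp

lemma comparison_maps_0:
  obtains U V where "hm (P 0) U (Free (words G 0))" "hm (Free (words G 0)) V (P 0)"
    "\<And>p. p \<in> P 0 \<Longrightarrow> aug (U p) = ep p" "\<And>b. b \<in> Free (words G 0) \<Longrightarrow> ep (V b) = aug b"
proof -
  obtain p0 where p0: "p0 \<in> P 0" "ep p0 = e" using ep_onto by blast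
  \<comment> \<open>The augmentation of \<open>P 0\<close> is determined by its values at
    \<open>s 0 j\<close>; the corresponding multiples of the single basis element \<open>[]\<close>
    have the same augmentation. Conversely \<open>V\<close> sends \<open>[]\<close> to an element of
    augmentation \<open>e\<close>.\<close>
  define U where "U = ext (\<lambda>j. sc (ep (s 0 j)) (bas ([] :: 'g list)))"
  define V where "V = ext (\<lambda>_ :: 'g list. p0)"
  have s: "s 0 j \<in> P 0" if "j < m 0" for j using projD(3)[OF P_proj] that by simp
  have n: "sc (ep (s 0 j)) (bas []) \<in> Free (words G 0)" if "j < m 0" for j
    using ep_in[OF s[OF that]] nil_word by (intro sc_Free bas_Free)
  have U: "hm (P 0) U (Free (words G 0))"
    unfolding U_def by (rule P_hm_ext[OF submod_Free n])
  have V: "hm (Free (words G 0)) V (P 0)"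
    unfolding V_def by (rule hm_ext[OF P_submod p0(1)])
  have "aug (U p) = ep p" if p: "p \<in> P 0" for p
  proof -
    have "aug (U p) = (\<Sum>q\<in>supp p. p (fst q) (snd q) * aug (sc (ep (s 0 (fst q))) (bas ([] :: 'g list))))"
      unfolding U_def by (rule trivial_valued_ext[OF trivial_valued_aug submod_Free n P_Free[OF p]]) auto
    also have "\<dots> = (\<Sum>q\<in>supp p. p (fst q) (snd q) * ep (s 0 (fst q)))"
    proof (rule sum.cong)
      fix q assume "q \<in> supp p"
      then have "fst q < m 0" using FreeD(5)[OF P_Free[OF p]] by auto
      then have "aug (sc (ep (s 0 (fst q))) (bas ([] :: 'g list))) = ep (s 0 (fst q))"
        using aug_sc[OF bas_Free[OF nil_word]] ep_in[OF s] by (simp add: aug_bas)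
      then show "p (fst q) (snd q) * aug (sc (ep (s 0 (fst q))) (bas ([] :: 'g list))) =
          p (fst q) (snd q) * ep (s 0 (fst q))" by simp
    qed simp
    also have "\<dots> = ep (ext (s 0) p)"
      by (rule trivial_valued_ext[OF trivial_valued_ep P_submod s P_Free[OF p], symmetric]) auto
    finally show ?thesis using projD(4)[OF P_proj p] by simp
  qed
  moreover have "ep (V b) = aug b" if b: "b \<in> Free (words G 0)" for b
  proof -
    have "ep (V b) = (\<Sum>q\<in>supp b. b (fst q) (snd q) * ep p0)"
      unfolding V_def by (rule trivial_valued_ext[OF trivial_valued_ep P_submod p0(1) b])
    also have "\<dots> = aug b" unfolding aug_def by (rule sum.cong) (use FreeD(1)[OF b] p0 in auto)
    finally show ?thesis .
  qed
  ultimately show thesis using that U V by blast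
qed

lemma homotopy_lift:
  assumes f: "hm (P k) f (P k)" and ker: "\<And>p. p \<in> P k \<Longrightarrow> f p \<in> pker k"
  shows "\<exists>h. hm (P k) h (P (Suc k)) \<and> (\<forall>p\<in>P k. d k (h p) = f p)"
proof -
  have "\<forall>j. \<exists>q. j < m k \<longrightarrow> q \<in> P (Suc k) \<and> d k q = f (s k j)"
    using pker_exact[OF ker] projD(3)[OF P_proj[of k]] by blast
  then obtain n where n: "\<And>j. j < m k \<Longrightarrow> n j \<in> P (Suc k) \<and> d k (n j) = f (s k j)" by metis
  have "hm (P k) (ext n) (P (Suc k))" "\<forall>p\<in>P k. d k (ext n p) = f p"
    using proj_lift[OF P_proj f P_submod d_hm] n by auto
  then show ?thesis by blast
qed

lemma comparison_0: "\<exists>U V h. comparison 0 U V h"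
proof -
  obtain U V where U: "hm (P 0) U (Free (words G 0))" and V: "hm (Free (words G 0)) V (P 0)"
    and aU: "\<And>p. p \<in> P 0 \<Longrightarrow> aug (U p) = ep p" and eV: "\<And>b. b \<in> Free (words G 0) \<Longrightarrow> ep (V b) = aug b"
    using comparison_maps_0 by metis
  have VU: "V (U p) \<in> P 0" if "p \<in> P 0" for p using hmD(1)[OF V hmD(1)[OF U that]] .
  obtain h where h: "hm (P 0) h (P (Suc 0))" "\<forall>p\<in>P 0. d 0 (h p) = p - V (U p)"
  proof -
    have "hm (P 0) (\<lambda>p. p - V (U p)) (P 0)" by (rule hm_minus[OF hm_id hm_comp[OF U V] P_submod])
    moreover have "p - V (U p) \<in> pker 0" if "p \<in> P 0" for p
      using that VU hmD(1)[OF U] aU eV by (simp add: pker_def ep_diff submod_diff[OF P_submod])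
    ultimately show thesis using that homotopy_lift[of 0 "\<lambda>p. p - V (U p)"] by blast
  qed
  have "comparison 0 U V h"
    unfolding comparison_def using U V h aU eV hmD(1)[OF U] hmD(1)[OF V]
    by (simp add: pker_def bar_ker_def)
  then show ?thesis by blast
qed

lemma comparison_Suc:
  assumes "comparison k U V h"
  shows "\<exists>U' V' h'. comparison (Suc k) U' V' h'"
proof -
  have U: "hm (P k) U (Free (words G k))" and V: "hm (Free (words G k)) V (P k)" and h: "hm (P k) h (P (Suc k))"
    and Uk: "\<And>p. p \<in> pker k \<Longrightarrow> U p \<in> bar_ker k" and Vk: "\<And>b. b \<in> bar_ker k \<Longrightarrow> V b \<in> pker k"
    and hk: "\<And>p. p \<in> pker k \<Longrightarrow> p - V (U p) = d k (h p)"
    using assms by (auto simp: comparison_def)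
  have dk: "d k p \<in> P k" if "p \<in> P (Suc k)" for p using hmD(1)[OF d_hm that] .
  obtain U' where U': "hm (P (Suc k)) U' (Free (words G (Suc k)))"
    "\<And>p. p \<in> P (Suc k) \<Longrightarrow> bar_d (U' p) = U (d k p)"
  proof -
    \<comment> \<open>The contraction is applied to the images of the generators only; extending by
      \<open>ext\<close> restores equivariance.\<close>
    let ?n = "\<lambda>j. contract (U (d k (s (Suc k) j)))"
    have n: "?n j \<in> Free (words G (Suc k)) \<and> bar_d (?n j) = U (d k (s (Suc k) j))" if "j \<in> {..<m (Suc k)}" for j
      using bar_ker_exact[OF Uk[OF d_in_pker[OF projD(3)[OF P_proj that]]]] by blast
    have f: "hm (P (Suc k)) (\<lambda>p. U (d k p)) (Free (words G k))" by (rule hm_comp[OF d_hm U])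
    note lift = proj_lift[OF P_proj f submod_Free hm_bar_d, where n = ?n]
    have "hm (P (Suc k)) (ext ?n) (Free (words G (Suc k)))" using n by (intro lift(1))
    moreover have "bar_d (ext ?n p) = U (d k p)" if "p \<in> P (Suc k)" for p
      using n that by (intro lift(2))
    ultimately show thesis by (rule that)
  qed
  have Vbd: "V (bd w) \<in> pker k" if "w \<in> words G (Suc k)" for w
    using Vk[OF bar_d_in_ker[OF bas_Free[OF that]]] ext_bas[of bd w, OF bd_Free[OF that]] by simp
  obtain V' where V': "hm (Free (words G (Suc k))) V' (P (Suc k))"
    "\<And>b. b \<in> Free (words G (Suc k)) \<Longrightarrow> d k (V' b) = V (bar_d b)"
  proof -
    have "\<forall>w. \<exists>q. w \<in> words G (Suc k) \<longrightarrow> q \<in> P (Suc k) \<and> d k q = V (bar_d (bas w))"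
      using pker_exact[OF Vbd] ext_bas[of bd, OF bd_Free] by metis
    then obtain n where n: "\<And>w. w \<in> words G (Suc k) \<Longrightarrow> n w \<in> P (Suc k) \<and> d k (n w) = V (bar_d (bas w))"
      by metis
    have f: "hm (Free (words G (Suc k))) (\<lambda>b. V (bar_d b)) (P k)" by (rule hm_comp[OF hm_bar_d V])
    note lift = proj_lift[OF proj_Free f P_submod d_hm, where n = n]
    have "hm (Free (words G (Suc k))) (ext n) (P (Suc k))" using n by (intro lift(1))
    moreover have "d k (ext n b) = V (bar_d b)" if "b \<in> Free (words G (Suc k))" for b
      using n that by (intro lift(2))
    ultimately show thesis by (rule that)
  qed
  have mem: "V' (U' p) \<in> P (Suc k)" "h (d k p) \<in> P (Suc k)" if "p \<in> P (Suc k)" for p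
    using hmD(1)[OF V' (1) hmD(1)[OF U'(1) that]] hmD(1)[OF h dk[OF that]] .
  obtain h' where h': "hm (P (Suc k)) h' (P (Suc (Suc k)))"
    "\<forall>p\<in>P (Suc k). d (Suc k) (h' p) = p - V' (U' p) - h (d k p)"
  proof -
    have "hm (P (Suc k)) (\<lambda>p. V' (U' p)) (P (Suc k))" "hm (P (Suc k)) (\<lambda>p. h (d k p)) (P (Suc k))"
      by (rule hm_comp[OF U'(1) V'(1)], rule hm_comp[OF d_hm h])
    then have f: "hm (P (Suc k)) (\<lambda>p. p - V' (U' p) - h (d k p)) (P (Suc k))"
      by (simp add: hm_minus hm_id P_submod)
    \<comment> \<open>The obstruction to the next stage of the homotopy is a cycle since
      \<open>h\<close> already works for the cycle \<open>d k p\<close>; exactness of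
      \<open>P\<close> then provides the lift.\<close>
    have ker: "p - V' (U' p) - h (d k p) \<in> pker (Suc k)" if p: "p \<in> P (Suc k)" for p
    proof -
      have 1: "d k (p - V' (U' p) - h (d k p)) = d k p - d k (V' (U' p)) - d k (h (d k p))"
        using mem[OF p] p hm_diff[OF d_hm P_submod P_submod] submod_diff[OF P_submod] by simp
      have 2: "d k (V' (U' p)) = V (U (d k p))"
        using V'(2)[OF hmD(1)[OF U'(1) p]] U'(2)[OF p] by simp
      have 3: "d k (h (d k p)) = d k p - V (U (d k p))" using hk[OF d_in_pker[OF p]] by simp
      have "d k (p - V' (U' p) - h (d k p)) = 0" unfolding 1 2 3 by simp
      then show ?thesis using hmD(1)[OF f p] by (simp add: pker_Suc)
    qed
    show thesis using homotopy_lift[OF f ker] that by blast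
  qed
  have "comparison (Suc k) U' V' h'"
    unfolding comparison_def
  proof (intro conjI ballI)
    fix p assume p: "p \<in> pker (Suc k)"
    then have pP: "p \<in> P (Suc k)" "d k p = 0" by (auto simp: pker_Suc)
    show "U' p \<in> bar_ker (Suc k)"
      using hmD(1)[OF U'(1) pP(1)] U'(2)[OF pP(1)] pP(2) hm_zero[OF U P_submod] by (simp add: bar_ker_def)
    show "p - V' (U' p) = d (Suc k) (h' p)" using h'(2) pP hm_zero[OF h P_submod] by simp
  next
    fix b assume "b \<in> bar_ker (Suc k)"
    then have "b \<in> Free (words G (Suc k))" "bar_d b = 0" by (auto simp: bar_ker_def)
    then show "V' b \<in> pker (Suc k)"
      using V'(2)[of b] hmD(1)[OF V'(1), of b] hm_zero[OF V submod_Free] by (simp add: pker_Suc)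
  qed (use U' V' h' in auto)
  then show ?thesis by blast
qed

lemma comparison_ex: "\<exists>U V h. comparison k U V h"
proof (induction k)
  case 0
  show ?case by (rule comparison_0)
next
  case (Suc k)
  then show ?case using comparison_Suc by blast
qed

text \<open>The connecting map from homomorphisms on cycles of degree \<open>k\<close> to cohomology
  in degree \<open>k + 1\<close>, on the level of bar cochains: \<open>V\<close> maps boundaries to
  cycles, where \<open>\<phi>\<close> is defined.\<close>

lemma cocycle_of_hom:
  assumes V: "hm (Free (words G k)) V (P k)" and Vk: "\<forall>b\<in>bar_ker k. V b \<in> pker k"
    and \<phi>: "hm (pker k) \<phi> (Free {..<n :: nat})"
  defines "f \<equiv> \<lambda>w. \<phi> (V (bd w))"
  shows "w \<in> words G (Suc k) \<Longrightarrow> f w \<in> Free {..<n}"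
    and "w \<in> words G (Suc (Suc k)) \<Longrightarrow> ext f (bd w) = 0"
    and "b \<in> Free (words G (Suc k)) \<Longrightarrow> \<phi> (V (bar_d b)) = ext f b"
proof -
  have Vd: "hm (Free (words G (Suc k))) (\<lambda>b. V (bar_d b)) (pker k)"
    by (rule hm_mono[OF hm_comp[OF hm_bar_d V]]) (use Vk bar_d_in_ker in auto)
  have F: "hm (Free (words G (Suc k))) (\<lambda>b. \<phi> (V (bar_d b))) (Free {..<n})"
    by (rule hm_comp[OF Vd \<phi>])
  have f: "f w = \<phi> (V (bar_d (bas w)))" if "w \<in> words G (Suc k)" for w
    using ext_bas[of bd w, OF bd_Free[OF that]] by (simp add: f_def)
  show 1: "f w \<in> Free {..<n}" if "w \<in> words G (Suc k)" for w
    using hmD(1)[OF F bas_Free[OF that]] f[OF that] by simp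
  show 2: "\<phi> (V (bar_d b)) = ext f b" if b: "b \<in> Free (words G (Suc k))" for b
    using proj_hm_eq_ext[OF proj_Free F b] ext_cong[OF b, of f "\<lambda>w. \<phi> (V (bar_d (bas w)))"] f by simp
  show "ext f (bd w) = 0" if w: "w \<in> words G (Suc (Suc k))" for w
  proof -
    have "bar_d (bas w) \<in> bar_ker (Suc k)" by (rule bar_d_in_ker[OF bas_Free[OF w]])
    then have "bar_d (bd w) = 0" using ext_bas[of bd w, OF bd_Free[OF w]] by (simp add: bar_ker_def)
    then show ?thesis
      using 2[OF bd_Free[OF w]] hm_zero[OF V submod_Free] hm_zero[OF \<phi> pker_submod] by simp
  qed
qed

text \<open>The cocycle of \<open>\<phi>\<close> is the coboundary of some \<open>c\<close>, so
  \<open>\<phi> (V b) = ext c b\<close> for cycles \<open>b\<close> of the bar resolution. A cycle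
  \<open>p\<close> is \<open>V (U p) + d k (h p)\<close>, whence
  \<open>\<phi> p = ext c (U p) + \<phi> (d k (h p))\<close>, and the right-hand side makes sense on
  all of \<open>P k\<close>.\<close>

lemma extend_hom:
  assumes van: "vanishing k" and \<phi>: "hm (pker k) \<phi> (Free {..<n :: nat})"
  shows "\<exists>\<Phi>. hm (P k) \<Phi> (Free {..<n}) \<and> (\<forall>p\<in>pker k. \<Phi> p = \<phi> p)"
proof -
  obtain U V h where cmp: "comparison k U V h" using comparison_ex by blast
  have U: "hm (P k) U (Free (words G k))" and V: "hm (Free (words G k)) V (P k)" and h: "hm (P k) h (P (Suc k))"
    and Uk: "\<And>p. p \<in> pker k \<Longrightarrow> U p \<in> bar_ker k" and Vk: "\<And>b. b \<in> bar_ker k \<Longrightarrow> V b \<in> pker k"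
    and hk: "\<And>p. p \<in> pker k \<Longrightarrow> p - V (U p) = d k (h p)"
    using cmp by (auto simp: comparison_def)
  define f where "f = (\<lambda>w. \<phi> (V (bd w)))"
  have "\<forall>b\<in>bar_ker k. V b \<in> pker k" using Vk by blast
  note coc = cocycle_of_hom[OF V this \<phi>, folded f_def]
  obtain c where c: "\<And>w. w \<in> words G k \<Longrightarrow> c w \<in> Free {..<n}"
    "\<And>w. w \<in> words G (Suc k) \<Longrightarrow> f w = ext c (bd w)"
  proof -
    have "\<exists>c. (\<forall>w\<in>words G k. c w \<in> Free {..<n}) \<and> (\<forall>w\<in>words G (Suc k). f w = ext c (bd w))"
      by (rule van[unfolded vanishing_def, rule_format]) (use coc(1,2) in \<open>auto simp: f_def\<close>)
    then show thesis using that by blast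
  qed
  define \<Phi> where "\<Phi> = (\<lambda>p. ext c (U p) + \<phi> (d k (h p)))"
  have "hm (P k) (\<lambda>p. d k (h p)) (pker k)"
    by (rule hm_mono[OF hm_comp[OF h d_hm]]) (auto intro: d_in_pker hmD(1)[OF h])
  then have 1: "hm (P k) (\<lambda>p. \<phi> (d k (h p))) (Free {..<n})" by (rule hm_comp[OF _ \<phi>])
  have "hm (Free (words G k)) (ext c) (Free {..<n})" by (rule hm_ext[OF submod_Free c(1)])
  then have "hm (P k) (\<lambda>p. ext c (U p)) (Free {..<n})" by (rule hm_comp[OF U])
  then have "hm (P k) \<Phi> (Free {..<n})"
    unfolding \<Phi>_def using 1 by (rule hm_add[OF _ _ submod_Free])
  moreover have "\<Phi> p = \<phi> p" if p: "p \<in> pker k" for p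
  proof -
    let ?b = "contract (U p)"
    have b: "?b \<in> Free (words G (Suc k))" "bar_d ?b = U p" using bar_ker_exact[OF Uk[OF p]] .
    have "\<phi> (V (U p)) = ext f ?b" using coc(3)[OF b(1)] b(2) by simp
    also have "\<dots> = ext (\<lambda>w. ext c (bd w)) ?b" by (rule ext_cong[OF b(1) c(2)])
    also have "\<dots> = ext c (U p)"
      using ext_bar_d[OF submod_Free c(1) b(1)] b(2) by simp
    finally have 1: "\<phi> (V (U p)) = ext c (U p)" .
    have 2: "d k (h p) \<in> pker k" using d_in_pker[OF hmD(1)[OF h pker_P[OF p]]] .
    have 3: "V (U p) \<in> pker k" using Vk[OF Uk[OF p]] .
    have "\<phi> (V (U p) + d k (h p)) = \<phi> (V (U p)) + \<phi> (d k (h p))" using hmD(2)[OF \<phi> 3 2] .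
    moreover have "V (U p) + d k (h p) = p" using hk[OF p] by (simp add: algebra_simps)
    ultimately show ?thesis using 1 by (simp add: \<Phi>_def)
  qed
  ultimately show ?thesis by blast
qed

text \<open>The cycles of degree \<open>k\<close> as a retract of a free module of rank
  \<open>n\<close>. In contrast to \<open>proj\<close>, the coordinates \<open>z\<close> are not
  those of the ambient module; comparing their sizes is the isoperimetric problem.\<close>

definition dual_basis :: "nat \<Rightarrow> nat \<Rightarrow> (nat \<Rightarrow> nat \<Rightarrow> 'g \<Rightarrow> 'u) \<Rightarrow> ((nat \<Rightarrow> 'g \<Rightarrow> 'u) \<Rightarrow> nat \<Rightarrow> 'g \<Rightarrow> 'u) \<Rightarrow> bool" where
  "dual_basis k n t z \<longleftrightarrow> (\<forall>i<n. t i \<in> pker k) \<and> hm (pker k) z (Free {..<n}) \<and> (\<forall>p\<in>pker k. ext t (z p) = p)"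

text \<open>Once \<open>z\<close> extends to \<open>P (Suc k)\<close>, the map \<open>ext t\<close>
  after the extension retracts \<open>P (Suc k)\<close> onto its cycles. The complementary
  projection \<open>q\<close> vanishes on the kernel of \<open>d k\<close> and so induces a section
  of \<open>d k\<close> over \<open>pker k\<close>, which becomes a retract of
  \<open>P (Suc k)\<close>.\<close>

lemma dual_basis_descend:
  assumes van: "vanishing (Suc k)" and db: "dual_basis (Suc k) n t z"
  shows "\<exists>n t z. dual_basis k n t z"
proof -
  have t: "\<And>i. i \<in> {..<n} \<Longrightarrow> t i \<in> pker (Suc k)" and z: "hm (pker (Suc k)) z (Free {..<n})"
    and tz: "\<And>p. p \<in> pker (Suc k) \<Longrightarrow> ext t (z p) = p"
    using db by (auto simp: dual_basis_def)
  obtain Z where Z: "hm (P (Suc k)) Z (Free {..<n})" "\<And>p. p \<in> pker (Suc k) \<Longrightarrow> Z p = z p"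
    using extend_hom[OF van z] by blast
  define q where "q = (\<lambda>p. p - ext t (Z p))"
  have tZ: "hm (P (Suc k)) (\<lambda>p. ext t (Z p)) (pker (Suc k))"
    by (rule hm_comp[OF Z(1) hm_ext[OF pker_submod t]])
  have q: "hm (P (Suc k)) q (P (Suc k))"
  proof -
    have "hm (P (Suc k)) (\<lambda>p. ext t (Z p)) (P (Suc k))"
      by (rule hm_mono[OF tZ subset_refl]) (rule pker_P[OF hmD(1)[OF tZ]])
    then show ?thesis unfolding q_def by (rule hm_minus[OF hm_id _ P_submod])
  qed
  have q0: "q p = 0" if "p \<in> pker (Suc k)" for p
    using Z(2)[OF that] tz[OF that] by (simp add: q_def)
  have dq: "d k (q p) = d k p" if p: "p \<in> P (Suc k)" for p
  proof -
    have tp: "ext t (Z p) \<in> pker (Suc k)" using hmD(1)[OF tZ p] .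
    then have "d k (p - ext t (Z p)) = d k p - d k (ext t (Z p))"
      using hm_diff[OF d_hm P_submod P_submod p pker_P] by simp
    then show ?thesis using tp by (simp add: q_def pker_Suc)
  qed
  have q_eq: "q p = q p'" if p: "p \<in> P (Suc k)" "p' \<in> P (Suc k)" "d k p = d k p'" for p p'
  proof -
    have "p - p' \<in> pker (Suc k)"
      using p hm_diff[OF d_hm P_submod P_submod p(1,2)] submod_diff[OF P_submod p(1,2)] by (simp add: pker_Suc)
    then show ?thesis using q0[of "p - p'"] hm_diff[OF q P_submod P_submod p(1,2)] by simp
  qed
  have "\<forall>y. \<exists>p. y \<in> pker k \<longrightarrow> p \<in> P (Suc k) \<and> d k p = y" using pker_exact by blast
  then obtain \<sigma> where \<sigma>: "\<And>y. y \<in> pker k \<Longrightarrow> \<sigma> y \<in> P (Suc k) \<and> d k (\<sigma> y) = y" by metis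
  \<comment> \<open>The preimages \<open>\<sigma> y\<close> are arbitrary and
    \<open>\<sigma>\<close> is not additive. Two preimages differ by a cycle, on which
    \<open>q\<close> vanishes, so \<open>z'\<close> is a homomorphism.\<close>
  define z' where "z' = (\<lambda>y. q (\<sigma> y))"
  have z'_d: "z' (d k p) = q p" if "p \<in> P (Suc k)" for p
    unfolding z'_def using \<sigma>[OF d_in_pker[OF that]] that by (intro q_eq) auto
  have z'P: "hm (pker k) z' (P (Suc k))"
    unfolding hm_def
  proof (intro conjI ballI)
    fix x assume x: "x \<in> pker k"
    show "z' x \<in> P (Suc k)" unfolding z'_def using hmD(1)[OF q] \<sigma>[OF x] by simp
    show "z' (x + y) = z' x + z' y" if y: "y \<in> pker k" for y
      using z'_d[of "\<sigma> x + \<sigma> y"] \<sigma>[OF x] \<sigma>[OF y] hmD(2)[OF d_hm, of "\<sigma> x" k "\<sigma> y"] hmD(2)[OF q, of "\<sigma> x" "\<sigma> y"]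
        submodD(3)[OF P_submod] by (simp add: z'_def)
    show "z' (sc r x) = sc r (z' x)" if "r \<in> Rs" for r
      using z'_d[of "sc r (\<sigma> x)"] \<sigma>[OF x] hmD(3)[OF d_hm that, of "\<sigma> x" k] hmD(3)[OF q that, of "\<sigma> x"]
        submodD(4)[OF P_submod that] by (simp add: z'_def)
    show "z' (act g x) = act g (z' x)" if "g \<in> carrier G" for g
      using z'_d[of "act g (\<sigma> x)"] \<sigma>[OF x] hmD(4)[OF d_hm that, of "\<sigma> x" k] hmD(4)[OF q that, of "\<sigma> x"]
        submodD(5)[OF P_submod that] by (simp add: z'_def)
  qed
  then have z': "hm (pker k) z' (Free {..<m (Suc k)})"
    by (rule hm_mono[OF _ subset_refl]) (rule P_Free[OF hmD(1)[OF z'P]])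
  define t' where "t' = (\<lambda>j. d k (s (Suc k) j))"
  have "ext t' (z' y) = y" if y: "y \<in> pker k" for y
  proof -
    have zP: "z' y \<in> P (Suc k)" unfolding z'_def using hmD(1)[OF q] \<sigma>[OF y] by simp
    have "ext t' (z' y) = d k (z' y)" using proj_hm_eq_ext[OF P_proj d_hm zP] by (simp add: t'_def)
    then show ?thesis using dq \<sigma>[OF y] by (simp add: z'_def)
  qed
  then have "dual_basis k (m (Suc k)) t' z'"
    using z' projD(3)[OF P_proj[of "Suc k"]] by (auto simp: dual_basis_def t'_def intro!: d_in_pker)
  then show ?thesis by blast
qed

text \<open>Above the length of the resolution there are no nonzero cycles, and the descent starts
  there. Its last step, from degree 2 to degree 1, uses \<open>vanishing 2\<close>, which concerns
  cohomology in degree 3; one more step would ask for \<open>vanishing 1\<close>, that is, for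
  degree 2.\<close>

lemma dual_basis_ex:
  assumes van: "\<And>j. 2 \<le> j \<Longrightarrow> vanishing j"
  shows "\<exists>n t z. dual_basis 1 n t z"
proof -
  have "\<exists>n t z. dual_basis (Suc len - i) n t z" if "i \<le> len" for i
    using that
  proof (induction i)
    case 0
    have "pker (Suc len) \<subseteq> {0}" using P_length[of "Suc len"] pker_P by auto
    then have "dual_basis (Suc len) 0 (\<lambda>_. 0) (\<lambda>p. p)"
      unfolding dual_basis_def hm_def by (auto simp: ext_def subset_iff)
    then show ?case by fastforce
  next
    case (Suc i)
    then obtain n t z where db: "dual_basis (Suc (Suc len - Suc i)) n t z"
      by (metis Suc_diff_le Suc_leD diff_Suc_Suc le_SucI)
    have "2 \<le> Suc (Suc len - Suc i)" using Suc.prems by simp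
    then show ?case using dual_basis_descend[OF van db] by blast
  qed
  from this[of len] show ?thesis by simp
qed

end

text \<open>From an element with single coordinate 0 to a vector of length \<open>n\<close>, whose
  coordinate \<open>j\<close> is a right multiple by \<open>\<rho> j\<close>. Scaling on the right
  commutes with the left module structure even if \<open>R\<close> is not commutative.\<close>

definition right_scale :: "nat \<Rightarrow> (nat \<Rightarrow> 'u::ring) \<Rightarrow> (nat \<Rightarrow> 'g \<Rightarrow> 'u) \<Rightarrow> nat \<Rightarrow> 'g \<Rightarrow> 'u" where
  "right_scale n \<rho> b = (\<lambda>j x. if j < n then b 0 x * \<rho> j else 0)"

lemma supp_right_scale: "supp (right_scale n \<rho> b) \<subseteq> {..<n} \<times> snd ` supp b"
proof
  fix p assume "p \<in> supp (right_scale n \<rho> b)"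
  then have "fst p < n" "b 0 (snd p) \<noteq> 0" by (auto simp: supp_def right_scale_def split: if_splits)
  moreover from this have "(0, snd p) \<in> supp b" by (simp add: supp_def)
  then have "snd p \<in> snd ` supp b" by (intro image_eqI[of _ snd "(0, snd p)"]) auto
  ultimately show "p \<in> {..<n} \<times> snd ` supp b" by (simp add: mem_Times_iff)
qed

context group_coeff
begin

definition right_act :: "'g \<Rightarrow> ('j \<Rightarrow> 'g \<Rightarrow> 'u) \<Rightarrow> 'j \<Rightarrow> 'g \<Rightarrow> 'u" where
  "right_act g b = (\<lambda>j x. if x \<in> carrier G then b j (x \<otimes> inv g) else 0)"

lemma right_act_Free:
  assumes g: "g \<in> carrier G" and b: "b \<in> Free J"
  shows "right_act g b \<in> Free J"
proof -
  have "supp (right_act g b) \<subseteq> (\<lambda>p. (fst p, snd p \<otimes> g)) ` supp b"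
  proof
    fix p assume "p \<in> supp (right_act g b)"
    then have p: "snd p \<in> carrier G" "b (fst p) (snd p \<otimes> inv g) \<noteq> 0"
      by (auto simp: supp_def right_act_def split: if_splits)
    then have "p = (fst p, (snd p \<otimes> inv g) \<otimes> g)" using g by (simp add: m_assoc)
    then show "p \<in> (\<lambda>p. (fst p, snd p \<otimes> g)) ` supp b"
      using p by (intro image_eqI[of _ _ "(fst p, snd p \<otimes> inv g)"]) (auto simp: supp_def)
  qed
  moreover have "(\<lambda>p. (fst p, snd p \<otimes> g)) ` supp b \<subseteq> J \<times> carrier G"
    using FreeD(5)[OF b] g by auto
  ultimately have "supp (right_act g b) \<subseteq> J \<times> carrier G" "finite (supp (right_act g b))"
    using FreeD(2)[OF b] by (auto intro: finite_subset)
  then show ?thesis unfolding Free_def[of J] mem_Collect_eq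
    using FreeD(1)[OF b] by (auto simp: right_act_def)
qed

lemma hm_right_act:
  assumes g: "g \<in> carrier G"
  shows "hm (Free J) (right_act g) (Free J)"
proof -
  have "right_act g (act h b) = act h (right_act g b)" if "h \<in> carrier G" for h and b :: "'a \<Rightarrow> 'g \<Rightarrow> 'u"
    using g that by (auto simp: right_act_def act_def fun_eq_iff m_assoc)
  then show ?thesis
    unfolding hm_def using right_act_Free[OF g] by (auto simp: right_act_def sc_def fun_eq_iff)
qed

lemma hm_right_scale:
  assumes \<rho>: "\<And>j. \<rho> j \<in> Rs"
  shows "hm (Free J) (right_scale n \<rho>) (Free {..<n})"
proof -
  have "right_scale n \<rho> b \<in> Free {..<n}" if b: "b \<in> Free J" for b
  proof -
    have "supp (right_scale n \<rho> b) \<subseteq> {..<n} \<times> snd ` supp b"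
      by (rule supp_right_scale)
    moreover have "{..<n} \<times> snd ` supp b \<subseteq> {..<n} \<times> carrier G" "finite ({..<n} \<times> snd ` supp b)"
      using FreeD(2,5)[OF b] by auto
    ultimately have "supp (right_scale n \<rho> b) \<subseteq> {..<n} \<times> carrier G" "finite (supp (right_scale n \<rho> b))"
      by (auto intro: finite_subset)
    then show ?thesis unfolding Free_def[of "{..<n}"] mem_Collect_eq
      using FreeD(1)[OF b] \<rho> by (auto simp: right_scale_def)
  qed
  then show ?thesis
    unfolding hm_def by (auto simp: right_scale_def sc_def act_def fun_eq_iff distrib_right mult.assoc)
qed

lemma sz_right_scale:
  assumes b: "b \<in> Free {..<1}"
  shows "sz (right_scale n \<rho> b) \<le> n * sz b"
proof -
  have "supp (right_scale n \<rho> b) \<subseteq> {..<n} \<times> snd ` supp b"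
    by (rule supp_right_scale)
  then have "card (supp (right_scale n \<rho> b)) \<le> card ({..<n} \<times> snd ` supp b)"
    by (rule card_mono[rotated]) (use FreeD(2)[OF b] in auto)
  also have "\<dots> = n * card (snd ` supp b)" by (simp add: card_cartesian_product)
  also have "\<dots> \<le> n * card (supp b)" by (intro mult_le_mono2 card_image_le[OF FreeD(2)[OF b]])
  finally show ?thesis by (simp add: sz_def)
qed

lemma ext_plus: "ext (\<lambda>j. n j + n' j) b = ext n b + ext n' b"
  by (simp add: ext_def sum.distrib)

text \<open>\<open>H\<^sup>2(G; RG)\<close> is generated over \<open>R\<close>, acting on the right, by the class of the cocycle \<open>f0\<close>;
  with coefficients in \<open>(RG)\<^sup>n\<close> each coordinate gets its own scalar \<open>\<rho> j\<close>.\<close>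

definition H2_generator :: "('g list \<Rightarrow> nat \<Rightarrow> 'g \<Rightarrow> 'u) \<Rightarrow> bool" where
  "H2_generator f0 \<longleftrightarrow> (\<forall>w\<in>words G 2. f0 w \<in> Free {..<1}) \<and> (\<forall>w\<in>words G 3. ext f0 (bd w) = 0) \<and>
     (\<forall>(n :: nat) f. (\<forall>w\<in>words G 2. f w \<in> Free {..<n}) \<longrightarrow> (\<forall>w\<in>words G 3. ext f (bd w) = 0) \<longrightarrow>
       (\<exists>\<rho> c. (\<forall>j. \<rho> j \<in> Rs) \<and> (\<forall>w\<in>words G 1. c w \<in> Free {..<n}) \<and>
         (\<forall>w\<in>words G 2. f w = right_scale n \<rho> (f0 w) + ext c (bd w))))"

lemma H2_generatorE:
  assumes gen: "H2_generator f0" and f: "\<And>w. w \<in> words G 2 \<Longrightarrow> f w \<in> Free {..<n :: nat}"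
    "\<And>w. w \<in> words G 3 \<Longrightarrow> ext f (bd w) = 0"
  obtains \<rho> c where "\<And>j. \<rho> j \<in> Rs" "\<And>w. w \<in> words G 1 \<Longrightarrow> c w \<in> Free {..<n}"
    "\<And>b. b \<in> Free (words G 2) \<Longrightarrow> ext f b = right_scale n \<rho> (ext f0 b) + ext c (bar_d b)"
proof -
  have "\<exists>\<rho> c. (\<forall>j. \<rho> j \<in> Rs) \<and> (\<forall>w\<in>words G 1. c w \<in> Free {..<n}) \<and>
      (\<forall>w\<in>words G 2. f w = right_scale n \<rho> (f0 w) + ext c (bd w))"
    using gen f unfolding H2_generator_def by simp
  then obtain \<rho> c where \<rho>: "\<And>j. \<rho> j \<in> Rs" and c: "\<And>w. w \<in> words G 1 \<Longrightarrow> c w \<in> Free {..<n}"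
    and eq: "\<And>w. w \<in> words G 2 \<Longrightarrow> f w = right_scale n \<rho> (f0 w) + ext c (bd w)" by blast
  have f0: "\<And>w. w \<in> words G 2 \<Longrightarrow> f0 w \<in> Free {..<1}" using gen by (simp add: H2_generator_def)
  have "ext f b = right_scale n \<rho> (ext f0 b) + ext c (bar_d b)" if b: "b \<in> Free (words G 2)" for b
  proof -
    have "ext f b = ext (\<lambda>w. right_scale n \<rho> (f0 w) + ext c (bd w)) b" by (rule ext_cong[OF b eq])
    also have "\<dots> = ext (\<lambda>w. right_scale n \<rho> (f0 w)) b + ext (\<lambda>w. ext c (bd w)) b" by (rule ext_plus)
    also have "ext (\<lambda>w. right_scale n \<rho> (f0 w)) b = right_scale n \<rho> (ext f0 b)"
      by (rule hm_of_ext[OF hm_right_scale[OF \<rho>] submod_Free f0 b, symmetric])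
    also have "ext (\<lambda>w. ext c (bd w)) b = ext c (bar_d b)"
      by (rule ext_bar_d[OF submod_Free]) (use c b in \<open>auto simp: numeral_2_eq_2\<close>)
    finally show ?thesis .
  qed
  then show thesis using that \<rho> c by blast
qed

end

section \<open>The linear isoperimetric inequality for cycles in \<open>P 1\<close>\<close>

context projective_resolution
begin

text \<open>The hypothesis \<open>nonamenable\<close> bounds the support of
  \<open>\<theta> p\<close> by the number of points that right translations by \<open>T\<close> move
  out of it. For each \<open>g\<close> these points lie in the support of
  \<open>ext c (U p)\<close>, a homomorphism on all of \<open>P 1\<close>, to which
  \<open>proj_hm_sz\<close> applies.\<close>

lemma generator_isoperimetry:
  assumes gen: "H2_generator f0" and cmp: "comparison 1 U V h"
    and T: "finite T" "T \<subseteq> carrier G"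
    and nonamenable: "\<And>F. finite F \<Longrightarrow> F \<subseteq> carrier G \<Longrightarrow>
      card F \<le> K * (\<Sum>g\<in>T. card ((\<lambda>x. x \<otimes> g) ` F - F))"
  shows "\<exists>C. \<forall>p\<in>pker 1. sz (ext f0 (contract (U p))) \<le> C * sz p"
proof -
  have f0: "\<And>w. w \<in> words G 2 \<Longrightarrow> f0 w \<in> Free {..<1}" and f0c: "\<And>w. w \<in> words G 3 \<Longrightarrow> ext f0 (bd w) = 0"
    using gen by (auto simp: H2_generator_def)
  have U: "hm (P 1) U (Free (words G 1))" and Uk: "\<And>p. p \<in> pker 1 \<Longrightarrow> U p \<in> bar_ker 1"
    using cmp by (auto simp: comparison_def)
  \<comment> \<open>The cocycle evaluated on a chain with boundary \<open>U p\<close>. The values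
    \<open>f0 w\<close> range over all words, so this formula gives no uniform bound on the
    size.\<close>
  define \<theta> where "\<theta> = (\<lambda>p. ext f0 (contract (U p)))"
  have b: "contract (U p) \<in> Free (words G 2)" "bar_d (contract (U p)) = U p" if "p \<in> pker 1" for p
    using bar_ker_exact[OF Uk[OF that]] by (simp_all add: numeral_2_eq_2)
  have \<theta>F: "\<theta> p \<in> Free {..<1}" if "p \<in> pker 1" for p
    unfolding \<theta>_def by (rule ext_closed[OF submod_Free f0 b(1)[OF that]])
  have "\<exists>C. \<forall>p\<in>pker 1. card ((\<lambda>x. x \<otimes> g) ` {x. \<theta> p 0 x \<noteq> 0} - {x. \<theta> p 0 x \<noteq> 0}) \<le> C * sz p"
    if g: "g \<in> T" for g
  proof -
    have gG: "g \<in> carrier G" using g T by auto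
    \<comment> \<open>Right translation commutes with the left module structure, so the translated
      cocycle is a cocycle and again a scalar multiple of \<open>f0\<close> up to a
      coboundary.\<close>
    let ?f = "\<lambda>w. right_act g (f0 w)"
    have ext_f: "ext ?f c = right_act g (ext f0 c)" if "c \<in> Free (words G 2)" for c
      by (rule hm_of_ext[OF hm_right_act[OF gG] submod_Free f0 that, symmetric])
    obtain \<rho> c where c: "\<And>w. w \<in> words G 1 \<Longrightarrow> c w \<in> Free {..<1 :: nat}"
      and eq: "\<And>b. b \<in> Free (words G 2) \<Longrightarrow> ext ?f b = right_scale 1 \<rho> (ext f0 b) + ext c (bar_d b)"
    proof (rule H2_generatorE[OF gen, of ?f 1])
      show "?f w \<in> Free {..<1}" if "w \<in> words G 2" for w
        using right_act_Free[OF gG f0[OF that]] .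
      show "ext ?f (bd w) = 0" if w: "w \<in> words G 3" for w
        using ext_f[of "bd w"] bd_Free[of w 2] w f0c hm_zero[OF hm_right_act[OF gG, of UNIV] submod_Free]
        by (simp add: numeral_3_eq_3 numeral_2_eq_2)
    qed blast
    have "hm (Free (words G 1)) (ext c) (Free {..<1})" by (rule hm_ext[OF submod_Free c])
    then have hc: "hm (P 1) (\<lambda>p. ext c (U p)) (Free {..<1})" by (rule hm_comp[OF U])
    obtain C where C: "\<And>p. p \<in> P 1 \<Longrightarrow> sz (ext c (U p)) \<le> C * sz p"
      using proj_hm_sz[OF P_proj finite_lessThan hc] by blast
    have "card ((\<lambda>x. x \<otimes> g) ` {x. \<theta> p 0 x \<noteq> 0} - {x. \<theta> p 0 x \<noteq> 0}) \<le> C * sz p" if p: "p \<in> pker 1" for p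
    proof -
      have \<theta>_eq: "right_act g (\<theta> p) = right_scale 1 \<rho> (\<theta> p) + ext c (U p)"
        using eq[OF b(1)[OF p]] ext_f[OF b(1)[OF p]] b(2)[OF p] by (simp add: \<theta>_def)
      have "Pair 0 ` ((\<lambda>x. x \<otimes> g) ` {x. \<theta> p 0 x \<noteq> 0} - {x. \<theta> p 0 x \<noteq> 0}) \<subseteq> supp (ext c (U p))"
      proof
        fix q assume "q \<in> Pair (0 :: nat) ` ((\<lambda>x. x \<otimes> g) ` {x. \<theta> p 0 x \<noteq> 0} - {x. \<theta> p 0 x \<noteq> 0})"
        then obtain x where x: "q = (0, x \<otimes> g)" "\<theta> p 0 x \<noteq> 0" "\<theta> p 0 (x \<otimes> g) = 0" by auto
        have xG: "x \<in> carrier G" using FreeD(4)[OF \<theta>F[OF p] x(2)] .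
        have "right_act g (\<theta> p) 0 (x \<otimes> g) = \<theta> p 0 x" using xG gG by (simp add: right_act_def m_assoc)
        moreover have "right_act g (\<theta> p) 0 (x \<otimes> g) = ext c (U p) 0 (x \<otimes> g)"
          unfolding \<theta>_eq using x(3) by (simp add: right_scale_def)
        ultimately show "q \<in> supp (ext c (U p))" using x by (simp add: supp_def)
      qed
      then have "card (Pair (0::nat) ` ((\<lambda>x. x \<otimes> g) ` {x. \<theta> p 0 x \<noteq> 0} - {x. \<theta> p 0 x \<noteq> 0})) \<le> sz (ext c (U p))"
        unfolding sz_def by (rule card_mono[OF FreeD(2)[OF hmD(1)[OF hc pker_P[OF p]]]])
      also have "\<dots> \<le> C * sz p" by (rule C[OF pker_P[OF p]])
      finally show ?thesis by (subst (asm) card_image) (auto simp: inj_on_def)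
    qed
    then show ?thesis by blast
  qed
  then have "\<forall>g. \<exists>C. g \<in> T \<longrightarrow> (\<forall>p\<in>pker 1. card ((\<lambda>x. x \<otimes> g) ` {x. \<theta> p 0 x \<noteq> 0} - {x. \<theta> p 0 x \<noteq> 0}) \<le> C * sz p)"
    by blast
  then obtain C where C: "\<And>g p. g \<in> T \<Longrightarrow> p \<in> pker 1 \<Longrightarrow>
      card ((\<lambda>x. x \<otimes> g) ` {x. \<theta> p 0 x \<noteq> 0} - {x. \<theta> p 0 x \<noteq> 0}) \<le> C g * sz p" by metis
  have "sz (\<theta> p) \<le> (K * sum C T) * sz p" if p: "p \<in> pker 1" for p
  proof -
    let ?F = "{x. \<theta> p 0 x \<noteq> 0}"
    have supp: "supp (\<theta> p) = Pair 0 ` ?F"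
      using FreeD(3)[OF \<theta>F[OF p]] by (force simp: supp_def)
    have fin: "finite ?F" using FreeD(2)[OF \<theta>F[OF p]] unfolding supp
      by (rule finite_imageD) (simp add: inj_on_def)
    have "sz (\<theta> p) = card ?F" unfolding sz_def supp by (rule card_image) (simp add: inj_on_def)
    also have "\<dots> \<le> K * (\<Sum>g\<in>T. card ((\<lambda>x. x \<otimes> g) ` ?F - ?F))"
      by (rule nonamenable[OF fin]) (use FreeD(4)[OF \<theta>F[OF p]] in auto)
    also have "\<dots> \<le> K * (\<Sum>g\<in>T. C g * sz p)" by (intro mult_le_mono2 sum_mono C p)
    also have "\<dots> = (K * sum C T) * sz p" by (simp add: sum_distrib_right mult.assoc)
    finally show ?thesis .
  qed
  then show ?thesis unfolding \<theta>_def by blast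
qed

text \<open>On a cycle, \<open>z p\<close> splits into \<open>z (V (U p))\<close> and
  \<open>z (d 1 (h p))\<close>. The former is a scaled value of the generating cocycle plus
  \<open>ext c (U p)\<close>; the scaled value is handled by \<open>generator_isoperimetry\<close>.
  The two remaining terms are restrictions of homomorphisms on \<open>P 1\<close>.\<close>

lemma dual_basis_isoperimetry:
  assumes gen: "H2_generator f0" and db: "dual_basis 1 n t z"
    and T: "finite T" "T \<subseteq> carrier G"
    and nonamenable: "\<And>F. finite F \<Longrightarrow> F \<subseteq> carrier G \<Longrightarrow>
      card F \<le> K * (\<Sum>g\<in>T. card ((\<lambda>x. x \<otimes> g) ` F - F))"
  shows "\<exists>C. \<forall>p\<in>pker 1. sz (z p) \<le> C * sz p"
proof -
  have z: "hm (pker 1) z (Free {..<n})" using db by (simp add: dual_basis_def)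
  obtain U V h where cmp: "comparison 1 U V h" using comparison_ex by blast
  have U: "hm (P 1) U (Free (words G 1))" and V: "hm (Free (words G 1)) V (P 1)" and h: "hm (P 1) h (P 2)"
    and Uk: "\<And>p. p \<in> pker 1 \<Longrightarrow> U p \<in> bar_ker 1" and Vk: "\<forall>b\<in>bar_ker 1. V b \<in> pker 1"
    and hk: "\<And>p. p \<in> pker 1 \<Longrightarrow> p - V (U p) = d 1 (h p)"
    using cmp by (auto simp: comparison_def numeral_2_eq_2)
  obtain C1 where C1: "\<And>p. p \<in> pker 1 \<Longrightarrow> sz (ext f0 (contract (U p))) \<le> C1 * sz p"
    using generator_isoperimetry[OF gen cmp T nonamenable] by blast
  define f where "f = (\<lambda>w. z (V (bd w)))"
  note coc = cocycle_of_hom[OF V Vk z, folded f_def]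
  obtain \<rho> c where \<rho>: "\<And>j. \<rho> j \<in> Rs" and c: "\<And>w. w \<in> words G 1 \<Longrightarrow> c w \<in> Free {..<n}"
    and eq: "\<And>b. b \<in> Free (words G 2) \<Longrightarrow> ext f b = right_scale n \<rho> (ext f0 b) + ext c (bar_d b)"
    by (rule H2_generatorE[OF gen, of f n])
      (use coc(1,2) in \<open>auto simp: numeral_2_eq_2 numeral_3_eq_3 f_def\<close>)
  have "hm (Free (words G 1)) (ext c) (Free {..<n})" by (rule hm_ext[OF submod_Free c])
  then have hc: "hm (P 1) (\<lambda>p. ext c (U p)) (Free {..<n})" by (rule hm_comp[OF U])
  obtain C2 where C2: "\<And>p. p \<in> P 1 \<Longrightarrow> sz (ext c (U p)) \<le> C2 * sz p"
    using proj_hm_sz[OF P_proj finite_lessThan hc] by blast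
  have dh: "d 1 (h p) \<in> pker 1" if "p \<in> P 1" for p
    using d_in_pker[of "h p" 1] hmD(1)[OF h that] by (simp add: numeral_2_eq_2)
  have "hm (P 2) (d 1) (P 1)" using d_hm[of 1] by (simp add: numeral_2_eq_2)
  then have "hm (P 1) (\<lambda>p. d 1 (h p)) (P 1)" by (rule hm_comp[OF h])
  then have "hm (P 1) (\<lambda>p. d 1 (h p)) (pker 1)" by (rule hm_mono[OF _ subset_refl dh])
  then have hz: "hm (P 1) (\<lambda>p. z (d 1 (h p))) (Free {..<n})" by (rule hm_comp[OF _ z])
  obtain C3 where C3: "\<And>p. p \<in> P 1 \<Longrightarrow> sz (z (d 1 (h p))) \<le> C3 * sz p"
    using proj_hm_sz[OF P_proj finite_lessThan hz] by blast
  have f0: "\<And>w. w \<in> words G 2 \<Longrightarrow> f0 w \<in> Free {..<1}" using gen by (simp add: H2_generator_def)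
  have "sz (z p) \<le> (n * C1 + C2 + C3) * sz p" if p: "p \<in> pker 1" for p
  proof -
    have pP: "p \<in> P 1" by (rule pker_P[OF p])
    let ?b = "contract (U p)"
    have b: "?b \<in> Free (words G 2)" "bar_d ?b = U p"
      using bar_ker_exact[OF Uk[OF p]] by (simp_all add: numeral_2_eq_2)
    let ?\<theta> = "ext f0 ?b"
    have \<theta>F: "?\<theta> \<in> Free {..<1}" by (rule ext_closed[OF submod_Free f0 b(1)])
    have "z (V (U p)) = right_scale n \<rho> ?\<theta> + ext c (U p)"
      using coc(3)[of ?b] eq[OF b(1)] b by (simp add: numeral_2_eq_2)
    moreover have "z (V (U p) + d 1 (h p)) = z (V (U p)) + z (d 1 (h p))"
      using Vk Uk[OF p] dh[OF pP] by (intro hmD(2)[OF z]) auto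
    moreover have "V (U p) + d 1 (h p) = p" using hk[OF p] by (simp add: algebra_simps)
    ultimately have zp: "z p = right_scale n \<rho> ?\<theta> + ext c (U p) + z (d 1 (h p))" by simp
    have F: "right_scale n \<rho> ?\<theta> \<in> Free {..<n}" "ext c (U p) \<in> Free {..<n}" "z (d 1 (h p)) \<in> Free {..<n}"
      using hmD(1)[OF hm_right_scale[OF \<rho>] \<theta>F] hmD(1)[OF hc pP] hmD(1)[OF hz pP] by auto
    have "sz (z p) \<le> sz (right_scale n \<rho> ?\<theta> + ext c (U p)) + sz (z (d 1 (h p)))"
      unfolding zp by (rule sz_add[OF add_Free[OF F(1,2)] F(3)])
    also have "sz (right_scale n \<rho> ?\<theta> + ext c (U p)) \<le> sz (right_scale n \<rho> ?\<theta>) + sz (ext c (U p))"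
      by (rule sz_add[OF F(1,2)])
    also have "sz (right_scale n \<rho> ?\<theta>) \<le> n * sz ?\<theta>" by (rule sz_right_scale[OF \<theta>F])
    also have "n * sz ?\<theta> \<le> n * (C1 * sz p)" by (intro mult_le_mono2 C1 p)
    also have "sz (ext c (U p)) \<le> C2 * sz p" by (rule C2[OF pP])
    also have "sz (z (d 1 (h p))) \<le> C3 * sz p" by (rule C3[OF pP])
    finally show ?thesis by (simp add: algebra_simps)
  qed
  then show ?thesis by blast
qed

end

section \<open>The Cayley graph\<close>

lemma sum_list_index:
  fixes h :: "'a \<Rightarrow> 'b::comm_monoid_add"
  assumes "finite A"
  shows "\<exists>\<omega>. (\<Sum>a\<in>A. h a) = (\<Sum>i<card A. \<omega> i) \<and> (\<forall>i<card A. \<omega> i \<in> h ` A)"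
proof -
  obtain \<phi> where "bij_betw \<phi> {0..<card A} A" using ex_bij_betw_nat_finite[OF assms] by blast
  then have \<phi>: "bij_betw \<phi> {..<card A} A" by (simp add: atLeast0LessThan)
  have "(\<Sum>i<card A. h (\<phi> i)) = (\<Sum>a\<in>A. h a)" by (rule sum.reindex_bij_betw[OF \<phi>])
  moreover have "\<forall>i<card A. h (\<phi> i) \<in> h ` A" using \<phi> by (auto simp: bij_betw_def)
  ultimately show ?thesis by (intro exI[of _ "\<lambda>i. h (\<phi> i)"]) simp
qed

context group_coeff
begin

text \<open>The cellular chain complex \<open>RG\<^sup>S \<rightarrow> RG\<close> of the Cayley graph; \<open>RG\<close> is the term of degree \<open>0\<close> of the bar
  resolution.\<close>

definition cayley_bd :: "'g \<Rightarrow> 'g list \<Rightarrow> 'g \<Rightarrow> 'u" where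
  "cayley_bd g = act g (bas []) - bas []"

abbreviation cayley_d :: "('g \<Rightarrow> 'g \<Rightarrow> 'u) \<Rightarrow> 'g list \<Rightarrow> 'g \<Rightarrow> 'u" where
  "cayley_d \<equiv> ext cayley_bd"

lemma bas_nil: "bas [] \<in> Free (words G 0)"
  by (rule bas_Free) (simp add: words_def)

lemma cayley_bd_Free: "g \<in> carrier G \<Longrightarrow> cayley_bd g \<in> Free (words G 0)"
  unfolding cayley_bd_def by (intro submod_diff[OF submod_Free] act_Free bas_nil)

lemma hm_cayley_d: "S \<subseteq> carrier G \<Longrightarrow> hm (Free S) cayley_d (Free (words G 0))"
  by (rule hm_ext[OF submod_Free]) (auto intro: cayley_bd_Free)

lemma aug_diff: "b \<in> Free J \<Longrightarrow> c \<in> Free J \<Longrightarrow> aug (b - c) = aug b - aug c"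
  using aug_add[of b J "- c"] aug_uminus[of c J] submod_uminus[OF submod_Free, of c J] by simp

lemma aug_cayley_bd: "g \<in> carrier G \<Longrightarrow> aug (cayley_bd g) = 0"
  unfolding cayley_bd_def
  by (simp add: aug_diff[OF act_Free[OF _ bas_nil] bas_nil] aug_act[OF bas_nil])

lemma aug_cayley_d:
  assumes "S \<subseteq> carrier G" "c \<in> Free S"
  shows "aug (cayley_d c) = 0"
proof -
  have "aug (cayley_d c) = (\<Sum>p\<in>supp c. c (fst p) (snd p) * aug (cayley_bd (fst p)))"
    by (rule aug_ext[OF assms(2)]) (use assms in \<open>auto intro: cayley_bd_Free\<close>)
  also have "\<dots> = 0"
  proof (rule sum.neutral, rule ballI)
    fix p assume "p \<in> supp c"
    then have "p \<in> S \<times> carrier G" using FreeD(5)[OF assms(2)] by blast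
    then have "fst p \<in> carrier G" using assms(1) by auto
    then show "c (fst p) (snd p) * aug (cayley_bd (fst p)) = 0" by (simp add: aug_cayley_bd)
  qed
  finally show ?thesis .
qed

text \<open>The chain of a path from the unit to \<open>g\<close>: the rules of
  \<open>generate\<close> correspond to the constant path, an edge, an edge run backwards, and the
  concatenation of a path with a translated one.\<close>

lemma cayley_path_ex:
  assumes S: "S \<subseteq> carrier G" and g: "g \<in> generate G S"
  shows "\<exists>c\<in>Free S. cayley_d c = cayley_bd g"
  using g
proof (induction rule: generate.induct)
  case one
  have "cayley_bd \<one> = 0" by (simp add: cayley_bd_def act_one[OF bas_nil])
  then have "cayley_d 0 = cayley_bd \<one>" by (simp add: ext_def)
  then show ?case by (rule bexI[OF _ zero_Free])
next
  case (incl h)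
  then have "cayley_d (bas h) = cayley_bd h" using ext_bas[of cayley_bd h, OF cayley_bd_Free] S by auto
  then show ?case by (rule bexI[OF _ bas_Free[OF incl]])
next
  case (inv h)
  have h: "h \<in> carrier G" using inv S by auto
  have F: "act (inv h) (- bas h) \<in> Free S"
    using inv h by (intro act_Free submod_uminus[OF submod_Free] bas_Free) auto
  have "cayley_d (bas h) = cayley_bd h" using ext_bas[of cayley_bd h, OF cayley_bd_Free[OF h]] .
  then have "cayley_d (act (inv h) (- bas h)) = act (inv h) (- cayley_bd h)"
    using ext_act[of "- bas h" S "inv h" cayley_bd] h inv
      hm_uminus[OF hm_cayley_d[OF S] submod_Free submod_Free, of "bas h"]
      submod_uminus[OF submod_Free, of "bas h" S] bas_Free[of h S] by simp
  also have "\<dots> = cayley_bd (inv h)"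
    using h by (simp add: cayley_bd_def act_act act_one[OF bas_nil])
  finally show ?case by (rule bexI[OF _ F])
next
  case (eng h1 h2)
  have h: "h1 \<in> carrier G" "h2 \<in> carrier G" using eng generate_in_carrier[OF S] by auto
  obtain c1 c2 where c: "c1 \<in> Free S" "cayley_d c1 = cayley_bd h1" "c2 \<in> Free S" "cayley_d c2 = cayley_bd h2"
    using eng by blast
  have F: "c1 + act h1 c2 \<in> Free S" using c h by (intro add_Free act_Free)
  have "cayley_d (c1 + act h1 c2) = cayley_bd h1 + act h1 (cayley_bd h2)"
    using ext_add[of c1 S "act h1 c2" cayley_bd] ext_act[OF c(3) h(1), of cayley_bd] c act_Free[OF h(1) c(3)] by simp
  also have "\<dots> = cayley_bd (h1 \<otimes> h2)" using h by (simp add: cayley_bd_def act_act)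
  finally show ?case by (rule bexI[OF _ F])
qed

text \<open>An element of augmentation zero is a combination of differences of group elements and
  the unit, each of which is the boundary of a path.\<close>

lemma cayley_exact:
  assumes S: "S \<subseteq> carrier G" "generate G S = carrier G" and b: "b \<in> Free (words G 0)" "aug b = 0"
  shows "\<exists>c\<in>Free S. cayley_d c = b"
proof -
  obtain c where c: "\<And>g. g \<in> carrier G \<Longrightarrow> c g \<in> Free S \<and> cayley_d (c g) = cayley_bd g"
    using cayley_path_ex[OF S(1)] S(2) by metis
  let ?h = "\<lambda>p. sc (b (fst p) (snd p)) (c (snd p))"
  have mem: "b (fst p) (snd p) \<in> Rs \<and> snd p \<in> carrier G \<and> fst p = []" if "p \<in> supp b" for p
    using that FreeD[OF b(1)] by (auto simp: words_def)
  have F: "?h p \<in> Free S" if "p \<in> supp b" for p using mem[OF that] c by (intro sc_Free) auto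
  have "cayley_d (sum ?h (supp b)) = (\<Sum>p\<in>supp b. cayley_d (?h p))"
    by (rule hm_sum[OF hm_cayley_d[OF S(1)] submod_Free F])
  also have "\<dots> = (\<Sum>p\<in>supp b. sc (b (fst p) (snd p)) (act (snd p) (bas (fst p))) -
      sc (b (fst p) (snd p)) (bas []))"
  proof (rule sum.cong)
    fix p assume p: "p \<in> supp b"
    have cp: "c (snd p) \<in> Free S" "cayley_d (c (snd p)) = cayley_bd (snd p)" "fst p = []" using mem[OF p] c by auto
    show "cayley_d (?h p) = sc (b (fst p) (snd p)) (act (snd p) (bas (fst p))) - sc (b (fst p) (snd p)) (bas [])"
      unfolding ext_sc[OF cp(1)] cp(2,3) by (simp add: cayley_bd_def)
  qed simp
  also have "\<dots> = ext bas b - (\<Sum>p\<in>supp b. sc (b (fst p) (snd p)) (bas []))"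
    by (simp add: sum_subtractf ext_def)
  also have "(\<Sum>p\<in>supp b. sc (b (fst p) (snd p)) (bas [])) = (sc (aug b) (bas []) :: 'g list \<Rightarrow> 'g \<Rightarrow> 'u)"
    unfolding aug_def using sum_comp_morphism[of "\<lambda>r. sc r (bas [])" "\<lambda>p. b (fst p) (snd p)" "supp b"]
    by (simp add: o_def)
  finally have "cayley_d (sum ?h (supp b)) = b" using b by (simp add: ext_bas_id)
  moreover have "sum ?h (supp b) \<in> Free S" by (rule submod_sum[OF submod_Free F])
  ultimately show ?thesis by (rule bexI)
qed

end

context projective_resolution
begin

text \<open>Chain maps between the Cayley complex and \<open>P\<close> in both directions transfer the inequality.\<close>

theorem cayley_isoperimetry:
  assumes S: "finite S" "S \<subseteq> carrier G" "generate G S = carrier G"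
    and db: "dual_basis 1 n t z" and iso: "\<And>p. p \<in> pker 1 \<Longrightarrow> sz (z p) \<le> K * sz p"
  shows "\<exists>C W. finite W \<and> (\<forall>w\<in>W. w \<in> Free S \<and> cayley_d w = 0) \<and>
    (\<forall>c\<in>Free S. cayley_d c = 0 \<longrightarrow> (\<exists>N \<omega>. N \<le> C * sz c \<and> c = (\<Sum>i<N. \<omega> i) \<and>
      (\<forall>i<N. \<exists>w\<in>W. \<exists>r\<in>Rs. \<exists>g\<in>carrier G. \<omega> i = sc r (act g w))))"
proof -
  have t: "\<And>i. i \<in> {..<n} \<Longrightarrow> t i \<in> pker 1" and z: "hm (pker 1) z (Free {..<n})"
    and tz: "\<And>p. p \<in> pker 1 \<Longrightarrow> ext t (z p) = p"
    using db by (auto simp: dual_basis_def)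
  obtain U V where U: "hm (P 0) U (Free (words G 0))" and V: "hm (Free (words G 0)) V (P 0)"
    and aU: "\<And>p. p \<in> P 0 \<Longrightarrow> aug (U p) = ep p" and eV: "\<And>b. b \<in> Free (words G 0) \<Longrightarrow> ep (V b) = aug b"
    using comparison_maps_0 by metis
  note dS = hm_cayley_d[OF S(2)]
  have d0: "hm (P 1) (d 0) (P 0)" using d_hm[of 0] by simp
  obtain \<kappa> where \<kappa>: "hm (Free S) \<kappa> (P 1)" "\<And>c. c \<in> Free S \<Longrightarrow> d 0 (\<kappa> c) = V (cayley_d c)"
  proof -
    have f: "hm (Free S) (\<lambda>c. V (cayley_d c)) (P 0)" by (rule hm_comp[OF dS V])
    have "\<exists>q\<in>P 1. d 0 q = V (cayley_d (bas g))" if g: "g \<in> S" for g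
    proof -
      have F: "bas g \<in> Free S" using g by (rule bas_Free)
      have "V (cayley_d (bas g)) \<in> pker 0"
        using hmD(1)[OF f F] eV[OF hmD(1)[OF dS F]] aug_cayley_d[OF S(2) F] by (simp add: pker_def)
      then show ?thesis using pker_exact[of _ 0] by auto
    qed
    then obtain q where q: "\<And>g. g \<in> S \<Longrightarrow> q g \<in> P 1 \<and> d 0 (q g) = V (cayley_d (bas g))" by metis
    note lift = proj_lift[OF proj_Free f P_submod d0, where n = q]
    have "hm (Free S) (ext q) (P 1)" using q by (intro lift(1))
    moreover have "d 0 (ext q c) = V (cayley_d c)" if "c \<in> Free S" for c using q that by (intro lift(2))
    ultimately show thesis by (rule that)
  qed
  obtain \<chi> where \<chi>: "hm (P 1) \<chi> (Free S)" "\<And>p. p \<in> P 1 \<Longrightarrow> cayley_d (\<chi> p) = U (d 0 p)"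
  proof -
    have f: "hm (P 1) (\<lambda>p. U (d 0 p)) (Free (words G 0))" by (rule hm_comp[OF d0 U])
    have "\<exists>y\<in>Free S. cayley_d y = U (d 0 (s 1 j))" if j: "j \<in> {..<m 1}" for j
    proof (rule cayley_exact[OF S(2,3)])
      have sj: "s 1 j \<in> P 1" using projD(3)[OF P_proj j] .
      show "U (d 0 (s 1 j)) \<in> Free (words G 0)" using hmD(1)[OF f sj] .
      have "d 0 (s 1 j) \<in> pker 0" using d_in_pker[of "s 1 j" 0] sj by simp
      then show "aug (U (d 0 (s 1 j))) = 0" using aU by (simp add: pker_def)
    qed
    then obtain y where y: "\<And>j. j \<in> {..<m 1} \<Longrightarrow> y j \<in> Free S \<and> cayley_d (y j) = U (d 0 (s 1 j))" by metis
    note lift = proj_lift[OF P_proj f submod_Free dS, where n = y]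
    have "hm (P 1) (ext y) (Free S)" using y by (intro lift(1))
    moreover have "cayley_d (ext y p) = U (d 0 p)" if "p \<in> P 1" for p using y that by (intro lift(2))
    ultimately show thesis by (rule that)
  qed
  obtain H where H: "hm (Free (words G 0)) H (Free S)"
    "\<And>b. b \<in> Free (words G 0) \<Longrightarrow> cayley_d (H b) = b - U (V b)"
  proof -
    have UV: "hm (Free (words G 0)) (\<lambda>b. U (V b)) (Free (words G 0))" by (rule hm_comp[OF V U])
    have f: "hm (Free (words G 0)) (\<lambda>b. b - U (V b)) (Free (words G 0))"
      by (rule hm_minus[OF hm_id UV submod_Free])
    have "\<exists>x\<in>Free S. cayley_d x = bas w - U (V (bas w))" if w: "w \<in> words G 0" for w
    proof (rule cayley_exact[OF S(2,3)])
      have F: "bas w \<in> Free (words G 0)" using w by (rule bas_Free)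
      show "bas w - U (V (bas w)) \<in> Free (words G 0)" using hmD(1)[OF f F] .
      show "aug (bas w - U (V (bas w))) = 0"
        using aug_diff[OF F hmD(1)[OF UV F]] aU[OF hmD(1)[OF V F]] eV[OF F] by simp
    qed
    then obtain x where x: "\<And>w. w \<in> words G 0 \<Longrightarrow> x w \<in> Free S \<and> cayley_d (x w) = bas w - U (V (bas w))" by metis
    note lift = proj_lift[OF proj_Free f submod_Free dS, where n = x]
    have "hm (Free (words G 0)) (ext x) (Free S)" using x by (intro lift(1))
    moreover have "cayley_d (ext x b) = b - U (V b)" if "b \<in> Free (words G 0)" for b using x that by (intro lift(2))
    ultimately show thesis by (rule that)
  qed
  \<comment> \<open>The homotopy between \<open>\<chi> \<kappa>\<close> and the identity cannot be
    continued, since the Cayley complex has no cells of dimension 2; \<open>\<rho>\<close> is the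
    defect. It is a homomorphism with values in cycles, so on a cycle \<open>c\<close> it
    contributes at most \<open>sz c\<close> multiples of translates of the cycles
    \<open>\<rho> (bas g)\<close>.\<close>
  define \<rho> where "\<rho> = (\<lambda>c. c - \<chi> (\<kappa> c) - H (cayley_d c))"
  have \<chi>\<kappa>: "hm (Free S) (\<lambda>c. \<chi> (\<kappa> c)) (Free S)" by (rule hm_comp[OF \<kappa>(1) \<chi>(1)])
  have Hd: "hm (Free S) (\<lambda>c. H (cayley_d c)) (Free S)" by (rule hm_comp[OF dS H(1)])
  have \<rho>: "hm (Free S) \<rho> (Free S)"
    unfolding \<rho>_def by (intro hm_minus[OF hm_minus[OF hm_id \<chi>\<kappa> submod_Free] Hd submod_Free])
  have \<rho>_cycle: "cayley_d (\<rho> c) = 0" if c: "c \<in> Free S" for c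
  proof -
    have F: "\<chi> (\<kappa> c) \<in> Free S" "H (cayley_d c) \<in> Free S" "c - \<chi> (\<kappa> c) \<in> Free S" "cayley_d c \<in> Free (words G 0)"
      using hmD(1)[OF \<chi>\<kappa> c] hmD(1)[OF Hd c] hmD(1)[OF dS c] c submod_diff[OF submod_Free] by auto
    have 1: "cayley_d (\<rho> c) = cayley_d (c - \<chi> (\<kappa> c)) - cayley_d (H (cayley_d c))"
      unfolding \<rho>_def by (rule hm_diff[OF dS submod_Free submod_Free F(3,2)])
    have 2: "cayley_d (c - \<chi> (\<kappa> c)) = cayley_d c - cayley_d (\<chi> (\<kappa> c))"
      by (rule hm_diff[OF dS submod_Free submod_Free c F(1)])
    have 3: "cayley_d (\<chi> (\<kappa> c)) = U (V (cayley_d c))"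
      using \<chi>(2)[OF hmD(1)[OF \<kappa>(1) c]] \<kappa>(2)[OF c] by simp
    show ?thesis unfolding 1 2 3 H(2)[OF F(4)] by simp
  qed
  obtain C1 where C1: "\<And>c. c \<in> Free S \<Longrightarrow> sz (\<kappa> c) \<le> C1 * sz c"
  proof -
    have "hm (Free S) \<kappa> (Free {..<m 1})" by (rule hm_mono[OF \<kappa>(1) subset_refl]) (rule P_Free[OF hmD(1)[OF \<kappa>(1)]])
    from proj_hm_sz[OF proj_Free S(1) this] show thesis using that by blast
  qed
  \<comment> \<open>The first kind of cycles fills \<open>\<chi> (\<kappa> c)\<close> by means of
    the dual basis, as often as \<open>z (\<kappa> c)\<close> has nonzero coefficients; the second
    kind fills the defect.\<close>
  define W where "W = (\<lambda>i. \<chi> (t i)) ` {..<n} \<union> (\<lambda>g. \<rho> (bas g)) ` S"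
  have \<chi>t: "\<chi> p \<in> Free S \<and> cayley_d (\<chi> p) = 0" if "p \<in> pker 1" for p
    using hmD(1)[OF \<chi>(1) pker_P[OF that]] \<chi>(2)[OF pker_P[OF that]] that hm_zero[OF U P_submod]
    by (simp add: pker_def)
  have "\<exists>N \<omega>. N \<le> (K * C1 + 1) * sz c \<and> c = (\<Sum>i<N. \<omega> i) \<and>
      (\<forall>i<N. \<exists>w\<in>W. \<exists>r\<in>Rs. \<exists>g\<in>carrier G. \<omega> i = sc r (act g w))"
    if c: "c \<in> Free S" "cayley_d c = 0" for c
  proof -
    have \<kappa>c: "\<kappa> c \<in> pker 1"
      using hmD(1)[OF \<kappa>(1) c(1)] \<kappa>(2)[OF c(1)] c(2) hm_zero[OF V submod_Free] by (simp add: pker_def)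
    define y where "y = z (\<kappa> c)"
    have yF: "y \<in> Free {..<n}" unfolding y_def using hmD(1)[OF z \<kappa>c] .
    have "\<chi> (\<kappa> c) = \<chi> (ext t y)" using tz[OF \<kappa>c] by (simp add: y_def)
    also have "\<dots> = ext (\<lambda>i. \<chi> (t i)) y"
      by (rule hm_of_ext[OF \<chi>(1) P_submod pker_P[OF t] yF])
    finally have e1: "\<chi> (\<kappa> c) = ext (\<lambda>i. \<chi> (t i)) y" .
    have e2: "\<rho> c = ext (\<lambda>g. \<rho> (bas g)) c" by (rule proj_hm_eq_ext[OF proj_Free \<rho> c(1)])
    have "H (cayley_d c) = 0" using c(2) hm_zero[OF H(1) submod_Free] by simp
    then have "c = \<chi> (\<kappa> c) + \<rho> c" by (simp add: \<rho>_def)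
    then have ce: "c = ext (\<lambda>i. \<chi> (t i)) y + ext (\<lambda>g. \<rho> (bas g)) c"
      using e1 e2 by simp
    define A where "A = supp y <+> supp c"
    define \<eta> where "\<eta> = case_sum (\<lambda>p. sc (y (fst p) (snd p)) (act (snd p) (\<chi> (t (fst p)))))
      (\<lambda>p. sc (c (fst p) (snd p)) (act (snd p) (\<rho> (bas (fst p)))))"
    have fin: "finite (supp y)" "finite (supp c)" using FreeD(2) yF c(1) by auto
    have cA: "card A = sz y + sz c" "finite A" unfolding A_def sz_def using fin by (auto simp: card_Plus)
    have "(\<Sum>a\<in>A. \<eta> a) = ext (\<lambda>i. \<chi> (t i)) y + ext (\<lambda>g. \<rho> (bas g)) c"
      unfolding A_def sum.Plus[OF fin] by (simp add: \<eta>_def ext_def)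
    then have cs: "c = (\<Sum>a\<in>A. \<eta> a)" using ce by simp
    obtain \<omega> where \<omega>: "(\<Sum>a\<in>A. \<eta> a) = (\<Sum>i<card A. \<omega> i)" "\<forall>i<card A. \<omega> i \<in> \<eta> ` A"
      using sum_list_index[OF cA(2)] by blast
    have "\<exists>w\<in>W. \<exists>r\<in>Rs. \<exists>g\<in>carrier G. \<eta> a = sc r (act g w)" if a: "a \<in> A" for a
    proof (cases a)
      case (Inl p)
      then have p: "p \<in> supp y" using a by (auto simp: A_def)
      have "\<chi> (t (fst p)) \<in> W" "y (fst p) (snd p) \<in> Rs" "snd p \<in> carrier G"
        using FreeD(1,5)[OF yF] p by (auto simp: W_def)
      then show ?thesis unfolding Inl \<eta>_def by auto
    next
      case (Inr p)
      then have p: "p \<in> supp c" using a by (auto simp: A_def)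
      have "\<rho> (bas (fst p)) \<in> W" "c (fst p) (snd p) \<in> Rs" "snd p \<in> carrier G"
        using FreeD(1,5)[OF c(1)] p by (auto simp: W_def)
      then show ?thesis unfolding Inr \<eta>_def by auto
    qed
    then have "\<forall>i<card A. \<exists>w\<in>W. \<exists>r\<in>Rs. \<exists>g\<in>carrier G. \<omega> i = sc r (act g w)"
      using \<omega>(2) by (metis imageE)
    moreover have "card A \<le> (K * C1 + 1) * sz c"
    proof -
      have "sz y \<le> K * sz (\<kappa> c)" unfolding y_def by (rule iso[OF \<kappa>c])
      also have "\<dots> \<le> K * (C1 * sz c)" by (intro mult_le_mono2 C1 c(1))
      finally show ?thesis unfolding cA by (simp add: algebra_simps)
    qed
    moreover have "c = (\<Sum>i<card A. \<omega> i)" using cs \<omega>(1) by simp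
    ultimately show ?thesis by blast
  qed
  moreover have "finite W" using S(1) by (simp add: W_def)
  moreover have "w \<in> Free S \<and> cayley_d w = 0" if "w \<in> W" for w
    using that t \<chi>t hmD(1)[OF \<rho> bas_Free] \<rho>_cycle[OF bas_Free] by (auto simp: W_def)
  ultimately show ?thesis by (intro exI[of _ "K * C1 + 1"] exI[of _ W]) blast
qed

end

text \<open>Used for a subgroup \<open>K\<close>, to prove that the group is finitely generated, and
  for a set \<open>K\<close> of vertices, where the value on a boundary is a flux.\<close>

definition partial_aug :: "'g set \<Rightarrow> ('j \<Rightarrow> 'g \<Rightarrow> 'u::ring) \<Rightarrow> 'u" where
  "partial_aug K b = (\<Sum>p\<in>supp b. if snd p \<in> K then b (fst p) (snd p) else 0)"

context group_coeff
begin

lemma partial_aug_superset: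
  "finite T \<Longrightarrow> supp b \<subseteq> T \<Longrightarrow> partial_aug K b = (\<Sum>p\<in>T. if snd p \<in> K then b (fst p) (snd p) else 0)"
  unfolding partial_aug_def by (rule sum.mono_neutral_left) (auto simp: supp_def)

lemma partial_aug_add:
  assumes "b \<in> Free J" "c \<in> Free J"
  shows "partial_aug K (b + c) = partial_aug K b + partial_aug K c"
proof -
  let ?T = "supp b \<union> supp c"
  have T: "finite ?T" using FreeD(2) assms by auto
  have "partial_aug K (b + c) = (\<Sum>p\<in>?T. (if snd p \<in> K then b (fst p) (snd p) else 0) +
      (if snd p \<in> K then c (fst p) (snd p) else 0))"
    unfolding partial_aug_superset[OF T supp_add] by (rule sum.cong) auto
  then show ?thesis
    using partial_aug_superset[OF T, of b] partial_aug_superset[OF T, of c] by (simp add: sum.distrib)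
qed

lemma partial_aug_zero [simp]: "partial_aug K 0 = 0"
  by (simp add: partial_aug_def)

lemma partial_aug_uminus:
  assumes "b \<in> Free J" shows "partial_aug K (- b) = - partial_aug K b"
  using partial_aug_add[OF assms submod_uminus[OF submod_Free assms], of K] by (simp add: minus_unique)

lemma partial_aug_diff: "b \<in> Free J \<Longrightarrow> c \<in> Free J \<Longrightarrow> partial_aug K (b - c) = partial_aug K b - partial_aug K c"
  using partial_aug_add[of b J "- c" K] partial_aug_uminus[of c J K] submod_uminus[OF submod_Free, of c J] by simp

lemma partial_aug_sc:
  assumes "b \<in> Free J"
  shows "partial_aug K (sc r b) = r * partial_aug K b"
proof -
  have "partial_aug K (sc r b) = (\<Sum>p\<in>supp b. r * (if snd p \<in> K then b (fst p) (snd p) else 0))"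
    unfolding partial_aug_superset[OF FreeD(2)[OF assms] supp_sc] by (rule sum.cong) (auto simp: sc_def)
  then show ?thesis by (simp add: partial_aug_def sum_distrib_left)
qed

lemma partial_aug_act_bas:
  assumes "g \<in> carrier G"
  shows "partial_aug K (act g (bas j)) = (if g \<in> K then e else 0)"
proof -
  have "partial_aug K (act g (bas j)) = (\<Sum>p\<in>{(j, g)}. if snd p \<in> K then act g (bas j) (fst p) (snd p) else 0)"
  proof (rule partial_aug_superset)
    show "supp (act g (bas j)) \<subseteq> {(j, g)}"
      using supp_act[OF assms bas_Free[of j UNIV]] assms by (auto simp: supp_def bas_def split: if_splits)
  qed simp
  moreover have "act g (bas j) j g = e" using assms by (simp add: act_def bas_def)
  ultimately show ?thesis by simp
qed

lemma partial_aug_ext: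
  assumes n: "\<And>j. j \<in> J \<Longrightarrow> n j \<in> Free I" and b: "b \<in> Free J"
  shows "partial_aug K (ext n b) = (\<Sum>p\<in>supp b. b (fst p) (snd p) * partial_aug K (act (snd p) (n (fst p))))"
proof -
  let ?h = "\<lambda>p. sc (b (fst p) (snd p)) (act (snd p) (n (fst p)))"
  have mem: "b (fst p) (snd p) \<in> Rs" "act (snd p) (n (fst p)) \<in> Free I" if "p \<in> supp b" for p
    using that FreeD[OF b] n by (auto intro!: act_Free)
  have "partial_aug K (sum ?h A) = (\<Sum>p\<in>A. b (fst p) (snd p) * partial_aug K (act (snd p) (n (fst p))))"
    if "finite A" "A \<subseteq> supp b" for A
    using that
  proof (induct A)
    case empty
    show "partial_aug K (sum ?h {}) = (\<Sum>p\<in>{}. b (fst p) (snd p) * partial_aug K (act (snd p) (n (fst p))))"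
      by simp
  next
    case (insert q F)
    have hF: "?h p \<in> Free I" if "p \<in> supp b" for p using mem[OF that] by (rule sc_Free)
    then have "sum ?h F \<in> Free I" "?h q \<in> Free I" using insert by (auto intro!: submod_sum[OF submod_Free])
    then have "partial_aug K (?h q + sum ?h F) = partial_aug K (?h q) + partial_aug K (sum ?h F)"
      by (intro partial_aug_add)
    moreover have "partial_aug K (?h q) = b (fst q) (snd q) * partial_aug K (act (snd q) (n (fst q)))"
      using mem(2)[of q] insert by (intro partial_aug_sc[of _ I]) auto
    ultimately show "partial_aug K (sum ?h (insert q F)) =
        (\<Sum>p\<in>insert q F. b (fst p) (snd p) * partial_aug K (act (snd p) (n (fst p))))"
      using insert by simp
  qed
  from this[OF FreeD(2)[OF b] subset_refl] show ?thesis by (simp add: ext_def)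
qed

text \<open>The support of the translate lies in the coset of \<open>H\<close> through
  \<open>g\<close>, which is either \<open>H\<close> itself or disjoint from it.\<close>

lemma partial_aug_subgroup:
  assumes H: "subgroup H G" and g: "g \<in> carrier G" and b: "b \<in> Free J" "snd ` supp b \<subseteq> H"
  shows "partial_aug H (act g b) = (if g \<in> H then aug b else 0)"
proof -
  have "partial_aug H (act g b) = (\<Sum>p\<in>supp b. if g \<otimes> snd p \<in> H then act g b (fst p) (g \<otimes> snd p) else 0)"
    unfolding partial_aug_def supp_act[OF g b(1)]
    by (subst sum.reindex[OF inj_supp_act[OF g b(1)]]) (simp only: o_def fst_conv snd_conv)
  also have "\<dots> = (\<Sum>p\<in>supp b. if g \<in> H then b (fst p) (snd p) else 0)"
  proof (rule sum.cong)
    fix p assume p: "p \<in> supp b"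
    then have x: "snd p \<in> H" using b(2) by auto
    then have xG: "snd p \<in> carrier G" by (rule subgroup.mem_carrier[OF H])
    have "g \<otimes> snd p \<in> H \<longleftrightarrow> g \<in> H"
      using H x xG g by (metis inv_solve_right subgroup.m_closed subgroup.m_inv_closed subgroup.mem_carrier)
    moreover have "act g b (fst p) (g \<otimes> snd p) = b (fst p) (snd p)"
      using xG g by (simp add: act_def m_assoc[symmetric])
    ultimately show "(if g \<otimes> snd p \<in> H then act g b (fst p) (g \<otimes> snd p) else 0) =
        (if g \<in> H then b (fst p) (snd p) else 0)" by simp
  qed simp
  also have "\<dots> = (if g \<in> H then aug b else 0)" by (simp add: aug_def)
  finally show ?thesis .
qed

end

section \<open>Finite generation of the group\<close>

context projective_resolution
begin

text \<open>Sum coefficients over the subgroup \<open>H\<close> generated by the finitely many group elements that occur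
  in the presentation matrix of the trivial module: this kills all relations, so that \<open>g p0 - p0\<close> being
  a relation forces \<open>g \<in> H\<close>.\<close>

lemma finitely_generated:
  assumes "e \<noteq> 0"
  shows "\<exists>S. finite S \<and> S \<subseteq> carrier G \<and> generate G S = carrier G"
proof -
  obtain U V where U: "hm (P 0) U (Free (words G 0))" and aU: "\<And>p. p \<in> P 0 \<Longrightarrow> aug (U p) = ep p"
    using comparison_maps_0 by metis
  obtain p0 where p0: "p0 \<in> P 0" "ep p0 = e" using ep_onto by blast
  have d0: "hm (P 1) (d 0) (P 0)" using d_hm[of 0] by simp
  have Ud: "hm (P 1) (\<lambda>p. U (d 0 p)) (Free (words G 0))" by (rule hm_comp[OF d0 U])
  define y where "y j = U (d 0 (s 1 j))" for j
  have s1: "s 1 j \<in> P 1" if "j < m 1" for j using projD(3)[OF P_proj] that by simp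
  have yF: "y j \<in> Free (words G 0)" "aug (y j) = 0" if "j \<in> {..<m 1}" for j
  proof -
    have j: "j < m 1" using that by simp
    show "y j \<in> Free (words G 0)" unfolding y_def using hmD(1)[OF Ud s1[OF j]] .
    have "d 0 (s 1 j) \<in> pker 0" using d_in_pker[of "s 1 j" 0] s1[OF j] by simp
    then show "aug (y j) = 0" using aU by (simp add: y_def pker_def)
  qed
  have UF: "U p0 \<in> Free (words G 0)" "aug (U p0) = e" using hmD(1)[OF U p0(1)] aU p0 by auto
  define S where "S = snd ` supp (U p0) \<union> (\<Union>j\<in>{..<m 1}. snd ` supp (y j))"
  have finS: "finite S" unfolding S_def using FreeD(2)[OF UF(1)] FreeD(2)[OF yF(1)] by auto
  have SG: "S \<subseteq> carrier G"
  proof -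
    have "snd ` supp (U p0) \<subseteq> carrier G" using FreeD(5)[OF UF(1)] by auto
    moreover have "snd ` supp (y j) \<subseteq> carrier G" if "j \<in> {..<m 1}" for j using FreeD(5)[OF yF(1)[OF that]] by auto
    ultimately show ?thesis unfolding S_def by blast
  qed
  define H where "H = generate G S"
  have H: "subgroup H G" unfolding H_def by (rule generate_is_subgroup[OF SG])
  have SH: "S \<subseteq> H" unfolding H_def by (auto intro: generate.incl)
  have "g \<in> H" if g: "g \<in> carrier G" for g
  proof (rule ccontr)
    assume gH: "g \<notin> H"
    have gp: "act g p0 \<in> P 0" using submodD(5)[OF P_submod g p0(1)] .
    have "act g p0 - p0 \<in> pker 0"
      using submod_diff[OF P_submod gp p0(1)] ep_diff[OF gp p0(1)] ep_act[OF g p0(1)] by (simp add: pker_def)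
    then obtain q where q: "q \<in> P 1" "d 0 q = act g p0 - p0" using pker_exact[of _ 0] by auto
    have "partial_aug H (U (d 0 q)) = 0"
    proof -
      have "U (d 0 q) = ext y q" unfolding y_def by (rule proj_hm_eq_ext[OF P_proj Ud q(1)])
      then have "partial_aug H (U (d 0 q)) = (\<Sum>p\<in>supp q. q (fst p) (snd p) * partial_aug H (act (snd p) (y (fst p))))"
        using partial_aug_ext[OF yF(1) P_Free[OF q(1)], where K = H] by simp
      also have "\<dots> = 0"
      proof (rule sum.neutral, rule ballI)
        fix p assume "p \<in> supp q"
        then have p: "fst p \<in> {..<m 1}" "snd p \<in> carrier G" using FreeD(5)[OF P_Free[OF q(1)]] by auto
        have "snd ` supp (y (fst p)) \<subseteq> H" using SH p(1) unfolding S_def by blast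
        then show "q (fst p) (snd p) * partial_aug H (act (snd p) (y (fst p))) = 0"
          using partial_aug_subgroup[OF H p(2) yF(1)[OF p(1)]] yF(2)[OF p(1)] by simp
      qed
      finally show ?thesis .
    qed
    moreover have "U (d 0 q) = act g (U p0) - U p0"
      unfolding q(2) using hm_diff[OF U P_submod submod_Free gp p0(1)] hmD(4)[OF U g p0(1)] by simp
    moreover have "snd ` supp (U p0) \<subseteq> H" using SH unfolding S_def by blast
    then have "partial_aug H (act g (U p0)) = 0" "partial_aug H (act \<one> (U p0)) = e"
      using partial_aug_subgroup[OF H g UF(1)] partial_aug_subgroup[OF H one_closed UF(1)] gH
        subgroup.one_closed[OF H] UF(2) by auto
    ultimately show False
      using partial_aug_diff[OF act_Free[OF g UF(1)] UF(1), of H] act_one[OF UF(1)] assms by simp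
  qed
  then have "generate G S = carrier G" using subgroup.subset[OF H] by (auto simp: H_def)
  then show ?thesis using finS SG by blast
qed

end

section \<open>Word metrics\<close>

lemma (in group) symmetric_generating_set:
  assumes "finite S" "S \<subseteq> carrier G" "generate G S = carrier G"
  shows "\<exists>S'. finite S' \<and> S' \<subseteq> carrier G \<and> generate G S' = carrier G \<and> \<one> \<in> S' \<and> m_inv G ` S' = S'"
proof -
  let ?S = "insert \<one> (S \<union> m_inv G ` S)"
  have G: "?S \<subseteq> carrier G" using assms(2) by auto
  have "carrier G \<subseteq> generate G ?S" using assms(3) mono_generate[of S ?S] by auto
  moreover have "generate G ?S \<subseteq> carrier G" using generate_in_carrier[OF G] by auto
  moreover have "m_inv G ` ?S = ?S"
  proof -
    have "m_inv G ` m_inv G ` S = S" using assms(2) by (force simp: image_image subset_iff)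
    then show ?thesis by (simp add: image_Un Un_commute)
  qed
  ultimately show ?thesis using assms(1) G by (intro exI[of _ ?S]) auto
qed

text \<open>With \<open>S\<close> symmetric and containing the unit, two vertices have distance at
  most 1 exactly if they differ by right multiplication with an element of \<open>S\<close>; in
  particular a pausing step of a path is an edge as well.\<close>

locale cayley_graph = group G for G :: "('g, 'y) monoid_scheme" (structure) +
  fixes S :: "'g set"
  assumes S_carrier: "S \<subseteq> carrier G" and S_generates: "generate G S = carrier G"
    and S_one: "\<one> \<in> S" and S_inv: "m_inv G ` S = S"
begin

abbreviation prd :: "'g list \<Rightarrow> 'g" where
  "prd w \<equiv> foldr (\<otimes>) w \<one>"

lemma prd_closed: "set w \<subseteq> carrier G \<Longrightarrow> prd w \<in> carrier G"
  by (induction w) auto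

lemma prd_append: "set u \<subseteq> carrier G \<Longrightarrow> set v \<subseteq> carrier G \<Longrightarrow> prd (u @ v) = prd u \<otimes> prd v"
  by (induction u) (auto simp: prd_closed m_assoc)

lemma prd_rev: "set w \<subseteq> carrier G \<Longrightarrow> prd (rev (map (m_inv G) w)) = inv (prd w)"
proof (induction w)
  case (Cons x w)
  have "set (rev (map (m_inv G) w)) \<subseteq> carrier G" using Cons.prems by auto
  then have "prd (rev (map (m_inv G) w) @ [inv x]) = inv (prd w) \<otimes> inv x"
    using prd_append[of "rev (map (m_inv G) w)" "[inv x]"] Cons by simp
  then show ?case using Cons.prems by (simp add: inv_mult_group prd_closed)
qed simp

lemma word_ex:
  assumes "g \<in> carrier G"
  shows "\<exists>w. set w \<subseteq> S \<and> prd w = g"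
proof -
  have "g \<in> generate G S" using assms S_generates by simp
  then show ?thesis
  proof (induction rule: generate.induct)
    case one
    show ?case by (rule exI[of _ "[]"]) simp
  next
    case (incl h)
    then show ?case using S_carrier by (intro exI[of _ "[h]"]) auto
  next
    case (inv h)
    then have "inv h \<in> S" using S_inv by auto
    then show ?case using S_carrier by (intro exI[of _ "[inv h]"]) auto
  next
    case (eng h1 h2)
    then obtain u v where "set u \<subseteq> S" "prd u = h1" "set v \<subseteq> S" "prd v = h2" by blast
    then show ?case using prd_append[of u v] S_carrier by (intro exI[of _ "u @ v"]) auto
  qed
qed

abbreviation norm :: "'g \<Rightarrow> nat" where
  "norm \<equiv> word_norm G S"

lemma norm_eq: "norm g = (LEAST n. \<exists>w. length w = n \<and> set w \<subseteq> S \<and> prd w = g)"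
  by (simp add: word_norm_def S_inv)

lemma norm_word:
  assumes "g \<in> carrier G"
  obtains w where "length w = norm g" "set w \<subseteq> S" "prd w = g"
proof -
  have "\<exists>n w. length w = n \<and> set w \<subseteq> S \<and> prd w = g" using word_ex[OF assms] by blast
  then have "\<exists>w. length w = norm g \<and> set w \<subseteq> S \<and> prd w = g" unfolding norm_eq by (rule LeastI_ex)
  then show thesis using that by blast
qed

lemma norm_le: "set w \<subseteq> S \<Longrightarrow> prd w = g \<Longrightarrow> norm g \<le> length w"
  unfolding norm_eq by (rule Least_le) blast

lemma norm_one: "norm \<one> = 0"
  using norm_le[of "[]" \<one>] by simp

lemma norm_mult:
  assumes "g \<in> carrier G" "h \<in> carrier G"
  shows "norm (g \<otimes> h) \<le> norm g + norm h"
proof -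
  obtain u where u: "length u = norm g" "set u \<subseteq> S" "prd u = g" using norm_word[OF assms(1)] .
  obtain v where v: "length v = norm h" "set v \<subseteq> S" "prd v = h" using norm_word[OF assms(2)] .
  have "prd (u @ v) = g \<otimes> h" using u v S_carrier by (subst prd_append) auto
  then show ?thesis using norm_le[of "u @ v"] u v by simp
qed

lemma norm_inv_le: "g \<in> carrier G \<Longrightarrow> norm (inv g) \<le> norm g"
proof -
  assume g: "g \<in> carrier G"
  obtain u where u: "length u = norm g" "set u \<subseteq> S" "prd u = g" using norm_word[OF g] .
  have "prd (rev (map (m_inv G) u)) = inv g" using prd_rev[of u] u S_carrier by auto
  moreover have "set (rev (map (m_inv G) u)) \<subseteq> S" using u S_inv by auto
  ultimately show ?thesis using norm_le[of "rev (map (m_inv G) u)"] u by simp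
qed

lemma norm_inv: "g \<in> carrier G \<Longrightarrow> norm (inv g) = norm g"
  using norm_inv_le[of g] norm_inv_le[of "inv g"] by simp

lemma norm_le_1: "g \<in> S \<Longrightarrow> norm g \<le> 1"
  using norm_le[of "[g]" g] S_carrier by auto

lemma norm_le_1_D:
  assumes "g \<in> carrier G" "norm g \<le> 1"
  shows "g \<in> S"
proof -
  obtain w where w: "length w = norm g" "set w \<subseteq> S" "prd w = g" using norm_word[OF assms(1)] .
  have "length w \<le> 1" using w(1) assms(2) by simp
  then consider "w = []" | s where "w = [s]" by (cases w) auto
  then show ?thesis using w S_one S_carrier by cases auto
qed

abbreviation dst :: "'g \<Rightarrow> 'g \<Rightarrow> nat" where
  "dst x y \<equiv> norm (inv x \<otimes> y)"

sublocale discrete_geodesic_space "carrier G" dst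
proof
  show "dst x x = 0" if "x \<in> carrier G" for x using that by (simp add: norm_one)
  show "dst x y = dst y x" if "x \<in> carrier G" "y \<in> carrier G" for x y
    using norm_inv[of "inv x \<otimes> y"] that by (simp add: inv_mult_group)
  show "dst x z \<le> dst x y + dst y z" if "x \<in> carrier G" "y \<in> carrier G" "z \<in> carrier G" for x y z
  proof -
    have "y \<otimes> (inv y \<otimes> z) = z" using that by (simp add: m_assoc[symmetric])
    then have "inv x \<otimes> z = (inv x \<otimes> y) \<otimes> (inv y \<otimes> z)" using that by (simp add: m_assoc)
    then show ?thesis using norm_mult[of "inv x \<otimes> y" "inv y \<otimes> z"] that by simp
  qed
  show "\<exists>p. p 0 = x \<and> p (dst x y) = y \<and> (\<forall>i\<le>dst x y. p i \<in> carrier G) \<and> (\<forall>i<dst x y. dst (p i) (p (Suc i)) \<le> 1)"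
    if x: "x \<in> carrier G" and y: "y \<in> carrier G" for x y
  proof -
    have "inv x \<otimes> y \<in> carrier G" using x y by simp
    then obtain w where w: "length w = dst x y" "set w \<subseteq> S" "prd w = inv x \<otimes> y" by (rule norm_word)
    let ?p = "\<lambda>i. x \<otimes> prd (take i w)"
    have tk: "set (take i w) \<subseteq> carrier G" for i using w(2) S_carrier set_take_subset by (metis subset_trans)
    have step: "dst (?p i) (?p (Suc i)) \<le> 1" if i: "i < dst x y" for i
    proof -
      have wi: "w ! i \<in> S" using i w by (auto simp: nth_mem subset_iff)
      then have wG: "w ! i \<in> carrier G" using S_carrier by auto
      have "take (Suc i) w = take i w @ [w ! i]" using i w by (simp add: take_Suc_conv_app_nth)
      then have "prd (take (Suc i) w) = prd (take i w) \<otimes> w ! i"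
        using prd_append[OF tk[of i], of "[w ! i]"] wG by simp
      then have "?p (Suc i) = ?p i \<otimes> w ! i" "?p i \<in> carrier G"
        using prd_closed[OF tk[of i]] wG x by (simp_all add: m_assoc)
      then have "inv (?p i) \<otimes> ?p (Suc i) = w ! i"
        using wG by (simp add: m_assoc[symmetric])
      then show ?thesis using norm_le_1[OF wi] by simp
    qed
    have "?p (dst x y) = y" using w x y by (simp add: m_assoc[symmetric])
    then show ?thesis using step x prd_closed[OF tk] by (intro exI[of _ ?p]) auto
  qed
qed

end

section \<open>Cellular chains as functions on oriented edges\<close>

context group_coeff
begin

text \<open>The basis element of a generator \<open>s\<close>, translated by \<open>x\<close>,
  becomes the edge from \<open>x\<close> to \<open>x s\<close>.\<close>

definition edge_chain :: "('g \<Rightarrow> 'g \<Rightarrow> 'u) \<Rightarrow> 'g \<times> 'g \<Rightarrow> 'u" where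
  "edge_chain c = (\<lambda>(x, y). if x \<in> carrier G \<and> y \<in> carrier G then c (inv x \<otimes> y) x else 0)"

lemma edge_chain_sum: "edge_chain (sum f A) = (\<Sum>i\<in>A. edge_chain (f i))"
proof -
  have "edge_chain (b + c) = edge_chain b + edge_chain c" for b c
    by (auto simp: edge_chain_def fun_eq_iff)
  moreover have "edge_chain 0 = 0" by (auto simp: edge_chain_def fun_eq_iff)
  ultimately show ?thesis using sum_comp_morphism[of edge_chain f A] by (simp add: o_def)
qed

lemma edge_supp_edge_chain:
  assumes S: "S \<subseteq> carrier G" and c: "c \<in> Free S"
  shows "edge_supp (edge_chain c) = (\<lambda>q. (snd q, snd q \<otimes> fst q)) ` supp c"
proof
  show "edge_supp (edge_chain c) \<subseteq> (\<lambda>q. (snd q, snd q \<otimes> fst q)) ` supp c"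
  proof
    fix p assume "p \<in> edge_supp (edge_chain c)"
    then obtain x y where p: "p = (x, y)" "x \<in> carrier G" "y \<in> carrier G" "c (inv x \<otimes> y) x \<noteq> 0"
      by (cases p) (auto simp: edge_supp_def edge_chain_def split: if_splits)
    then have "p = (x, x \<otimes> (inv x \<otimes> y))" by (simp add: m_assoc[symmetric])
    then show "p \<in> (\<lambda>q. (snd q, snd q \<otimes> fst q)) ` supp c"
      using p by (intro image_eqI[of _ _ "(inv x \<otimes> y, x)"]) (auto simp: supp_def)
  qed
  show "(\<lambda>q. (snd q, snd q \<otimes> fst q)) ` supp c \<subseteq> edge_supp (edge_chain c)"
  proof
    fix p assume "p \<in> (\<lambda>q. (snd q, snd q \<otimes> fst q)) ` supp c"
    then obtain a x where q: "c a x \<noteq> 0" "p = (x, x \<otimes> a)" by (auto simp: supp_def)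
    then have "a \<in> carrier G" "x \<in> carrier G" using FreeD(3,4)[OF c q(1)] S by auto
    then show "p \<in> edge_supp (edge_chain c)"
      using q by (simp add: edge_supp_def edge_chain_def m_assoc[symmetric])
  qed
qed

lemma inj_edge: "S \<subseteq> carrier G \<Longrightarrow> c \<in> Free S \<Longrightarrow> inj_on (\<lambda>q. (snd q, snd q \<otimes> fst q)) (supp c)"
proof (rule inj_onI)
  fix q q' assume S: "S \<subseteq> carrier G" and c: "c \<in> Free S" and q: "q \<in> supp c" "q' \<in> supp c"
    and eq: "(snd q, snd q \<otimes> fst q) = (snd q', snd q' \<otimes> fst q')"
  have "q \<in> S \<times> carrier G" "q' \<in> S \<times> carrier G" using FreeD(5)[OF c] q by blast+
  then have "fst q \<in> carrier G" "fst q' \<in> carrier G" "snd q \<in> carrier G" using S by auto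
  moreover have "snd q = snd q'" "snd q \<otimes> fst q = snd q' \<otimes> fst q'" using eq by auto
  ultimately have "fst q = fst q'" by (metis inv_solve_left m_closed)
  then show "q = q'" using \<open>snd q = snd q'\<close> by (simp add: prod_eq_iff)
qed

text \<open>Links the algebraic notion of a cycle, \<open>cayley_d c = 0\<close>, to the one by
  fluxes in the geometric argument: the boundary of an edge is its end minus its start.\<close>

lemma flux_edge_chain:
  assumes S: "S \<subseteq> carrier G" and c: "c \<in> Free S"
  shows "flux K (edge_chain c) = partial_aug K (cayley_d c)"
proof -
  have "flux K (edge_chain c) = (\<Sum>q\<in>supp c. (if snd q \<otimes> fst q \<in> K then edge_chain c (snd q, snd q \<otimes> fst q) else 0) -
      (if snd q \<in> K then edge_chain c (snd q, snd q \<otimes> fst q) else 0))"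
    unfolding flux_def edge_supp_edge_chain[OF S c]
    by (subst sum.reindex[OF inj_edge[OF S c]]) (simp only: o_def fst_conv snd_conv)
  also have "\<dots> = (\<Sum>q\<in>supp c. c (fst q) (snd q) * partial_aug K (act (snd q) (cayley_bd (fst q))))"
  proof (rule sum.cong)
    fix q assume "q \<in> supp c"
    then have "q \<in> S \<times> carrier G" using FreeD(5)[OF c] by blast
    then have q: "fst q \<in> carrier G" "snd q \<in> carrier G" using S by auto
    have "act (snd q) (cayley_bd (fst q)) = act (snd q \<otimes> fst q) (bas []) - act (snd q) (bas [])"
      using q by (simp add: cayley_bd_def act_act)
    then have "partial_aug K (act (snd q) (cayley_bd (fst q))) =
        (if snd q \<otimes> fst q \<in> K then e else 0) - (if snd q \<in> K then e else 0)"
      using partial_aug_diff[OF act_Free[OF _ bas_nil] act_Free[OF _ bas_nil], of "snd q \<otimes> fst q" "snd q" K] q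
      by (simp add: partial_aug_act_bas)
    moreover have "edge_chain c (snd q, snd q \<otimes> fst q) = c (fst q) (snd q)"
      using q by (simp add: edge_chain_def m_assoc[symmetric])
    ultimately show "(if snd q \<otimes> fst q \<in> K then edge_chain c (snd q, snd q \<otimes> fst q) else 0) -
        (if snd q \<in> K then edge_chain c (snd q, snd q \<otimes> fst q) else 0) =
        c (fst q) (snd q) * partial_aug K (act (snd q) (cayley_bd (fst q)))"
      using FreeD(1)[OF c] by (auto simp: right_diff_distrib)
  qed simp
  also have "\<dots> = partial_aug K (cayley_d c)"
    by (rule partial_aug_ext[OF cayley_bd_Free c, symmetric]) (use S in auto)
  finally show ?thesis .
qed

text \<open>Translations are isometries and scalars do not enlarge supports, so the finiteness of
  \<open>W\<close> gives a single \<open>D\<close> for which all cycles in all fillings are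
  small.\<close>

theorem hyperbolic_of_linear_filling:
  assumes "e \<noteq> 0" and S: "finite S" "S \<subseteq> carrier G" "generate G S = carrier G" "\<one> \<in> S" "m_inv G ` S = S"
    and W: "finite W" "\<And>w. w \<in> W \<Longrightarrow> w \<in> Free S \<and> cayley_d w = 0"
    and fill: "\<And>c. c \<in> Free S \<Longrightarrow> cayley_d c = 0 \<Longrightarrow> \<exists>N \<omega>. N \<le> C * sz c \<and> c = (\<Sum>i<N. \<omega> i) \<and>
      (\<forall>i<N. \<exists>w\<in>W. \<exists>r\<in>Rs. \<exists>g\<in>carrier G. \<omega> i = sc r (act g w))"
  shows "gromov_hyperbolic (carrier G) (word_dist G S)"
proof -
  interpret cayley_graph G S by unfold_locales (use S in auto)
  define B where "B = (\<Union>w\<in>W. (\<lambda>(p, q). dst (snd p) (snd q)) ` (supp w \<times> supp w))"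
  \<comment> \<open>The set \<open>B\<close> contains the distances between starting points of
    edges; the additional 1 accounts for their ends.\<close>
  define D where "D = Max (insert 0 ((\<lambda>w. card (supp w)) ` W)) + Max (insert 0 B) + 1"
  have finB: "finite B" unfolding B_def using W FreeD(2) by (auto intro!: finite_imageI)
  have small: "small_cycle D (edge_chain (sc r (act g w)))"
    if w: "w \<in> W" and r: "r \<in> Rs" and g: "g \<in> carrier G" for w r g
  proof -
    let ?c = "sc r (act g w)"
    have wF: "w \<in> Free S" "cayley_d w = 0" using W(2)[OF w] by auto
    have cF: "?c \<in> Free S" by (rule sc_Free[OF r act_Free[OF g wF(1)]])
    have "cayley_d ?c = sc r (act g (cayley_d w))"
      using ext_sc[OF act_Free[OF g wF(1)], of cayley_bd r] ext_act[OF wF(1) g, of cayley_bd] by simp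
    then have c0: "cayley_d ?c = 0" using wF(2) by simp
    have supp_c: "supp ?c \<subseteq> (\<lambda>p. (fst p, g \<otimes> snd p)) ` supp w"
      using supp_sc[of r "act g w"] supp_act[OF g wF(1)] by simp
    have "card (edge_supp (edge_chain ?c)) = card (supp ?c)"
      unfolding edge_supp_edge_chain[OF S(2) cF] by (rule card_image[OF inj_edge[OF S(2) cF]])
    also have "\<dots> \<le> card (supp w)"
      using card_mono[OF finite_imageI[OF FreeD(2)[OF wF(1)]] supp_c] card_image_le[OF FreeD(2)[OF wF(1)]]
      by (rule le_trans)
    also have "\<dots> \<le> Max (insert 0 ((\<lambda>w. card (supp w)) ` W))" using W(1) w by (intro Max_ge) auto
    finally have card: "card (edge_supp (edge_chain ?c)) \<le> D" by (simp add: D_def)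
    have edge: "\<exists>p\<in>supp w. u = g \<otimes> snd p \<and> snd p \<in> carrier G \<and> v \<in> carrier G \<and> inv u \<otimes> v \<in> S"
      if "edge_chain ?c (u, v) \<noteq> 0" for u v
    proof -
      have uv: "u \<in> carrier G" "v \<in> carrier G" "?c (inv u \<otimes> v) u \<noteq> 0"
        using that by (auto simp: edge_chain_def split: if_splits)
      then have "(inv u \<otimes> v, u) \<in> supp ?c" by (simp add: supp_def)
      then obtain p where p: "p \<in> supp w" "u = g \<otimes> snd p" using supp_c by auto
      have "snd p \<in> carrier G" using FreeD(5)[OF wF(1)] p(1) by auto
      then show ?thesis using p uv FreeD(3)[OF cF uv(3)] by blast
    qed
    show ?thesis
      unfolding small_cycle_def
    proof (intro conjI allI impI)
      show "finite (edge_supp (edge_chain ?c))"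
        unfolding edge_supp_edge_chain[OF S(2) cF] using FreeD(2)[OF cF] by simp
      show "flux K (edge_chain ?c) = 0" for K using flux_edge_chain[OF S(2) cF, of K] c0 by simp
    next
      fix u v assume uv: "edge_chain ?c (u, v) \<noteq> 0"
      obtain p where "p \<in> supp w" "u = g \<otimes> snd p" "snd p \<in> carrier G" "v \<in> carrier G" "inv u \<otimes> v \<in> S"
        using edge[OF uv] by blast
      then show "u \<in> carrier G" "v \<in> carrier G" "dst u v \<le> 1" using g norm_le_1 by auto
    next
      fix u v u' v' assume uv: "edge_chain ?c (u, v) \<noteq> 0" and uv': "edge_chain ?c (u', v') \<noteq> 0"
      obtain p where p: "p \<in> supp w" "u = g \<otimes> snd p" "snd p \<in> carrier G" "v \<in> carrier G" "inv u \<otimes> v \<in> S"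
        using edge[OF uv] by blast
      obtain p' where p': "p' \<in> supp w" "u' = g \<otimes> snd p'" "snd p' \<in> carrier G"
        using edge[OF uv'] by blast
      have "inv u \<otimes> u' = inv (snd p) \<otimes> (inv g \<otimes> (g \<otimes> snd p'))"
        using p p' g by (simp add: inv_mult_group m_assoc)
      also have "inv g \<otimes> (g \<otimes> snd p') = snd p'" using p' g by (simp add: m_assoc[symmetric])
      finally have "dst u u' = dst (snd p) (snd p')" by simp
      moreover have "dst (snd p) (snd p') \<in> B"
        unfolding B_def using w p(1) p'(1) by (intro UN_I[OF w] image_eqI[of _ _ "(p, p')"]) auto
      then have "dst (snd p) (snd p') \<le> Max (insert 0 B)" using finB by (intro Max_ge) auto
      ultimately have uu: "dst u u' \<le> Max (insert 0 B)" by simp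
      have V: "u \<in> carrier G" "u' \<in> carrier G" using p p' g by auto
      have "dst v u' \<le> dst v u + dst u u'" using p(4) V by (intro d_tri)
      moreover have "dst v u = dst u v" using p(4) V by (intro d_sym)
      moreover have "dst u v \<le> 1" using norm_le_1[OF p(5)] .
      ultimately show "dst u u' \<le> D" "dst v u' \<le> D" using uu by (auto simp: D_def)
    qed (rule card)
  qed
  have "linear_isoperimetric_space (carrier G) dst e C D"
  proof unfold_locales
    show "e \<noteq> 0" by fact
    fix p n assume p: "is_path p n" "p n = p 0"
    \<comment> \<open>The step from \<open>p k\<close> to \<open>p (Suc k)\<close> is the translate
      by \<open>p k\<close> of the edge that starts at the unit and carries the quotient of the two
      points as its label.\<close>
    define c where "c = (\<Sum>k<n. act (p k) (bas (inv (p k) \<otimes> p (Suc k))))"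
    have pG: "p k \<in> carrier G" if "k \<le> n" for k using p(1) that by (simp add: is_path_def)
    have pS: "inv (p k) \<otimes> p (Suc k) \<in> S" if "k < n" for k
      using p(1) that pG[of k] pG[of "Suc k"] by (intro norm_le_1_D) (auto simp: is_path_def)
    have F: "act (p k) (bas (inv (p k) \<otimes> p (Suc k))) \<in> Free S" if "k \<in> {..<n}" for k
      using pG[of k] pS[of k] that by (intro act_Free bas_Free) auto
    have cF: "c \<in> Free S" unfolding c_def by (rule submod_sum[OF submod_Free F])
    have "cayley_d c = (\<Sum>k<n. cayley_d (act (p k) (bas (inv (p k) \<otimes> p (Suc k)))))"
      unfolding c_def by (rule hm_sum[OF hm_cayley_d[OF S(2)] submod_Free F])
    also have "\<dots> = (\<Sum>k<n. act (p (Suc k)) (bas []) - act (p k) (bas []))"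
    proof (rule sum.cong)
      fix k assume "k \<in> {..<n}"
      then have k: "k < n" "p k \<in> carrier G" "p (Suc k) \<in> carrier G" "inv (p k) \<otimes> p (Suc k) \<in> S"
        using pG[of k] pG[of "Suc k"] pS by auto
      let ?s = "inv (p k) \<otimes> p (Suc k)"
      have sG: "?s \<in> carrier G" using k by simp
      have "cayley_d (act (p k) (bas ?s)) = act (p k) (cayley_bd ?s)"
        using ext_act[OF bas_Free[OF k(4)] k(2), of cayley_bd] ext_bas[of cayley_bd ?s, OF cayley_bd_Free[OF sG]] by simp
      also have "\<dots> = act (p k \<otimes> ?s) (bas []) - act (p k) (bas [])"
        using k sG by (simp add: cayley_bd_def act_act)
      also have "p k \<otimes> ?s = p (Suc k)" using k by (simp add: m_assoc[symmetric])
      finally show "cayley_d (act (p k) (bas ?s)) = act (p (Suc k)) (bas []) - act (p k) (bas [])" .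
    qed simp
    also have "\<dots> = act (p n) (bas []) - act (p 0) (bas [])"
      by (rule sum_lessThan_telescope)
    finally have c0: "cayley_d c = 0" using p(2) by simp
    have "sz c \<le> (\<Sum>k<n. sz (act (p k) (bas (inv (p k) \<otimes> p (Suc k)))))"
      unfolding c_def by (rule sz_sum[OF F])
    also have "\<dots> \<le> (\<Sum>k<n. 1)"
    proof (rule sum_mono)
      fix k assume "k \<in> {..<n}"
      then have "p k \<in> carrier G" using pG[of k] by auto
      then have "sz (act (p k) (bas (inv (p k) \<otimes> p (Suc k)))) = sz (bas (inv (p k) \<otimes> p (Suc k)))"
        by (rule sz_act[OF _ bas_Free[OF UNIV_I]])
      also have "\<dots> \<le> card {(inv (p k) \<otimes> p (Suc k), \<one>)}"
        unfolding sz_def by (rule card_mono) (auto simp: supp_def bas_def split: if_splits)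
      finally show "sz (act (p k) (bas (inv (p k) \<otimes> p (Suc k)))) \<le> 1" by simp
    qed
    finally have szc: "sz c \<le> n" by simp
    have "edge_chain c = (\<Sum>k<n. edge_chain (act (p k) (bas (inv (p k) \<otimes> p (Suc k)))))"
      unfolding c_def by (rule edge_chain_sum)
    also have "\<dots> = (\<Sum>k<n. sgl (p k, p (Suc k)) e)"
    proof (rule sum.cong)
      fix k assume "k \<in> {..<n}"
      then have k: "p k \<in> carrier G" "p (Suc k) \<in> carrier G" using pG[of k] pG[of "Suc k"] by auto
      show "edge_chain (act (p k) (bas (inv (p k) \<otimes> p (Suc k)))) = sgl (p k, p (Suc k)) e"
      proof (intro HOL.ext)
        fix q :: "'g \<times> 'g"
        obtain x y where q: "q = (x, y)" by (cases q)
        have a: "act (p k) (bas (inv (p k) \<otimes> p (Suc k))) (inv x \<otimes> y) x =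
            (if x = p k \<and> inv x \<otimes> y = inv (p k) \<otimes> p (Suc k) then e else 0)"
          if "x \<in> carrier G"
        proof -
          have "inv (p k) \<otimes> x = \<one> \<longleftrightarrow> x = p k"
            using that k by (metis inv_closed inv_inv inv_equality l_inv)
          then show ?thesis using that by (auto simp: act_def bas_def)
        qed
        show "edge_chain (act (p k) (bas (inv (p k) \<otimes> p (Suc k)))) q = sgl (p k, p (Suc k)) e q"
          unfolding q edge_chain_def sgl_def prod.case using a k by auto
      qed
    qed simp
    finally have pc: "path_chain e p 0 n = edge_chain c"
      by (simp add: path_chain_def atLeast0LessThan)
    obtain N \<omega> where N: "N \<le> C * sz c" and c\<omega>: "c = (\<Sum>i<N. \<omega> i)"
      and \<omega>: "\<And>i. i < N \<Longrightarrow> \<exists>w\<in>W. \<exists>r\<in>Rs. \<exists>g\<in>carrier G. \<omega> i = sc r (act g w)"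
      using fill[OF cF c0] by blast
    have "path_chain e p 0 n = (\<Sum>i<N. edge_chain (\<omega> i))"
      unfolding pc using c\<omega> edge_chain_sum[of \<omega> "{..<N}"] by simp
    moreover have "small_cycle D (edge_chain (\<omega> i))" if "i < N" for i
      using \<omega>[OF that] small by auto
    moreover have "N \<le> C * n" using N szc by (meson le_trans mult_le_mono2)
    ultimately show "\<exists>N \<omega>. N \<le> C * n \<and> path_chain e p 0 n = (\<Sum>i<N. \<omega> i) \<and> (\<forall>i<N. small_cycle D (\<omega> i))"
      by (intro exI[of _ N] exI[of _ "\<lambda>i. edge_chain (\<omega> i)"]) auto
  qed
  then have "gromov_hyperbolic (carrier G) (\<lambda>x y. real (dst x y))"
    by (rule linear_isoperimetric_space.gromov_hyperbolic)
  then show ?thesis by (simp add: word_dist_def[abs_def])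
qed

end

section \<open>Modules and cohomology over the group ring\<close>

text \<open>Free for finite \<open>S\<close>, the only case that occurs. With \<open>S\<close>
  inside the carrier of a module, the carrier type is the one that \<open>lmod_projective\<close>
  admits for the source of a surjection.\<close>

definition free_lmod :: "('a, 'z) ring_scheme \<Rightarrow> 's set \<Rightarrow> ('a, 's \<Rightarrow> 'a) module" where
  "free_lmod A S = \<lparr>carrier = {c. (\<forall>s\<in>S. c s \<in> carrier A) \<and> (\<forall>s. s \<notin> S \<longrightarrow> c s = \<zero>\<^bsub>A\<^esub>)},
     mult = undefined, one = undefined, zero = (\<lambda>s. \<zero>\<^bsub>A\<^esub>),
     add = (\<lambda>c c' s. c s \<oplus>\<^bsub>A\<^esub> c' s), smult = (\<lambda>a c s. a \<otimes>\<^bsub>A\<^esub> c s)\<rparr>"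

lemma left_module_free_lmod:
  assumes "ring A"
  shows "left_module A (free_lmod A S)"
proof -
  interpret A: ring A by fact
  have "\<exists>y\<in>carrier (free_lmod A S). y \<oplus>\<^bsub>free_lmod A S\<^esub> x = \<zero>\<^bsub>free_lmod A S\<^esub>"
    if "x \<in> carrier (free_lmod A S)" for x
  proof
    show "(\<lambda>s. \<ominus>\<^bsub>A\<^esub> x s) \<in> carrier (free_lmod A S)" using that by (auto simp: free_lmod_def)
    show "(\<lambda>s. \<ominus>\<^bsub>A\<^esub> x s) \<oplus>\<^bsub>free_lmod A S\<^esub> x = \<zero>\<^bsub>free_lmod A S\<^esub>"
    proof
      fix s
      have "x s \<in> carrier A" using that by (cases "s \<in> S") (auto simp: free_lmod_def)
      then show "((\<lambda>s. \<ominus>\<^bsub>A\<^esub> x s) \<oplus>\<^bsub>free_lmod A S\<^esub> x) s = \<zero>\<^bsub>free_lmod A S\<^esub> s"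
        by (simp add: free_lmod_def A.l_neg)
    qed
  qed
  note inverse = this
  have in_A: "c s \<in> carrier A" if "c \<in> carrier (free_lmod A S)" for c s
    using that by (cases "s \<in> S") (auto simp: free_lmod_def)
  have ops: "add (free_lmod A S) = (\<lambda>c c' s. c s \<oplus>\<^bsub>A\<^esub> c' s)" "zero (free_lmod A S) = (\<lambda>s. \<zero>\<^bsub>A\<^esub>)"
    "smult (free_lmod A S) = (\<lambda>a c s. a \<otimes>\<^bsub>A\<^esub> c s)"
    by (simp_all add: free_lmod_def)
  have closed: "x \<oplus>\<^bsub>free_lmod A S\<^esub> y \<in> carrier (free_lmod A S)" "a \<odot>\<^bsub>free_lmod A S\<^esub> x \<in> carrier (free_lmod A S)"
    if "x \<in> carrier (free_lmod A S)" "y \<in> carrier (free_lmod A S)" "a \<in> carrier A" for x y a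
    using that by (simp_all add: free_lmod_def)
  have "abelian_group (free_lmod A S)"
  proof (rule abelian_groupI)
    show "\<zero>\<^bsub>free_lmod A S\<^esub> \<in> carrier (free_lmod A S)" by (simp add: free_lmod_def)
  next
    fix x y assume x: "x \<in> carrier (free_lmod A S)" and y: "y \<in> carrier (free_lmod A S)"
    show "x \<oplus>\<^bsub>free_lmod A S\<^esub> y \<in> carrier (free_lmod A S)" using closed(1)[OF x y A.zero_closed] .
    show "x \<oplus>\<^bsub>free_lmod A S\<^esub> y = y \<oplus>\<^bsub>free_lmod A S\<^esub> x"
      unfolding ops by (rule ext) (rule A.a_comm[OF in_A[OF x] in_A[OF y]])
  next
    fix x y z assume x: "x \<in> carrier (free_lmod A S)" "y \<in> carrier (free_lmod A S)" "z \<in> carrier (free_lmod A S)"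
    show "x \<oplus>\<^bsub>free_lmod A S\<^esub> y \<oplus>\<^bsub>free_lmod A S\<^esub> z = x \<oplus>\<^bsub>free_lmod A S\<^esub> (y \<oplus>\<^bsub>free_lmod A S\<^esub> z)"
      unfolding ops using A.a_assoc in_A x by simp
  next
    fix x assume x: "x \<in> carrier (free_lmod A S)"
    show "\<zero>\<^bsub>free_lmod A S\<^esub> \<oplus>\<^bsub>free_lmod A S\<^esub> x = x" unfolding ops using in_A[OF x] by simp
    show "\<exists>y\<in>carrier (free_lmod A S). y \<oplus>\<^bsub>free_lmod A S\<^esub> x = \<zero>\<^bsub>free_lmod A S\<^esub>" using inverse[OF x] .
  qed
  moreover have "left_module_axioms A (free_lmod A S)"
  proof
    fix a x assume a: "a \<in> carrier A" and x: "x \<in> carrier (free_lmod A S)"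
    show "a \<odot>\<^bsub>free_lmod A S\<^esub> x \<in> carrier (free_lmod A S)" using closed(2)[OF x x a] .
    fix y assume y: "y \<in> carrier (free_lmod A S)"
    show "a \<odot>\<^bsub>free_lmod A S\<^esub> (x \<oplus>\<^bsub>free_lmod A S\<^esub> y) = a \<odot>\<^bsub>free_lmod A S\<^esub> x \<oplus>\<^bsub>free_lmod A S\<^esub> a \<odot>\<^bsub>free_lmod A S\<^esub> y"
      unfolding ops using a in_A[OF x] in_A[OF y] by (simp add: A.r_distr)
  next
    fix a b x assume ab: "a \<in> carrier A" "b \<in> carrier A" and x: "x \<in> carrier (free_lmod A S)"
    show "(a \<oplus>\<^bsub>A\<^esub> b) \<odot>\<^bsub>free_lmod A S\<^esub> x = a \<odot>\<^bsub>free_lmod A S\<^esub> x \<oplus>\<^bsub>free_lmod A S\<^esub> b \<odot>\<^bsub>free_lmod A S\<^esub> x"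
      unfolding ops using ab in_A[OF x] by (simp add: A.l_distr)
    show "(a \<otimes>\<^bsub>A\<^esub> b) \<odot>\<^bsub>free_lmod A S\<^esub> x = a \<odot>\<^bsub>free_lmod A S\<^esub> (b \<odot>\<^bsub>free_lmod A S\<^esub> x)"
      unfolding ops using ab in_A[OF x] by (simp add: A.m_assoc)
  next
    fix x assume x: "x \<in> carrier (free_lmod A S)"
    show "\<one>\<^bsub>A\<^esub> \<odot>\<^bsub>free_lmod A S\<^esub> x = x" unfolding ops using in_A[OF x] by simp
  qed
  ultimately show ?thesis using assms by (simp add: left_module_def)
qed

lemma lmod_homD:
  assumes "h \<in> lmod_hom A M N"
  shows "x \<in> carrier M \<Longrightarrow> h x \<in> carrier N"
    "x \<in> carrier M \<Longrightarrow> y \<in> carrier M \<Longrightarrow> h (x \<oplus>\<^bsub>M\<^esub> y) = h x \<oplus>\<^bsub>N\<^esub> h y"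
    "a \<in> carrier A \<Longrightarrow> x \<in> carrier M \<Longrightarrow> h (a \<odot>\<^bsub>M\<^esub> x) = a \<odot>\<^bsub>N\<^esub> h x"
  using assms by (auto simp: lmod_hom_def hom_def)

lemma lmod_homI:
  assumes "\<And>x. x \<in> carrier M \<Longrightarrow> h x \<in> carrier N"
    "\<And>x y. x \<in> carrier M \<Longrightarrow> y \<in> carrier M \<Longrightarrow> h (x \<oplus>\<^bsub>M\<^esub> y) = h x \<oplus>\<^bsub>N\<^esub> h y"
    "\<And>a x. a \<in> carrier A \<Longrightarrow> x \<in> carrier M \<Longrightarrow> h (a \<odot>\<^bsub>M\<^esub> x) = a \<odot>\<^bsub>N\<^esub> h x"
  shows "h \<in> lmod_hom A M N"
  using assms by (auto simp: lmod_hom_def hom_def)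

lemma lmod_hom_zero:
  assumes "h \<in> lmod_hom A M N" "abelian_group M" "abelian_group N"
  shows "h \<zero>\<^bsub>M\<^esub> = \<zero>\<^bsub>N\<^esub>"
proof -
  interpret M: abelian_group M by fact
  interpret N: abelian_group N by fact
  have h0: "h \<zero>\<^bsub>M\<^esub> \<in> carrier N" using lmod_homD(1)[OF assms(1)] by simp
  have "h \<zero>\<^bsub>M\<^esub> \<oplus>\<^bsub>N\<^esub> h \<zero>\<^bsub>M\<^esub> = h \<zero>\<^bsub>M\<^esub>"
    using lmod_homD(2)[OF assms(1), of "\<zero>\<^bsub>M\<^esub>" "\<zero>\<^bsub>M\<^esub>"] by simp
  then show ?thesis using h0 N.add.l_cancel_one by auto
qed

lemma lmod_hom_finsum:
  assumes h: "h \<in> lmod_hom A M N" "abelian_group M" "abelian_group N" and "finite I" "f \<in> I \<rightarrow> carrier M"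
  shows "h (\<Oplus>\<^bsub>M\<^esub>i\<in>I. f i) = (\<Oplus>\<^bsub>N\<^esub>i\<in>I. h (f i))"
proof -
  interpret M: abelian_group M by fact
  interpret N: abelian_group N by fact
  from assms(4,5) show ?thesis
  proof (induction I rule: finite_induct)
    case empty
    show ?case using lmod_hom_zero[OF h] by simp
  next
    case (insert x F)
    then have "f \<in> F \<rightarrow> carrier M" "f x \<in> carrier M" by auto
    then show ?case
      using insert lmod_homD[OF h(1)] by (simp add: M.finsum_closed Pi_def)
  qed
qed

text \<open>Apply projectivity to the surjection from the free module on a finite generating set.\<close>

lemma dual_basis_lemma:
  fixes A :: "'a ring" and M :: "('a, 'm) module"
  assumes M: "left_module A M" and fg: "lmod_finitely_generated A M" and proj: "lmod_projective A M"
  shows "\<exists>(m :: nat) t z. (\<forall>j<m. t j \<in> carrier M) \<and> (\<forall>j<m. z j \<in> lmod_hom A M (regular_module A)) \<and>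
    (\<forall>p\<in>carrier M. p = (\<Oplus>\<^bsub>M\<^esub>j\<in>{..<m}. z j p \<odot>\<^bsub>M\<^esub> t j))"
proof -
  interpret M: left_module A M by fact
  obtain S where S: "finite S" "S \<subseteq> carrier M"
    and gen: "\<And>x. x \<in> carrier M \<Longrightarrow> \<exists>c\<in>S \<rightarrow> carrier A. x = (\<Oplus>\<^bsub>M\<^esub>s\<in>S. c s \<odot>\<^bsub>M\<^esub> s)"
    using fg unfolding lmod_finitely_generated_def by blast
  let ?X = "free_lmod A S :: ('a, 'm \<Rightarrow> 'a) module"
  let ?f = "\<lambda>c. \<Oplus>\<^bsub>M\<^esub>s\<in>S. c s \<odot>\<^bsub>M\<^esub> s"
  have X: "left_module A ?X" by (rule left_module_free_lmod[OF M.R.ring_axioms])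
  have cS: "c s \<in> carrier A" "c s \<odot>\<^bsub>M\<^esub> s \<in> carrier M" if "c \<in> carrier ?X" "s \<in> S" for c s
    using that S M.smult_closed by (auto simp: free_lmod_def)
  have f: "?f \<in> lmod_hom A ?X M"
  proof (rule lmod_homI)
    fix c assume c: "c \<in> carrier ?X"
    show "?f c \<in> carrier M" using cS[OF c] by (intro M.finsum_closed) auto
    fix c' assume c': "c' \<in> carrier ?X"
    have "?f (c \<oplus>\<^bsub>?X\<^esub> c') = (\<Oplus>\<^bsub>M\<^esub>s\<in>S. c s \<odot>\<^bsub>M\<^esub> s \<oplus>\<^bsub>M\<^esub> c' s \<odot>\<^bsub>M\<^esub> s)"
      using cS[OF c] cS[OF c'] S by (intro M.finsum_cong') (auto simp: free_lmod_def M.smult_l_distr)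
    then show "?f (c \<oplus>\<^bsub>?X\<^esub> c') = ?f c \<oplus>\<^bsub>M\<^esub> ?f c'"
      using cS[OF c] cS[OF c'] by (simp add: M.finsum_addf)
  next
    fix a c assume a: "a \<in> carrier A" and c: "c \<in> carrier ?X"
    have "a \<odot>\<^bsub>M\<^esub> (\<Oplus>\<^bsub>M\<^esub>s\<in>T. c s \<odot>\<^bsub>M\<^esub> s) = (\<Oplus>\<^bsub>M\<^esub>s\<in>T. (a \<otimes>\<^bsub>A\<^esub> c s) \<odot>\<^bsub>M\<^esub> s)" if "T \<subseteq> S" for T
    proof -
      have "finite T" using that S(1) finite_subset by blast
      then show ?thesis using that
      proof (induction T rule: finite_induct)
        case empty
        have "a \<odot>\<^bsub>M\<^esub> \<zero>\<^bsub>M\<^esub> \<oplus>\<^bsub>M\<^esub> a \<odot>\<^bsub>M\<^esub> \<zero>\<^bsub>M\<^esub> = a \<odot>\<^bsub>M\<^esub> \<zero>\<^bsub>M\<^esub>"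
          using M.smult_r_distr[OF a M.zero_closed M.zero_closed] by simp
        then show ?case using M.smult_closed[OF a M.zero_closed] M.add.l_cancel_one by auto
      next
        case (insert s F)
        have F: "(\<lambda>s. c s \<odot>\<^bsub>M\<^esub> s) \<in> F \<rightarrow> carrier M" "(\<lambda>s. (a \<otimes>\<^bsub>A\<^esub> c s) \<odot>\<^bsub>M\<^esub> s) \<in> F \<rightarrow> carrier M"
          using cS[OF c] a insert.prems S by (auto intro!: M.smult_closed)
        have s: "s \<in> S" "s \<in> carrier M" using insert.prems S by auto
        show ?case
          using insert F s cS[OF c s(1)] a
          by (simp add: M.smult_r_distr M.finsum_closed M.smult_assoc M.smult_closed)
      qed
    qed
    then show "?f (a \<odot>\<^bsub>?X\<^esub> c) = a \<odot>\<^bsub>M\<^esub> ?f c" by (simp add: free_lmod_def)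
  qed
  have "?f ` carrier ?X = carrier M"
  proof
    show "?f ` carrier ?X \<subseteq> carrier M" using lmod_homD(1)[OF f] by auto
    show "carrier M \<subseteq> ?f ` carrier ?X"
    proof
      fix x assume "x \<in> carrier M"
      then obtain c where c: "c \<in> S \<rightarrow> carrier A" "x = ?f c" using gen by blast
      let ?c = "\<lambda>s. if s \<in> S then c s else \<zero>\<^bsub>A\<^esub>"
      have cX: "?c \<in> carrier ?X" using c(1) by (auto simp: free_lmod_def)
      have "?f c = ?f ?c"
        using c(1) S by (intro M.finsum_cong') (auto intro!: M.smult_closed)
      with c(2) have "x = ?f ?c" by simp
      then show "x \<in> ?f ` carrier ?X" using cX by (rule image_eqI)
    qed
  qed
  moreover have "(\<lambda>x. x) \<in> lmod_hom A M M" by (rule lmod_homI) auto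
  ultimately have "\<exists>h\<in>lmod_hom A M ?X. \<forall>x\<in>carrier M. ?f (h x) = x"
    using proj[unfolded lmod_projective_def, rule_format, OF X M f] by simp
  then obtain h where h: "h \<in> lmod_hom A M ?X" "\<And>x. x \<in> carrier M \<Longrightarrow> ?f (h x) = x"
    by blast
  obtain \<phi> where "bij_betw \<phi> {0..<card S} S" using ex_bij_betw_nat_finite[OF S(1)] by blast
  then have \<phi>: "bij_betw \<phi> {..<card S} S" by (simp add: atLeast0LessThan)
  then have \<phi>S: "\<phi> j \<in> S" if "j < card S" for j using that by (auto simp: bij_betw_def)
  define z where "z j p = h p (\<phi> j)" for j p
  have hX: "h p \<in> carrier ?X" if "p \<in> carrier M" for p using lmod_homD(1)[OF h(1) that] .
  have "z j \<in> lmod_hom A M (regular_module A)" if j: "j < card S" for j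
    using lmod_homD[OF h(1)] cS(1)[OF hX \<phi>S[OF j]]
    by (intro lmod_homI) (auto simp: z_def regular_module_def free_lmod_def)
  moreover have "p = (\<Oplus>\<^bsub>M\<^esub>j\<in>{..<card S}. z j p \<odot>\<^bsub>M\<^esub> \<phi> j)" if p: "p \<in> carrier M" for p
  proof -
    have "p = (\<Oplus>\<^bsub>M\<^esub>s\<in>\<phi> ` {..<card S}. h p s \<odot>\<^bsub>M\<^esub> s)" using h(2)[OF p] \<phi> by (simp add: bij_betw_def)
    also have "\<dots> = (\<Oplus>\<^bsub>M\<^esub>j\<in>{..<card S}. h p (\<phi> j) \<odot>\<^bsub>M\<^esub> \<phi> j)"
      by (rule M.finsum_reindex) (use cS(2)[OF hX[OF p]] \<phi> in \<open>auto simp: bij_betw_def\<close>)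
    finally show ?thesis by (simp add: z_def)
  qed
  ultimately show ?thesis using \<phi>S S(2) by (intro exI[of _ "card S"] exI[of _ \<phi>] exI[of _ z]) auto
qed

section \<open>Coordinates for projective modules over the group ring\<close>

locale group_ring_coeff = group G + R: ring R
  for G :: "('g, 'y) monoid_scheme" (structure) and R :: "('r, 'x) ring_scheme" +
  assumes group_ring_ring: "ring (group_ring R G)"
begin

sublocale A: ring "group_ring R G"
  by (rule group_ring_ring)

sublocale group_coeff G "emb R ` carrier R" "emb R \<one>\<^bsub>R\<^esub>"
proof unfold_locales
  show "0 \<in> emb R ` carrier R" using R.emb_zero by (metis R.zero_closed image_eqI)
  fix r s assume "r \<in> emb R ` carrier R"
  then obtain r' where r: "r = emb R r'" "r' \<in> carrier R" by blast
  show "- r \<in> emb R ` carrier R" unfolding r(1) R.emb_minus[OF r(2), symmetric] using r(2) by simp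
  show "emb R \<one>\<^bsub>R\<^esub> * r = r" "r * emb R \<one>\<^bsub>R\<^esub> = r" unfolding r(1) using r(2) by (simp_all flip: R.emb_mult)
  assume "s \<in> emb R ` carrier R"
  then obtain s' where s: "s = emb R s'" "s' \<in> carrier R" by blast
  show "r + s \<in> emb R ` carrier R" "r * s \<in> emb R ` carrier R"
    unfolding r(1) s(1) using r(2) s(2) by (simp_all flip: R.emb_mult R.emb_add)
qed simp

lemma gr_carrierD:
  assumes "a \<in> carrier (group_ring R G)"
  shows "a x \<in> carrier R" "{x. a x \<noteq> \<zero>\<^bsub>R\<^esub>} \<subseteq> carrier G" "finite {x. a x \<noteq> \<zero>\<^bsub>R\<^esub>}"
    "x \<notin> carrier G \<Longrightarrow> a x = \<zero>\<^bsub>R\<^esub>"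
  using assms by (auto simp: group_ring_def)

lemma gr_ops: "(a \<oplus>\<^bsub>group_ring R G\<^esub> b) x = a x \<oplus>\<^bsub>R\<^esub> b x" "\<zero>\<^bsub>group_ring R G\<^esub> = (\<lambda>x. \<zero>\<^bsub>R\<^esub>)"
  by (simp_all add: group_ring_def)

lemma gr_monom_carrier:
  assumes "r \<in> carrier R" "g \<in> carrier G"
  shows "gr_monom R r g \<in> carrier (group_ring R G)"
proof -
  have "{x. gr_monom R r g x \<noteq> \<zero>\<^bsub>R\<^esub>} \<subseteq> {g}" by (auto simp: gr_monom_def)
  then have "finite {x. gr_monom R r g x \<noteq> \<zero>\<^bsub>R\<^esub>}" by (rule finite_subset) simp
  then show ?thesis using assms by (auto simp: group_ring_def gr_monom_def)
qed

lemma emb_gr_mult: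
  assumes a: "a \<in> carrier (group_ring R G)" and b: "b \<in> carrier (group_ring R G)"
  shows "emb R ((a \<otimes>\<^bsub>group_ring R G\<^esub> b) x) = (if x \<in> carrier G
    then \<Sum>h\<in>{h. a h \<noteq> \<zero>\<^bsub>R\<^esub>}. emb R (a h) * emb R (b (inv h \<otimes> x)) else 0)"
proof (cases "x \<in> carrier G")
  case True
  have "(a \<otimes>\<^bsub>group_ring R G\<^esub> b) x = (\<Oplus>\<^bsub>R\<^esub>h\<in>{h. a h \<noteq> \<zero>\<^bsub>R\<^esub>}. a h \<otimes>\<^bsub>R\<^esub> b (inv h \<otimes> x))"
    using True by (simp add: group_ring_def)
  then show ?thesis
    using True R.emb_finsum[OF gr_carrierD(3)[OF a], of "\<lambda>h. a h \<otimes>\<^bsub>R\<^esub> b (inv h \<otimes> x)"]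
      gr_carrierD(1)[OF a] gr_carrierD(1)[OF b] by (simp add: R.emb_mult)
next
  case False
  then show ?thesis by (simp add: group_ring_def R.emb_zero)
qed

lemma emb_gr_mult_superset:
  assumes a: "a \<in> carrier (group_ring R G)" and b: "b \<in> carrier (group_ring R G)" and x: "x \<in> carrier G"
    and T: "finite T" "{h. a h \<noteq> \<zero>\<^bsub>R\<^esub>} \<subseteq> T"
  shows "emb R ((a \<otimes>\<^bsub>group_ring R G\<^esub> b) x) = (\<Sum>h\<in>T. emb R (a h) * emb R (b (inv h \<otimes> x)))"
  unfolding emb_gr_mult[OF a b] using x
  by (simp, intro sum.mono_neutral_left[OF T]) (auto simp: R.emb_zero)

lemma emb_monom_mult:
  assumes "r \<in> carrier R" "g \<in> carrier G" "a \<in> carrier (group_ring R G)"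
  shows "emb R ((gr_monom R r g \<otimes>\<^bsub>group_ring R G\<^esub> a) x) =
    (if x \<in> carrier G then emb R r * emb R (a (inv g \<otimes> x)) else 0)"
proof (cases "x \<in> carrier G")
  case True
  have "emb R ((gr_monom R r g \<otimes>\<^bsub>group_ring R G\<^esub> a) x) =
      (\<Sum>h\<in>{g}. emb R (gr_monom R r g h) * emb R (a (inv h \<otimes> x)))"
    by (rule emb_gr_mult_superset[OF gr_monom_carrier[OF assms(1,2)] assms(3) True])
      (auto simp: gr_monom_def)
  then show ?thesis using True by (simp add: gr_monom_def)
qed (simp add: emb_gr_mult[OF gr_monom_carrier[OF assms(1,2)] assms(3)])

lemma emb_mult_monom_one:
  assumes "r \<in> carrier R" "a \<in> carrier (group_ring R G)"
  shows "emb R ((a \<otimes>\<^bsub>group_ring R G\<^esub> gr_monom R r \<one>) x) = emb R (a x) * emb R r"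
proof (cases "x \<in> carrier G")
  case True
  have "emb R ((a \<otimes>\<^bsub>group_ring R G\<^esub> gr_monom R r \<one>) x) =
      (\<Sum>h\<in>insert x {h. a h \<noteq> \<zero>\<^bsub>R\<^esub>}. emb R (a h) * emb R (gr_monom R r \<one> (inv h \<otimes> x)))"
    by (rule emb_gr_mult_superset[OF assms(2) gr_monom_carrier[OF assms(1) one_closed] True])
      (use gr_carrierD(3)[OF assms(2)] in auto)
  also have "\<dots> = (\<Sum>h\<in>insert x {h. a h \<noteq> \<zero>\<^bsub>R\<^esub>}. if h = x then emb R (a x) * emb R r else 0)"
  proof (rule sum.cong)
    fix h assume "h \<in> insert x {h. a h \<noteq> \<zero>\<^bsub>R\<^esub>}"
    then have h: "h \<in> carrier G" using gr_carrierD(2)[OF assms(2)] True by auto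
    then have "inv h \<otimes> x = \<one> \<longleftrightarrow> h = x" using True by (metis inv_closed inv_inv inv_equality l_inv)
    then show "emb R (a h) * emb R (gr_monom R r \<one> (inv h \<otimes> x)) = (if h = x then emb R (a x) * emb R r else 0)"
      by (auto simp: gr_monom_def R.emb_zero)
  qed simp
  also have "\<dots> = emb R (a x) * emb R r" using gr_carrierD(3)[OF assms(2)] by simp
  finally show ?thesis .
next
  case False
  then show ?thesis
    using emb_gr_mult[OF assms(2) gr_monom_carrier[OF assms(1) one_closed]] gr_carrierD(4)[OF assms(2) False]
    by (simp add: R.emb_zero)
qed

lemma augmentation_monom:
  assumes "r \<in> carrier R"
  shows "augmentation R (gr_monom R r g) = r"
proof (cases "r = \<zero>\<^bsub>R\<^esub>")
  case True
  then have "{x. gr_monom R r g x \<noteq> \<zero>\<^bsub>R\<^esub>} = {}" by (simp add: gr_monom_def)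
  then show ?thesis using True unfolding augmentation_def by simp
next
  case False
  then have "{x. gr_monom R r g x \<noteq> \<zero>\<^bsub>R\<^esub>} = {g}" by (auto simp: gr_monom_def)
  then show ?thesis using assms unfolding augmentation_def by (simp add: gr_monom_def)
qed

lemma emb_gr_finsum:
  assumes "finite I" "f \<in> I \<rightarrow> carrier (group_ring R G)"
  shows "emb R ((\<Oplus>\<^bsub>group_ring R G\<^esub>i\<in>I. f i) x) = (\<Sum>i\<in>I. emb R (f i x))"
  using assms
proof (induction I rule: finite_induct)
  case empty
  then show ?case by (simp add: gr_ops R.emb_zero)
next
  case (insert i F)
  have F: "f i \<in> carrier (group_ring R G)" "(\<Oplus>\<^bsub>group_ring R G\<^esub>i\<in>F. f i) \<in> carrier (group_ring R G)"
    using insert.prems by (auto intro!: A.finsum_closed)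
  then show ?case
    using insert gr_carrierD(1)[OF F(1)] gr_carrierD(1)[OF F(2)] by (simp add: gr_ops R.emb_add Pi_def)
qed

lemma gr_eqI:
  assumes "a \<in> carrier (group_ring R G)" "b \<in> carrier (group_ring R G)" "\<And>x. emb R (a x) = emb R (b x)"
  shows "a = b"
  using assms(3) inj_onD[OF R.inj_emb] gr_carrierD(1)[OF assms(1)] gr_carrierD(1)[OF assms(2)] by blast

text \<open>The coordinates \<open>z j p\<close> of the dual basis lemma embed \<open>M\<close> into
  a free module. The coordinate vectors of the \<open>t j\<close> then form an idempotent matrix
  with the image of \<open>M\<close> as its range, because \<open>p\<close> is the combination of
  the \<open>t j\<close> with coefficients \<open>z j p\<close>.\<close>

lemma module_embedding:
  fixes M :: "('g \<Rightarrow> 'r, 'm) module"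
  assumes M: "left_module (group_ring R G) M" and fg: "lmod_finitely_generated (group_ring R G) M"
    and pr: "lmod_projective (group_ring R G) M"
  shows "\<exists>(m :: nat) s \<iota>. inj_on \<iota> (carrier M) \<and> proj {..<m} s (\<iota> ` carrier M) \<and>
    (\<forall>p\<in>carrier M. \<forall>q\<in>carrier M. \<iota> (p \<oplus>\<^bsub>M\<^esub> q) = \<iota> p + \<iota> q) \<and>
    (\<forall>r\<in>carrier R. \<forall>g\<in>carrier G. \<forall>p\<in>carrier M. \<iota> (gr_monom R r g \<odot>\<^bsub>M\<^esub> p) = sc (emb R r) (act g (\<iota> p)))"
proof -
  let ?A = "group_ring R G"
  interpret M: left_module ?A M by fact
  obtain m :: nat and t z where t: "\<And>j. j < m \<Longrightarrow> t j \<in> carrier M"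
    and z: "\<And>j. j < m \<Longrightarrow> z j \<in> lmod_hom ?A M (regular_module ?A)"
    and tz: "\<And>p. p \<in> carrier M \<Longrightarrow> p = (\<Oplus>\<^bsub>M\<^esub>j\<in>{..<m}. z j p \<odot>\<^bsub>M\<^esub> t j)"
    using dual_basis_lemma[OF M fg pr] by blast
  have zA: "z j p \<in> carrier ?A" if "j < m" "p \<in> carrier M" for j p
    using lmod_homD(1)[OF z[OF that(1)] that(2)] by (simp add: regular_module_def)
  define \<iota> where "\<iota> p = (\<lambda>j x. if j < m then emb R (z j p x) else 0)" for p
  have supp_\<iota>: "supp (\<iota> p) = Sigma {..<m} (\<lambda>j. {x. z j p x \<noteq> \<zero>\<^bsub>R\<^esub>})" if p: "p \<in> carrier M" for p
    using R.emb_eq_0_iff gr_carrierD(1)[OF zA[OF _ p]] by (auto simp: supp_def \<iota>_def)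
  have \<iota>F: "\<iota> p \<in> Free {..<m}" if p: "p \<in> carrier M" for p
  proof -
    have "supp (\<iota> p) \<subseteq> {..<m} \<times> carrier G" "finite (supp (\<iota> p))"
      unfolding supp_\<iota>[OF p] using gr_carrierD(2,3)[OF zA[OF _ p]] by (auto intro!: finite_SigmaI)
    moreover have "\<iota> p j x \<in> emb R ` carrier R" for j x
      using gr_carrierD(1)[OF zA[OF _ p]] by (simp add: \<iota>_def)
    ultimately show ?thesis by (simp add: Free_def)
  qed
  have add: "\<iota> (p \<oplus>\<^bsub>M\<^esub> q) = \<iota> p + \<iota> q" if p: "p \<in> carrier M" and q: "q \<in> carrier M" for p q
  proof (intro HOL.ext)
    fix j x
    show "\<iota> (p \<oplus>\<^bsub>M\<^esub> q) j x = (\<iota> p + \<iota> q) j x"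
    proof (cases "j < m")
      case True
      have "z j (p \<oplus>\<^bsub>M\<^esub> q) = z j p \<oplus>\<^bsub>?A\<^esub> z j q"
        using lmod_homD(2)[OF z[OF True] p q] by (simp add: regular_module_def)
      then show ?thesis
        using True gr_carrierD(1)[OF zA[OF True p]] gr_carrierD(1)[OF zA[OF True q]]
        by (simp add: \<iota>_def gr_ops R.emb_add)
    qed (simp add: \<iota>_def)
  qed
  have smult: "\<iota> (gr_monom R r g \<odot>\<^bsub>M\<^esub> p) = sc (emb R r) (act g (\<iota> p))"
    if r: "r \<in> carrier R" and g: "g \<in> carrier G" and p: "p \<in> carrier M" for r g p
  proof (intro HOL.ext)
    fix j x
    show "\<iota> (gr_monom R r g \<odot>\<^bsub>M\<^esub> p) j x = sc (emb R r) (act g (\<iota> p)) j x"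
    proof (cases "j < m")
      case True
      have "z j (gr_monom R r g \<odot>\<^bsub>M\<^esub> p) = gr_monom R r g \<otimes>\<^bsub>?A\<^esub> z j p"
        using lmod_homD(3)[OF z[OF True] gr_monom_carrier[OF r g] p] by (simp add: regular_module_def)
      then show ?thesis
        using True emb_monom_mult[OF r g zA[OF True p]] by (simp add: \<iota>_def sc_def act_def)
    qed (simp add: \<iota>_def sc_def act_def)
  qed
  have inj: "inj_on \<iota> (carrier M)"
  proof (rule inj_onI)
    fix p q assume p: "p \<in> carrier M" and q: "q \<in> carrier M" and eq: "\<iota> p = \<iota> q"
    have "z j p = z j q" if j: "j < m" for j
    proof (rule gr_eqI[OF zA[OF j p] zA[OF j q]])
      fix x show "emb R (z j p x) = emb R (z j q x)"
        using fun_cong[OF fun_cong[OF eq, of j], of x] j by (simp add: \<iota>_def)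
    qed
    then have "(\<Oplus>\<^bsub>M\<^esub>j\<in>{..<m}. z j p \<odot>\<^bsub>M\<^esub> t j) = (\<Oplus>\<^bsub>M\<^esub>j\<in>{..<m}. z j q \<odot>\<^bsub>M\<^esub> t j)"
      using zA[OF _ q] t by (intro M.finsum_cong') (auto intro!: M.smult_closed)
    then show "p = q" using tz[OF p] tz[OF q] by simp
  qed
  have ext_\<iota>: "ext (\<lambda>j. \<iota> (t j)) (\<iota> p) = \<iota> p" if p: "p \<in> carrier M" for p
  proof (intro HOL.ext)
    fix i y
    show "ext (\<lambda>j. \<iota> (t j)) (\<iota> p) i y = \<iota> p i y"
    proof (cases "i < m")
      case i: True
      have fin: "finite {x. z j p x \<noteq> \<zero>\<^bsub>R\<^esub>}" if "j < m" for j using gr_carrierD(3)[OF zA[OF that p]] .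
      have closed: "z j p \<odot>\<^bsub>M\<^esub> t j \<in> carrier M" if "j < m" for j using zA[OF that p] t[OF that] by (rule M.smult_closed)
      have "\<exists>b\<in>carrier ?A. b \<oplus>\<^bsub>?A\<^esub> a = \<zero>\<^bsub>?A\<^esub>" if "a \<in> carrier ?A" for a
        using A.l_neg[OF that] A.a_inv_closed[OF that] by blast
      then have reg: "abelian_group (regular_module ?A)"
        by (intro abelian_groupI) (auto simp: regular_module_def A.a_assoc intro: A.a_comm)
      \<comment> \<open>The row vector of the \<open>z j p\<close> is reproduced by the matrix with
        entries \<open>z i (t j)\<close>.\<close>
      have "z i p = z i (\<Oplus>\<^bsub>M\<^esub>j\<in>{..<m}. z j p \<odot>\<^bsub>M\<^esub> t j)" using tz[OF p] by simp
      also have "\<dots> = (\<Oplus>\<^bsub>regular_module ?A\<^esub>j\<in>{..<m}. z i (z j p \<odot>\<^bsub>M\<^esub> t j))"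
        by (rule lmod_hom_finsum[OF z[OF i] M.M.abelian_group_axioms reg]) (use closed in auto)
      also have "\<dots> = (\<Oplus>\<^bsub>?A\<^esub>j\<in>{..<m}. z i (z j p \<odot>\<^bsub>M\<^esub> t j))"
        by (simp add: finsum_def regular_module_def finprod_def)
      also have "\<dots> = (\<Oplus>\<^bsub>?A\<^esub>j\<in>{..<m}. z j p \<otimes>\<^bsub>?A\<^esub> z i (t j))"
        using zA[OF _ p] zA[OF i t] lmod_homD(3)[OF z[OF i] zA[OF _ p] t]
        by (intro A.finsum_cong') (auto simp: regular_module_def)
      finally have "emb R (z i p y) = (\<Sum>j<m. emb R ((z j p \<otimes>\<^bsub>?A\<^esub> z i (t j)) y))"
        using emb_gr_finsum[of "{..<m}" "\<lambda>j. z j p \<otimes>\<^bsub>?A\<^esub> z i (t j)" y] zA[OF _ p] zA[OF i t] by auto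
      also have "\<dots> = (\<Sum>j<m. \<Sum>h\<in>{x. z j p x \<noteq> \<zero>\<^bsub>R\<^esub>}. sc (\<iota> p j h) (act h (\<iota> (t j))) i y)"
        by (rule sum.cong) (use i in \<open>auto simp: emb_gr_mult zA p t sc_def act_def \<iota>_def\<close>)
      also have "\<dots> = (\<Sum>q\<in>supp (\<iota> p). sc (\<iota> p (fst q) (snd q)) (act (snd q) (\<iota> (t (fst q)))) i y)"
        unfolding supp_\<iota>[OF p] by (subst sum.Sigma) (use fin in \<open>auto simp: case_prod_beta\<close>)
      also have "\<dots> = ext (\<lambda>j. \<iota> (t j)) (\<iota> p) i y" by (simp add: ext_def sum_fun_apply)
      finally show ?thesis using i by (simp add: \<iota>_def)
    next
      case False
      then have "\<iota> q i x = 0" for q x by (simp add: \<iota>_def)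
      then show ?thesis by (auto simp: ext_def sum_fun_apply sc_def act_def intro!: sum.neutral)
    qed
  qed
  have "submod (\<iota> ` carrier M)"
    unfolding submod_def
  proof (intro conjI ballI)
    show "\<iota> ` carrier M \<subseteq> Free UNIV" using \<iota>F Free_UNIV by auto
    have "\<iota> \<zero>\<^bsub>M\<^esub> + \<iota> \<zero>\<^bsub>M\<^esub> = \<iota> \<zero>\<^bsub>M\<^esub>" using add[of "\<zero>\<^bsub>M\<^esub>" "\<zero>\<^bsub>M\<^esub>"] by simp
    then have "\<iota> \<zero>\<^bsub>M\<^esub> = 0" by simp
    then show "0 \<in> \<iota> ` carrier M" by (metis M.zero_closed image_eqI)
    fix x assume "x \<in> \<iota> ` carrier M"
    then obtain p where p: "p \<in> carrier M" "x = \<iota> p" by blast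
    show "act g x \<in> \<iota> ` carrier M" if g: "g \<in> carrier G" for g
    proof -
      have "act g x = sc (emb R \<one>\<^bsub>R\<^esub>) (act g (\<iota> p))"
        using sc_e[OF act_Free[OF g \<iota>F[OF p(1)]]] p by simp
      also have "\<dots> = \<iota> (gr_monom R \<one>\<^bsub>R\<^esub> g \<odot>\<^bsub>M\<^esub> p)" using smult[OF R.one_closed g p(1)] by simp
      finally show ?thesis using M.smult_closed[OF gr_monom_carrier[OF R.one_closed g] p(1)] by (rule image_eqI)
    qed
    show "sc r x \<in> \<iota> ` carrier M" if rR: "r \<in> emb R ` carrier R" for r
    proof -
      obtain r' where r: "r = emb R r'" "r' \<in> carrier R" using rR by blast
      have "sc r x = \<iota> (gr_monom R r' \<one> \<odot>\<^bsub>M\<^esub> p)"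
        using smult[OF r(2) one_closed p(1)] act_one[OF \<iota>F[OF p(1)]] p r by simp
      then show ?thesis using M.smult_closed[OF gr_monom_carrier[OF r(2) one_closed] p(1)] by (rule image_eqI)
    qed
    show "x + y \<in> \<iota> ` carrier M" if y: "y \<in> \<iota> ` carrier M" for y
    proof -
      obtain q where q: "q \<in> carrier M" "y = \<iota> q" using y by blast
      have "x + y = \<iota> (p \<oplus>\<^bsub>M\<^esub> q)" using add[OF p(1) q(1)] p q by simp
      then show ?thesis using M.M.a_closed[OF p(1) q(1)] by (rule image_eqI)
    qed
  qed
  then have "proj {..<m} (\<lambda>j. \<iota> (t j)) (\<iota> ` carrier M)"
    unfolding proj_def using \<iota>F ext_\<iota> t by auto
  then show ?thesis using inj add smult by blast
qed

end

lemma sgn_if_apply: "sgn_if i f x = sgn_if i (f x)"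
  by (simp add: sgn_if_def)

lemma sgn_if_simps: "sgn_if i (a + b) = sgn_if i a + sgn_if i (b :: 'u::ring)" "sgn_if i (a * b) = sgn_if i a * b"
  "sgn_if i (0 :: 'u) = 0"
  by (simp_all add: sgn_if_def)

context group_coeff
begin

lemma ext_bd:
  assumes N: "submod N" and f: "\<And>w. w \<in> words G k \<Longrightarrow> f w \<in> N" and w: "w \<in> words G (Suc k)"
  shows "ext f (bd w) = act (hd w) (f (tl w)) + (\<Sum>i<k. sgn_if (Suc i) (f (merge i w))) + sgn_if (Suc k) (f (butlast w))"
proof -
  note F = submod_Free[of "words G k"]
  have hm: "hm (Free (words G k)) (ext f) N" by (rule hm_ext[OF N f])
  have b: "ext f (bas v) = f v" "bas v \<in> Free (words G k)" if "v \<in> words G k" for v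
    using ext_bas[of f v, OF submodD(1)[OF N f[OF that]]] bas_Free[OF that] .
  have sg: "ext f (sgn_if i (bas v)) = sgn_if i (f v)" "sgn_if i (bas v) \<in> Free (words G k)"
    if "v \<in> words G k" for i v
    using b[OF that] hm_uminus[OF hm F N, of "bas v"] submod_uminus[OF F, of "bas v"] by (auto simp: sgn_if_def)
  have m: "merge i w \<in> words G k" if "i \<in> {..<k}" for i using merge_words[OF w] that by simp
  let ?a = "act (hd w) (bas (tl w))" and ?s = "\<Sum>i<k. sgn_if (Suc i) (bas (merge i w))"
    and ?z = "sgn_if (Suc k) (bas (butlast w))"
  have mem: "?a \<in> Free (words G k)" "?s \<in> Free (words G k)" "?z \<in> Free (words G k)"
    using act_Free[OF wordsD(1)[OF w] b(2)[OF wordsD(2)[OF w]]] sg(2)[OF m] sg(2)[OF wordsD(3)[OF w]]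
    by (auto intro: submod_sum[OF F])
  have "ext f (bd w) = ext f ((?a + ?s) + ?z)" unfolding bd_def using wordsD(4)[OF w] by simp
  also have "\<dots> = ext f (?a + ?s) + ext f ?z" by (rule hmD(2)[OF hm submodD(3)[OF F mem(1,2)] mem(3)])
  also have "ext f (?a + ?s) = ext f ?a + ext f ?s" by (rule hmD(2)[OF hm mem(1,2)])
  also have "ext f ?a = act (hd w) (f (tl w))"
    using hmD(4)[OF hm wordsD(1)[OF w] b(2)[OF wordsD(2)[OF w]]] b(1)[OF wordsD(2)[OF w]] by simp
  also have "ext f ?s = (\<Sum>i<k. ext f (sgn_if (Suc i) (bas (merge i w))))"
    by (rule hm_sum[OF hm F sg(2)[OF m]])
  also have "\<dots> = (\<Sum>i<k. sgn_if (Suc i) (f (merge i w)))" by (rule sum.cong) (use sg(1) m in auto)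
  also have "ext f ?z = sgn_if (Suc k) (f (butlast w))" by (rule sg(1)[OF wordsD(3)[OF w]])
  finally show ?thesis .
qed

end

section \<open>Cochains and cohomology classes\<close>

context group_ring_coeff
begin

abbreviation GR where "GR \<equiv> group_ring R G"

lemma emb_gr_uminus:
  assumes "a \<in> carrier GR"
  shows "emb R ((\<ominus>\<^bsub>GR\<^esub> a) x) = - emb R (a x)"
proof -
  have c: "\<ominus>\<^bsub>GR\<^esub> a \<in> carrier GR" using assms by simp
  have "(a \<oplus>\<^bsub>GR\<^esub> \<ominus>\<^bsub>GR\<^esub> a) x = \<zero>\<^bsub>GR\<^esub> x" using A.r_neg[OF assms] by simp
  then have "a x \<oplus>\<^bsub>R\<^esub> (\<ominus>\<^bsub>GR\<^esub> a) x = \<zero>\<^bsub>R\<^esub>" by (simp add: gr_ops)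
  then have "emb R (a x) + emb R ((\<ominus>\<^bsub>GR\<^esub> a) x) = 0"
    using R.emb_add[OF gr_carrierD(1)[OF assms] gr_carrierD(1)[OF c], of x x] R.emb_zero by simp
  then show ?thesis by (metis minus_unique)
qed

lemma emb_gr_add:
  assumes "a \<in> carrier GR" "b \<in> carrier GR"
  shows "emb R ((a \<oplus>\<^bsub>GR\<^esub> b) x) = emb R (a x) + emb R (b x)"
  using assms gr_carrierD(1) by (simp add: gr_ops R.emb_add)

lemma alt_sign_closed: "a \<in> carrier GR \<Longrightarrow> alt_sign GR i a \<in> carrier GR"
  by (simp add: alt_sign_def)

lemma emb_alt_sign: "a \<in> carrier GR \<Longrightarrow> emb R (alt_sign GR i a x) = sgn_if i (emb R (a x))"
  by (simp add: alt_sign_def sgn_if_def emb_gr_uminus)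

lemma coboundary_word:
  assumes f: "f \<in> words G k \<rightarrow> carrier GR" and w: "w \<in> words G (Suc k)"
  shows "coboundary R G k f w \<in> carrier GR"
    and "emb R (coboundary R G k f w x) = (if x \<in> carrier G then emb R (f (tl w) (inv (hd w) \<otimes> x)) else 0) +
      (\<Sum>i<k. sgn_if (Suc i) (emb R (f (merge i w) x))) + sgn_if (Suc k) (emb R (f (butlast w) x))"
proof -
  let ?a = "gr_monom R \<one>\<^bsub>R\<^esub> (hd w) \<otimes>\<^bsub>GR\<^esub> f (tl w)"
  let ?s = "\<Oplus>\<^bsub>GR\<^esub>i\<in>{..<k}. alt_sign GR (Suc i) (f (merge i w))"
  let ?z = "alt_sign GR (Suc k) (f (butlast w))"
  have fm: "f (tl w) \<in> carrier GR" "f (butlast w) \<in> carrier GR" "\<And>i. i < k \<Longrightarrow> f (merge i w) \<in> carrier GR"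
    using f wordsD[OF w] merge_words[OF w] by auto
  have mon: "gr_monom R \<one>\<^bsub>R\<^esub> (hd w) \<in> carrier GR" by (rule gr_monom_carrier[OF R.one_closed wordsD(1)[OF w]])
  have mem: "?a \<in> carrier GR" "?s \<in> carrier GR" "?z \<in> carrier GR"
    using fm mon by (auto intro!: A.finsum_closed alt_sign_closed)
  have eq: "coboundary R G k f w = ?a \<oplus>\<^bsub>GR\<^esub> ?s \<oplus>\<^bsub>GR\<^esub> ?z"
    using w by (simp add: coboundary_def Let_def merge_def)
  show "coboundary R G k f w \<in> carrier GR" unfolding eq using mem by simp
  have "emb R (f (tl w) y) = emb R \<one>\<^bsub>R\<^esub> * emb R (f (tl w) y)" for y
    using gr_carrierD(1)[OF fm(1)] by simp
  then have "emb R (?a x) = (if x \<in> carrier G then emb R (f (tl w) (inv (hd w) \<otimes> x)) else 0)"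
    using emb_monom_mult[OF R.one_closed wordsD(1)[OF w] fm(1), of x] by simp
  moreover have "emb R (?s x) = (\<Sum>i<k. emb R (alt_sign GR (Suc i) (f (merge i w)) x))"
    by (rule emb_gr_finsum) (use fm in \<open>auto intro: alt_sign_closed\<close>)
  then have "emb R (?s x) = (\<Sum>i<k. sgn_if (Suc i) (emb R (f (merge i w) x)))"
    using fm by (simp add: emb_alt_sign)
  ultimately show "emb R (coboundary R G k f w x) = (if x \<in> carrier G then emb R (f (tl w) (inv (hd w) \<otimes> x)) else 0) +
      (\<Sum>i<k. sgn_if (Suc i) (emb R (f (merge i w) x))) + sgn_if (Suc k) (emb R (f (butlast w) x))"
    unfolding eq using mem fm by (simp add: emb_gr_add emb_alt_sign)
qed

lemma coboundary_outside: "w \<notin> words G (Suc k) \<Longrightarrow> coboundary R G k f w = undefined"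
  by (simp add: coboundary_def Let_def)

lemma cochainsD:
  assumes "f \<in> carrier (cochains R star G k)"
  shows "f \<in> words G k \<rightarrow> carrier GR" "w \<in> words G k \<Longrightarrow> f w \<in> carrier GR" "w \<notin> words G k \<Longrightarrow> f w = undefined"
  using assms by (auto simp: cochains_def)

lemma cochains_add: "f \<oplus>\<^bsub>cochains R star G k\<^esub> f' = (\<lambda>w\<in>words G k. f w \<oplus>\<^bsub>GR\<^esub> f' w)"
  by (simp add: cochains_def)

lemma cochains_zero: "\<zero>\<^bsub>cochains R star G k\<^esub> = (\<lambda>w\<in>words G k. \<zero>\<^bsub>GR\<^esub>)"
  by (simp add: cochains_def)

lemma coboundary_closed:
  "f \<in> carrier (cochains R star G k) \<Longrightarrow> coboundary R G k f \<in> carrier (cochains R star G (Suc k))"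
  using coboundary_word(1)[OF cochainsD(1)] coboundary_outside by (auto simp: cochains_def PiE_def extensional_def)

lemma coboundary_eqI:
  assumes "f \<in> carrier (cochains R star G k)" "h \<in> carrier (cochains R star G (Suc k))"
    "\<And>w x. w \<in> words G (Suc k) \<Longrightarrow> emb R (coboundary R G k f w x) = emb R (h w x)"
  shows "coboundary R G k f = h"
proof
  fix w show "coboundary R G k f w = h w"
  proof (cases "w \<in> words G (Suc k)")
    case True
    then show ?thesis
      using gr_eqI[OF coboundary_word(1)[OF cochainsD(1)[OF assms(1)]] cochainsD(2)[OF assms(2)]] assms(3) by blast
  next
    case False
    then show ?thesis using cochainsD(3)[OF assms(2)] coboundary_outside by simp
  qed
qed

lemma cochains_closed:
  "f \<in> carrier (cochains R star G k) \<Longrightarrow> f' \<in> carrier (cochains R star G k) \<Longrightarrow>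
    f \<oplus>\<^bsub>cochains R star G k\<^esub> f' \<in> carrier (cochains R star G k)"
  "\<zero>\<^bsub>cochains R star G k\<^esub> \<in> carrier (cochains R star G k)"
  by (auto simp: cochains_def PiE_def)

lemma coboundary_add:
  assumes f: "f \<in> carrier (cochains R star G k)" and f': "f' \<in> carrier (cochains R star G k)"
  shows "coboundary R G k (f \<oplus>\<^bsub>cochains R star G k\<^esub> f') =
    coboundary R G k f \<oplus>\<^bsub>cochains R star G (Suc k)\<^esub> coboundary R G k f'"
proof (rule coboundary_eqI[OF cochains_closed(1)[OF f f'] cochains_closed(1)[OF coboundary_closed[OF f] coboundary_closed[OF f']]])
  fix w x assume w: "w \<in> words G (Suc k)"
  let ?F = "f \<oplus>\<^bsub>cochains R star G k\<^esub> f'"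
  have e: "emb R (?F v y) = emb R (f v y) + emb R (f' v y)" if "v \<in> words G k" for v y
    using that cochainsD(2)[OF f that] cochainsD(2)[OF f' that] by (simp add: cochains_add emb_gr_add)
  have m: "tl w \<in> words G k" "butlast w \<in> words G k" "\<And>i. i < k \<Longrightarrow> merge i w \<in> words G k"
    using wordsD[OF w] merge_words[OF w] by auto
  have "emb R (coboundary R G k ?F w x) = emb R (coboundary R G k f w x) + emb R (coboundary R G k f' w x)"
    unfolding coboundary_word(2)[OF cochainsD(1)[OF cochains_closed(1)[OF f f']] w]
      coboundary_word(2)[OF cochainsD(1)[OF f] w] coboundary_word(2)[OF cochainsD(1)[OF f'] w]
    using m by (simp add: e sgn_if_simps sum.distrib algebra_simps)
  also have "\<dots> = emb R ((coboundary R G k f \<oplus>\<^bsub>cochains R star G (Suc k)\<^esub> coboundary R G k f') w x)"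
    using w coboundary_word(1)[OF cochainsD(1)[OF f] w] coboundary_word(1)[OF cochainsD(1)[OF f'] w]
    by (simp add: cochains_add emb_gr_add)
  finally show "emb R (coboundary R G k ?F w x) =
      emb R ((coboundary R G k f \<oplus>\<^bsub>cochains R star G (Suc k)\<^esub> coboundary R G k f') w x)" .
qed

lemma coboundary_zero: "coboundary R G k \<zero>\<^bsub>cochains R star G k\<^esub> = \<zero>\<^bsub>cochains R star G (Suc k)\<^esub>"
proof (rule coboundary_eqI[OF cochains_closed(2) cochains_closed(2)])
  fix w x assume w: "w \<in> words G (Suc k)"
  have m: "tl w \<in> words G k" "butlast w \<in> words G k" "\<And>i. i < k \<Longrightarrow> merge i w \<in> words G k"
    using wordsD[OF w] merge_words[OF w] by auto
  show "emb R (coboundary R G k \<zero>\<^bsub>cochains R star G k\<^esub> w x) = emb R (\<zero>\<^bsub>cochains R star G (Suc k)\<^esub> w x)"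
    unfolding coboundary_word(2)[OF cochainsD(1)[OF cochains_closed(2)[of star k]] w]
    using m w by (simp add: cochains_zero gr_ops R.emb_zero sgn_if_simps)
qed

lemma gr_star_monom:
  assumes "star \<zero>\<^bsub>R\<^esub> = \<zero>\<^bsub>R\<^esub>"
  shows "gr_star R G star (gr_monom R r \<one>) = gr_monom R (star r) \<one>"
proof
  fix g show "gr_star R G star (gr_monom R r \<one>) g = gr_monom R (star r) \<one> g"
    using assms by (auto simp: gr_star_def gr_monom_def inv_eq_1_iff)
qed

lemma cochains_smult:
  assumes "star \<zero>\<^bsub>R\<^esub> = \<zero>\<^bsub>R\<^esub>"
  shows "gr_monom R r \<one> \<odot>\<^bsub>cochains R star G k\<^esub> f = (\<lambda>w\<in>words G k. f w \<otimes>\<^bsub>GR\<^esub> gr_monom R (star r) \<one>)"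
  by (simp add: cochains_def gr_star_monom[of star, OF assms])

lemma smult_closed:
  assumes "star \<zero>\<^bsub>R\<^esub> = \<zero>\<^bsub>R\<^esub>" "star r \<in> carrier R" "f \<in> carrier (cochains R star G k)"
  shows "gr_monom R r \<one> \<odot>\<^bsub>cochains R star G k\<^esub> f \<in> carrier (cochains R star G k)"
  unfolding cochains_smult[of star, OF assms(1)]
  using gr_monom_carrier[OF assms(2) one_closed] cochainsD(2)[OF assms(3)] by (auto simp: cochains_def)

lemma coboundary_smult:
  assumes s0: "star \<zero>\<^bsub>R\<^esub> = \<zero>\<^bsub>R\<^esub>" and sr: "star r \<in> carrier R" and f: "f \<in> carrier (cochains R star G k)"
  shows "coboundary R G k (gr_monom R r \<one> \<odot>\<^bsub>cochains R star G k\<^esub> f) =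
    gr_monom R r \<one> \<odot>\<^bsub>cochains R star G (Suc k)\<^esub> coboundary R G k f"
proof (rule coboundary_eqI[OF smult_closed[OF s0 sr f] smult_closed[OF s0 sr coboundary_closed[OF f]]])
  fix w x assume w: "w \<in> words G (Suc k)"
  let ?F = "gr_monom R r \<one> \<odot>\<^bsub>cochains R star G k\<^esub> f"
  have e: "emb R (?F v y) = emb R (f v y) * emb R (star r)" if "v \<in> words G k" for v y
    using that emb_mult_monom_one[OF sr cochainsD(2)[OF f that]] by (simp add: cochains_smult[of star, OF s0])
  have m: "tl w \<in> words G k" "butlast w \<in> words G k" "\<And>i. i < k \<Longrightarrow> merge i w \<in> words G k"
    using wordsD[OF w] merge_words[OF w] by auto
  have "emb R (coboundary R G k ?F w x) = emb R (coboundary R G k f w x) * emb R (star r)"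
    unfolding coboundary_word(2)[OF cochainsD(1)[OF smult_closed[OF s0 sr f]] w]
      coboundary_word(2)[OF cochainsD(1)[OF f] w]
    using m by (simp add: e sgn_if_simps distrib_right sum_distrib_right)
  also have "\<dots> = emb R ((gr_monom R r \<one> \<odot>\<^bsub>cochains R star G (Suc k)\<^esub> coboundary R G k f) w x)"
    using w emb_mult_monom_one[OF sr coboundary_word(1)[OF cochainsD(1)[OF f] w]]
    by (simp add: cochains_smult[of star, OF s0])
  finally show "emb R (coboundary R G k ?F w x) =
      emb R ((gr_monom R r \<one> \<odot>\<^bsub>cochains R star G (Suc k)\<^esub> coboundary R G k f) w x)" .
qed

lemma add_zero_cochain:
  assumes "f \<in> carrier (cochains R star G k)"
  shows "\<zero>\<^bsub>cochains R star G k\<^esub> \<oplus>\<^bsub>cochains R star G k\<^esub> f = f"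
proof
  fix w show "(\<zero>\<^bsub>cochains R star G k\<^esub> \<oplus>\<^bsub>cochains R star G k\<^esub> f) w = f w"
    using cochainsD(2,3)[OF assms, of w] by (cases "w \<in> words G k") (auto simp: cochains_add cochains_zero)
qed

lemma cocycles_iff:
  "f \<in> cocycles R star G k \<longleftrightarrow> f \<in> carrier (cochains R star G k) \<and>
    coboundary R G k f = \<zero>\<^bsub>cochains R star G (Suc k)\<^esub>"
  by (simp add: cocycles_def a_kernel_def')

lemma zero_coboundaries: "\<zero>\<^bsub>cochains R star G (Suc k)\<^esub> \<in> coboundaries R star G (Suc k)"
  unfolding coboundaries.simps(2) coboundary_zero[of k star, symmetric] by (rule imageI[OF cochains_closed(2)])

abbreviation cocycle_class where
  "cocycle_class star k f \<equiv> (\<lambda>n. n \<oplus>\<^bsub>cochains R star G k\<^esub> f) ` coboundaries R star G k"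

lemma in_cocycle_class:
  assumes "f \<in> carrier (cochains R star G (Suc k))"
  shows "f \<in> cocycle_class star (Suc k) f"
  by (rule image_eqI[of f "\<lambda>n. n \<oplus>\<^bsub>cochains R star G (Suc k)\<^esub> f", OF _ zero_coboundaries])
    (rule add_zero_cochain[OF assms, symmetric])

lemma carrier_cohomology:
  "carrier (group_cohomology R star G k) = cocycle_class star k ` cocycles R star G k"
  by (auto simp: group_cohomology_def quotient_lmod_def A_RCOSETS_defs RCOSETS_def r_coset_def)

lemma vanishing_cohomology:
  assumes van: "carrier (group_cohomology R star G (Suc k)) = {\<zero>\<^bsub>group_cohomology R star G (Suc k)\<^esub>}"
    and f: "f \<in> cocycles R star G (Suc k)"
  shows "\<exists>c\<in>carrier (cochains R star G k). coboundary R G k c = f"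
proof -
  have fc: "f \<in> carrier (cochains R star G (Suc k))" using f by (simp add: cocycles_iff)
  have "cocycle_class star (Suc k) f \<in> carrier (group_cohomology R star G (Suc k))"
    unfolding carrier_cohomology using f by (rule imageI)
  then have "cocycle_class star (Suc k) f = coboundaries R star G (Suc k)"
    unfolding van by (simp add: group_cohomology_def quotient_lmod_def)
  moreover have "f \<in> cocycle_class star (Suc k) f"
    by (rule in_cocycle_class[OF fc])
  ultimately show ?thesis by auto
qed

text \<open>The class that the isomorphism \<open>h\<close> sends to the unit generates: a class
  with image \<open>r\<close> is \<open>r\<close> times that class. Since right modules are turned
  into left ones by the involution, the scalar appears as right multiplication by
  \<open>star r\<close>.\<close>

lemma cyclic_cohomology:
  assumes iso: "lmod_isomorphic R (restrict_scalars (\<lambda>r. gr_monom R r \<one>) (group_cohomology R star G (Suc k)))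
      (regular_module R)"
    and star: "star \<in> carrier R \<rightarrow> carrier R" "star \<zero>\<^bsub>R\<^esub> = \<zero>\<^bsub>R\<^esub>"
  shows "\<exists>f0\<in>cocycles R star G (Suc k). \<forall>f\<in>cocycles R star G (Suc k). \<exists>r\<in>carrier R.
    \<exists>c\<in>carrier (cochains R star G k). \<forall>w\<in>words G (Suc k).
      f w = coboundary R G k c w \<oplus>\<^bsub>GR\<^esub> (f0 w \<otimes>\<^bsub>GR\<^esub> gr_monom R (star r) \<one>)"
proof -
  let ?H = "restrict_scalars (\<lambda>r. gr_monom R r \<one>) (group_cohomology R star G (Suc k))"
  let ?C = "cochains R star G (Suc k)"
  let ?N = "coboundaries R star G (Suc k)"
  let ?cl = "cocycle_class star (Suc k)"
  have carr: "carrier ?H = ?cl ` cocycles R star G (Suc k)"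
    by (simp add: restrict_scalars_def carrier_cohomology)
  obtain h where h: "h \<in> lmod_hom R ?H (regular_module R)" and bij: "bij_betw h (carrier ?H) (carrier R)"
    using iso by (auto simp: lmod_isomorphic_def regular_module_def)
  have "\<one>\<^bsub>R\<^esub> \<in> h ` carrier ?H" using bij_betw_imp_surj_on[OF bij] by (metis R.one_closed)
  then obtain X0 where X0: "X0 \<in> carrier ?H" "h X0 = \<one>\<^bsub>R\<^esub>" by (elim imageE) simp
  have "X0 \<in> ?cl ` cocycles R star G (Suc k)" using X0(1) unfolding carr .
  then obtain f0 where f0: "f0 \<in> cocycles R star G (Suc k)" "X0 = ?cl f0" by (elim imageE) simp
  have f0c: "f0 \<in> carrier ?C" using f0 by (simp add: cocycles_iff)
  have Nc: "n \<in> carrier ?C" if "n \<in> ?N" for n using that coboundary_closed by auto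
  have smult_X0: "r \<odot>\<^bsub>?H\<^esub> X0 = ?cl (gr_monom R r \<one> \<odot>\<^bsub>?C\<^esub> f0)" if r: "r \<in> carrier R" for r
  proof -
    let ?r = "gr_monom R r \<one>"
    have sr: "star r \<in> carrier R" using star(1) r by auto
    note sm = smult_closed[of star, OF star(2) sr]
    \<comment> \<open>Scalar multiplication on the quotient is a union over all representatives. It
      is a single coset because coboundaries are closed under sums and scalars.\<close>
    have "r \<odot>\<^bsub>?H\<^esub> X0 = (\<Union>x\<in>?cl f0. ?cl (?r \<odot>\<^bsub>?C\<^esub> x))"
      unfolding f0(2) by (auto simp: restrict_scalars_def group_cohomology_def quotient_lmod_def a_r_coset_def r_coset_def)
    also have "\<dots> = ?cl (?r \<odot>\<^bsub>?C\<^esub> f0)"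
    proof
      have "f0 \<in> ?cl f0" by (rule in_cocycle_class[OF f0c])
      then show "?cl (?r \<odot>\<^bsub>?C\<^esub> f0) \<subseteq> (\<Union>x\<in>?cl f0. ?cl (?r \<odot>\<^bsub>?C\<^esub> x))" by blast
      show "(\<Union>x\<in>?cl f0. ?cl (?r \<odot>\<^bsub>?C\<^esub> x)) \<subseteq> ?cl (?r \<odot>\<^bsub>?C\<^esub> f0)"
      proof
        fix y assume "y \<in> (\<Union>x\<in>?cl f0. ?cl (?r \<odot>\<^bsub>?C\<^esub> x))"
        then obtain n n0 where n: "n \<in> ?N" "n0 \<in> ?N" and y: "y = n \<oplus>\<^bsub>?C\<^esub> (?r \<odot>\<^bsub>?C\<^esub> (n0 \<oplus>\<^bsub>?C\<^esub> f0))" by blast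
        obtain c c0 where c: "c \<in> carrier (cochains R star G k)" "n = coboundary R G k c"
          "c0 \<in> carrier (cochains R star G k)" "n0 = coboundary R G k c0" using n by auto
        let ?n = "coboundary R G k (c \<oplus>\<^bsub>cochains R star G k\<^esub> (?r \<odot>\<^bsub>cochains R star G k\<^esub> c0))"
        have "?n = n \<oplus>\<^bsub>?C\<^esub> (?r \<odot>\<^bsub>?C\<^esub> n0)"
          using coboundary_add[OF c(1) sm[OF c(3)]] coboundary_smult[of star, OF star(2) sr c(3)] c by simp
        moreover have nN: "?n \<in> ?N" using cochains_closed(1)[OF c(1) sm[OF c(3)]] by auto
        moreover have "y = (n \<oplus>\<^bsub>?C\<^esub> (?r \<odot>\<^bsub>?C\<^esub> n0)) \<oplus>\<^bsub>?C\<^esub> (?r \<odot>\<^bsub>?C\<^esub> f0)"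
        proof
          fix w
          show "y w = ((n \<oplus>\<^bsub>?C\<^esub> (?r \<odot>\<^bsub>?C\<^esub> n0)) \<oplus>\<^bsub>?C\<^esub> (?r \<odot>\<^bsub>?C\<^esub> f0)) w"
          proof (cases "w \<in> words G (Suc k)")
            case True
            have "n w \<in> carrier GR" "n0 w \<in> carrier GR" "f0 w \<in> carrier GR"
              using cochainsD(2)[OF Nc[OF n(1)] True] cochainsD(2)[OF Nc[OF n(2)] True] cochainsD(2)[OF f0c True] .
            then show ?thesis
              using True gr_monom_carrier[OF sr one_closed]
              by (simp add: y cochains_add cochains_smult[of star, OF star(2)] A.l_distr A.a_assoc)
          qed (simp add: y cochains_add)
        qed
        ultimately have "y = ?n \<oplus>\<^bsub>?C\<^esub> (?r \<odot>\<^bsub>?C\<^esub> f0)" by (simp only:)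
        then show "y \<in> ?cl (?r \<odot>\<^bsub>?C\<^esub> f0)" using imageI[OF nN] by (simp only:)
      qed
    qed
    finally show ?thesis .
  qed
  have "\<exists>r\<in>carrier R. \<exists>c\<in>carrier (cochains R star G k). \<forall>w\<in>words G (Suc k).
      f w = coboundary R G k c w \<oplus>\<^bsub>GR\<^esub> (f0 w \<otimes>\<^bsub>GR\<^esub> gr_monom R (star r) \<one>)"
    if f: "f \<in> cocycles R star G (Suc k)" for f
  proof -
    have fc: "f \<in> carrier ?C" using f by (simp add: cocycles_iff)
    have X: "?cl f \<in> carrier ?H" unfolding carr using f by (rule imageI)
    define r where "r = h (?cl f)"
    have r: "r \<in> carrier R" using lmod_homD(1)[OF h X] by (simp add: r_def regular_module_def)
    have sr: "star r \<in> carrier R" using star(1) r by auto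
    have "coboundary R G (Suc k) (gr_monom R r \<one> \<odot>\<^bsub>?C\<^esub> f0) = \<zero>\<^bsub>cochains R star G (Suc (Suc k))\<^esub>"
    proof -
      have "gr_monom R r \<one> \<odot>\<^bsub>cochains R star G (Suc (Suc k))\<^esub> \<zero>\<^bsub>cochains R star G (Suc (Suc k))\<^esub> =
          \<zero>\<^bsub>cochains R star G (Suc (Suc k))\<^esub>"
        using gr_monom_carrier[OF sr one_closed]
        by (auto simp: cochains_smult[of star, OF star(2)] cochains_zero fun_eq_iff)
      then show ?thesis
        using coboundary_smult[of star, OF star(2) sr f0c] f0(1) by (simp add: cocycles_iff)
    qed
    then have "gr_monom R r \<one> \<odot>\<^bsub>?C\<^esub> f0 \<in> cocycles R star G (Suc k)"
      using smult_closed[of star, OF star(2) sr f0c] by (simp add: cocycles_iff)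
    then have Y: "r \<odot>\<^bsub>?H\<^esub> X0 \<in> carrier ?H" unfolding smult_X0[OF r] carr by (rule imageI)
    have "h (r \<odot>\<^bsub>?H\<^esub> X0) = h (?cl f)"
      using lmod_homD(3)[OF h r X0(1)] X0(2) r by (simp add: regular_module_def r_def)
    then have "r \<odot>\<^bsub>?H\<^esub> X0 = ?cl f" by (rule inj_onD[OF bij_betw_imp_inj_on[OF bij] _ Y X])
    then have "f \<in> ?cl (gr_monom R r \<one> \<odot>\<^bsub>?C\<^esub> f0)"
      unfolding smult_X0[OF r] using in_cocycle_class[OF fc] by simp
    then obtain c where c: "c \<in> carrier (cochains R star G k)"
      "f = coboundary R G k c \<oplus>\<^bsub>?C\<^esub> (gr_monom R r \<one> \<odot>\<^bsub>?C\<^esub> f0)" by auto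
    have "f w = coboundary R G k c w \<oplus>\<^bsub>GR\<^esub> (f0 w \<otimes>\<^bsub>GR\<^esub> gr_monom R (star r) \<one>)" if w: "w \<in> words G (Suc k)" for w
      unfolding c(2) using w by (simp add: cochains_add cochains_smult[of star, OF star(2)])
    then show ?thesis using r c(1) by blast
  qed
  then show ?thesis using f0(1) by blast
qed

end

section \<open>Cochains with values in free modules\<close>

context group_ring_coeff
begin

text \<open>Coordinate \<open>j\<close> of a cochain with values in a free module, pulled back along
  \<open>emb\<close> to a cochain over the group ring; \<open>emb_cochain\<close> goes in the
  opposite direction and combines \<open>n\<close> coordinates.\<close>

definition unemb where
  "unemb k f j = (\<lambda>w\<in>words G k. \<lambda>x. inv_into (carrier R) (emb R) (f w j x))"

definition emb_cochain where
  "emb_cochain n C w = (\<lambda>j x. if j < (n :: nat) then emb R (C j w x) else 0)"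

lemma emb_unemb:
  assumes f: "\<And>w. w \<in> words G k \<Longrightarrow> f w \<in> Free J" and w: "w \<in> words G k"
  shows "emb R (unemb k f j w x) = f w j x"
  using w FreeD(1)[OF f[OF w], of j x] by (simp add: unemb_def f_inv_into_f)

lemma unemb_cochain:
  assumes f: "\<And>w. w \<in> words G k \<Longrightarrow> f w \<in> Free J"
  shows "unemb k f j \<in> carrier (cochains R star G k)"
proof -
  have "unemb k f j w \<in> carrier GR" if w: "w \<in> words G k" for w
  proof -
    have c: "unemb k f j w x \<in> carrier R" for x
      using w FreeD(1)[OF f[OF w], of j x] by (simp add: unemb_def inv_into_into)
    have nz: "f w j x \<noteq> 0" if "unemb k f j w x \<noteq> \<zero>\<^bsub>R\<^esub>" for x
    proof -
      have "emb R (unemb k f j w x) \<noteq> 0" using R.emb_eq_0_iff[OF c] that by simp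
      moreover have "emb R (unemb k f j w x) = f w j x" by (rule emb_unemb[OF f w])
      ultimately show ?thesis by simp
    qed
    have "{x. unemb k f j w x \<noteq> \<zero>\<^bsub>R\<^esub>} \<subseteq> snd ` supp (f w)"
    proof
      fix x assume "x \<in> {x. unemb k f j w x \<noteq> \<zero>\<^bsub>R\<^esub>}"
      then have "(j, x) \<in> supp (f w)" using nz[of x] by (simp add: supp_def)
      then show "x \<in> snd ` supp (f w)" by (intro image_eqI[of _ snd "(j, x)"]) auto
    qed
    then have "finite {x. unemb k f j w x \<noteq> \<zero>\<^bsub>R\<^esub>}"
      by (rule finite_subset) (simp add: FreeD(2)[OF f[OF w]])
    moreover have "{x. unemb k f j w x \<noteq> \<zero>\<^bsub>R\<^esub>} \<subseteq> carrier G"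
      using nz FreeD(4)[OF f[OF w]] by blast
    ultimately show ?thesis using c by (simp add: group_ring_def)
  qed
  then show ?thesis by (auto simp: cochains_def unemb_def)
qed

lemma emb_cochain_Free:
  assumes C: "\<And>j. j < n \<Longrightarrow> C j \<in> carrier (cochains R star G k)" and w: "w \<in> words G k"
  shows "emb_cochain n C w \<in> Free {..<n}"
proof -
  have c: "C j w \<in> carrier GR" if "j < n" for j using cochainsD(2)[OF C[OF that] w] .
  have "supp (emb_cochain n C w) = Sigma {..<n} (\<lambda>j. {x. C j w x \<noteq> \<zero>\<^bsub>R\<^esub>})"
    using R.emb_eq_0_iff gr_carrierD(1)[OF c] by (auto simp: supp_def emb_cochain_def)
  moreover have "finite (Sigma {..<n} (\<lambda>j. {x. C j w x \<noteq> \<zero>\<^bsub>R\<^esub>}))"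
    using gr_carrierD(3)[OF c] by (intro finite_SigmaI) auto
  moreover have "Sigma {..<n} (\<lambda>j. {x. C j w x \<noteq> \<zero>\<^bsub>R\<^esub>}) \<subseteq> {..<n} \<times> carrier G"
    using gr_carrierD(2)[OF c] by blast
  moreover have "0 \<in> emb R ` carrier R" by (rule image_eqI[of _ _ "\<zero>\<^bsub>R\<^esub>"]) (simp_all add: R.emb_zero)
  then have "emb_cochain n C w j x \<in> emb R ` carrier R" for j x
    using gr_carrierD(1)[OF c, of j x] by (simp add: emb_cochain_def)
  ultimately show ?thesis unfolding Free_def by simp
qed

text \<open>Evaluating a cochain on bar boundaries is the coboundary; since all operations are
  coordinatewise, statements about cochains over the group ring carry over to free modules of any
  finite rank.\<close>

lemma emb_coboundary:
  assumes f: "\<And>w. w \<in> words G k \<Longrightarrow> f w \<in> Free J" and F: "F \<in> carrier (cochains R star G k)"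
    and fF: "\<And>v x. v \<in> words G k \<Longrightarrow> f v j x = emb R (F v x)" and w: "w \<in> words G (Suc k)"
  shows "ext f (bd w) j x = emb R (coboundary R G k F w x)"
proof -
  have m: "tl w \<in> words G k" "butlast w \<in> words G k" "\<And>i. i < k \<Longrightarrow> merge i w \<in> words G k"
    using wordsD[OF w] merge_words[OF w] by auto
  have "ext f (bd w) j x = act (hd w) (f (tl w)) j x + (\<Sum>i<k. sgn_if (Suc i) (f (merge i w) j x))
      + sgn_if (Suc k) (f (butlast w) j x)"
  proof -
    have "ext f (bd w) = act (hd w) (f (tl w)) + (\<Sum>i<k. sgn_if (Suc i) (f (merge i w))) + sgn_if (Suc k) (f (butlast w))"
      by (rule ext_bd[OF submod_Free f w])
    then show ?thesis by (simp add: sum_fun_apply sgn_if_apply)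
  qed
  also have "\<dots> = emb R (coboundary R G k F w x)"
    unfolding coboundary_word(2)[OF cochainsD(1)[OF F] w] using m by (simp add: fF act_def)
  finally show ?thesis .
qed

lemma unemb_cocycle:
  assumes f: "\<And>w. w \<in> words G k \<Longrightarrow> f w \<in> Free J" and cocycle: "\<And>w. w \<in> words G (Suc k) \<Longrightarrow> ext f (bd w) = 0"
  shows "unemb k f j \<in> cocycles R star G k"
proof -
  note F = unemb_cochain[where star = star and j = j, OF f]
  have "coboundary R G k (unemb k f j) = \<zero>\<^bsub>cochains R star G (Suc k)\<^esub>"
  proof (rule coboundary_eqI[OF F cochains_closed(2)])
    fix w x assume w: "w \<in> words G (Suc k)"
    have "emb R (coboundary R G k (unemb k f j) w x) = ext f (bd w) j x"
      by (rule emb_coboundary[OF f F emb_unemb[OF f, symmetric] w, symmetric])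
    then show "emb R (coboundary R G k (unemb k f j) w x) = emb R (\<zero>\<^bsub>cochains R star G (Suc k)\<^esub> w x)"
      using cocycle[OF w] w by (simp add: cochains_zero gr_ops R.emb_zero)
  qed
  then show ?thesis using F by (simp add: cocycles_iff)
qed

lemma ext_emb_cochain:
  assumes C: "\<And>j. C j \<in> carrier (cochains R star G k)" and w: "w \<in> words G (Suc k)"
  shows "ext (emb_cochain n C) (bd w) j x = (if j < n then emb R (coboundary R G k (C j) w x) else 0)"
proof (cases "j < n")
  case True
  have e: "emb_cochain n C v j x = emb R (C j v x)" for v x using True by (simp add: emb_cochain_def)
  have "ext (emb_cochain n C) (bd w) j x = emb R (coboundary R G k (C j) w x)"
    by (rule emb_coboundary[OF emb_cochain_Free[where n = n and star = star, OF C] C e w])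
  then show ?thesis using True by simp
next
  case False
  have "ext (emb_cochain n C) (bd w) j x = emb R (coboundary R G k \<zero>\<^bsub>cochains R star G k\<^esub> w x)"
    by (rule emb_coboundary[OF emb_cochain_Free[where n = n and star = star, OF C] cochains_closed(2) _ w])
      (simp_all add: emb_cochain_def False cochains_zero gr_ops R.emb_zero)
  then show ?thesis unfolding coboundary_zero using False w by (simp add: cochains_zero gr_ops R.emb_zero)
qed

lemma vanishing_of_cohomology:
  assumes van: "carrier (group_cohomology R star G (Suc k)) = {\<zero>\<^bsub>group_cohomology R star G (Suc k)\<^esub>}"
  shows "vanishing k"
  unfolding vanishing_def
proof (intro allI impI)
  fix n :: nat and f
  assume "\<forall>w\<in>words G (Suc k). f w \<in> Free {..<n}" and "\<forall>w\<in>words G (Suc (Suc k)). ext f (bd w) = 0"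
  then have f: "\<And>w. w \<in> words G (Suc k) \<Longrightarrow> f w \<in> Free {..<n}"
    and cocycle: "\<And>w. w \<in> words G (Suc (Suc k)) \<Longrightarrow> ext f (bd w) = 0" by auto
  have "\<forall>j. \<exists>c. c \<in> carrier (cochains R star G k) \<and> coboundary R G k c = unemb (Suc k) f j"
    using vanishing_cohomology[OF van unemb_cocycle[OF f cocycle]] by auto
  from choice[OF this] obtain C where C: "\<And>j. C j \<in> carrier (cochains R star G k)"
    and dC: "\<And>j. coboundary R G k (C j) = unemb (Suc k) f j" by auto
  have "f w = ext (emb_cochain n C) (bd w)" if w: "w \<in> words G (Suc k)" for w
  proof (intro ext)
    fix j x
    show "f w j x = ext (emb_cochain n C) (bd w) j x"
      using ext_emb_cochain[where j = j and x = x and n = n, OF C w] emb_unemb[where j = j and x = x, OF f w] FreeD(3)[OF f[OF w], of j x]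
      by (auto simp: dC)
  qed
  then show "\<exists>c. (\<forall>w\<in>words G k. c w \<in> Free {..<n}) \<and> (\<forall>w\<in>words G (Suc k). f w = ext c (bd w))"
    using emb_cochain_Free[where n = n and star = star, OF C] by (intro exI[of _ "emb_cochain n C"]) auto
qed

lemma H2_generator_of_cohomology:
  assumes iso: "lmod_isomorphic R (restrict_scalars (\<lambda>r. gr_monom R r \<one>) (group_cohomology R star G 2))
      (regular_module R)"
    and star: "star \<in> carrier R \<rightarrow> carrier R" "star \<zero>\<^bsub>R\<^esub> = \<zero>\<^bsub>R\<^esub>"
  shows "\<exists>f0. H2_generator f0"
proof -
  obtain F0 where F0: "F0 \<in> cocycles R star G (Suc 1)"
    and gen: "\<And>f. f \<in> cocycles R star G (Suc 1) \<Longrightarrow> \<exists>r\<in>carrier R. \<exists>c\<in>carrier (cochains R star G 1).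
      \<forall>w\<in>words G (Suc 1). f w = coboundary R G 1 c w \<oplus>\<^bsub>GR\<^esub> (F0 w \<otimes>\<^bsub>GR\<^esub> gr_monom R (star r) \<one>)"
    using cyclic_cohomology[of star 1, OF _ star] iso by (auto simp: numeral_2_eq_2)
  have F0c: "F0 \<in> carrier (cochains R star G (Suc 1))"
    and dF0: "coboundary R G (Suc 1) F0 = \<zero>\<^bsub>cochains R star G (Suc (Suc 1))\<^esub>" using F0 by (auto simp: cocycles_iff)
  define f0 where "f0 = emb_cochain 1 (\<lambda>_. F0)"
  have f0: "f0 w \<in> Free {..<1}" if "w \<in> words G (Suc 1)" for w
    unfolding f0_def by (rule emb_cochain_Free[OF F0c that])
  have df0: "ext f0 (bd w) = 0" if w: "w \<in> words G (Suc (Suc 1))" for w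
  proof (intro ext)
    fix j x
    show "ext f0 (bd w) j x = 0 j x"
      unfolding f0_def using ext_emb_cochain[where n = 1 and j = j and x = x and C = "\<lambda>_. F0", OF F0c w] w
      by (simp only: dF0) (simp add: cochains_zero gr_ops R.emb_zero)
  qed
  have main: "\<exists>\<rho> c. (\<forall>j. \<rho> j \<in> emb R ` carrier R) \<and> (\<forall>w\<in>words G 1. c w \<in> Free {..<n}) \<and>
      (\<forall>w\<in>words G (Suc 1). f w = right_scale n \<rho> (f0 w) + ext c (bd w))"
    if f: "\<And>w. w \<in> words G (Suc 1) \<Longrightarrow> f w \<in> Free {..<n}"
      and cocycle: "\<And>w. w \<in> words G (Suc (Suc 1)) \<Longrightarrow> ext f (bd w) = 0" for n :: nat and f
  proof -
    have "\<forall>j. \<exists>p. fst p \<in> carrier R \<and> snd p \<in> carrier (cochains R star G 1) \<and> (\<forall>w\<in>words G (Suc 1).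
        unemb (Suc 1) f j w = coboundary R G 1 (snd p) w \<oplus>\<^bsub>GR\<^esub> (F0 w \<otimes>\<^bsub>GR\<^esub> gr_monom R (star (fst p)) \<one>))"
      using gen[OF unemb_cocycle[OF f cocycle]] by fastforce
    from choice[OF this] obtain p where p: "\<And>j. fst (p j) \<in> carrier R" "\<And>j. snd (p j) \<in> carrier (cochains R star G 1)"
      "\<And>j w. w \<in> words G (Suc 1) \<Longrightarrow> unemb (Suc 1) f j w =
        coboundary R G 1 (snd (p j)) w \<oplus>\<^bsub>GR\<^esub> (F0 w \<otimes>\<^bsub>GR\<^esub> gr_monom R (star (fst (p j))) \<one>)" by auto
    define C where "C j = snd (p j)" for j
    \<comment> \<open>The scalar by which the left action of \<open>fst (p j)\<close> multiplies
      cochains on the right.\<close>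
    define \<rho> where "\<rho> j = emb R (star (fst (p j)))" for j
    have C: "\<And>j. C j \<in> carrier (cochains R star G 1)" using p(2) by (simp add: C_def)
    have sp: "star (fst (p j)) \<in> carrier R" for j using star(1) p(1)[of j] by auto
    have "f w = right_scale n \<rho> (f0 w) + ext (emb_cochain n C) (bd w)" if w: "w \<in> words G (Suc 1)" for w
    proof (intro ext)
      fix j x
      have F0w: "F0 w \<in> carrier GR" using cochainsD(2)[OF F0c w] .
      have "f w j x = emb R (unemb (Suc 1) f j w x)" by (rule emb_unemb[OF f w, symmetric])
      also have "\<dots> = emb R (coboundary R G 1 (C j) w x) + emb R (F0 w x) * \<rho> j"
        unfolding p(3)[OF w] C_def \<rho>_def
        using emb_gr_add[OF coboundary_word(1)[OF cochainsD(1)[OF p(2)] w] A.m_closed[OF F0w gr_monom_carrier[OF sp one_closed]]]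
          emb_mult_monom_one[OF sp F0w] by simp
      finally show "f w j x = (right_scale n \<rho> (f0 w) + ext (emb_cochain n C) (bd w)) j x"
        using ext_emb_cochain[where j = j and x = x and n = n, OF C w] FreeD(3)[OF f[OF w], of j x]
        by (cases "j < n") (auto simp: right_scale_def f0_def emb_cochain_def)
    qed
    moreover have "\<rho> j \<in> emb R ` carrier R" for j using sp by (simp add: \<rho>_def)
    moreover have "emb_cochain n C w \<in> Free {..<n}" if "w \<in> words G 1" for w by (rule emb_cochain_Free[OF C that])
    ultimately show ?thesis by (intro exI[of _ \<rho>] exI[of _ "emb_cochain n C"]) simp
  qed
  have two: "Suc 1 = 2" "Suc (Suc 1) = 3" by simp_all
  have "H2_generator f0"
    unfolding H2_generator_def two[symmetric]
  proof (intro conjI allI impI ballI)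
    fix n :: nat and f :: "'g list \<Rightarrow> nat \<Rightarrow> 'g \<Rightarrow> 'r ring_product"
    assume f: "\<forall>w\<in>words G (Suc 1). f w \<in> Free {..<n}" "\<forall>w\<in>words G (Suc (Suc 1)). ext f (bd w) = 0"
    show "\<exists>\<rho> c. (\<forall>j. \<rho> j \<in> emb R ` carrier R) \<and> (\<forall>w\<in>words G 1. c w \<in> Free {..<n}) \<and>
      (\<forall>w\<in>words G (Suc 1). f w = right_scale n \<rho> (f0 w) + ext c (bd w))"
      by (rule main[OF bspec[OF f(1)] bspec[OF f(2)]])
  qed (rule f0 df0, assumption)+
  then show ?thesis by (intro exI[of H2_generator f0])
qed

end

lemma (in projective_resolution) hyperbolic_of_duality:
  assumes "e \<noteq> 0" and gen: "H2_generator f0" and van: "\<And>j. 2 \<le> j \<Longrightarrow> vanishing j"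
    and T: "finite T" "T \<subseteq> carrier G"
    and nonamenable: "\<And>F. finite F \<Longrightarrow> F \<subseteq> carrier G \<Longrightarrow>
      card F \<le> K * (\<Sum>g\<in>T. card ((\<lambda>x. x \<otimes> g) ` F - F))"
  shows "hyperbolic_group G"
proof -
  obtain S0 where S0: "finite S0" "S0 \<subseteq> carrier G" "generate G S0 = carrier G"
    using finitely_generated[OF assms(1)] by blast
  obtain S where S: "finite S" "S \<subseteq> carrier G" "generate G S = carrier G" "\<one> \<in> S" "m_inv G ` S = S"
    using symmetric_generating_set[OF S0] by blast
  obtain n t z where db: "dual_basis 1 n t z" using dual_basis_ex[OF van] by blast
  obtain C where C: "\<And>p. p \<in> pker 1 \<Longrightarrow> sz (z p) \<le> C * sz p"
    using dual_basis_isoperimetry[OF gen db T nonamenable] by blast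
  obtain C' W where W: "finite W" "\<forall>w\<in>W. w \<in> Free S \<and> cayley_d w = 0"
    and fill: "\<forall>c\<in>Free S. cayley_d c = 0 \<longrightarrow> (\<exists>N \<omega>. N \<le> C' * sz c \<and> c = (\<Sum>i<N. \<omega> i) \<and>
      (\<forall>i<N. \<exists>w\<in>W. \<exists>r\<in>Rs. \<exists>g\<in>carrier G. \<omega> i = sc r (act g w)))"
    by (rule cayley_isoperimetry[OF S(1-3) db, elim_format], erule C, elim exE conjE, rule that)
  have "gromov_hyperbolic (carrier G) (word_dist G S)"
    by (rule hyperbolic_of_linear_filling[OF assms(1) S W(1) bspec[OF W(2)] mp[OF bspec[OF fill]]])
  then show ?thesis unfolding hyperbolic_group_def using S group_axioms by blast
qed

section \<open>Resolutions in coordinates\<close>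

context group_ring_coeff
begin

lemma equivariant_module_embedding:
  fixes M :: "('g \<Rightarrow> 'r, 'm) module"
  assumes M: "left_module GR M" and fg: "lmod_finitely_generated GR M" and pr: "lmod_projective GR M"
  shows "\<exists>(m :: nat) s \<iota>. inj_on \<iota> (carrier M) \<and> proj {..<m} s (\<iota> ` carrier M) \<and> \<iota> \<zero>\<^bsub>M\<^esub> = 0 \<and>
    (\<forall>p\<in>carrier M. \<forall>q\<in>carrier M. \<iota> (p \<oplus>\<^bsub>M\<^esub> q) = \<iota> p + \<iota> q) \<and>
    (\<forall>r\<in>carrier R. \<forall>p\<in>carrier M. \<iota> (gr_monom R r \<one> \<odot>\<^bsub>M\<^esub> p) = sc (emb R r) (\<iota> p)) \<and>
    (\<forall>g\<in>carrier G. \<forall>p\<in>carrier M. \<iota> (gr_monom R \<one>\<^bsub>R\<^esub> g \<odot>\<^bsub>M\<^esub> p) = act g (\<iota> p))"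
proof -
  interpret M: left_module GR M by fact
  obtain m :: nat and s \<iota> where inj: "inj_on \<iota> (carrier M)" and pr: "proj {..<m} s (\<iota> ` carrier M)"
    and add: "\<And>p q. p \<in> carrier M \<Longrightarrow> q \<in> carrier M \<Longrightarrow> \<iota> (p \<oplus>\<^bsub>M\<^esub> q) = \<iota> p + \<iota> q"
    and monom: "\<And>r g p. r \<in> carrier R \<Longrightarrow> g \<in> carrier G \<Longrightarrow> p \<in> carrier M \<Longrightarrow>
      \<iota> (gr_monom R r g \<odot>\<^bsub>M\<^esub> p) = sc (emb R r) (act g (\<iota> p))"
    using module_embedding[OF M fg pr] by auto
  have F: "\<iota> p \<in> Free UNIV" if "p \<in> carrier M" for p
    by (rule submodD(1)[OF projD(1)[OF pr] imageI[OF that]])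
  have "\<iota> \<zero>\<^bsub>M\<^esub> = 0" using add[of "\<zero>\<^bsub>M\<^esub>" "\<zero>\<^bsub>M\<^esub>"] by simp
  moreover have "\<iota> (gr_monom R r \<one> \<odot>\<^bsub>M\<^esub> p) = sc (emb R r) (\<iota> p)" if "r \<in> carrier R" "p \<in> carrier M" for r p
    unfolding monom[OF that(1) one_closed that(2)] act_one[OF F[OF that(2)]] ..
  moreover have "\<iota> (gr_monom R \<one>\<^bsub>R\<^esub> g \<odot>\<^bsub>M\<^esub> p) = act g (\<iota> p)" if "g \<in> carrier G" "p \<in> carrier M" for g p
    unfolding monom[OF R.one_closed that] by (rule sc_e[OF act_Free[OF that(1) F[OF that(2)]]])
  ultimately show ?thesis using inj pr add by blast
qed

text \<open>The given resolution is transported along embeddings of its modules into free ones. As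
  \<open>hm\<close> treats scalars and translations separately, linearity of the maps is needed for
  the monomials \<open>r \<one>\<close> and \<open>1 g\<close> only.\<close>

lemma projective_resolution_of_type_FP:
  assumes "lmod_type_FP GR (trivial_module R :: ('g \<Rightarrow> 'r, 'r) module)"
  shows "\<exists>P m s d ep len. projective_resolution G (emb R ` carrier R) (emb R \<one>\<^bsub>R\<^esub>) P m s d ep len"
proof -
  let ?T = "trivial_module R :: ('g \<Rightarrow> 'r, 'r) module"
  obtain Q :: "nat \<Rightarrow> ('g \<Rightarrow> 'r, nat \<Rightarrow> 'g \<Rightarrow> 'r) module" and \<delta> \<epsilon> n where FP:
    "(\<forall>k. left_module GR (Q k) \<and> lmod_finitely_generated GR (Q k) \<and> lmod_projective GR (Q k)) \<and>
     (\<forall>k>n. carrier (Q k) = {\<zero>\<^bsub>Q k\<^esub>}) \<and> (\<forall>k. \<delta> k \<in> lmod_hom GR (Q (Suc k)) (Q k)) \<and>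
     \<epsilon> \<in> lmod_hom GR (Q 0) ?T \<and> \<epsilon> ` carrier (Q 0) = carrier ?T \<and>
     a_kernel (Q 0) ?T \<epsilon> = \<delta> 0 ` carrier (Q 1) \<and>
     (\<forall>k. a_kernel (Q (Suc k)) (Q k) (\<delta> k) = \<delta> (Suc k) ` carrier (Q (Suc (Suc k))))"
    using assms unfolding lmod_type_FP_def by (elim exE) (rule that)
  have Q: "left_module GR (Q k)" "lmod_finitely_generated GR (Q k)" "lmod_projective GR (Q k)" for k
    using FP by simp_all
  have len: "carrier (Q k) = {\<zero>\<^bsub>Q k\<^esub>}" if "n < k" for k using FP that by simp
  have \<delta>: "\<delta> k \<in> lmod_hom GR (Q (Suc k)) (Q k)" for k using FP by simp
  have \<epsilon>: "\<epsilon> \<in> lmod_hom GR (Q 0) ?T" and onto: "\<epsilon> ` carrier (Q 0) = carrier ?T"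
    and ex0: "a_kernel (Q 0) ?T \<epsilon> = \<delta> 0 ` carrier (Q (Suc 0))" using FP by simp_all
  have exS: "a_kernel (Q (Suc k)) (Q k) (\<delta> k) = \<delta> (Suc k) ` carrier (Q (Suc (Suc k)))" for k using FP by simp
  \<comment> \<open>Rank, retraction and embedding are packed into one triple, so that a single
    choice over all degrees suffices.\<close>
  have "\<forall>k. \<exists>t :: nat \<times> (nat \<Rightarrow> nat \<Rightarrow> 'g \<Rightarrow> 'r ring_product) \<times> ((nat \<Rightarrow> 'g \<Rightarrow> 'r) \<Rightarrow> nat \<Rightarrow> 'g \<Rightarrow> 'r ring_product).
     inj_on (snd (snd t)) (carrier (Q k)) \<and> proj {..<fst t} (fst (snd t)) (snd (snd t) ` carrier (Q k)) \<and>
     snd (snd t) \<zero>\<^bsub>Q k\<^esub> = 0 \<and>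
     (\<forall>p\<in>carrier (Q k). \<forall>q\<in>carrier (Q k). snd (snd t) (p \<oplus>\<^bsub>Q k\<^esub> q) = snd (snd t) p + snd (snd t) q) \<and>
     (\<forall>r\<in>carrier R. \<forall>p\<in>carrier (Q k). snd (snd t) (gr_monom R r \<one> \<odot>\<^bsub>Q k\<^esub> p) = sc (emb R r) (snd (snd t) p)) \<and>
     (\<forall>g\<in>carrier G. \<forall>p\<in>carrier (Q k). snd (snd t) (gr_monom R \<one>\<^bsub>R\<^esub> g \<odot>\<^bsub>Q k\<^esub> p) = act g (snd (snd t) p))"
    using equivariant_module_embedding[OF Q] by simp
  from choice[OF this] obtain t :: "nat \<Rightarrow> nat \<times> (nat \<Rightarrow> nat \<Rightarrow> 'g \<Rightarrow> 'r ring_product) \<times> ((nat \<Rightarrow> 'g \<Rightarrow> 'r) \<Rightarrow> nat \<Rightarrow> 'g \<Rightarrow> 'r ring_product)"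
    where t: "\<forall>k. inj_on (snd (snd (t k))) (carrier (Q k)) \<and>
     proj {..<fst (t k)} (fst (snd (t k))) (snd (snd (t k)) ` carrier (Q k)) \<and>
     snd (snd (t k)) \<zero>\<^bsub>Q k\<^esub> = 0 \<and>
     (\<forall>p\<in>carrier (Q k). \<forall>q\<in>carrier (Q k). snd (snd (t k)) (p \<oplus>\<^bsub>Q k\<^esub> q) = snd (snd (t k)) p + snd (snd (t k)) q) \<and>
     (\<forall>r\<in>carrier R. \<forall>p\<in>carrier (Q k). snd (snd (t k)) (gr_monom R r \<one> \<odot>\<^bsub>Q k\<^esub> p) = sc (emb R r) (snd (snd (t k)) p)) \<and>
     (\<forall>g\<in>carrier G. \<forall>p\<in>carrier (Q k). snd (snd (t k)) (gr_monom R \<one>\<^bsub>R\<^esub> g \<odot>\<^bsub>Q k\<^esub> p) = act g (snd (snd (t k)) p))"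
    by (rule exE)
  define m where "m k = fst (t k)" for k
  define s where "s k = fst (snd (t k))" for k
  define \<iota> where "\<iota> k = snd (snd (t k))" for k
  note t = t[folded m_def s_def \<iota>_def, rule_format]
  have inj: "inj_on (\<iota> k) (carrier (Q k))" for k using t by simp
  have pr: "proj {..<m k} (s k) (\<iota> k ` carrier (Q k))" for k using t by simp
  have zero: "\<iota> k \<zero>\<^bsub>Q k\<^esub> = 0" for k using t by simp
  have add: "\<iota> k (p \<oplus>\<^bsub>Q k\<^esub> q) = \<iota> k p + \<iota> k q" if "p \<in> carrier (Q k)" "q \<in> carrier (Q k)" for k p q
    using t that by simp
  have scal: "\<iota> k (gr_monom R r \<one> \<odot>\<^bsub>Q k\<^esub> p) = sc (emb R r) (\<iota> k p)" if "r \<in> carrier R" "p \<in> carrier (Q k)" for k r p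
    using t that by simp
  have trans: "\<iota> k (gr_monom R \<one>\<^bsub>R\<^esub> g \<odot>\<^bsub>Q k\<^esub> p) = act g (\<iota> k p)" if "g \<in> carrier G" "p \<in> carrier (Q k)" for k g p
    using t that by simp
  define \<kappa> where "\<kappa> k = inv_into (carrier (Q k)) (\<iota> k)" for k
  have \<kappa>: "\<kappa> k (\<iota> k p) = p" if "p \<in> carrier (Q k)" for k p
    using inv_into_f_f[OF inj that] by (simp add: \<kappa>_def)
  define d where "d k x = \<iota> k (\<delta> k (\<kappa> (Suc k) x))" for k x
  define ep where "ep x = emb R (\<epsilon> (\<kappa> 0 x))" for x
  have d: "d k (\<iota> (Suc k) p) = \<iota> k (\<delta> k p)" if "p \<in> carrier (Q (Suc k))" for k p by (simp add: d_def \<kappa>[OF that])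
  have ep: "ep (\<iota> 0 p) = emb R (\<epsilon> p)" if "p \<in> carrier (Q 0)" for p by (simp add: ep_def \<kappa>[OF that])
  have add_closed: "p \<oplus>\<^bsub>Q k\<^esub> q \<in> carrier (Q k)" if "p \<in> carrier (Q k)" "q \<in> carrier (Q k)" for k p q
    using abelian_monoid.a_closed[OF abelian_group.axioms(1)[OF left_module.axioms(2)[OF Q(1)]] that] .
  have zero_closed: "\<zero>\<^bsub>Q k\<^esub> \<in> carrier (Q k)" for k
    using abelian_groupE(2)[OF left_module.axioms(2)[OF Q(1)]] .
  have monom_closed: "gr_monom R r g \<odot>\<^bsub>Q k\<^esub> p \<in> carrier (Q k)"
    if "r \<in> carrier R" "g \<in> carrier G" "p \<in> carrier (Q k)" for k r g p
    by (rule left_module.smult_closed[OF Q(1) gr_monom_carrier[OF that(1,2)] that(3)])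
  have \<delta>c: "\<delta> k p \<in> carrier (Q k)" if "p \<in> carrier (Q (Suc k))" for k p by (rule lmod_homD(1)[OF \<delta> that])
  have \<epsilon>c: "\<epsilon> p \<in> carrier R" if "p \<in> carrier (Q 0)" for p
    using lmod_homD(1)[OF \<epsilon> that] by (simp add: trivial_module_def)
  have \<epsilon>_monom: "\<epsilon> (gr_monom R r g \<odot>\<^bsub>Q 0\<^esub> p) = r \<otimes>\<^bsub>R\<^esub> \<epsilon> p"
    if "r \<in> carrier R" "g \<in> carrier G" "p \<in> carrier (Q 0)" for r g p
    using lmod_homD(3)[OF \<epsilon> gr_monom_carrier[OF that(1,2)] that(3)] augmentation_monom[OF that(1), of g]
    by (simp add: trivial_module_def)
  have "projective_resolution G (emb R ` carrier R) (emb R \<one>\<^bsub>R\<^esub>) (\<lambda>k. \<iota> k ` carrier (Q k)) m s d ep n"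
  proof (unfold_locales, goal_cases)
    case (1 k) show ?case by (rule pr)
  next
    case (2 k)
    show ?case
      unfolding hm_def
    proof (intro conjI ballI, goal_cases)
      case (1 x)
      then obtain p where "p \<in> carrier (Q (Suc k))" "x = \<iota> (Suc k) p" by (elim imageE) simp
      then show ?case using d \<delta>c by simp
    next
      case (2 x y)
      from 2(1) obtain p where p: "p \<in> carrier (Q (Suc k))" "x = \<iota> (Suc k) p" by (elim imageE) simp
      from 2(2) obtain q where q: "q \<in> carrier (Q (Suc k))" "y = \<iota> (Suc k) q" by (elim imageE) simp
      have "d k (x + y) = d k (\<iota> (Suc k) (p \<oplus>\<^bsub>Q (Suc k)\<^esub> q))" using add[OF p(1) q(1)] p q by simp
      also have "\<dots> = \<iota> k (\<delta> k p \<oplus>\<^bsub>Q k\<^esub> \<delta> k q)"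
        unfolding d[OF add_closed[OF p(1) q(1)]] lmod_homD(2)[OF \<delta> p(1) q(1)] ..
      also have "\<dots> = d k x + d k y" unfolding add[OF \<delta>c[OF p(1)] \<delta>c[OF q(1)]] p(2) q(2) d[OF p(1)] d[OF q(1)] ..
      finally show ?case .
    next
      case (3 u x)
      from 3(1) obtain r where r: "r \<in> carrier R" "u = emb R r" by (elim imageE) simp
      from 3(2) obtain p where p: "p \<in> carrier (Q (Suc k))" "x = \<iota> (Suc k) p" by (elim imageE) simp
      show ?case
        unfolding r(2) p(2) scal[OF r(1) p(1), symmetric] d[OF monom_closed[OF r(1) one_closed p(1)]] d[OF p(1)]
          lmod_homD(3)[OF \<delta> gr_monom_carrier[OF r(1) one_closed] p(1)] by (rule scal[OF r(1) \<delta>c[OF p(1)]])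
    next
      case (4 g x)
      from 4(2) obtain p where p: "p \<in> carrier (Q (Suc k))" "x = \<iota> (Suc k) p" by (elim imageE) simp
      show ?case
        unfolding p(2) trans[OF 4(1) p(1), symmetric] d[OF monom_closed[OF R.one_closed 4(1) p(1)]] d[OF p(1)]
          lmod_homD(3)[OF \<delta> gr_monom_carrier[OF R.one_closed 4(1)] p(1)] by (rule trans[OF 4(1) \<delta>c[OF p(1)]])
    qed
  next
    case (3 x)
    then obtain p where "p \<in> carrier (Q 0)" "x = \<iota> 0 p" by (elim imageE) simp
    then show ?case using ep \<epsilon>c by simp
  next
    case (4 x y)
    from 4(1) obtain p where p: "p \<in> carrier (Q 0)" "x = \<iota> 0 p" by (elim imageE) simp
    from 4(2) obtain q where q: "q \<in> carrier (Q 0)" "y = \<iota> 0 q" by (elim imageE) simp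
    have "\<epsilon> (p \<oplus>\<^bsub>Q 0\<^esub> q) = \<epsilon> p \<oplus>\<^bsub>R\<^esub> \<epsilon> q"
      using lmod_homD(2)[OF \<epsilon> p(1) q(1)] by (simp add: trivial_module_def)
    then show ?case
      unfolding p(2) q(2) add[OF p(1) q(1), symmetric] ep[OF add_closed[OF p(1) q(1)]] ep[OF p(1)] ep[OF q(1)]
      using R.emb_add[OF \<epsilon>c[OF p(1)] \<epsilon>c[OF q(1)]] by simp
  next
    case (5 u x)
    from 5(1) obtain r where r: "r \<in> carrier R" "u = emb R r" by (elim imageE) simp
    from 5(2) obtain p where p: "p \<in> carrier (Q 0)" "x = \<iota> 0 p" by (elim imageE) simp
    show ?case
      unfolding r(2) p(2) scal[OF r(1) p(1), symmetric] ep[OF monom_closed[OF r(1) one_closed p(1)]] ep[OF p(1)]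
        \<epsilon>_monom[OF r(1) one_closed p(1)] by (rule R.emb_mult[OF r(1) \<epsilon>c[OF p(1)]])
  next
    case (6 g x)
    from 6(2) obtain p where p: "p \<in> carrier (Q 0)" "x = \<iota> 0 p" by (elim imageE) simp
    show ?case
      unfolding p(2) trans[OF 6(1) p(1), symmetric] ep[OF monom_closed[OF R.one_closed 6(1) p(1)]] ep[OF p(1)]
        \<epsilon>_monom[OF R.one_closed 6(1) p(1)] using \<epsilon>c[OF p(1)] by simp
  next
    case 7
    have "\<one>\<^bsub>R\<^esub> \<in> \<epsilon> ` carrier (Q 0)" using onto by (simp add: trivial_module_def)
    then obtain p where p: "p \<in> carrier (Q 0)" "\<one>\<^bsub>R\<^esub> = \<epsilon> p" by (elim imageE) simp
    show ?case by (rule bexI[of _ "\<iota> 0 p"]) (use ep[OF p(1)] p in auto)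
  next
    case (8 x)
    then obtain p where p: "p \<in> carrier (Q 0)" "x = \<iota> 0 p" by (elim imageE) simp
    have "ep x = 0 \<longleftrightarrow> p \<in> a_kernel (Q 0) ?T \<epsilon>"
      unfolding p(2) ep[OF p(1)] R.emb_eq_0_iff[OF \<epsilon>c[OF p(1)]] using p(1) by (simp add: a_kernel_def' trivial_module_def)
    also have "\<dots> \<longleftrightarrow> p \<in> \<delta> 0 ` carrier (Q (Suc 0))" unfolding ex0 by simp
    also have "\<dots> \<longleftrightarrow> \<iota> 0 p \<in> \<iota> 0 ` (\<delta> 0 ` carrier (Q (Suc 0)))"
      by (rule inj_on_image_mem_iff[OF inj p(1), symmetric]) (use \<delta>c in blast)
    also have "\<iota> 0 ` (\<delta> 0 ` carrier (Q (Suc 0))) = d 0 ` (\<iota> (Suc 0) ` carrier (Q (Suc 0)))"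
      unfolding image_image by (rule image_cong[OF refl]) (simp add: d)
    finally show ?case unfolding p(2) One_nat_def .
  next
    case (9 x k)
    then obtain p where p: "p \<in> carrier (Q (Suc k))" "x = \<iota> (Suc k) p" by (elim imageE) simp
    have "d k x = 0 \<longleftrightarrow> \<iota> k (\<delta> k p) = \<iota> k \<zero>\<^bsub>Q k\<^esub>" unfolding p(2) d[OF p(1)] zero ..
    also have "\<dots> \<longleftrightarrow> p \<in> a_kernel (Q (Suc k)) (Q k) (\<delta> k)"
      using inj_on_eq_iff[OF inj \<delta>c[OF p(1)] zero_closed] p(1) by (simp add: a_kernel_def')
    also have "\<dots> \<longleftrightarrow> p \<in> \<delta> (Suc k) ` carrier (Q (Suc (Suc k)))" unfolding exS ..
    also have "\<dots> \<longleftrightarrow> \<iota> (Suc k) p \<in> \<iota> (Suc k) ` (\<delta> (Suc k) ` carrier (Q (Suc (Suc k))))"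
      by (rule inj_on_image_mem_iff[OF inj p(1), symmetric]) (use \<delta>c in blast)
    also have "\<iota> (Suc k) ` (\<delta> (Suc k) ` carrier (Q (Suc (Suc k)))) =
        d (Suc k) ` (\<iota> (Suc (Suc k)) ` carrier (Q (Suc (Suc k))))"
      unfolding image_image by (rule image_cong[OF refl]) (simp add: d)
    finally show ?case unfolding p(2) .
  next
    case (10 k)
    then show ?case using len[of k] zero[of k] by simp
  qed
  then show ?thesis by (intro exI)
qed

end

section \<open>The dichotomy for groups with Poincare duality in dimension 2\<close>

lemma (in group) hyperbolic_or_amenable:
  fixes R :: "('r, 'x) ring_scheme"
  assumes R: "ring R" "\<exists>r\<in>carrier R. \<exists>s\<in>carrier R. r \<noteq> s" and PD: "PD_group R star 2 G"
    and star: "star \<in> carrier R \<rightarrow> carrier R" "star \<zero>\<^bsub>R\<^esub> = \<zero>\<^bsub>R\<^esub>"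
  shows "(hyperbolic_group G \<and> \<not> virtually_cyclic G) \<or> amenable_group G"
proof (cases "amenable_group G")
  case False
  interpret R: ring R by fact
  obtain T and n :: nat where T: "finite T" "T \<subseteq> carrier G"
    and bad: "\<And>F. finite F \<Longrightarrow> F \<noteq> {} \<Longrightarrow> F \<subseteq> carrier G \<Longrightarrow> \<exists>g\<in>T. \<not> n * card ((\<lambda>x. x \<otimes> g) ` F - F) \<le> card F"
    using folner_imp_amenable False by meson
  \<comment> \<open>The element of \<open>T\<close> that violates the Folner condition depends on
    \<open>F\<close>; summing over \<open>T\<close> removes this dependence.\<close>
  have nonamenable: "card F \<le> n * (\<Sum>g\<in>T. card ((\<lambda>x. x \<otimes> g) ` F - F))" if F: "finite F" "F \<subseteq> carrier G" for F
  proof (cases "F = {}")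
    case False
    obtain g where g: "g \<in> T" "card F \<le> n * card ((\<lambda>x. x \<otimes> g) ` F - F)" using bad[OF F(1) False F(2)] by fastforce
    have "card ((\<lambda>x. x \<otimes> g) ` F - F) \<le> (\<Sum>g\<in>T. card ((\<lambda>x. x \<otimes> g) ` F - F))"
      by (rule member_le_sum[OF g(1)]) (use T in auto)
    then show ?thesis using g(2) by (meson le_trans mult_le_mono2)
  qed simp
  have fp: "lmod_type_FP (group_ring R G) (trivial_module R :: ('a \<Rightarrow> 'r, 'r) module)"
    and iso: "lmod_isomorphic R (restrict_scalars (\<lambda>r. gr_monom R r \<one>) (group_cohomology R star G 2)) (regular_module R)"
    and van: "\<And>k. k \<noteq> 2 \<Longrightarrow> carrier (group_cohomology R star G k) = {\<zero>\<^bsub>group_cohomology R star G k\<^esub>}"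
    using PD by (auto simp: PD_group_def)
  \<comment> \<open>A left module comes with the statement that its scalars form a ring, so the
    resolution itself supplies the ring axioms.\<close>
  have "ring (group_ring R G)"
    using fp unfolding lmod_type_FP_def
  proof (elim exE conjE)
    fix P :: "nat \<Rightarrow> ('a \<Rightarrow> 'r, nat \<Rightarrow> 'a \<Rightarrow> 'r) module"
    assume "\<forall>k. left_module (group_ring R G) (P k) \<and> lmod_finitely_generated (group_ring R G) (P k) \<and>
      lmod_projective (group_ring R G) (P k)"
    then have "left_module (group_ring R G) (P 0)" by simp
    then show ?thesis by (rule left_module.axioms(1))
  qed
  then interpret group_ring_coeff G R
    by (rule group_ring_coeff.intro[OF group_axioms R.ring_axioms group_ring_coeff_axioms.intro])
  obtain P m s d ep len where "projective_resolution G (emb R ` carrier R) (emb R \<one>\<^bsub>R\<^esub>) P m s d ep len"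
    using projective_resolution_of_type_FP[OF fp] by (elim exE) (rule that)
  then interpret projective_resolution G "emb R ` carrier R" "emb R \<one>\<^bsub>R\<^esub>" P m s d ep len .
  obtain f0 where f0: "H2_generator f0" using H2_generator_of_cohomology[OF iso star] by blast
  \<comment> \<open>By the shift in \<open>vanishing\<close> this concerns cohomology in degree
    \<open>j + 1\<close>, which is at least 3.\<close>
  have v: "vanishing j" if "2 \<le> j" for j
    by (rule vanishing_of_cohomology[of star, OF van]) (use that in simp)
  have "\<one>\<^bsub>R\<^esub> \<noteq> \<zero>\<^bsub>R\<^esub>" using R(2) R.one_zeroD by auto
  then have "emb R \<one>\<^bsub>R\<^esub> \<noteq> 0" using R.emb_eq_0_iff[OF R.one_closed] by simp
  then have "hyperbolic_group G" by (rule hyperbolic_of_duality[OF _ f0 v T nonamenable])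
  \<comment> \<open>An elementary group is amenable, so non-amenability also gives that the group is
    non-elementary.\<close>
  then show ?thesis using virtually_cyclic_imp_amenable False by blast
qed simp

theorem theorem1p3:
  fixes R :: "('r, 'x) ring_scheme" and G :: "('g, 'y) monoid_scheme"
  assumes "ring R"
    and "\<exists>r\<in>carrier R. \<exists>s\<in>carrier R. r \<noteq> s"
    and "group G"
    and "(cring R \<and> PD_group R (\<lambda>r. r) 2 G) \<or>
         (\<exists>star. star_ring R star \<and> oriented_PD_group R star 2 G)"
  shows "(hyperbolic_group G \<and> \<not> virtually_cyclic G) \<or> amenable_group G"
proof -
  interpret R: ring R by fact
  \<comment> \<open>The two cases merge: for commutative \<open>R\<close> the identity serves as the
    involution, and in general additivity gives that zero is fixed.\<close>
  have "\<exists>star. PD_group R star 2 G \<and> star \<in> carrier R \<rightarrow> carrier R \<and> star \<zero>\<^bsub>R\<^esub> = \<zero>\<^bsub>R\<^esub>"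
    using assms(4)
  proof
    assume "\<exists>star. star_ring R star \<and> oriented_PD_group R star 2 G"
    then obtain star where star: "star_ring R star" and PD: "PD_group R star 2 G"
      by (auto simp: oriented_PD_group_def)
    have c: "star \<in> carrier R \<rightarrow> carrier R" using star by (simp add: star_ring_def)
    then have z: "star \<zero>\<^bsub>R\<^esub> \<in> carrier R" by auto
    have "star (\<zero>\<^bsub>R\<^esub> \<oplus>\<^bsub>R\<^esub> \<zero>\<^bsub>R\<^esub>) = star \<zero>\<^bsub>R\<^esub> \<oplus>\<^bsub>R\<^esub> star \<zero>\<^bsub>R\<^esub>"
      using star unfolding star_ring_def by blast
    then have "star \<zero>\<^bsub>R\<^esub> \<oplus>\<^bsub>R\<^esub> star \<zero>\<^bsub>R\<^esub> = star \<zero>\<^bsub>R\<^esub>" by simp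
    then have "star \<zero>\<^bsub>R\<^esub> = \<zero>\<^bsub>R\<^esub>" using z R.add.l_cancel_one by metis
    then show ?thesis using PD c by blast
  qed (intro exI[of _ "\<lambda>r. r"], simp)
  then show ?thesis using group.hyperbolic_or_amenable[OF assms(3,1,2)] by blast
qed

end
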